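(* Let $K$ be a connected semisimple Lie group and $H\subset K$ a closed subgroup such that $K/H$ is a reductive homogeneous space with decomposition $\mathfrak{k}=\mathfrak{h}\oplus\mathfrak{m}$, $\operatorname{Ad}_H(\mathfrak{m})\subset\mathfrak{m}$, and with faithful linear isotropy representation. Assume that the restriction $B_{\mathfrak{h}}$ of the Killing form $B_{\mathfrak{k}}$ of $\mathfrak{k}$ to $\mathfrak{h}$ is non-degenerate and that $\operatorname{rank}K=\operatorname{rank}H$. Let $G\to P\to K/H$ be a $K$-invariant $G$-structure over $K/H$, with linear isotropy representation $\lambda:\mathfrak{h}\to\mathfrak{g}$, and let $v\in\mathfrak{g}^*$. Let $X_v^{\lambda}\in\mathfrak{h}$ be the vector determined by $B_{\mathfrak{h}}(X_v^{\lambda},Y)=\langle v,\lambda(Y)\rangle$ for all $Y\in\mathfrak{h}$. Then $v$ is fat with respect to the canonical connection in $P$ if and only if the $2$-form $$(X,Y)\mapsto B_{\mathfrak{k}}(X^{\lambda}_v,[X,Y]),\qquad X,Y\in\mathfrak{m},$$ on $\mathfrak{m}$ is non-degenerate.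
   Context: A $G$-structure on a manifold $M$ of dimension $n$ is a reduction $G\to P\to M$ of the frame bundle $L(M)$ to a Lie group $G$ (with Lie algebra $\mathfrak{g}$). For $M=K/H$ it is $K$-invariant if every left translation $\tau(k):aH\mapsto kaH$, $k\in K$, lifts (via its differential acting on frames) to an automorphism of the $G$-structure. Fix a frame $u_o:\mathbb{R}^n\to T_o(K/H)$ in $P$ over $o=H$. The linear isotropy representation is the homomorphism $\lambda:H\to G$, $\lambda(h)=u_o^{-1}\,d\tau(h)_o\,u_o$; the induced Lie algebra homomorphism $\mathfrak{h}\to\mathfrak{g}$ is also denoted $\lambda$. Under $T_o(K/H)\cong\mathfrak{m}$ it is identified with the restriction of the adjoint representation of $H$ (respectively $\mathfrak{h}$) to $\mathfrak{m}$. $K$-invariant connections in $P$ correspond bijectively to linear maps $\Lambda_{\mathfrak{m}}:\mathfrak{m}\to\mathfrak{g}$ that are $\operatorname{Ad}_H$-equivariant, i.e. $\Lambda_{\mathfrak{m}}(\operatorname{Ad}_h Z)=\operatorname{Ad}_{\lambda(h)}(\Lambda_{\mathfrak{m}}(Z))$. The canonical connection is the one corresponding to $\Lambda_{\mathfrak{m}}=0$; its curvature form (at $u_o$) is $\Theta(X,Y)=-\lambda([X,Y]_{\mathfrak{h}})$, $X,Y\in\mathfrak{m}$, where $[\cdot,\cdot]_{\mathfrak{h}}$ is the $\mathfrak{h}$-component with respect to $\mathfrak{k}=\mathfrak{h}\oplus\mathfrak{m}$. A vector $v\in\mathfrak{g}^*$ is fat with respect to a connection with curvature form $\Theta$ if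 the two-form $(X,Y)\mapsto\langle v,\Theta(X,Y)\rangle$ is non-degenerate on horizontal vectors. *)

theory Defs
  imports "HOL-Analysis.Analysis" "HOL-Algebra.Left_Coset"
begin

section \<open>Smooth maps between open subsets of Euclidean spaces\<close>

primrec C_k_on :: "nat \<Rightarrow> 'a::euclidean_space set \<Rightarrow> ('a \<Rightarrow> 'b::real_normed_vector) \<Rightarrow> bool" where
  "C_k_on 0 S f \<longleftrightarrow> continuous_on S f"
| "C_k_on (Suc k) S f \<longleftrightarrow>
     f differentiable_on S \<and> (\<forall>v. C_k_on k S (\<lambda>x. frechet_derivative f (at x) v))"

definition smooth_on :: "'a::euclidean_space set \<Rightarrow> ('a \<Rightarrow> 'b::real_normed_vector) \<Rightarrow> bool" where
  "smooth_on S f \<longleftrightarrow> open S \<and> (\<forall>k. C_k_on k S f)"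


section \<open>Smooth manifolds\<close>

text \<open>
  A manifold is given by an atlas. A chart is a pair \<open>(U, \<phi>)\<close> of its domain and its coordinate
  map; only the values of \<open>\<phi>\<close> on \<open>U\<close> matter. The point set is the union of the chart domains.
\<close>

type_synonym ('p, 'e) atlas = "('p set \<times> ('p \<Rightarrow> 'e)) set"

definition points :: "('p, 'e) atlas \<Rightarrow> 'p set" where
  "points A = (\<Union>(U, \<phi>)\<in>A. U)"

definition manifold_topology :: "('p, 'e::euclidean_space) atlas \<Rightarrow> 'p topology" where
  "manifold_topology A = topology (\<lambda>S. S \<subseteq> points A \<and> (\<forall>(U, \<phi>)\<in>A. open (\<phi> ` (S \<inter> U))))"

definition smooth_manifold :: "('p, 'e::euclidean_space) atlas \<Rightarrow> bool" where
  "smooth_manifold A \<longleftrightarrow>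
     (\<forall>(U, \<phi>)\<in>A. inj_on \<phi> U \<and> open (\<phi> ` U)) \<and>
     (\<forall>(U, \<phi>)\<in>A. \<forall>(V, \<psi>)\<in>A. smooth_on (\<phi> ` (U \<inter> V)) (\<psi> \<circ> inv_into U \<phi>)) \<and>
     Hausdorff_space (manifold_topology A) \<and> second_countable (manifold_topology A)"

lemma openin_manifold_topology:
  assumes "smooth_manifold A"
  shows "openin (manifold_topology A) S \<longleftrightarrow>
           S \<subseteq> points A \<and> (\<forall>(U, \<phi>)\<in>A. open (\<phi> ` (S \<inter> U)))"
proof -
  have inj: "inj_on \<phi> U" if "(U, \<phi>) \<in> A" for U \<phi>
    using assms that unfolding smooth_manifold_def by blast
  have "istopology (\<lambda>S. S \<subseteq> points A \<and> (\<forall>(U, \<phi>)\<in>A. open (\<phi> ` (S \<inter> U))))"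
    unfolding istopology_def
  proof (intro conjI allI impI)
    fix S T :: "'a set"
    assume S: "S \<subseteq> points A \<and> (\<forall>(U, \<phi>)\<in>A. open (\<phi> ` (S \<inter> U)))"
      and T: "T \<subseteq> points A \<and> (\<forall>(U, \<phi>)\<in>A. open (\<phi> ` (T \<inter> U)))"
    then show "S \<inter> T \<subseteq> points A" by blast
    have "open (\<phi> ` (S \<inter> T \<inter> U))" if "(U, \<phi>) \<in> A" for U \<phi>
    proof -
      have "\<phi> ` (S \<inter> T \<inter> U) = \<phi> ` (S \<inter> U) \<inter> \<phi> ` (T \<inter> U)"
        using inj[OF that] unfolding inj_on_def by blast
      moreover have "open (\<phi> ` (S \<inter> U))" "open (\<phi> ` (T \<inter> U))" using S T that by auto
      ultimately show ?thesis by (simp add: open_Int)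
    qed
    then show "\<forall>(U, \<phi>)\<in>A. open (\<phi> ` (S \<inter> T \<inter> U))" by blast
  next
    fix \<K> assume K: "\<forall>S\<in>\<K>. S \<subseteq> points A \<and> (\<forall>(U, \<phi>)\<in>A. open (\<phi> ` (S \<inter> U)))"
    then show "\<Union>\<K> \<subseteq> points A" by blast
    have "open (\<phi> ` (\<Union>\<K> \<inter> U))" if "(U, \<phi>) \<in> A" for U \<phi>
    proof -
      have "\<phi> ` (\<Union>\<K> \<inter> U) = (\<Union>S\<in>\<K>. \<phi> ` (S \<inter> U))" by blast
      moreover have "\<forall>S\<in>\<K>. open (\<phi> ` (S \<inter> U))" using K that by auto
      ultimately show ?thesis by (simp add: open_UN)
    qed
    then show "\<forall>(U, \<phi>)\<in>A. open (\<phi> ` (\<Union>\<K> \<inter> U))" by blast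
  qed
  then show ?thesis unfolding manifold_topology_def by (simp add: topology_inverse')
qed

definition vector_space_atlas :: "('e, 'e) atlas" where
  "vector_space_atlas = {(UNIV, \<lambda>x. x)}"

definition product_atlas :: "('p, 'e) atlas \<Rightarrow> ('q, 'f) atlas \<Rightarrow> ('p \<times> 'q, 'e \<times> 'f) atlas" where
  "product_atlas A B = {(U \<times> V, map_prod \<phi> \<psi>) | U \<phi> V \<psi>. (U, \<phi>) \<in> A \<and> (V, \<psi>) \<in> B}"

definition restrict_atlas :: "('p, 'e) atlas \<Rightarrow> 'p set \<Rightarrow> ('p, 'e) atlas" where
  "restrict_atlas A S = (\<lambda>(U, \<phi>). (U \<inter> S, \<phi>)) ` A"

text \<open>Continuity is contained in the openness that is part of \<^const>\<open>smooth_on\<close>.\<close>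

definition smooth_map ::
    "('p, 'e::euclidean_space) atlas \<Rightarrow> ('q, 'f::euclidean_space) atlas \<Rightarrow> ('p \<Rightarrow> 'q) \<Rightarrow> bool" where
  "smooth_map A B f \<longleftrightarrow> f ` points A \<subseteq> points B \<and>
     (\<forall>(U, \<phi>)\<in>A. \<forall>(V, \<psi>)\<in>B. smooth_on (\<phi> ` (U \<inter> f -` V)) (\<psi> \<circ> f \<circ> inv_into U \<phi>))"

definition diffeomorphism ::
    "('p, 'e::euclidean_space) atlas \<Rightarrow> ('q, 'f::euclidean_space) atlas \<Rightarrow> ('p \<Rightarrow> 'q) \<Rightarrow> bool" where
  "diffeomorphism A B f \<longleftrightarrow> smooth_map A B f \<and> bij_betw f (points A) (points B) \<and>
     smooth_map B A (inv_into (points A) f)"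


section \<open>Tangent spaces and differential forms\<close>

text \<open>
  One chart around every point \<open>p\<close> is chosen once and for all; the tangent space at \<open>p\<close> is the
  model space, its elements being the coordinate vectors with respect to that chart.
  The map \<open>chart_diff A \<phi> p\<close> is the differential at \<open>p\<close> of the coordinate map of an arbitrary
  chart, and \<open>mderiv A B f p\<close> is the differential \<open>df\<close> from the tangent space at \<open>p\<close>
  to the tangent space at \<open>f p\<close>.
\<close>

definition chart_at :: "('p, 'e) atlas \<Rightarrow> 'p \<Rightarrow> 'p set \<times> ('p \<Rightarrow> 'e)" where
  "chart_at A p = (SOME c. c \<in> A \<and> p \<in> fst c)"

definition coord :: "('p, 'e) atlas \<Rightarrow> 'p \<Rightarrow> 'p \<Rightarrow> 'e" where
  "coord A p = snd (chart_at A p)"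

definition coord_inv :: "('p, 'e) atlas \<Rightarrow> 'p \<Rightarrow> 'e \<Rightarrow> 'p" where
  "coord_inv A p = inv_into (fst (chart_at A p)) (coord A p)"

definition chart_diff :: "('p, 'e::euclidean_space) atlas \<Rightarrow> ('p \<Rightarrow> 'e) \<Rightarrow> 'p \<Rightarrow> 'e \<Rightarrow> 'e" where
  "chart_diff A \<phi> p = frechet_derivative (\<phi> \<circ> coord_inv A p) (at (coord A p p))"

definition mderiv ::
    "('p, 'e::euclidean_space) atlas \<Rightarrow> ('q, 'f::euclidean_space) atlas \<Rightarrow> ('p \<Rightarrow> 'q) \<Rightarrow> 'p \<Rightarrow> 'e \<Rightarrow> 'f"
  where
  "mderiv A B f p = frechet_derivative (coord B (f p) \<circ> f \<circ> coord_inv A p) (at (coord A p p))"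

text \<open>
  A vector-valued 1-form assigns to every point \<open>p\<close> a linear map on the tangent space at \<open>p\<close>;
  \<open>form_in_chart A U \<phi> \<omega> x w\<close> is the value at \<open>x\<close> of its coefficient in the coordinate
  direction \<open>w\<close> of the chart \<open>(U, \<phi>)\<close>.
\<close>

definition form_in_chart ::
    "('p, 'e::euclidean_space) atlas \<Rightarrow> 'p set \<Rightarrow> ('p \<Rightarrow> 'e) \<Rightarrow> ('p \<Rightarrow> 'e \<Rightarrow> 'g) \<Rightarrow> 'e \<Rightarrow> 'e \<Rightarrow> 'g" where
  "form_in_chart A U \<phi> \<omega> x w =
     (let p = inv_into U \<phi> x in \<omega> p (frechet_derivative (coord A p \<circ> inv_into U \<phi>) (at x) w))"

definition smooth_one_form ::
    "('p, 'e::euclidean_space) atlas \<Rightarrow> ('p \<Rightarrow> 'e \<Rightarrow> 'g::real_normed_vector) \<Rightarrow> bool" where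
  "smooth_one_form A \<omega> \<longleftrightarrow> (\<forall>p\<in>points A. linear (\<omega> p)) \<and>
     (\<forall>(U, \<phi>)\<in>A. \<forall>w. smooth_on (\<phi> ` U) (\<lambda>x. form_in_chart A U \<phi> \<omega> x w))"

text \<open>
  The convention is \<open>d\<omega>(\<xi>, \<eta>) = \<xi>(\<omega>(\<eta>)) - \<eta>(\<omega>(\<xi>)) - \<omega>([\<xi>, \<eta>])\<close> without a factor 1/2,
  evaluated on fields that are constant in the chosen coordinates around \<open>p\<close>.
\<close>

definition ext_deriv ::
    "('p, 'e::euclidean_space) atlas \<Rightarrow> ('p \<Rightarrow> 'e \<Rightarrow> 'g::real_normed_vector) \<Rightarrow> 'p \<Rightarrow> 'e \<Rightarrow> 'e \<Rightarrow> 'g"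
  where
  "ext_deriv A \<omega> p \<xi> \<eta> =
     (let W = form_in_chart A (fst (chart_at A p)) (coord A p) \<omega>; x = coord A p p
      in frechet_derivative (\<lambda>y. W y \<eta>) (at x) \<xi> - frechet_derivative (\<lambda>y. W y \<xi>) (at x) \<eta>)"


section \<open>Lie groups\<close>

definition lie_group :: "'k monoid \<Rightarrow> ('k, 'e::euclidean_space) atlas \<Rightarrow> bool" where
  "lie_group K A \<longleftrightarrow> group K \<and> smooth_manifold A \<and> points A = carrier K \<and>
     smooth_map (product_atlas A A) A (\<lambda>(x, y). x \<otimes>\<^bsub>K\<^esub> y) \<and> smooth_map A A (\<lambda>x. inv\<^bsub>K\<^esub> x)"

definition Ad :: "'k monoid \<Rightarrow> ('k, 'e::euclidean_space) atlas \<Rightarrow> 'k \<Rightarrow> 'e \<Rightarrow> 'e" where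
  "Ad K A a = mderiv A A (\<lambda>x. a \<otimes>\<^bsub>K\<^esub> x \<otimes>\<^bsub>K\<^esub> inv\<^bsub>K\<^esub> a) \<one>\<^bsub>K\<^esub>"

text \<open>
  The Lie algebra is the tangent space at the identity, i.e. the whole model space. Its bracket
  is \<open>[X, Y] = ad X Y\<close>, where \<open>ad\<close> is the differential of \<open>Ad\<close> at the identity; this is the
  bracket of left-invariant vector fields.
\<close>

definition lie_bracket :: "'k monoid \<Rightarrow> ('k, 'e::euclidean_space) atlas \<Rightarrow> 'e \<Rightarrow> 'e \<Rightarrow> 'e" where
  "lie_bracket K A X Y = mderiv A vector_space_atlas (\<lambda>a. Ad K A a Y) \<one>\<^bsub>K\<^esub> X"

text \<open>
  Lie subgroups are immersed, with a topology that may be finer than the subspace topology.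
  A closed subgroup is a Lie subgroup for exactly one smooth structure (up to the choice of
  an atlas), and it then carries the subspace topology.
\<close>

definition lie_subgroup ::
    "'k monoid \<Rightarrow> ('k, 'e::euclidean_space) atlas \<Rightarrow> 'k set \<Rightarrow> ('k, 'd::euclidean_space) atlas \<Rightarrow> bool"
  where
  "lie_subgroup K A S B \<longleftrightarrow> subgroup S K \<and> lie_group (K\<lparr>carrier := S\<rparr>) B \<and>
     smooth_map B A (\<lambda>x. x) \<and> (\<forall>x\<in>S. inj (mderiv B A (\<lambda>x. x) x))"

definition closed_lie_subgroup ::
    "'k monoid \<Rightarrow> ('k, 'e::euclidean_space) atlas \<Rightarrow> 'k set \<Rightarrow> ('k, 'd::euclidean_space) atlas \<Rightarrow> bool"
  where
  "closed_lie_subgroup K A H B \<longleftrightarrow> lie_subgroup K A H B \<and> closedin (manifold_topology A) H \<and>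
     manifold_topology B = subtopology (manifold_topology A) H"

definition subgroup_algebra_inclusion ::
    "'k monoid \<Rightarrow> ('k, 'e::euclidean_space) atlas \<Rightarrow> ('k, 'd::euclidean_space) atlas \<Rightarrow> 'd \<Rightarrow> 'e"
  where
  "subgroup_algebra_inclusion K A B = mderiv B A (\<lambda>x. x) \<one>\<^bsub>K\<^esub>"

definition subgroup_algebra ::
    "'k monoid \<Rightarrow> ('k, 'e::euclidean_space) atlas \<Rightarrow> ('k, 'd::euclidean_space) atlas \<Rightarrow> 'e set" where
  "subgroup_algebra K A B = range (subgroup_algebra_inclusion K A B)"


section \<open>Lie algebras\<close>

text \<open>Lie algebras are given by their bracket and, for subalgebras, by a subspace.\<close>

definition nondegenerate_on :: "'e::real_vector set \<Rightarrow> ('e \<Rightarrow> 'e \<Rightarrow> real) \<Rightarrow> bool" where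
  "nondegenerate_on V b \<longleftrightarrow> (\<forall>x\<in>V. (\<forall>y\<in>V. b x y = 0) \<longrightarrow> x = 0)"

definition linear_trace :: "('e::euclidean_space \<Rightarrow> 'e) \<Rightarrow> real" where
  "linear_trace f = (\<Sum>b\<in>Basis. f b \<bullet> b)"

definition killing_form :: "('e::euclidean_space \<Rightarrow> 'e \<Rightarrow> 'e) \<Rightarrow> 'e \<Rightarrow> 'e \<Rightarrow> real" where
  "killing_form br X Y = linear_trace (br X \<circ> br Y)"

definition semisimple :: "('e::euclidean_space \<Rightarrow> 'e \<Rightarrow> 'e) \<Rightarrow> bool" where
  "semisimple br \<longleftrightarrow>
     (\<forall>I. subspace I \<and> (\<forall>x. \<forall>y\<in>I. br x y \<in> I) \<and> (\<forall>x\<in>I. \<forall>y\<in>I. br x y = 0) \<longrightarrow> I = {0})"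

primrec lower_central :: "('e::euclidean_space \<Rightarrow> 'e \<Rightarrow> 'e) \<Rightarrow> 'e set \<Rightarrow> nat \<Rightarrow> 'e set" where
  "lower_central br g 0 = g"
| "lower_central br g (Suc n) = span {br x y | x y. x \<in> g \<and> y \<in> lower_central br g n}"

definition cartan_subalgebra :: "('e::euclidean_space \<Rightarrow> 'e \<Rightarrow> 'e) \<Rightarrow> 'e set \<Rightarrow> 'e set \<Rightarrow> bool" where
  "cartan_subalgebra br g c \<longleftrightarrow> subspace c \<and> c \<subseteq> g \<and> (\<forall>x\<in>c. \<forall>y\<in>c. br x y \<in> c) \<and>
     (\<exists>n. lower_central br c n = {0}) \<and> {x\<in>g. \<forall>y\<in>c. br x y \<in> c} = c"

text \<open>
  All Cartan subalgebras of a real Lie algebra have the same dimension, so \<open>LEAST\<close> only serves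
  to name that common value.
\<close>

definition lie_rank :: "('e::euclidean_space \<Rightarrow> 'e \<Rightarrow> 'e) \<Rightarrow> 'e set \<Rightarrow> nat" where
  "lie_rank br g = (LEAST r. \<exists>c. cartan_subalgebra br g c \<and> dim c = r)"


section \<open>Homogeneous spaces\<close>

text \<open>
  The base point is the coset \<open>H\<close>. The smooth structure on the set of left cosets is the
  unique one for which the projection is a submersion.
\<close>

definition homogeneous_space ::
    "'k monoid \<Rightarrow> ('k, 'e::euclidean_space) atlas \<Rightarrow> 'k set \<Rightarrow> ('k set, 'b::euclidean_space) atlas \<Rightarrow> bool"
  where
  "homogeneous_space K A H M \<longleftrightarrow> smooth_manifold M \<and> points M = lcosets\<^bsub>K\<^esub> H \<and>
     smooth_map A M (\<lambda>a. a <#\<^bsub>K\<^esub> H) \<and>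
     (\<forall>a\<in>carrier K. surj (mderiv A M (\<lambda>a. a <#\<^bsub>K\<^esub> H) a))"

definition translation :: "'k monoid \<Rightarrow> 'k \<Rightarrow> 'k set \<Rightarrow> 'k set" where
  "translation K a c = a <#\<^bsub>K\<^esub> c"

definition reductive_decomposition ::
    "'k monoid \<Rightarrow> ('k, 'e::euclidean_space) atlas \<Rightarrow> 'k set \<Rightarrow> 'e set \<Rightarrow> 'e set \<Rightarrow> bool" where
  "reductive_decomposition K A H h m \<longleftrightarrow> subspace h \<and> subspace m \<and> h \<inter> m = {0} \<and>
     {x + y | x y. x \<in> h \<and> y \<in> m} = UNIV \<and> (\<forall>a\<in>H. Ad K A a ` m \<subseteq> m)"


section \<open>Frames and G-structures\<close>

definition GL :: "(real^'n^'n) monoid" where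
  "GL = \<lparr>carrier = {u. invertible u}, mult = (**), one = mat 1\<rparr>"

definition GL_atlas :: "(real^'n^'n, real^'n^'n) atlas" where
  "GL_atlas = {({u. invertible u}, \<lambda>u. u)}"

text \<open>
  A frame at \<open>p\<close> is a pair \<open>(p, u)\<close> with \<open>u\<close> the matrix of a linear isomorphism from \<open>\<real>\<^sup>n\<close> onto
  the tangent space at \<open>p\<close>; the latter is the model space \<open>real^'n\<close>.
\<close>

type_synonym ('p, 'n) frame = "'p \<times> (real^'n^'n)"

definition frame_atlas :: "('p, real^'n) atlas \<Rightarrow> (('p, 'n) frame, (real^'n) \<times> (real^'n^'n)) atlas" where
  "frame_atlas M =
     (\<lambda>(U, \<phi>). (U \<times> {u. invertible u}, \<lambda>(p, u). (\<phi> p, matrix (chart_diff M \<phi> p) ** u))) ` M"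

definition frame_act :: "('p, 'n) frame \<Rightarrow> real^'n^'n \<Rightarrow> ('p, 'n) frame" where
  "frame_act u g = (fst u, snd u ** g)"

definition frame_lift ::
    "('p, real^'n) atlas \<Rightarrow> ('p \<Rightarrow> 'p) \<Rightarrow> ('p, 'n) frame \<Rightarrow> ('p, 'n) frame" where
  "frame_lift M f u = (f (fst u), matrix (mderiv M M f (fst u)) ** snd u)"

definition principal_bundle ::
    "('u, 'q::euclidean_space) atlas \<Rightarrow> ('p, 'b::euclidean_space) atlas \<Rightarrow> 'a monoid \<Rightarrow>
     ('a, 'g::euclidean_space) atlas \<Rightarrow> ('u \<Rightarrow> 'a \<Rightarrow> 'u) \<Rightarrow> ('u \<Rightarrow> 'p) \<Rightarrow> bool" where
  "principal_bundle P M G AG act pr \<longleftrightarrow>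
     smooth_manifold P \<and> smooth_manifold M \<and> lie_group G AG \<and>
     smooth_map (product_atlas P AG) P (\<lambda>(u, g). act u g) \<and> smooth_map P M pr \<and>
     (\<forall>u\<in>points P. act u \<one>\<^bsub>G\<^esub> = u \<and>
        (\<forall>g\<in>carrier G. pr (act u g) = pr u \<and>
           (\<forall>g'\<in>carrier G. act (act u g) g' = act u (g \<otimes>\<^bsub>G\<^esub> g')))) \<and>
     (\<forall>p\<in>points M. \<exists>U \<psi>. openin (manifold_topology M) U \<and> p \<in> U \<and>
        diffeomorphism (restrict_atlas P {u\<in>points P. pr u \<in> U})
          (product_atlas (restrict_atlas M U) AG) (\<lambda>u. (pr u, \<psi> u)) \<and>
        (\<forall>u\<in>points P. \<forall>g\<in>carrier G. pr u \<in> U \<longrightarrow> \<psi> (act u g) = \<psi> u \<otimes>\<^bsub>G\<^esub> g))"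

text \<open>
  A G-structure is a reduction of the frame bundle to the Lie subgroup \<open>G\<close> of \<open>GL(n, \<real>)\<close>:
  a principal \<open>G\<close>-bundle whose points are frames, immersed in the frame bundle, with the
  action and the projection inherited from it.
\<close>

definition G_structure ::
    "('p, real^'n) atlas \<Rightarrow> (real^'n^'n) set \<Rightarrow> (real^'n^'n, 'g::euclidean_space) atlas \<Rightarrow>
     (('p, 'n) frame, 'q::euclidean_space) atlas \<Rightarrow> bool" where
  "G_structure M G AG P \<longleftrightarrow> lie_subgroup GL GL_atlas G AG \<and>
     principal_bundle P M (GL\<lparr>carrier := G\<rparr>) AG frame_act fst \<and>
     smooth_map P (frame_atlas M) (\<lambda>u. u) \<and>
     (\<forall>u\<in>points P. inj (mderiv P (frame_atlas M) (\<lambda>u. u) u))"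

definition invariant_G_structure ::
    "'k monoid \<Rightarrow> ('k set, real^'n) atlas \<Rightarrow> (('k set, 'n) frame, 'q::euclidean_space) atlas \<Rightarrow> bool"
  where
  "invariant_G_structure K M P \<longleftrightarrow>
     (\<forall>a\<in>carrier K. frame_lift M (translation K a) ` points P = points P)"

text \<open>
  For a frame \<open>u\<close> over the base point \<open>H\<close> of \<open>K/H\<close>: the homomorphism
  \<open>\<lambda>(a) = u\<^sup>-\<^sup>1 d\<tau>(a) u\<close> from \<open>H\<close> to \<open>G\<close>, and its differential from the Lie algebra of \<open>H\<close>,
  regarded as a subspace of the one of \<open>K\<close>, to the Lie algebra of \<open>G\<close>.
\<close>

definition isotropy_rep ::
    "'k monoid \<Rightarrow> ('k set, real^'n) atlas \<Rightarrow> ('k set, 'n) frame \<Rightarrow> 'k \<Rightarrow> real^'n^'n" where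
  "isotropy_rep K M u a =
     matrix_inv (snd u) ** matrix (mderiv M M (translation K a) (fst u)) ** snd u"

definition isotropy_algebra_rep ::
    "'k monoid \<Rightarrow> ('k, 'e::euclidean_space) atlas \<Rightarrow> ('k, 'd::euclidean_space) atlas \<Rightarrow>
     ('k set, real^'n) atlas \<Rightarrow> (real^'n^'n, 'g::euclidean_space) atlas \<Rightarrow>
     ('k set, 'n) frame \<Rightarrow> 'e \<Rightarrow> 'g" where
  "isotropy_algebra_rep K A B M AG u Y =
     mderiv B AG (isotropy_rep K M u) \<one>\<^bsub>K\<^esub> (the_inv (subgroup_algebra_inclusion K A B) Y)"


section \<open>Connections in a G-structure\<close>

text \<open>The value at \<open>u\<close> of the fundamental vector field of \<open>Z\<close> in the Lie algebra of \<open>G\<close>.\<close>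

definition fundamental_vector ::
    "(real^'n^'n, 'g::euclidean_space) atlas \<Rightarrow> (('p, 'n) frame, 'q::euclidean_space) atlas \<Rightarrow>
     ('p, 'n) frame \<Rightarrow> 'g \<Rightarrow> 'q" where
  "fundamental_vector AG P u Z = mderiv AG P (\<lambda>g. frame_act u g) (mat 1) Z"

definition connection_form ::
    "(real^'n^'n) set \<Rightarrow> (real^'n^'n, 'g::euclidean_space) atlas \<Rightarrow>
     (('p, 'n) frame, 'q::euclidean_space) atlas \<Rightarrow> (('p, 'n) frame \<Rightarrow> 'q \<Rightarrow> 'g) \<Rightarrow> bool" where
  "connection_form G AG P \<omega> \<longleftrightarrow> smooth_one_form P \<omega> \<and>
     (\<forall>u\<in>points P. \<forall>Z. \<omega> u (fundamental_vector AG P u Z) = Z) \<and>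
     (\<forall>u\<in>points P. \<forall>g\<in>G. \<forall>\<xi>. \<omega> (frame_act u g) (mderiv P P (\<lambda>u. frame_act u g) u \<xi>) =
        Ad (GL\<lparr>carrier := G\<rparr>) AG (matrix_inv g) (\<omega> u \<xi>))"

definition invariant_form ::
    "'k monoid \<Rightarrow> ('k set, real^'n) atlas \<Rightarrow> (('k set, 'n) frame, 'q::euclidean_space) atlas \<Rightarrow>
     (('k set, 'n) frame \<Rightarrow> 'q \<Rightarrow> 'g) \<Rightarrow> bool" where
  "invariant_form K M P \<omega> \<longleftrightarrow> (\<forall>a\<in>carrier K. \<forall>u\<in>points P. \<forall>\<xi>.
     \<omega> (frame_lift M (translation K a) u) (mderiv P P (frame_lift M (translation K a)) u \<xi>) = \<omega> u \<xi>)"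

text \<open>
  The linear map from the Lie algebra of \<open>K\<close> to the one of \<open>G\<close> which belongs to an invariant
  connection: \<open>X\<close> is sent to the value of the connection form on the velocity at \<open>u\<close> of the
  action of \<open>K\<close> on the frames. Its restriction to \<open>m\<close> is the map \<open>\<Lambda>\<^sub>m\<close> that
  parametrizes the invariant connections.
\<close>

definition Lambda_map ::
    "'k monoid \<Rightarrow> ('k, 'e::euclidean_space) atlas \<Rightarrow> ('k set, real^'n) atlas \<Rightarrow>
     (('k set, 'n) frame, 'q::euclidean_space) atlas \<Rightarrow> ('k set, 'n) frame \<Rightarrow>
     (('k set, 'n) frame \<Rightarrow> 'q \<Rightarrow> 'g) \<Rightarrow> 'e \<Rightarrow> 'g" where
  "Lambda_map K A M P u \<omega> X =
     \<omega> u (mderiv A P (\<lambda>a. frame_lift M (translation K a) u) \<one>\<^bsub>K\<^esub> X)"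

definition canonical_connection ::
    "'k monoid \<Rightarrow> ('k, 'e::euclidean_space) atlas \<Rightarrow> ('k set, real^'n) atlas \<Rightarrow> 'e set \<Rightarrow>
     (real^'n^'n) set \<Rightarrow> (real^'n^'n, 'g::euclidean_space) atlas \<Rightarrow>
     (('k set, 'n) frame, 'q::euclidean_space) atlas \<Rightarrow> ('k set, 'n) frame \<Rightarrow>
     (('k set, 'n) frame \<Rightarrow> 'q \<Rightarrow> 'g) \<Rightarrow> bool" where
  "canonical_connection K A M m G AG P u \<omega> \<longleftrightarrow> connection_form G AG P \<omega> \<and> invariant_form K M P \<omega> \<and>
     (\<forall>X\<in>m. Lambda_map K A M P u \<omega> X = 0)"

definition horizontal :: "('u \<Rightarrow> 'q \<Rightarrow> 'g::zero) \<Rightarrow> 'u \<Rightarrow> 'q set" where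
  "horizontal \<omega> u = {\<xi>. \<omega> u \<xi> = 0}"

definition horizontal_part ::
    "(real^'n^'n, 'g::euclidean_space) atlas \<Rightarrow> (('p, 'n) frame, 'q::euclidean_space) atlas \<Rightarrow>
     (('p, 'n) frame \<Rightarrow> 'q \<Rightarrow> 'g) \<Rightarrow> ('p, 'n) frame \<Rightarrow> 'q \<Rightarrow> 'q" where
  "horizontal_part AG P \<omega> u \<xi> = \<xi> - fundamental_vector AG P u (\<omega> u \<xi>)"

definition curvature_form ::
    "(real^'n^'n, 'g::euclidean_space) atlas \<Rightarrow> (('p, 'n) frame, 'q::euclidean_space) atlas \<Rightarrow>
     (('p, 'n) frame \<Rightarrow> 'q \<Rightarrow> 'g) \<Rightarrow> ('p, 'n) frame \<Rightarrow> 'q \<Rightarrow> 'q \<Rightarrow> 'g" where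
  "curvature_form AG P \<omega> u \<xi> \<eta> =
     ext_deriv P \<omega> u (horizontal_part AG P \<omega> u \<xi>) (horizontal_part AG P \<omega> u \<eta>)"

text \<open>
  Fatness of a fixed covector \<open>v\<close> depends on the frame: passing from \<open>u\<close> to \<open>u g\<close> replaces \<open>v\<close>
  by another element of its coadjoint orbit. The frame is therefore a parameter.
\<close>

definition fat_at ::
    "(real^'n^'n, 'g::euclidean_space) atlas \<Rightarrow> (('p, 'n) frame, 'q::euclidean_space) atlas \<Rightarrow>
     (('p, 'n) frame \<Rightarrow> 'q \<Rightarrow> 'g) \<Rightarrow> ('p, 'n) frame \<Rightarrow> ('g \<Rightarrow> real) \<Rightarrow> bool" where
  "fat_at AG P \<omega> u v \<longleftrightarrow>
     nondegenerate_on (horizontal \<omega> u) (\<lambda>\<xi> \<eta>. v (curvature_form AG P \<omega> u \<xi> \<eta>))"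

end

(* Let Phi be the orbit map a |-> d tau(a) u_o from K to P and omega the connection form. The form
   Phi^* omega is left invariant with value Lambda at the identity, so that
   d omega (Phi_* X, Phi_* Y) = - Lambda [X, Y]. For the canonical connection Lambda vanishes on m
   and equals lambda on h, and Phi_* maps m onto the horizontal space at u_o. Fatness therefore
   says that (X, Y) |-> B (X_v, [X, Y]_h) is non-degenerate on m, and it remains to show that h and m
   are B-orthogonal.

   A Cartan subalgebra c of h on which B is non-degenerate is abelian. By the equality of ranks it
   is also a Cartan subalgebra of k: conjugates of elements of l = k_0(x), with x regular in c, fill
   an open subset of k, so some elements of l are regular in k; if l were larger than c, such a
   regular element would act invertibly on the complement of c in l, in contradiction to the
   vanishing of the traces of all powers of this action. Hence a regular x in c acts bijectively
   on m, so that B (c, m) = 0, and h = c + [h, c] gives B (h, m) = 0.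

   The orbit map is smooth as a map into P although P is only immersed in the frame bundle: G is
   second countable, so that a smooth map into GL(n) with values in G is smooth into G. *)

theory Submission
  imports Defs "HOL-Computational_Algebra.Polynomial_Factorial" "HOL-Computational_Algebra.Field_as_Ring"
begin


text \<open>Equality of ranks is only an equality of dimensions, and Cartan subalgebras of a real
  Lie algebra need not be conjugate, so c cannot simply be moved into a Cartan subalgebra of k. This
  is why an open set of conjugates of l is needed: it meets the dense set of elements whose null
  component is as small as that of a regular element of a Cartan subalgebra of k. Such an element of
  l need not lie in c; it is y + w with y in c and w in an ideal of l complementary to c, and the
  traces are compared along y + t w with the nilpotent case t = 0.

  Nothing is complexified: null components and Fitting decompositions replace root spaces, and the
  semisimple part of ad is a real polynomial in ad, found by Newton's iteration.

  Tangent spaces refer to one arbitrarily chosen chart per point, so differentials as such do not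
  vary continuously with the point. Smooth dependence is therefore read off in fixed charts, and the
  bracket enters the exterior derivative through mixed second derivatives of the multiplication in
  the chart at the identity.\<close>

section \<open>Generalized kernels, Fitting decomposition and traces of nilpotent maps\<close>

lemma linear_funpow:
  fixes f :: "'a::real_vector \<Rightarrow> 'a"
  assumes "linear f" shows "linear (f ^^ n)"
proof (induction n)
  case 0 show ?case using linear_id by (simp add: id_def)
next
  case (Suc n) then show ?case using linear_compose[OF Suc assms] by (simp add: o_def)
qed

lemma funpow_invariant: "(\<And>x. x \<in> V \<Longrightarrow> f x \<in> V) \<Longrightarrow> x \<in> V \<Longrightarrow> (f ^^ n) x \<in> V"
  by (induction n) auto

lemma funpow_zero_mono:
  fixes f :: "'a::real_vector \<Rightarrow> 'a"
  assumes "linear f" "(f ^^ n) v = 0" "n \<le> m" shows "(f ^^ m) v = 0"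
proof -
  have "(f ^^ m) v = (f ^^ (m - n)) ((f ^^ n) v)"
    using assms(3) by (metis comp_apply funpow_add le_add_diff_inverse2)
  then show ?thesis using assms linear_0[OF linear_funpow[OF assms(1)]] by simp
qed

lemma dim_subspace_psubset:
  fixes V W :: "'e::euclidean_space set"
  assumes "subspace V" "subspace W" "V \<subset> W" shows "dim V < dim W"
proof -
  have "span V = V" "span W = W" using assms span_eq_iff by metis+
  then show ?thesis using dim_psubset[of V W] assms(3) by metis
qed

text \<open>The kernels of the powers increase, and once two consecutive ones agree all later ones
  agree too, so at most \<open>DIM('e)\<close> strict steps occur. Hence the exponent
  \<open>DIM('e)\<close> stands for "some power" from here on.\<close>

lemma funpow_kernel_dim:
  fixes f :: "'e::euclidean_space \<Rightarrow> 'e"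
  assumes f: "linear f" and v: "(f ^^ n) v = 0"
  shows "(f ^^ DIM('e)) v = 0"
proof -
  define K where "K i = {v. (f ^^ i) v = 0}" for i
  have sub: "subspace (K i)" for i
    unfolding K_def using linear_subspace_kernel[OF linear_funpow[OF f]] .
  have mono: "K i \<subseteq> K (Suc i)" for i
    unfolding K_def by (intro subsetI CollectI, drule CollectD, erule funpow_zero_mono[OF f]) simp
  have stab: "K j = K i" if "K i = K (Suc i)" "i \<le> j" for i j
    using that(2)
  proof (induction rule: dec_induct)
    case (step j)
    have "K (Suc j) \<subseteq> K i"
    proof
      fix v assume "v \<in> K (Suc j)"
      then have "f v \<in> K j" by (simp add: K_def funpow_swap1)
      then have "f v \<in> K i" by (simp only: step.IH)
      then have "v \<in> K (Suc i)" by (simp add: K_def funpow_swap1)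
      then show "v \<in> K i" by (simp only: that(1)[symmetric])
    qed
    moreover have "K i \<subseteq> K (Suc j)" using mono[of j] by (simp only: step.IH)
    ultimately show ?case by (rule subset_antisym)
  qed (rule refl)
  have ex: "\<exists>i\<le>DIM('e). K i = K (Suc i)"
  proof (rule ccontr)
    assume "\<not> ?thesis"
    then have ne: "K i \<subset> K (Suc i)" if "i \<le> DIM('e)" for i
      using that mono[of i] by (auto simp only: psubset_eq)
    have "i \<le> Suc DIM('e) \<Longrightarrow> i \<le> dim (K i)" for i
    proof (induction i)
      case (Suc i)
      have "dim (K i) < dim (K (Suc i))"
        by (rule dim_subspace_psubset[OF sub sub ne]) (use Suc.prems in simp)
      then show ?case using Suc by simp
    qed simp
    from this[of "Suc DIM('e)"] show False
      using dim_subset_UNIV[of "K (Suc DIM('e))"] by simp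
  qed
  then obtain i where i: "i \<le> DIM('e)" "K i = K (Suc i)" by blast
  have "v \<in> K (max n DIM('e))"
    using v funpow_zero_mono[OF f] unfolding K_def by simp
  also have "K (max n DIM('e)) = K (DIM('e))"
    using stab[OF i(2), of "max n DIM('e)"] stab[OF i(2) i(1)] i(1) by simp
  finally show ?thesis by (simp add: K_def)
qed

lemma injective_on_subspace_surj:
  fixes f :: "'a::euclidean_space \<Rightarrow> 'a"
  assumes f: "linear f" and V: "subspace V" and im: "f ` V \<subseteq> V"
    and inj: "\<And>v. v \<in> V \<Longrightarrow> f v = 0 \<Longrightarrow> v = 0"
  shows "f ` V = V"
proof -
  have "inj_on f V" using linear_injective_on_subspace_0[OF f V] inj by auto
  then have "inj_on f (span V)" using span_eq_iff[of V] V by metis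
  from dim_image_eq[OF f this] have "dim (f ` V) = dim V" .
  then show ?thesis
    using subspace_dim_equal[OF linear_subspace_image[OF f V] V im] by simp
qed

text \<open>A power \<open>g\<close> with exponent at least \<open>DIM('e)\<close> has the same
  kernel as its square, so it is injective, hence bijective, on its image; choosing \<open>u\<close>
  with \<open>g v = g (g u)\<close> splits off the null part \<open>v - g u\<close>. The free
  \<open>n\<close> lets the other part be an \<open>n\<close>-th image: \<open>n = 1\<close> yields
  a bracket, \<open>n = DIM('e)\<close> a vector orthogonal to the null component of ad.\<close>

lemma fitting_decomposition:
  fixes f :: "'e::euclidean_space \<Rightarrow> 'e"
  assumes f: "linear f" and V: "subspace V" and im: "\<And>v. v \<in> V \<Longrightarrow> f v \<in> V" and v: "v \<in> V"
  obtains a b where "a \<in> V" "(f ^^ DIM('e)) a = 0" "b \<in> V" "v = a + (f ^^ n) b"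
proof -
  define g where "g = f ^^ (DIM('e) + n)"
  have g: "linear g" unfolding g_def by (rule linear_funpow[OF f])
  have gV: "g v \<in> V" if "v \<in> V" for v unfolding g_def using funpow_invariant[of V f] im that by blast
  have "g ` (g ` V) = g ` V"
  proof (rule injective_on_subspace_surj[OF g linear_subspace_image[OF g V]])
    show "g ` g ` V \<subseteq> g ` V" using gV by blast
    fix w assume w: "w \<in> g ` V" "g w = 0"
    then obtain u where u: "w = g u" by blast
    have "(f ^^ (DIM('e) + n + (DIM('e) + n))) u = 0"
      using w u unfolding g_def by (simp add: funpow_add)
    from funpow_kernel_dim[OF f this] show "w = 0"
      unfolding u g_def by (rule funpow_zero_mono[OF f _ le_add1])
  qed
  then obtain u where u: "u \<in> V" "g v = g (g u)" using v by (metis (no_types, lifting) imageE imageI)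
  let ?a = "v - g u"
  have "g ?a = 0" using u linear_diff[OF g] by simp
  then have a: "(f ^^ DIM('e)) ?a = 0" unfolding g_def by (rule funpow_kernel_dim[OF f])
  have "g u = (f ^^ n) ((f ^^ DIM('e)) u)" unfolding g_def by (simp add: add.commute funpow_add)
  moreover have "(f ^^ DIM('e)) u \<in> V" using funpow_invariant[of V f] im u by blast
  moreover have "?a \<in> V" using gV u v V by (simp add: subspace_diff)
  ultimately show ?thesis using that[of ?a "(f ^^ DIM('e)) u"] a by simp
qed

lemma linear_trace_comp_commute:
  fixes f g :: "'e::euclidean_space \<Rightarrow> 'e"
  assumes f: "linear f" and g: "linear g"
  shows "linear_trace (\<lambda>x. f (g x)) = linear_trace (\<lambda>x. g (f x))"
proof -
  have e: "F (G b) \<bullet> b = (\<Sum>c\<in>Basis. (G b \<bullet> c) * (F c \<bullet> b))" if F: "linear F" for F G :: "'e \<Rightarrow> 'e" and b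
  proof -
    have "F (G b) = F (\<Sum>c\<in>Basis. (G b \<bullet> c) *\<^sub>R c)" by (simp add: euclidean_representation)
    also have "\<dots> = (\<Sum>c\<in>Basis. (G b \<bullet> c) *\<^sub>R F c)"
      by (simp add: linear_sum[OF F] linear_cmul[OF F])
    finally show ?thesis by (simp add: inner_sum_left)
  qed
  have "linear_trace (\<lambda>x. f (g x)) = (\<Sum>b\<in>Basis. \<Sum>c\<in>Basis. (g b \<bullet> c) * (f c \<bullet> b))"
    unfolding linear_trace_def by (simp add: e[OF f])
  also have "\<dots> = (\<Sum>c\<in>Basis. \<Sum>b\<in>Basis. (g b \<bullet> c) * (f c \<bullet> b))" by (rule sum.swap)
  also have "\<dots> = linear_trace (\<lambda>x. g (f x))"
    unfolding linear_trace_def by (simp add: e[OF g] mult.commute)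
  finally show ?thesis .
qed

lemma linear_trace_add: "linear_trace (\<lambda>x. f x + g x) = linear_trace f + linear_trace g"
  by (simp add: linear_trace_def inner_add_left sum.distrib)
lemma linear_trace_diff: "linear_trace (\<lambda>x. f x - g x) = linear_trace f - linear_trace g"
  by (simp add: linear_trace_def inner_diff_left sum_subtractf)
lemma linear_trace_scale: "linear_trace (\<lambda>x. c *\<^sub>R f x) = c * linear_trace f"
  by (simp add: linear_trace_def sum_distrib_left)

text \<open>The trace is only available for endomorphisms of the whole space. Composition with
  \<open>Q\<close> extends an endomorphism of \<open>V\<close> to the whole space without changing
  its trace.\<close>

lemma orthogonal_projection:
  fixes V :: "'e::euclidean_space set"
  assumes V: "subspace V"
  obtains Q where "linear Q" "\<And>v. Q v \<in> V" "\<And>v. v \<in> V \<Longrightarrow> Q v = v"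
    "\<And>v w. w \<in> V \<Longrightarrow> (v - Q v) \<bullet> w = 0"
proof -
  obtain B where B: "B \<subseteq> V" "pairwise orthogonal B" "\<And>x. x \<in> B \<Longrightarrow> norm x = 1"
      "independent B" "span B = V"
    by (rule orthonormal_basis_subspace[OF V]) (rule that)
  have fin: "finite B" using independent_imp_finite[OF B(4)] .
  define Q where "Q v = (\<Sum>b\<in>B. (v \<bullet> b) *\<^sub>R b)" for v
  have lin: "linear Q"
    unfolding Q_def by (rule linearI)
      (simp_all add: inner_add_left scaleR_left_distrib sum.distrib scaleR_sum_right)
  have QV: "Q v \<in> V" for v
    unfolding Q_def using B(1) V by (intro subspace_sum subspace_scale) auto
  have bb: "b \<bullet> c = (if b = c then 1 else 0)" if "b \<in> B" "c \<in> B" for b c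
    using B(2,3) that unfolding pairwise_def orthogonal_def
    by (auto simp: norm_eq_1)
  have Qc: "Q v \<bullet> c = v \<bullet> c" if "c \<in> B" for v c
  proof -
    have "Q v \<bullet> c = (\<Sum>b\<in>B. if b = c then v \<bullet> b else 0)"
      unfolding Q_def inner_sum_left by (rule sum.cong) (use that in \<open>auto simp: bb\<close>)
    then show ?thesis using fin that by simp
  qed
  have orth: "(v - Q v) \<bullet> w = 0" if "w \<in> V" for v w
  proof -
    have "w \<in> span B" using that B(5) by simp
    then show ?thesis
    proof (induction rule: span_induct)
      case base show ?case unfolding subspace_def by (simp add: inner_add_right)
    next
      case (step x) then show ?case by (simp add: inner_diff_left Qc)
    qed
  qed
  have "Q v = v" if "v \<in> V" for v
  proof -
    have "v - Q v \<in> V" using that QV V by (simp add: subspace_diff)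
    from orth[OF this, of v] show ?thesis by simp
  qed
  from that[OF lin QV this orth] show ?thesis .
qed

text \<open>Induction on the dimension of the range. With \<open>Q\<close> the projection onto the
  range, \<open>f = Q f\<close>, so by cyclicity \<open>f Q\<close> has the same trace. Unless
  \<open>f = 0\<close>, the range of \<open>f Q\<close> is strictly smaller: otherwise every power
  of \<open>f\<close> would map the range of \<open>f\<close> onto itself, against
  \<open>f^n = 0\<close>.\<close>

lemma linear_trace_nilpotent:
  fixes f :: "'e::euclidean_space \<Rightarrow> 'e"
  assumes "linear f" "\<And>v. (f ^^ n) v = 0"
  shows "linear_trace f = 0"
  using assms
proof (induction "dim (range f)" arbitrary: f rule: less_induct)
  case less
  note f = less.prems(1)
  have sub: "subspace (range f)" using linear_subspace_image[OF f subspace_UNIV] .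
  show ?case
  proof (cases "range f = {0}")
    case True
    have "f x = 0" for x using rangeI[of f x] unfolding True by (rule singletonD)
    then show ?thesis by (simp add: linear_trace_def)
  next
    case False
    obtain Q where Q: "linear Q" "\<And>v. Q v \<in> range f" "\<And>v. v \<in> range f \<Longrightarrow> Q v = v"
      by (rule orthogonal_projection[OF sub]) (rule that)
    let ?g = "\<lambda>x. f (Q x)"
    have g: "linear ?g" using linear_compose[OF Q(1) f] by (simp add: o_def)
    have pow: "(?g ^^ Suc k) v = (f ^^ Suc k) (Q v)" for k v
    proof (induction k)
      case (Suc k)
      have "(?g ^^ Suc (Suc k)) v = f (Q ((?g ^^ Suc k) v))" by simp
      also have "\<dots> = f (Q (f ((f ^^ k) (Q v))))" unfolding Suc by simp
      also have "\<dots> = f (f ((f ^^ k) (Q v)))" by (simp only: Q(3)[OF rangeI])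
      finally show ?case by simp
    qed simp
    have nil': "(?g ^^ n) v = 0" for v
    proof (cases n)
      case 0 then show ?thesis using less.prems(2)[of v] by simp
    next
      case (Suc k) then show ?thesis using pow[of k v] less.prems(2)[of "Q v"] by metis
    qed
    have ss: "range ?g \<subseteq> range f" by (intro image_subsetI rangeI)
    have "range ?g \<noteq> range f"
    proof
      assume eq: "range ?g = range f"
      have "(f ^^ k) ` range f = range f" for k
      proof (induction k)
        case (Suc k)
        have "(f ^^ Suc k) ` range f = f ` ((f ^^ k) ` range f)" by (simp add: image_image)
        also have "\<dots> = f ` range f" by (simp only: Suc)
        also have "\<dots> = f ` range Q"
        proof -
          have "range Q = range f"
          proof
            show "range Q \<subseteq> range f" using Q(2) by (intro image_subsetI)
            show "range f \<subseteq> range Q"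
            proof
              fix w assume "w \<in> range f"
              then have "Q w = w" by (rule Q(3))
              then show "w \<in> range Q" by (metis rangeI)
            qed
          qed
          then show ?thesis by simp
        qed
        also have "\<dots> = range f" using eq by (simp add: image_image)
        finally show ?case .
      qed simp
      from this[of n] have *: "range f = (f ^^ n) ` range f" by (rule sym)
      have "x = 0" if x: "x \<in> range f" for x
      proof -
        have "x \<in> (f ^^ n) ` range f" using x * by simp
        then obtain y where "x = (f ^^ n) y" by (elim imageE)
        then show ?thesis using less.prems(2)[of y] by simp
      qed
      moreover have "0 \<in> range f" using subspace_0[OF sub] .
      ultimately have "range f = {0}" by (intro equalityI subsetI) simp_all
      with False show False by (rule notE)
    qed
    then have "dim (range ?g) < dim (range f)"
      using dim_subspace_psubset[OF linear_subspace_image[OF g subspace_UNIV] sub] ss by (simp add: psubset_eq)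
    from less.hyps[OF this g nil'] have "linear_trace ?g = 0" .
    moreover have "linear_trace ?g = linear_trace (\<lambda>x. Q (f x))"
      by (rule linear_trace_comp_commute[OF f Q(1)])
    moreover have "(\<lambda>x. Q (f x)) = f" by (simp only: Q(3)[OF rangeI])
    ultimately show ?thesis by simp
  qed
qed

subsection \<open>Polynomial families of vectors\<close>

definition poly_fun :: "(real \<Rightarrow> real) \<Rightarrow> bool" where
  "poly_fun g \<longleftrightarrow> (\<exists>p. \<forall>t. g t = poly p t)"

definition poly_vec :: "(real \<Rightarrow> 'e::euclidean_space) \<Rightarrow> bool" where
  "poly_vec f \<longleftrightarrow> (\<forall>w. poly_fun (\<lambda>t. f t \<bullet> w))"

lemma poly_fun_const: "poly_fun (\<lambda>t. c)"
  unfolding poly_fun_def by (rule exI[of _ "[:c:]"]) simp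
lemma poly_fun_ident: "poly_fun (\<lambda>t. t)"
  unfolding poly_fun_def by (rule exI[of _ "[:0, 1:]"]) simp
lemma poly_fun_add: "poly_fun f \<Longrightarrow> poly_fun g \<Longrightarrow> poly_fun (\<lambda>t. f t + g t)"
  unfolding poly_fun_def by (elim exE, rename_tac p q, rule_tac x = "p + q" in exI) simp
lemma poly_fun_diff: "poly_fun f \<Longrightarrow> poly_fun g \<Longrightarrow> poly_fun (\<lambda>t. f t - g t)"
  unfolding poly_fun_def by (elim exE, rename_tac p q, rule_tac x = "p - q" in exI) simp
lemma poly_fun_mult: "poly_fun f \<Longrightarrow> poly_fun g \<Longrightarrow> poly_fun (\<lambda>t. f t * g t)"
  unfolding poly_fun_def by (elim exE, rename_tac p q, rule_tac x = "p * q" in exI) simp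
lemma poly_fun_sum: "(\<And>i. i \<in> I \<Longrightarrow> poly_fun (f i)) \<Longrightarrow> poly_fun (\<lambda>t. \<Sum>i\<in>I. f i t)"
  by (induction I rule: infinite_finite_induct) (simp_all add: poly_fun_const poly_fun_add)

lemma poly_fun_zeros:
  assumes "poly_fun g" "g t0 \<noteq> 0" shows "finite {t. g t = 0}"
proof -
  obtain p where p: "\<And>t. g t = poly p t" using assms(1) unfolding poly_fun_def by blast
  then have "p \<noteq> 0" using assms(2) by auto
  then show ?thesis using poly_roots_finite[of p] p by simp
qed

lemma poly_vec_const: "poly_vec (\<lambda>t. c)"
  by (simp add: poly_vec_def poly_fun_const)
lemma poly_vec_add: "poly_vec f \<Longrightarrow> poly_vec g \<Longrightarrow> poly_vec (\<lambda>t. f t + g t)"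
  by (simp add: poly_vec_def inner_add_left poly_fun_add)
lemma poly_vec_diff: "poly_vec f \<Longrightarrow> poly_vec g \<Longrightarrow> poly_vec (\<lambda>t. f t - g t)"
  by (simp add: poly_vec_def inner_diff_left poly_fun_diff)
lemma poly_vec_scale: "poly_fun f \<Longrightarrow> poly_vec g \<Longrightarrow> poly_vec (\<lambda>t. f t *\<^sub>R g t)"
  by (simp add: poly_vec_def poly_fun_mult)
lemma poly_vec_linear:
  fixes L :: "'a::euclidean_space \<Rightarrow> 'a"
  assumes "linear L" "poly_vec f" shows "poly_vec (\<lambda>t. L (f t))"
  unfolding poly_vec_def
proof
  fix w
  have "L x \<bullet> w = x \<bullet> adjoint L w" for x
    using adjoint_works[OF assms(1), of x w] by (rule sym)
  then show "poly_fun (\<lambda>t. L (f t) \<bullet> w)"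
    using assms(2) by (simp add: poly_vec_def)
qed

lemma poly_vec_funpow:
  fixes A B :: "'e::euclidean_space \<Rightarrow> 'e"
  assumes A: "linear A" and B: "linear B"
  shows "poly_vec (\<lambda>t. ((\<lambda>u. A u + t *\<^sub>R B u) ^^ n) v)"
proof (induction n)
  case (Suc n)
  show ?case using poly_vec_add[OF poly_vec_linear[OF A Suc] poly_vec_scale[OF poly_fun_ident poly_vec_linear[OF B Suc]]]
    by simp
qed (simp add: poly_vec_const)

lemma poly_vec_zero:
  assumes "poly_vec f" "infinite {t. f t = 0}" shows "f t = 0"
proof (rule ccontr)
  assume "f t \<noteq> 0"
  then have "f t \<bullet> f t \<noteq> 0" by simp
  moreover have "poly_fun (\<lambda>s. f s \<bullet> f t)" using assms(1) unfolding poly_vec_def by blast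
  ultimately have "finite {s. f s \<bullet> f t = 0}" by (intro poly_fun_zeros[where ?t0.0 = t])
  then have "finite {s. f s = 0}" by (rule finite_subset[rotated]) (simp add: subset_iff)
  then show False using assms(2) by simp
qed

text \<open>Elimination without division: the coefficient \<open>p k\<close> of the pivot
  \<open>w k\<close> in the direction \<open>w k t0\<close> is a nonzero polynomial, and multiplying
  through by it keeps the reduced vectors \<open>u i\<close> polynomial. Outside the zeros of
  \<open>p k\<close>, a nontrivial relation among the \<open>w i\<close> yields one among the
  \<open>u i\<close>.\<close>

lemma poly_vec_independent:
  fixes w :: "'i \<Rightarrow> real \<Rightarrow> 'e::euclidean_space"
  assumes "finite I" "\<And>i. i \<in> I \<Longrightarrow> poly_vec (w i)"
    and "\<And>c. (\<Sum>i\<in>I. c i *\<^sub>R w i t0) = 0 \<Longrightarrow> \<forall>i\<in>I. c i = 0"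
  shows "finite {t. \<exists>c. (\<Sum>i\<in>I. c i *\<^sub>R w i t) = 0 \<and> (\<exists>i\<in>I. c i \<noteq> 0)}"
  using assms
proof (induction I arbitrary: w rule: finite_induct)
  case empty then show ?case by simp
next
  case (insert k I)
  have wk: "w k t0 \<noteq> 0"
  proof
    assume "w k t0 = 0"
    then have "(\<Sum>i\<in>insert k I. (if i = k then 1 else 0) *\<^sub>R w i t0) = 0"
      using insert.hyps by (auto intro!: sum.neutral)
    from insert.prems(2)[OF this] show False by simp
  qed
  define p where "p i t = w i t \<bullet> w k t0" for i t
  have pk: "p k t0 \<noteq> 0" using wk by (simp add: p_def)
  have pp: "poly_fun (p i)" if "i \<in> insert k I" for i
    using insert.prems(1)[OF that] unfolding p_def poly_vec_def by blast
  define u where "u i t = p k t *\<^sub>R w i t - p i t *\<^sub>R w k t" for i t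
  have pu: "poly_vec (u i)" if "i \<in> I" for i
    unfolding u_def using insert.prems(1) pp that by (intro poly_vec_diff poly_vec_scale) auto
  have comb: "(\<Sum>i\<in>insert k I. (if i = k then - (\<Sum>j\<in>I. c j * p j t) else c i * p k t) *\<^sub>R w i t)
      = (\<Sum>i\<in>I. c i *\<^sub>R u i t)" for c t
  proof -
    have "(\<Sum>i\<in>I. (if i = k then - (\<Sum>j\<in>I. c j * p j t) else c i * p k t) *\<^sub>R w i t)
        = (\<Sum>i\<in>I. (c i * p k t) *\<^sub>R w i t)"
      using insert.hyps by (intro sum.cong) auto
    then show ?thesis using insert.hyps
      by (simp add: u_def scaleR_diff_right sum_subtractf scaleR_sum_left)
  qed
  have "finite {t. \<exists>c. (\<Sum>i\<in>I. c i *\<^sub>R u i t) = 0 \<and> (\<exists>i\<in>I. c i \<noteq> 0)}"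
  proof (rule insert.IH)
    fix c assume "(\<Sum>i\<in>I. c i *\<^sub>R u i t0) = 0"
    with comb[of c t0] have "(\<Sum>i\<in>insert k I. (if i = k then - (\<Sum>j\<in>I. c j * p j t0) else c i * p k t0) *\<^sub>R w i t0) = 0"
      by (rule trans)
    from insert.prems(2)[OF this]
    have "c i * p k t0 = 0" if "i \<in> I" for i using that insert.hyps(2) by (metis insertI2)
    then show "\<forall>i\<in>I. c i = 0" using pk by simp
  qed (rule pu)
  moreover have "finite {t. p k t = 0}" using poly_fun_zeros[OF pp pk] by simp
  moreover have "{t. \<exists>c. (\<Sum>i\<in>insert k I. c i *\<^sub>R w i t) = 0 \<and> (\<exists>i\<in>insert k I. c i \<noteq> 0)}
     \<subseteq> {t. \<exists>c. (\<Sum>i\<in>I. c i *\<^sub>R u i t) = 0 \<and> (\<exists>i\<in>I. c i \<noteq> 0)} \<union> {t. p k t = 0}"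
  proof
    fix t assume "t \<in> {t. \<exists>c. (\<Sum>i\<in>insert k I. c i *\<^sub>R w i t) = 0 \<and> (\<exists>i\<in>insert k I. c i \<noteq> 0)}"
    then obtain c where c: "(\<Sum>i\<in>insert k I. c i *\<^sub>R w i t) = 0" "\<exists>i\<in>insert k I. c i \<noteq> 0" by blast
    have s: "c k *\<^sub>R w k t + (\<Sum>i\<in>I. c i *\<^sub>R w i t) = 0" using c(1) insert.hyps by simp
    then have "(c k *\<^sub>R w k t + (\<Sum>i\<in>I. c i *\<^sub>R w i t)) \<bullet> w k t0 = 0" by simp
    then have s2: "c k * p k t + (\<Sum>i\<in>I. c i * p i t) = 0"
      by (simp add: inner_add_left inner_sum_left p_def)
    have "(\<Sum>i\<in>I. c i *\<^sub>R u i t) = p k t *\<^sub>R (\<Sum>i\<in>I. c i *\<^sub>R w i t) - (\<Sum>i\<in>I. c i * p i t) *\<^sub>R w k t"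
      by (simp add: u_def scaleR_diff_right sum_subtractf scaleR_sum_left scaleR_sum_right mult.commute)
    also have "(\<Sum>i\<in>I. c i *\<^sub>R w i t) = - c k *\<^sub>R w k t" using s by (simp add: add_eq_0_iff)
    also have "(\<Sum>i\<in>I. c i * p i t) = - c k * p k t" using s2 by simp
    finally have "(\<Sum>i\<in>I. c i *\<^sub>R u i t) = 0" by (simp add: mult.commute)
    moreover have "\<exists>i\<in>I. c i \<noteq> 0" if "p k t \<noteq> 0"
    proof (rule ccontr)
      assume a: "\<not> ?thesis"
      then have "c k * p k t = 0" using s2 by simp
      then show False using a c(2) that by auto
    qed
    ultimately show "t \<in> {t. \<exists>c. (\<Sum>i\<in>I. c i *\<^sub>R u i t) = 0 \<and> (\<exists>i\<in>I. c i \<noteq> 0)} \<union> {t. p k t = 0}" by blast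
  qed
  ultimately show ?case by (meson finite_Un finite_subset)
qed

subsection \<open>Polynomials in a linear map\<close>

definition poly_map_action :: "real poly \<Rightarrow> ('e::real_vector \<Rightarrow> 'e) \<Rightarrow> 'e \<Rightarrow> 'e" where
  "poly_map_action p f v = (\<Sum>i\<le>degree p. coeff p i *\<^sub>R (f ^^ i) v)"

abbreviation "pact \<equiv> poly_map_action"

lemma pact_upto:
  assumes "degree p \<le> n" shows "pact p f v = (\<Sum>i\<le>n. coeff p i *\<^sub>R (f ^^ i) v)"
  unfolding poly_map_action_def
  by (rule sum.mono_neutral_left) (use assms in \<open>auto simp: coeff_eq_0\<close>)

lemma pact_0 [simp]: "pact 0 f v = 0"
  by (simp add: poly_map_action_def)

lemma pact_const [simp]: "pact [:a:] f v = a *\<^sub>R v"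
  by (simp add: poly_map_action_def)

lemma pact_1 [simp]: "pact 1 f v = v"
  using pact_const[of 1 f v] by (simp add: one_pCons)

lemma pact_add: "pact (p + q) f v = pact p f v + pact q f v"
proof -
  let ?n = "max (degree p) (degree q)"
  have "degree (p + q) \<le> ?n" by (rule degree_add_le_max)
  then show ?thesis
    by (simp add: pact_upto[of _ ?n] scaleR_left_distrib sum.distrib)
qed

lemma pact_smult: "pact (smult a p) f v = a *\<^sub>R pact p f v"
  by (simp add: pact_upto[of "smult a p" "degree p"] pact_upto[of p "degree p"] scaleR_sum_right)

lemma pact_minus: "pact (- p) f v = - pact p f v"
  using pact_smult[of "-1" p f v] by simp

lemma pact_diff: "pact (p - q) f v = pact p f v - pact q f v"
  using pact_add[of p "- q" f v] pact_minus[of q f v] by simp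

lemma pact_pCons:
  assumes f: "linear f" shows "pact (pCons a p) f v = a *\<^sub>R v + f (pact p f v)"
proof -
  have "pact (pCons a p) f v = (\<Sum>i\<le>Suc (degree p). coeff (pCons a p) i *\<^sub>R (f ^^ i) v)"
    by (rule pact_upto) (simp add: degree_pCons_le)
  also have "\<dots> = a *\<^sub>R v + (\<Sum>i\<le>degree p. coeff p i *\<^sub>R f ((f ^^ i) v))"
    by (simp add: sum.atMost_Suc_shift del: sum.atMost_Suc)
  also have "(\<Sum>i\<le>degree p. coeff p i *\<^sub>R f ((f ^^ i) v)) = f (pact p f v)"
    by (simp add: poly_map_action_def linear_sum[OF f] linear_cmul[OF f])
  finally show ?thesis .
qed

lemma linear_pact:
  assumes f: "linear f" shows "linear (pact p f)"
proof (rule linearI)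
  fix x y show "pact p f (x + y) = pact p f x + pact p f y"
    by (simp add: poly_map_action_def linear_add[OF linear_funpow[OF f]] scaleR_right_distrib sum.distrib)
next
  fix c x show "pact p f (c *\<^sub>R x) = c *\<^sub>R pact p f x"
    by (simp add: poly_map_action_def linear_cmul[OF linear_funpow[OF f]] scaleR_sum_right mult.commute)
qed

lemma pact_mult:
  assumes f: "linear f" shows "pact (p * q) f v = pact p f (pact q f v)"
proof (induction p)
  case (pCons a p)
  then show ?case
    by (simp add: mult_pCons_left pact_add pact_smult pact_pCons[OF f])
qed simp

lemma pact_commute:
  assumes "linear f" shows "pact p f (pact q f v) = pact q f (pact p f v)"
  by (metis pact_mult[OF assms] mult.commute)

lemma pact_power:
  assumes f: "linear f" shows "pact (p ^ n) f v = ((pact p f) ^^ n) v"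
  by (induction n) (simp_all add: pact_mult[OF f])

lemma pact_pcompose:
  assumes f: "linear f" shows "pact (pcompose p s) f v = pact p (pact s f) v"
proof (induction p)
  case (pCons a p)
  then show ?case
    by (simp add: pcompose_pCons pact_add pact_mult[OF f] pact_pCons[OF linear_pact[OF f]])
qed simp

lemma pact_X: assumes "linear f" shows "pact [:0, 1:] f v = f v"
  by (simp add: pact_pCons[OF assms] linear_0[OF assms])

lemma pact_dvd:
  assumes f: "linear f" and "p dvd q" and "\<And>v. pact p f v = 0" shows "pact q f v = 0"
  using assms(2,3) by (auto elim!: dvdE simp: mult.commute[of p] pact_mult[OF f] linear_0[OF linear_pact[OF f]])

text \<open>For a basis vector \<open>b\<close> the iterates of \<open>f\<close> on \<open>b\<close>
  up to exponent \<open>DIM('e)\<close> are one too many to be independent; a repetition among them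
  is treated separately because dependence is a property of the set. The product over the basis
  works since polynomials in \<open>f\<close> commute.\<close>

lemma annihilating_poly:
  fixes f :: "'e::euclidean_space \<Rightarrow> 'e"
  assumes f: "linear f"
  obtains p where "p \<noteq> 0" "\<And>v. pact p f v = 0"
proof -
  have ex: "\<exists>p. p \<noteq> 0 \<and> pact p f b = 0" for b
  proof (cases "inj_on (\<lambda>i. (f ^^ i) b) {..DIM('e)}")
    case True
    let ?S = "(\<lambda>i. (f ^^ i) b) ` {..DIM('e)}"
    have "card ?S = Suc (DIM('e))" using card_image[OF True] by simp
    then have "dependent ?S" using independent_card_le[of ?S] by fastforce
    then obtain u where u: "(\<Sum>v\<in>?S. u v *\<^sub>R v) = 0" "\<exists>v\<in>?S. u v \<noteq> 0"
      using dependent_finite[of ?S] by auto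
    let ?c = "\<lambda>i. if i \<le> DIM('e) then u ((f ^^ i) b) else 0"
    define p where "p = Abs_poly ?c"
    have co: "coeff p i = ?c i" for i
      unfolding p_def by (subst coeff_Abs_poly[of "DIM('e)"]) auto
    have "degree p \<le> DIM('e)" by (rule degree_le) (simp add: co)
    then have "pact p f b = (\<Sum>i\<le>DIM('e). u ((f ^^ i) b) *\<^sub>R (f ^^ i) b)"
      by (subst pact_upto[of _ "DIM('e)"]) (simp_all add: co)
    also have "\<dots> = 0" using u(1) by (subst (asm) sum.reindex[OF True]) simp
    finally have "pact p f b = 0" .
    moreover from u(2) obtain i where "i \<le> DIM('e)" "u ((f ^^ i) b) \<noteq> 0" by auto
    then have "coeff p i \<noteq> 0" by (simp add: co)
    then have "p \<noteq> 0" by auto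
    ultimately show ?thesis by blast
  next
    case False
    then obtain i j where ij: "(f ^^ i) b = (f ^^ j) b" "i \<noteq> j" unfolding inj_on_def by blast
    let ?p = "monom 1 i - monom 1 j :: real poly"
    have m: "pact (monom 1 i) f b = (f ^^ i) b" for i
    proof (induction i)
      case (Suc i) then show ?case by (simp add: monom_Suc pact_pCons[OF f])
    qed (simp add: monom_0)
    have "coeff ?p i = 1" using ij(2)[symmetric] by simp
    then have "?p \<noteq> 0" by (metis coeff_0 zero_neq_one)
    moreover have "pact ?p f b = 0" by (simp add: pact_diff m ij(1))
    ultimately show ?thesis by blast
  qed
  then obtain P where P: "\<And>b. P b \<noteq> 0" "\<And>b. pact (P b) f b = 0" by metis
  define p where "p = (\<Prod>b\<in>(Basis::'e set). P b)"
  have "pact p f b = 0" if "b \<in> Basis" for b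
  proof -
    have "p = (\<Prod>c\<in>Basis - {b}. P c) * P b"
      unfolding p_def using that by (simp add: prod.remove mult.commute)
    then show ?thesis by (simp add: pact_mult[OF f] P(2) linear_0[OF linear_pact[OF f]])
  qed
  then have "pact p f v = 0" for v
    using linear_eq_0_on_span[of "pact p f" Basis v] linear_pact[OF f] by simp
  moreover have "p \<noteq> 0" unfolding p_def using P(1) by simp
  ultimately show ?thesis using that[of p] by simp
qed

section \<open>The semisimple part as a polynomial\<close>

text \<open>The radical of \<open>P\<close>, obtained without factorization: among the polynomials
  with a power divisible by \<open>P\<close> one of least degree is taken. A common prime divisor
  \<open>q\<close> of it and its derivative would divide it twice, since \<open>q\<close> does not
  divide \<open>pderiv q\<close> for reasons of degree, and one copy of \<open>q\<close> could be
  dropped.\<close>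

lemma ex_poly_coprime_pderiv:
  fixes P :: "real poly"
  assumes "P \<noteq> 0"
  obtains p n where "P dvd p ^ n" "coprime p (pderiv p)"
proof -
  let ?A = "\<lambda>p. p \<noteq> 0 \<and> (\<exists>n. P dvd p ^ n)"
  have "?A P" using assms by (auto intro: exI[of _ 1])
  define p where "p = arg_min degree ?A"
  have p: "p \<noteq> 0" "\<exists>n. P dvd p ^ n"
    using arg_min_natI[of ?A P degree] \<open>?A P\<close> unfolding p_def by blast+
  have min: "degree p \<le> degree q" if "?A q" for q
    unfolding p_def using arg_min_nat_le[of ?A q degree] that by blast
  have "coprime p (pderiv p)"
  proof (rule ccontr)
    assume "\<not> coprime p (pderiv p)"
    then have "\<not> is_unit (gcd p (pderiv p))" by (simp add: coprime_iff_gcd_eq_1)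
    moreover have "gcd p (pderiv p) \<noteq> 0" using p(1) by simp
    ultimately obtain q where q: "q dvd gcd p (pderiv p)" "prime q"
      using prime_divisor_exists by blast
    then obtain r where r: "p = q * r" by (meson dvdE gcd_dvd1 dvd_trans)
    have "q dvd pderiv p" using q(1) by simp
    then have "q dvd pderiv q * r + q * pderiv r" unfolding r by (simp add: pderiv_mult mult.commute add.commute)
    then have "q dvd pderiv q * r" by (simp add: dvd_add_left_iff)
    moreover have "\<not> q dvd pderiv q"
    proof
      assume d: "q dvd pderiv q"
      have dq: "degree q > 0" using q(2) not_prime_unit[of q] is_unit_iff_degree[of q] by fastforce
      then have "pderiv q \<noteq> 0" by (simp add: pderiv_eq_0_iff)
      then show False using dvd_imp_degree_le[OF d] dq by (simp add: degree_pderiv)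
    qed
    ultimately have "q dvd r" using q(2) prime_dvd_multD by blast
    then obtain s where s: "r = q * s" by blast
    let ?p = "q * s"
    have p2: "p dvd ?p ^ 2" unfolding r s by (rule dvdI[of _ _ s]) (simp add: power2_eq_square algebra_simps)
    obtain n where "P dvd p ^ n" using p(2) by blast
    also have "p ^ n dvd (?p ^ 2) ^ n" using p2 by (rule dvd_power_same)
    finally have "P dvd ?p ^ (2 * n)" by (simp add: power_mult)
    moreover have "?p \<noteq> 0" using p(1) r s by auto
    ultimately have "degree p \<le> degree ?p" using min by blast
    moreover have "degree p = degree q + degree ?p" using \<open>?p \<noteq> 0\<close> p(1) unfolding r s by (simp add: degree_mult_eq)
    moreover have "degree q > 0" using q(2) not_prime_unit[of q] is_unit_iff_degree[of q] by fastforce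
    ultimately show False by simp
  qed
  then show ?thesis using p(2) that by blast
qed

lemma pcompose_taylor:
  fixes p s e :: "real poly"
  obtains z where "pcompose p (s + e) = pcompose p s + e * pcompose (pderiv p) s + e * e * z"
proof -
  have "\<exists>z. pcompose p (s + e) = pcompose p s + e * pcompose (pderiv p) s + e * e * z"
  proof (induction p)
    case (pCons a p)
    then obtain z where z: "pcompose p (s + e) = pcompose p s + e * pcompose (pderiv p) s + e * e * z" by blast
    have "pcompose (pCons a p) (s + e) = pcompose (pCons a p) s + e * pcompose (pderiv (pCons a p)) s
      + e * e * (pcompose (pderiv p) s + (s + e) * z)"
      unfolding pderiv_pCons pcompose_add pcompose_pCons z by (simp add: ring_distribs ac_simps)
    then show ?case by blast
  qed (auto intro: exI[of _ 0])
  then show ?thesis using that by blast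
qed

text \<open>Newton's iteration modulo powers of \<open>p\<close>, started at the polynomial X. With
  \<open>u * p + v * pderiv p = 1\<close>, the polynomial v(s) inverts p'(s) modulo p(s), so that
  passing to \<open>s - p(s) v(s)\<close> replaces p(s) by a multiple of its square. The correction
  is divisible by \<open>p\<close>, which keeps \<open>s\<close> congruent to X modulo
  \<open>p\<close>.\<close>

lemma newton_lift:
  fixes p :: "real poly"
  assumes "coprime p (pderiv p)"
  obtains s where "p ^ n dvd pcompose p s" "p dvd s - [:0, 1:]"
proof -
  obtain u v where uv: "u * p + v * pderiv p = 1"
    using assms bezout_coefficients_fst_snd[of p "pderiv p"] by (metis coprime_iff_gcd_eq_1)
  have "\<exists>s. p ^ Suc n dvd pcompose p s \<and> p dvd s - [:0, 1:]"
  proof (induction n)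
    case 0 then show ?case by (intro exI[of _ "[:0, 1:]"]) simp
  next
    case (Suc n)
    then obtain s where s: "p ^ Suc n dvd pcompose p s" "p dvd s - [:0, 1:]" by blast
    let ?P = "pcompose p s"
    let ?e = "- (?P * pcompose v s)"
    obtain z where z: "pcompose p (s + ?e) = ?P + ?e * pcompose (pderiv p) s + ?e * ?e * z"
      by (rule pcompose_taylor)
    have one: "pcompose u s * ?P + pcompose v s * pcompose (pderiv p) s = 1"
      using uv by (metis pcompose_1 pcompose_add pcompose_mult)
    have "?P + ?e * pcompose (pderiv p) s = ?P * (1 - pcompose v s * pcompose (pderiv p) s)"
      by (simp add: algebra_simps)
    also have "1 - pcompose v s * pcompose (pderiv p) s = pcompose u s * ?P"
      using one by (simp add: algebra_simps)
    finally have eq: "pcompose p (s + ?e) = (?P * ?P) * (pcompose u s + pcompose v s * pcompose v s * z)"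
      unfolding z by (simp add: algebra_simps)
    have "p ^ Suc (Suc n) dvd p ^ Suc n * p ^ Suc n"
      by (metis le_imp_power_dvd power_add Suc_le_mono add_Suc_right le_add1 power_Suc2 power_Suc)
    also have "\<dots> dvd ?P * ?P" using s(1) by (rule mult_dvd_mono) (rule s(1))
    finally have "p ^ Suc (Suc n) dvd pcompose p (s + ?e)" unfolding eq by (rule dvd_mult2)
    moreover have "p dvd ?P" using s(1) by (metis dvd_mult_left power_Suc)
    then have "p dvd (s - [:0, 1:]) + ?e" using s(2) by (intro dvd_add) (simp_all add: dvd_mult2)
    then have "p dvd (s + ?e) - [:0, 1:]" by (simp add: algebra_simps)
    ultimately show ?case by blast
  qed
  then obtain s where "p ^ Suc n dvd pcompose p s" "p dvd s - [:0, 1:]" by blast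
  moreover from this(1) have "p ^ n dvd pcompose p s" by (metis dvd_mult_right power_Suc)
  ultimately show ?thesis using that by blast
qed

text \<open>The Jordan-Chevalley decomposition without eigenvalues. If \<open>p ^ n\<close>
  annihilates \<open>f\<close>, then \<open>newton_lift\<close> makes s(f) a root of the separable
  \<open>p\<close>, and s(f) - f is nilpotent because \<open>p\<close> divides s - X.\<close>

lemma semisimple_part:
  fixes f :: "'e::euclidean_space \<Rightarrow> 'e"
  assumes f: "linear f"
  obtains s p n where "coprime p (pderiv p)" "\<And>v. pact p (pact s f) v = 0"
    "\<And>v. ((\<lambda>v. pact s f v - f v) ^^ n) v = 0"
proof -
  obtain P where P: "P \<noteq> 0" "\<And>v. pact P f v = 0" using annihilating_poly[OF f] by blast
  obtain p n where p: "P dvd p ^ n" "coprime p (pderiv p)" using ex_poly_coprime_pderiv[OF P(1)] by blast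
  obtain s where s: "p ^ n dvd pcompose p s" "p dvd s - [:0, 1:]" using newton_lift[OF p(2), of n] by blast
  have pn: "pact (p ^ n) f v = 0" for v by (rule pact_dvd[OF f p(1) P(2)])
  have "pact p (pact s f) v = 0" for v
    using pact_dvd[OF f s(1) pn] by (simp add: pact_pcompose[OF f])
  moreover have "((\<lambda>v. pact s f v - f v) ^^ n) v = 0" for v
  proof -
    have "pact ((s - [:0, 1:]) ^ n) f v = 0"
      by (rule pact_dvd[OF f _ pn]) (rule dvd_power_same[OF s(2)])
    moreover have "pact (s - [:0, 1:]) f = (\<lambda>v. pact s f v - f v)"
      by (rule ext) (simp only: pact_diff pact_X[OF f])
    ultimately show ?thesis by (simp add: pact_power[OF f])
  qed
  ultimately show ?thesis using that p(2) by blast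
qed

section \<open>Commutators with a semisimple part\<close>

definition commutator :: "('e \<Rightarrow> 'e) \<Rightarrow> ('e \<Rightarrow> 'e) \<Rightarrow> 'e \<Rightarrow> 'e::real_vector" where
  "commutator f g = (\<lambda>v. f (g v) - g (f v))"

lemma linear_commutator: "linear f \<Longrightarrow> linear g \<Longrightarrow> linear (commutator f g)"
  unfolding commutator_def
  by (intro linear_compose_sub) (use linear_compose in \<open>fastforce simp: o_def\<close>)+

text \<open>As \<open>S\<close> commutes with \<open>W = [S, X]\<close>, every polynomial satisfies
  \<open>[q(S), X] = q'(S) W\<close>. For \<open>q = p\<close> the left side vanishes, and
  \<open>p(S) = 0\<close> and \<open>p'(S) W = 0\<close> force \<open>W = 0\<close> by the Bezout
  identity.\<close>

lemma separable_commutator: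
  fixes S X :: "'e::real_vector \<Rightarrow> 'e"
  assumes S: "linear S" and X: "linear X" and cop: "coprime p (pderiv p)" and p: "\<And>v. pact p S v = 0"
    and c2: "commutator S (commutator S X) = (\<lambda>v. 0)"
  shows "commutator S X = (\<lambda>v. 0)"
proof -
  let ?W = "commutator S X"
  have W: "linear ?W" by (rule linear_commutator[OF S X])
  have SW: "S (?W v) = ?W (S v)" for v using fun_cong[OF c2, of v] by (simp add: commutator_def)
  have Wq: "?W (pact q S v) = pact q S (?W v)" for q v
  proof (induction q)
    case (pCons a q) then show ?case
      by (simp add: pact_pCons[OF S] linear_add[OF W] linear_cmul[OF W] SW[symmetric])
  qed (simp add: linear_0[OF W])
  have der: "pact q S (X v) - X (pact q S v) = pact (pderiv q) S (?W v)" for q v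
  proof (induction q)
    case (pCons a q)
    have "pact (pCons a q) S (X v) - X (pact (pCons a q) S v) = S (pact q S (X v)) - X (S (pact q S v))"
      by (simp add: pact_pCons[OF S] linear_add[OF X] linear_cmul[OF X])
    also have "\<dots> = S (pact q S (X v) - X (pact q S v)) + ?W (pact q S v)"
      by (simp add: commutator_def linear_diff[OF S])
    also have "\<dots> = S (pact (pderiv q) S (?W v)) + pact q S (?W v)" by (simp only: pCons Wq)
    finally show ?case by (simp add: pderiv_pCons pact_add pact_pCons[OF S])
  qed (simp add: linear_0[OF X])
  have z: "pact (pderiv p) S (?W v) = 0" for v
    using der[of p v] by (simp add: p linear_0[OF X])
  obtain a b where ab: "a * p + b * pderiv p = 1"
    using cop bezout_coefficients_fst_snd[of p "pderiv p"] by (metis coprime_iff_gcd_eq_1)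
  have "?W v = 0" for v
  proof -
    have "?W v = pact (a * p + b * pderiv p) S (?W v)" unfolding ab by simp
    also have "\<dots> = 0" by (simp add: pact_add pact_mult[OF S] p z linear_0[OF linear_pact[OF S]])
    finally show ?thesis .
  qed
  then show ?thesis by (rule ext)
qed

lemma separable_commutator_power:
  fixes S X :: "'e::real_vector \<Rightarrow> 'e"
  assumes S: "linear S" and cop: "coprime p (pderiv p)" and p: "\<And>v. pact p S v = 0"
    and X: "linear X" and c: "(commutator S ^^ m) X = (\<lambda>v. 0)"
  shows "commutator S X = (\<lambda>v. 0)"
  using X c
proof (induction m arbitrary: X)
  case 0 then show ?case using linear_0[OF S] by (simp add: commutator_def)
next
  case (Suc m)
  have "(commutator S ^^ m) (commutator S X) = (\<lambda>v. 0)" using Suc.prems(2) by (simp add: funpow_swap1)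
  then have "commutator S (commutator S X) = (\<lambda>v. 0)"
    by (rule Suc.IH[OF linear_commutator[OF S Suc.prems(1)]])
  then show ?case by (rule separable_commutator[OF S Suc.prems(1) cop p])
qed

lemma commutator_add: "linear f \<Longrightarrow> commutator f (\<lambda>v. g v + h v) = (\<lambda>v. commutator f g v + commutator f h v)"
  by (rule ext) (simp add: commutator_def linear_add)
lemma commutator_diff: "linear f \<Longrightarrow> commutator f (\<lambda>v. g v - h v) = (\<lambda>v. commutator f g v - commutator f h v)"
  by (rule ext) (simp add: commutator_def linear_diff)

lemma commutator_pow_add:
  assumes f: "linear f"
  shows "(commutator f ^^ m) (\<lambda>v. g v + h v) = (\<lambda>v. (commutator f ^^ m) g v + (commutator f ^^ m) h v)"
  by (induction m) (simp_all add: commutator_add[OF f])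
lemma commutator_pow_diff:
  assumes f: "linear f"
  shows "(commutator f ^^ m) (\<lambda>v. g v - h v) = (\<lambda>v. (commutator f ^^ m) g v - (commutator f ^^ m) h v)"
  by (induction m) (simp_all add: commutator_diff[OF f])
lemma commutator_pow_zero:
  assumes f: "linear f" and z: "(commutator f ^^ m) g = (\<lambda>v. 0)" and "m \<le> k"
  shows "(commutator f ^^ k) g = (\<lambda>v. 0)"
  using assms(3)
proof (induction rule: dec_induct)
  case (step k) then show ?case using linear_0[OF f] by (simp add: commutator_def)
qed (rule z)

text \<open>If \<open>[A, _]\<close> is nilpotent on \<open>X\<close> and \<open>N = A - S\<close> is nilpotent and commutes with \<open>S\<close>,
  then \<open>[S, _]\<close> is nilpotent on all \<open>N^i X N^j\<close>: by \<open>[S, X] = [A, X] - N X + X N\<close>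
  the double induction is on the nilpotency degree of \<open>X\<close> and downwards on \<open>i + j\<close>.\<close>

lemma commutator_nilpotent_shift:
  fixes A S N X :: "'e::real_vector \<Rightarrow> 'e"
  assumes S: "linear S" and N: "linear N" and A: "\<And>v. A v = S v + N v" and SN: "\<And>v. S (N v) = N (S v)"
    and nil: "\<And>v. (N ^^ n) v = 0"
    and X: "linear X" and c: "(commutator A ^^ k) X = (\<lambda>v. 0)"
  shows "\<exists>m. (commutator S ^^ m) (\<lambda>v. (N ^^ i) (X ((N ^^ j) v))) = (\<lambda>v. 0)"
  using X c
proof (induction k arbitrary: X i j)
  case 0
  then have "X = (\<lambda>v. 0)" by simp
  then show ?case using linear_0[OF linear_funpow[OF N]] by (intro exI[of _ 0]) simp
next
  case (Suc k)
  have linA: "linear A" using linear_compose_add[OF S N] by (simp add: A[abs_def])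
  define Y where "Y = commutator A X"
  have Y: "linear Y" unfolding Y_def by (rule linear_commutator[OF linA Suc.prems(1)])
  have Yk: "(commutator A ^^ k) Y = (\<lambda>v. 0)"
    using Suc.prems(2) unfolding Y_def by (simp add: funpow_swap1)
  note X = Suc.prems(1)
  have Npow: "linear (N ^^ i)" for i by (rule linear_funpow[OF N])
  have SNp: "S ((N ^^ i) v) = (N ^^ i) (S v)" for i v by (induction i) (simp_all add: SN)
  let ?T = "\<lambda>i j. (\<lambda>v. (N ^^ i) (X ((N ^^ j) v)))"
  have step: "commutator S (?T i j) = (\<lambda>v. ((N ^^ i) (Y ((N ^^ j) v)) - ?T (Suc i) j v) + ?T i (Suc j) v)" for i j
  proof
    fix v
    have "commutator S (?T i j) v = (N ^^ i) (S (X ((N ^^ j) v)) - X (S ((N ^^ j) v)))"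
      by (simp add: commutator_def SNp linear_diff[OF Npow])
    also have "S (X ((N ^^ j) v)) - X (S ((N ^^ j) v)) = Y ((N ^^ j) v) - N (X ((N ^^ j) v)) + X (N ((N ^^ j) v))"
      by (simp add: Y_def commutator_def A linear_add[OF X])
    finally show "commutator S (?T i j) v = ((N ^^ i) (Y ((N ^^ j) v)) - ?T (Suc i) j v) + ?T i (Suc j) v"
      by (simp add: linear_diff[OF Npow] linear_add[OF Npow] funpow_swap1)
  qed
  have z: "(N ^^ i) v = 0" if "n \<le> i" for i v using funpow_zero_mono[OF N nil that] .
  \<comment> \<open>The truncated subtraction is intended: for \<open>d = 0\<close> one of
    \<open>i\<close>, \<open>j\<close> is at least \<open>n\<close>, and the product
    vanishes.\<close>
  have "\<exists>m. (commutator S ^^ m) (?T i j) = (\<lambda>v. 0)" if "2 * n - (i + j) \<le> d" for d i j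
    using that
  proof (induction d arbitrary: i j)
    case 0
    then have "n \<le> i \<or> n \<le> j" by linarith
    then have "?T i j = (\<lambda>v. 0)"
      by (auto simp: z linear_0[OF X] linear_0[OF Npow])
    then show ?case by (intro exI[of _ 0]) simp
  next
    case (Suc d)
    obtain m1 where m1: "(commutator S ^^ m1) (\<lambda>v. (N ^^ i) (Y ((N ^^ j) v))) = (\<lambda>v. 0)"
      using Suc.prems \<open>\<And>X i j. linear X \<Longrightarrow> (commutator A ^^ k) X = (\<lambda>v. 0) \<Longrightarrow> \<exists>m. (commutator S ^^ m) (\<lambda>v. (N ^^ i) (X ((N ^^ j) v))) = (\<lambda>v. 0)\<close>[OF Y Yk] by blast
    obtain m2 where m2: "(commutator S ^^ m2) (?T (Suc i) j) = (\<lambda>v. 0)"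
      using Suc.IH[of "Suc i" j] Suc.prems by force
    obtain m3 where m3: "(commutator S ^^ m3) (?T i (Suc j)) = (\<lambda>v. 0)"
      using Suc.IH[of i "Suc j"] Suc.prems by force
    let ?m = "max m1 (max m2 m3)"
    have "(commutator S ^^ ?m) (commutator S (?T i j)) = (\<lambda>v. 0)"
      unfolding step commutator_pow_add[OF S] commutator_pow_diff[OF S]
      using commutator_pow_zero[OF S m1, of ?m] commutator_pow_zero[OF S m2, of ?m] commutator_pow_zero[OF S m3, of ?m]
      by simp
    then have "(commutator S ^^ Suc ?m) (?T i j) = (\<lambda>v. 0)" by (simp add: funpow_swap1)
    then show ?case by blast
  qed
  then show ?case by blast
qed

text \<open>Meant for \<open>A = ad y'\<close> and \<open>X = ad b\<close> with \<open>b\<close> in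
  the null component of \<open>y'\<close>: \<open>ad y'\<close> itself need not commute with
  \<open>ad b\<close>, but its semisimple part does, and this makes the cyclicity of the trace
  applicable.\<close>

lemma semisimple_part_commutes:
  fixes A :: "'e::euclidean_space \<Rightarrow> 'e"
  assumes A: "linear A"
  obtains s n where "\<And>v. ((\<lambda>v. A v - pact s A v) ^^ n) v = 0"
    "\<And>X k v. linear X \<Longrightarrow> (commutator A ^^ k) X = (\<lambda>v. 0) \<Longrightarrow> pact s A (X v) = X (pact s A v)"
proof -
  obtain s p n where s: "coprime p (pderiv p)" "\<And>v. pact p (pact s A) v = 0"
    "\<And>v. ((\<lambda>v. pact s A v - A v) ^^ n) v = 0"
    by (rule semisimple_part[OF A]) (rule that)
  let ?S = "pact s A" let ?N = "\<lambda>v. A v - ?S v"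
  have S: "linear ?S" by (rule linear_pact[OF A])
  have N: "linear ?N" by (rule linear_compose_sub[OF A S])
  have neg: "(?N ^^ k) v = (-1) ^ k *\<^sub>R ((\<lambda>v. ?S v - A v) ^^ k) v" for k v
  proof (induction k)
    case (Suc k) then show ?case
      by (simp add: linear_cmul[OF A] linear_cmul[OF S] scaleR_diff_right)
  qed simp
  have nil: "(?N ^^ n) v = 0" for v by (simp add: neg s(3))
  have SA: "?S (A v) = A (?S v)" for v
    using pact_commute[OF A, of s "[:0, 1:]" v] unfolding pact_X[OF A] .
  have SN: "?S (?N v) = ?N (?S v)" for v by (simp add: linear_diff[OF S] SA)
  have "?S (X v) = X (?S v)" if X: "linear X" and c: "(commutator A ^^ k) X = (\<lambda>v. 0)" for X k v
  proof -
    have AS: "A v = ?S v + ?N v" for v by simp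
    have "\<exists>m. (commutator ?S ^^ m) (\<lambda>v. (?N ^^ 0) (X ((?N ^^ 0) v))) = (\<lambda>v. 0)"
      by (rule commutator_nilpotent_shift[where A = A and n = n and k = k, OF S N]) (fact AS SN nil X c)+
    then obtain m where "(commutator ?S ^^ m) (\<lambda>v. (?N ^^ 0) (X ((?N ^^ 0) v))) = (\<lambda>v. 0)" ..
    then have "(commutator ?S ^^ m) X = (\<lambda>v. 0)" by simp
    from separable_commutator_power[OF S s(1,2) X this] have "commutator ?S X v = 0" by (rule fun_cong)
    then show ?thesis by (simp add: commutator_def)
  qed
  from that[OF nil this] show ?thesis .
qed

subsection \<open>Lie algebras, Engel's theorem and Cartan subalgebras\<close>

locale lie_algebra =
  fixes br :: "'e::euclidean_space \<Rightarrow> 'e \<Rightarrow> 'e"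
  assumes bilinear_br: "bilinear br"
    and br_self: "br x x = 0"
    and jacobi: "br x (br y z) = br (br x y) z + br y (br x z)"
begin

lemma lin: "linear (br x)" and lin_left: "linear (\<lambda>x. br x y)"
  using bilinear_br unfolding bilinear_def by auto

lemma br_add: "br x (y + z) = br x y + br x z" and br_diff: "br x (y - z) = br x y - br x z"
  and br_scale: "br x (c *\<^sub>R y) = c *\<^sub>R br x y" and br_0 [simp]: "br x 0 = 0"
  and br_neg: "br x (- y) = - br x y"
  using linear_add[OF lin] linear_diff[OF lin] linear_cmul[OF lin] linear_0[OF lin] linear_neg[OF lin] by auto
lemma br_add_left: "br (x + y) z = br x z + br y z"
  and br_scale_left: "br (c *\<^sub>R x) z = c *\<^sub>R br x z" and br_0_left [simp]: "br 0 z = 0"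
  using linear_add[OF lin_left] linear_cmul[OF lin_left] linear_0[OF lin_left] by auto

lemma br_swap: "br x y = - br y x"
proof -
  have "br (x + y) (x + y) = 0" by (rule br_self)
  then have "br x y + br y x = 0" unfolding br_add br_add_left by (simp add: br_self add.commute)
  then show ?thesis by (simp add: eq_neg_iff_add_eq_0)
qed

definition subalgebra :: "'e set \<Rightarrow> bool" where
  "subalgebra g \<longleftrightarrow> subspace g \<and> (\<forall>x\<in>g. \<forall>y\<in>g. br x y \<in> g)"

text \<open>The Fitting null component of \<open>ad x\<close>. By \<open>funpow_kernel_dim\<close>
  the exponent captures the whole generalized kernel.\<close>

definition ad0 :: "'e \<Rightarrow> 'e set" where
  "ad0 x = {v. (br x ^^ DIM('e)) v = 0}"

lemma ad0I: "(br x ^^ n) v = 0 \<Longrightarrow> v \<in> ad0 x"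
  unfolding ad0_def using funpow_kernel_dim[OF lin] by simp

lemma ad0D: "v \<in> ad0 x \<Longrightarrow> (br x ^^ DIM('e)) v = 0"
  by (simp add: ad0_def)

lemma ad0_adD: "br x v \<in> ad0 x \<Longrightarrow> v \<in> ad0 x"
  by (rule ad0I[where n = "Suc DIM('e)"]) (simp only: funpow_Suc_right o_apply ad0D)

lemma subspace_ad0: "subspace (ad0 x)"
  unfolding ad0_def by (rule linear_subspace_kernel[OF linear_funpow[OF lin]])

lemma ad0_self: "x \<in> ad0 x"
  by (rule ad0I[where n = 1]) (simp add: br_self)

text \<open>The Leibniz rule turns \<open>[x, [y, z]]\<close> into two brackets of smaller total
  nilpotency degree \<open>i + j\<close>. Both lie in the null component, hence so does
  \<open>[y, z]\<close>.\<close>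

lemma ad0_br:
  assumes "y \<in> ad0 x" "z \<in> ad0 x" shows "br y z \<in> ad0 x"
proof -
  have "br y z \<in> ad0 x" if "(br x ^^ i) y = 0" "(br x ^^ j) z = 0" "i + j = n" for i j n y z
    using that
  proof (induction n arbitrary: i j y z)
    case 0 then show ?case using subspace_0[OF subspace_ad0] by simp
  next
    case (Suc n)
    note p = Suc.prems and ih = Suc.IH
    have a: "br (br x y) z \<in> ad0 x"
    proof (cases i)
      case 0 then show ?thesis using p(1) subspace_0[OF subspace_ad0] by simp
    next
      case (Suc k)
      have "(br x ^^ k) (br x y) = 0" using p(1) unfolding Suc by (simp add: funpow_swap1)
      then show ?thesis by (rule ih[OF _ p(2)]) (use p(3) Suc in simp)
    qed
    have b: "br y (br x z) \<in> ad0 x"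
    proof (cases j)
      case 0 then show ?thesis using p(2) subspace_0[OF subspace_ad0] by simp
    next
      case (Suc k)
      have "(br x ^^ k) (br x z) = 0" using p(2) unfolding Suc by (simp add: funpow_swap1)
      then show ?thesis by (rule ih[OF p(1)]) (use p(3) Suc in simp)
    qed
    have "br x (br y z) \<in> ad0 x" unfolding jacobi[of x y z] by (rule subspace_add[OF subspace_ad0 a b])
    then show ?case by (rule ad0_adD)
  qed
  from this[OF ad0D[OF assms(1)] ad0D[OF assms(2)] refl] show ?thesis .
qed

lemma subalgebra_ad0: "subalgebra (ad0 x)"
  unfolding subalgebra_def using subspace_ad0 ad0_br by blast

lemma subalgebra_Int: "subalgebra g \<Longrightarrow> subalgebra k \<Longrightarrow> subalgebra (g \<inter> k)"
  unfolding subalgebra_def by (auto intro: subspace_inter)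

lemma subalgebra_UNIV: "subalgebra UNIV"
  by (simp add: subalgebra_def)

lemma subalgebra_subspace: "subalgebra g \<Longrightarrow> subspace g"
  and subalgebra_br: "subalgebra g \<Longrightarrow> x \<in> g \<Longrightarrow> y \<in> g \<Longrightarrow> br x y \<in> g"
  by (auto simp: subalgebra_def)

lemma span_insert_subspace:
  assumes "subspace V" shows "span (insert y V) = {v + c *\<^sub>R y | v c. v \<in> V}"
proof -
  have "span V = V" using assms span_eq_iff by blast
  have "(\<exists>k. x - k *\<^sub>R y \<in> V) \<longleftrightarrow> (\<exists>v c. x = v + c *\<^sub>R y \<and> v \<in> V)" for x
  proof
    assume "\<exists>k. x - k *\<^sub>R y \<in> V"
    then obtain k where "x - k *\<^sub>R y \<in> V" ..
    then show "\<exists>v c. x = v + c *\<^sub>R y \<and> v \<in> V" by (intro exI[of _ "x - k *\<^sub>R y"] exI[of _ k]) simp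
  next
    assume "\<exists>v c. x = v + c *\<^sub>R y \<and> v \<in> V"
    then obtain v c where "x = v + c *\<^sub>R y" "v \<in> V" by blast
    then show "\<exists>k. x - k *\<^sub>R y \<in> V" by (intro exI[of _ c]) simp
  qed
  then show ?thesis unfolding span_insert \<open>span V = V\<close> by simp
qed

text \<open>Engel's theorem relative to a submodule: \<open>s\<close> acts by nilpotent maps on
  \<open>U / W\<close>, and a common null vector of the quotient is sought. With \<open>U\<close>
  and \<open>W\<close> free, the induction hypothesis can be used twice for a smaller algebra
  \<open>t\<close>, once on \<open>s / t\<close> and once on \<open>U / W\<close>.\<close>

lemma engel:
  assumes "subalgebra s" "subspace U" "subspace W" "W \<subset> U"
    and "\<And>x v. x \<in> s \<Longrightarrow> v \<in> U \<Longrightarrow> br x v \<in> U" "\<And>x v. x \<in> s \<Longrightarrow> v \<in> W \<Longrightarrow> br x v \<in> W"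
    and "\<And>x. x \<in> s \<Longrightarrow> s \<union> U \<subseteq> ad0 x"
  shows "\<exists>u\<in>U - W. \<forall>x\<in>s. br x u \<in> W"
  using assms
proof (induction "dim s" arbitrary: s U W rule: less_induct)
  case less
  note s = less.prems(1) and U = less.prems(2) and W = less.prems(3) and WU = less.prems(4)
    and sU = less.prems(5) and sW = less.prems(6) and nil = less.prems(7)
  have subs: "subspace s" using s by (rule subalgebra_subspace)
  show ?case
  proof (cases "s = {0}")
    case True then show ?thesis using WU subspace_0[OF W] by auto
  next
    case False
    let ?P = "\<lambda>t. subalgebra t \<and> t \<subset> s"
    have P0: "?P {0}" using False subspace_0[OF subs] by (auto simp: subalgebra_def)
    have bnd: "\<forall>t. ?P t \<longrightarrow> dim t < Suc (dim s)" by (simp add: dim_subset psubset_imp_subset less_Suc_eq_le)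
    from ex_has_greatest_nat[of ?P "{0}" dim "Suc (dim s)", OF P0 bnd]
    obtain t where tt: "?P t \<and> (\<forall>t'. ?P t' \<longrightarrow> dim t' \<le> dim t)" ..
    then have t: "?P t" and max: "\<And>t'. ?P t' \<Longrightarrow> dim t' \<le> dim t" by simp_all
    have subt: "subspace t" using t subalgebra_subspace by blast
    have ts: "x \<in> s" if "x \<in> t" for x using t that by blast
    have dt: "dim t < dim s" using dim_subspace_psubset[OF subt subs] t by blast
    \<comment> \<open>On \<open>s / t\<close> this gives an element \<open>y\<close> normalizing
      \<open>t\<close>; so \<open>t\<close> and \<open>y\<close> span a subalgebra, which is all of
      \<open>s\<close> by the maximality of \<open>t\<close>.\<close>
    have "\<exists>y\<in>s - t. \<forall>x\<in>t. br x y \<in> t"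
    proof (rule less.hyps[OF dt])
      show "t \<union> s \<subseteq> ad0 x" if "x \<in> t" for x using nil[OF ts[OF that]] ts by blast
    qed (use t subs subt ts s in \<open>auto simp: subalgebra_def\<close>)
    then obtain y where y: "y \<in> s" "y \<notin> t" "\<And>x. x \<in> t \<Longrightarrow> br x y \<in> t" by blast
    let ?T = "span (insert y t)"
    note T = span_insert_subspace[OF subt, of y]
    have Ts: "?T \<subseteq> s" unfolding T using y(1) ts subs by (auto intro!: subspace_add subspace_scale)
    have "subalgebra ?T" unfolding subalgebra_def
    proof (intro conjI ballI)
      fix a b assume "a \<in> ?T" "b \<in> ?T"
      then obtain v c w d where ab: "a = v + c *\<^sub>R y" "b = w + d *\<^sub>R y" "v \<in> t" "w \<in> t" unfolding T by blast
      have "br a b = br v w + d *\<^sub>R br v y - c *\<^sub>R br w y"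
        unfolding ab br_add br_add_left br_scale br_scale_left br_self br_swap[of y w] by simp
      also have "\<dots> \<in> t" using ab(3,4) y(3) t subt
        by (intro subspace_diff subspace_add subspace_scale) (auto simp: subalgebra_def)
      finally show "br a b \<in> ?T" by (simp add: span_base)
    qed simp
    moreover have "dim t < dim ?T"
      by (rule dim_subspace_psubset[OF subt subspace_span]) (use y(2) in \<open>auto intro: span_base\<close>)
    ultimately have "?T = s" using max[of ?T] Ts by fastforce
    then have sT: "\<exists>v c. x = v + c *\<^sub>R y \<and> v \<in> t" if "x \<in> s" for x using that unfolding T by blast
    define W' where "W' = {u\<in>U. \<forall>x\<in>t. br x u \<in> W}"
    have "\<exists>u\<in>U - W. \<forall>x\<in>t. br x u \<in> W"
    proof (rule less.hyps[OF dt _ U W WU])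
      show "t \<union> U \<subseteq> ad0 x" if "x \<in> t" for x using nil[OF ts[OF that]] ts by blast
    qed (use t sU sW ts in auto)
    then obtain u where u: "u \<in> W'" "u \<notin> W" unfolding W'_def by blast
    have yW': "br y v \<in> W'" if "v \<in> W'" for v
    proof -
      have v: "v \<in> U" "\<And>x. x \<in> t \<Longrightarrow> br x v \<in> W" using that unfolding W'_def by auto
      have "br x (br y v) \<in> W" if x: "x \<in> t" for x
        unfolding jacobi[of x y v] using v(2)[OF y(3)[OF x]] sW[OF y(1) v(2)[OF x]] W by (intro subspace_add)
      then show ?thesis unfolding W'_def using sU[OF y(1) v(1)] by simp
    qed
    have "u \<in> ad0 y" using nil[OF y(1)] u(1) unfolding W'_def by blast
    then have "(br y ^^ DIM('e)) u \<in> W" using subspace_0[OF W] by (simp add: ad0D)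
    then have ex: "\<exists>n. (br y ^^ n) u \<in> W" ..
    \<comment> \<open>\<open>y\<close> preserves the space \<open>W'\<close> of vectors that
      \<open>t\<close> moves into \<open>W\<close>. The last vector outside \<open>W\<close> in the
      chain \<open>u\<close>, \<open>[y, u]\<close>, \<open>[y, [y, u]]\<close>, ... is therefore
      moved into \<open>W\<close> by \<open>t\<close> and by \<open>y\<close>.\<close>
    define n where "n = (LEAST n. (br y ^^ n) u \<in> W)"
    have n: "(br y ^^ n) u \<in> W" unfolding n_def using LeastI_ex[OF ex] .
    have "n \<noteq> 0" using n u(2) by (intro notI) simp
    then obtain k where k: "n = Suc k" using not0_implies_Suc by blast
    let ?v = "(br y ^^ k) u"
    have "?v \<notin> W" using not_less_Least[of k "\<lambda>n. (br y ^^ n) u \<in> W"] k unfolding n_def[symmetric] by simp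
    have vW': "?v \<in> W'" by (rule funpow_invariant[OF yW' u(1)])
    have "br y ?v \<in> W" using n k by simp
    have "br x ?v \<in> W" if xs: "x \<in> s" for x
    proof -
      obtain v c where x: "x = v + c *\<^sub>R y" "v \<in> t" using sT[OF xs] by blast
      have "br v ?v \<in> W" using vW' x(2) unfolding W'_def by blast
      then show ?thesis unfolding x(1) br_add_left br_scale_left
        using \<open>br y ?v \<in> W\<close> W by (intro subspace_add subspace_scale)
    qed
    moreover have "?v \<in> U" using vW' unfolding W'_def by blast
    ultimately show ?thesis using \<open>?v \<notin> W\<close> by blast
  qed
qed

text \<open>The starting space is separated from the acting algebra: \<open>lower_central\<close>
  uses one set for both, whereas \<open>engel_nilpotent\<close> lets only the starting space
  vary.\<close>

primrec descend :: "'e set \<Rightarrow> 'e set \<Rightarrow> nat \<Rightarrow> 'e set" where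
  "descend c W 0 = W"
| "descend c W (Suc n) = span {br x y | x y. x \<in> c \<and> y \<in> descend c W n}"

lemma lower_central_descend: "lower_central br c n = descend c c n"
  by (induction n) auto

lemma descend_mono: "W \<subseteq> W' \<Longrightarrow> descend c W n \<subseteq> descend c W' n"
proof (induction n)
  case (Suc n)
  have "{br x y | x y. x \<in> c \<and> y \<in> descend c W n} \<subseteq> {br x y | x y. x \<in> c \<and> y \<in> descend c W' n}"
    using Suc by blast
  then show ?case by (simp add: span_mono)
qed simp

lemma descend_Suc': "descend c W (Suc n) = descend c (descend c W 1) n"
  by (induction n) auto

text \<open>Among the ideals of \<open>c\<close> on which iterated brackets with \<open>c\<close>
  die out, one of greatest dimension is all of \<open>c\<close>: otherwise \<open>engel\<close>
  supplies a vector outside it that \<open>c\<close> moves into it, and adjoining this vector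
  lengthens the descending chain by only one step.\<close>

lemma engel_nilpotent:
  assumes c: "subalgebra c" and nil: "\<And>x. x \<in> c \<Longrightarrow> c \<subseteq> ad0 x"
  shows "\<exists>n. lower_central br c n = {0}"
proof -
  let ?P = "\<lambda>W. subspace W \<and> W \<subseteq> c \<and> (\<forall>x\<in>c. \<forall>v\<in>W. br x v \<in> W) \<and> (\<exists>n. descend c W n \<subseteq> {0})"
  have subc: "subspace c" using c by (rule subalgebra_subspace)
  have P0: "?P {0}" using subspace_0[OF subc] by (auto intro: exI[of _ 0])
  have bnd: "\<forall>W. ?P W \<longrightarrow> dim W < Suc (dim c)" by (simp add: dim_subset less_Suc_eq_le)
  from ex_has_greatest_nat[of ?P "{0}" dim "Suc (dim c)", OF P0 bnd]
  obtain W where WW: "?P W \<and> (\<forall>W'. ?P W' \<longrightarrow> dim W' \<le> dim W)" ..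
  then have W: "?P W" and max: "\<And>W'. ?P W' \<Longrightarrow> dim W' \<le> dim W" by simp_all
  have subW: "subspace W" using W by blast
  have "W = c"
  proof (rule ccontr)
    assume "W \<noteq> c"
    then have "W \<subset> c" using W by blast
    have "\<exists>u\<in>c - W. \<forall>x\<in>c. br x u \<in> W"
      by (rule engel[OF c subc subW \<open>W \<subset> c\<close>]) (use c W nil in \<open>auto simp: subalgebra_def\<close>)
    then obtain u where u: "u \<in> c" "u \<notin> W" "\<And>x. x \<in> c \<Longrightarrow> br x u \<in> W" by blast
    let ?T = "span (insert u W)"
    note T = span_insert_subspace[OF subW, of u]
    have Tc: "?T \<subseteq> c" unfolding T using u(1) W subc by (auto intro!: subspace_add subspace_scale)
    have TW: "br x v \<in> W" if xc: "x \<in> c" and vT: "v \<in> ?T" for x v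
    proof -
      obtain w a where "v = w + a *\<^sub>R u" "w \<in> W" using vT unfolding T by blast
      then show ?thesis using xc u(3) W by (auto simp: br_add br_scale intro!: subspace_add subspace_scale)
    qed
    obtain n where n: "descend c W n \<subseteq> {0}" using W by blast
    have "{br x y | x y. x \<in> c \<and> y \<in> ?T} \<subseteq> W" using TW by blast
    then have "descend c ?T 1 \<subseteq> W" using span_minimal[OF _ subW] by simp
    from subset_trans[OF descend_mono[OF this] n]
    have "descend c ?T (Suc n) \<subseteq> {0}" unfolding descend_Suc' .
    then have "\<exists>n. descend c ?T n \<subseteq> {0}" by (rule exI)
    moreover have "br x v \<in> ?T" if "x \<in> c" "v \<in> ?T" for x v
      using TW[OF that] by (simp add: span_base)
    ultimately have "?P ?T" using Tc by simp
    then have "dim ?T \<le> dim W" by (rule max)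
    moreover have "dim W < dim ?T"
      by (rule dim_subspace_psubset[OF subW subspace_span]) (use u(2) in \<open>auto intro: span_base\<close>)
    ultimately show False by simp
  qed
  then obtain n where n: "descend c c n \<subseteq> {0}" using W by auto
  moreover have "0 \<in> descend c c n" using subspace_0[OF subc] by (cases n) (auto simp: span_0)
  ultimately have "descend c c n = {0}" by blast
  then show ?thesis unfolding lower_central_descend by blast
qed

lemma lower_central_ad:
  assumes "x \<in> c" "v \<in> c" shows "(br x ^^ n) v \<in> lower_central br c n"
proof (induction n)
  case (Suc n)
  have "br x ((br x ^^ n) v) \<in> {br x y | x y. x \<in> c \<and> y \<in> lower_central br c n}" using assms(1) Suc by blast
  then show ?case by (simp add: span_base)
qed (simp add: assms(2))

text \<open>Perturbing a regular element \<open>z\<close> by \<open>t x\<close> keeps the complement of \<open>g \<inter> ad0 z\<close> free of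
  generalized kernel vectors for small \<open>t\<close>; minimality then makes \<open>ad (z + t x)\<close> nilpotent on
  \<open>g \<inter> ad0 z\<close>, and the top coefficient in \<open>t\<close> is a power of \<open>ad x\<close>.\<close>

lemma regular_ad0:
  assumes g: "subalgebra g" and sg: "s \<subseteq> g" and s: "subspace s" and z: "z \<in> s"
    and min: "\<And>x. x \<in> s \<Longrightarrow> dim (g \<inter> ad0 z) \<le> dim (g \<inter> ad0 x)" and s0: "s \<subseteq> ad0 z"
    and x: "x \<in> s"
  shows "g \<inter> ad0 z \<subseteq> ad0 x"
proof -
  let ?V = "g \<inter> ad0 z"
  have V: "subalgebra ?V" using subalgebra_Int[OF g subalgebra_ad0] .
  have subV: "subspace ?V" using V by (rule subalgebra_subspace)
  have subg: "subspace g" using g by (rule subalgebra_subspace)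
  obtain Q where Q: "linear Q" "\<And>v. Q v \<in> ?V" "\<And>v. v \<in> ?V \<Longrightarrow> Q v = v"
    "\<And>v w. w \<in> ?V \<Longrightarrow> (v - Q v) \<bullet> w = 0"
    by (rule orthogonal_projection[OF subV]) (rule that)
  define R where "R v = v - Q v" for v
  have R: "linear R" unfolding R_def[abs_def] by (rule linear_compose_sub[OF linear_ident Q(1)])
  have R0: "v \<in> ?V" if "R v = 0" for v using that Q(2)[of v] by (simp add: R_def)
  define U where "U = {u\<in>g. \<forall>w\<in>?V. u \<bullet> w = 0}"
  have subU: "subspace U" unfolding U_def subspace_def
    using subspace_0[OF subg] subspace_add[OF subg] subspace_scale[OF subg] by (auto simp: inner_add_left)
  have RU: "R v \<in> U" if "v \<in> g" for v
    unfolding U_def R_def using that Q(2)[of v] Q(4)[of _ v] subg by (auto intro: subspace_diff)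
  have inj: "\<forall>u\<in>U. R (br z u) = 0 \<longrightarrow> u = 0"
  proof (intro ballI impI)
    fix u assume u: "u \<in> U" "R (br z u) = 0"
    then have "br z u \<in> ad0 z" using R0 by blast
    then have "u \<in> ?V" using u(1) ad0_adD unfolding U_def by blast
    then have "u \<bullet> u = 0" using u(1) unfolding U_def by blast
    then show "u = 0" by simp
  qed
  have bl: "bounded_linear (\<lambda>u. R (br y u))" for y
    using linear_compose[OF lin R] by (simp add: o_def linear_conv_bounded_linear)
  \<comment> \<open>Injectivity modulo \<open>?V\<close> in quantitative form, so that it survives
    the perturbation by \<open>t x\<close> as long as \<open>\<bar>t\<bar> < e / M\<close>.\<close>
  obtain e where e: "e > 0" "\<And>u. u \<in> U \<Longrightarrow> e * norm u \<le> norm (R (br z u))"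
    using injective_imp_isometric[OF closed_subspace[OF subU] subU bl inj] by (auto simp: mult.commute)
  obtain M where M: "M > 0" "\<And>u. norm (R (br x u)) \<le> norm u * M"
    using bounded_linear.pos_bounded[OF bl[of x]] by blast
  have sV: "y \<in> ?V" if "y \<in> s" for y using that sg s0 by blast
  have small: "?V \<subseteq> ad0 (z + t *\<^sub>R x)" if t: "\<bar>t\<bar> < e / M" for t
  proof -
    let ?y = "z + t *\<^sub>R x"
    have ys: "?y \<in> s" using z x s by (intro subspace_add subspace_scale)
    have inj': "u = 0" if u: "u \<in> U" "R (br ?y u) = 0" for u
    proof -
      have "R (br z u) = - t *\<^sub>R R (br x u)"
        using u(2) by (simp add: br_add_left br_scale_left linear_add[OF R] linear_cmul[OF R] eq_neg_iff_add_eq_0)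
      then have "e * norm u \<le> \<bar>t\<bar> * (norm u * M)"
        using e(2)[OF u(1)] M(2)[of u] by (simp add: order_trans[OF _ mult_left_mono])
      moreover have "\<bar>t\<bar> * M < e" using t M(1) by (simp add: pos_less_divide_eq)
      ultimately have "e * norm u \<le> (\<bar>t\<bar> * M) * norm u" by (simp add: mult_ac)
      then show ?thesis using \<open>\<bar>t\<bar> * M < e\<close> by (smt (verit) mult_right_mono mult_strict_right_mono norm_ge_zero zero_less_norm_iff)
    qed
    \<comment> \<open>Induction on the number of brackets: \<open>[?y, v]\<close> is in
      \<open>?V\<close>, and so is \<open>[?y, Q v]\<close>. Hence the bracket of the complementary
      part \<open>R v\<close> lies in \<open>?V\<close> as well, which forces
      \<open>R v = 0\<close>.\<close>
    have "v \<in> ?V" if "v \<in> g" "(br ?y ^^ n) v = 0" for v n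
      using that
    proof (induction n arbitrary: v)
      case 0 then show ?case using subspace_0[OF subV] by simp
    next
      case (Suc n)
      have "br ?y v \<in> g" using ys sg Suc.prems(1) by (intro subalgebra_br[OF g]) auto
      then have 1: "br ?y v \<in> ?V" using Suc.prems(2) by (intro Suc.IH) (simp_all add: funpow_swap1)
      have 2: "br ?y (Q v) \<in> ?V" by (rule subalgebra_br[OF V sV[OF ys] Q(2)])
      have "br ?y (R v) \<in> ?V" unfolding R_def br_diff by (rule subspace_diff[OF subV 1 2])
      then have "R (br ?y (R v)) = 0" unfolding R_def[of "br ?y (R v)"] using Q(3) by simp
      then have "R v = 0" by (rule inj'[OF RU[OF Suc.prems(1)]])
      then show ?case by (rule R0)
    qed
    then have sub: "g \<inter> ad0 ?y \<subseteq> ?V" using ad0D by blast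
    have "g \<inter> ad0 ?y = ?V"
      by (rule subspace_dim_equal[OF subspace_inter[OF subg subspace_ad0] subV sub min[OF ys]])
    then show ?thesis by blast
  qed
  show ?thesis
  proof
    fix v assume v: "v \<in> ?V"
    \<comment> \<open>Homogeneity with \<open>s = 1 / t\<close>: small \<open>t\<close> corresponds
      to large \<open>s\<close>, and the value wanted is the one at \<open>s = 0\<close>, where only
      \<open>ad x\<close> is left.\<close>
    let ?f = "\<lambda>s. ((\<lambda>u. br x u + s *\<^sub>R br z u) ^^ DIM('e)) v"
    have pv: "poly_vec ?f" by (rule poly_vec_funpow[OF lin lin])
    have zero: "?f s = 0" if s: "s > M / e" for s
    proof -
      have "M / e > 0" using M(1) e(1) by simp
      then have s0: "s > 0" using s by linarith
      have "inverse s < e / M" using s s0 M(1) e(1) by (simp add: field_simps)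
      then have "v \<in> ad0 (z + inverse s *\<^sub>R x)" using small[of "inverse s"] s0 v by auto
      then have z: "(br (z + inverse s *\<^sub>R x) ^^ DIM('e)) v = 0" by (rule ad0D)
      have pow: "((\<lambda>u. br x u + s *\<^sub>R br z u) ^^ n) v = s ^ n *\<^sub>R (br (z + inverse s *\<^sub>R x) ^^ n) v" for n
      proof (induction n)
        case (Suc n) then show ?case using s0
          by (simp add: br_scale br_add_left br_scale_left scaleR_right_distrib)
      qed simp
      show ?thesis unfolding pow z by simp
    qed
    have "infinite {s. ?f s = 0}"
    proof (rule infinite_super)
      show "{M / e<..} \<subseteq> {s. ?f s = 0}" using zero by blast
      show "infinite {M / e<..}" by (rule infinite_Ioi)
    qed
    from poly_vec_zero[OF pv this, of 0] show "v \<in> ad0 x"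
      by (intro ad0I[where n = "DIM('e)"]) simp
  qed
qed

section \<open>Existence of Cartan subalgebras and their regular elements\<close>

lemma ex_min_ad0:
  assumes "subspace s"
  obtains z where "z \<in> s" "\<And>x. x \<in> s \<Longrightarrow> dim (g \<inter> ad0 z) \<le> dim (g \<inter> ad0 x)"
  using ex_has_least_nat[of "\<lambda>z. z \<in> s" 0 "\<lambda>z. dim (g \<inter> ad0 z)"] subspace_0[OF assms] by blast

text \<open>The null component of an element \<open>z\<close> for which it is smallest is nilpotent
  by \<open>regular_ad0\<close> and Engel's theorem. It is self-normalizing because it contains
  \<open>z\<close>: if \<open>[x, z]\<close> is in it, then \<open>ad z\<close> maps
  \<open>x\<close> into the null component, so \<open>x\<close> lies there already.\<close>

lemma cartan_exists:
  assumes g: "subalgebra g" shows "\<exists>c. cartan_subalgebra br g c"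
proof -
  have subg: "subspace g" using g by (rule subalgebra_subspace)
  obtain z where z: "z \<in> g" "\<And>x. x \<in> g \<Longrightarrow> dim (g \<inter> ad0 z) \<le> dim (g \<inter> ad0 x)"
    using ex_min_ad0[OF subg] by blast
  let ?c = "g \<inter> ad0 z"
  have c: "subalgebra ?c" by (rule subalgebra_Int[OF g subalgebra_ad0])
  have zc: "z \<in> ?c" using z(1) ad0_self by blast
  have nil: "?c \<subseteq> ad0 x" if "x \<in> ?c" for x
    by (rule regular_ad0[OF g _ subalgebra_subspace[OF c] zc _ _ that]) (use z in auto)
  have "{x\<in>g. \<forall>y\<in>?c. br x y \<in> ?c} = ?c"
  proof (intro equalityI subsetI)
    fix x assume x: "x \<in> {x\<in>g. \<forall>y\<in>?c. br x y \<in> ?c}"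
    then have "br x z \<in> ?c" using zc by blast
    then have "br z x \<in> ad0 z" using br_swap[of z x] subspace_neg[OF subspace_ad0] by auto
    then show "x \<in> ?c" using x ad0_adD by blast
  qed (use subalgebra_br[OF c] in auto)
  then have "cartan_subalgebra br g ?c" unfolding cartan_subalgebra_def
    using engel_nilpotent[OF c nil] c unfolding subalgebra_def by blast
  then show ?thesis ..
qed

lemma cartan_subalgebraD:
  assumes "cartan_subalgebra br g c"
  shows "subalgebra c" "c \<subseteq> g" "\<And>x. x \<in> c \<Longrightarrow> c \<subseteq> ad0 x"
    "\<And>x. x \<in> g \<Longrightarrow> (\<And>y. y \<in> c \<Longrightarrow> br y x \<in> c) \<Longrightarrow> x \<in> c"
proof -
  show c: "subalgebra c" "c \<subseteq> g" using assms unfolding cartan_subalgebra_def subalgebra_def by blast+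
  obtain n where n: "lower_central br c n = {0}" using assms unfolding cartan_subalgebra_def by blast
  show "c \<subseteq> ad0 x" if "x \<in> c" for x
    using lower_central_ad[OF that, of _ n] n by (auto intro: ad0I[where n = n])
  have norm: "{x\<in>g. \<forall>y\<in>c. br x y \<in> c} = c" using assms unfolding cartan_subalgebra_def by blast
  show "x \<in> c" if "x \<in> g" "\<And>y. y \<in> c \<Longrightarrow> br y x \<in> c" for x
  proof -
    have "br x y \<in> c" if "y \<in> c" for y
      using \<open>\<And>y. y \<in> c \<Longrightarrow> br y x \<in> c\<close>[OF that] br_swap[of x y] subspace_neg[OF subalgebra_subspace[OF c(1)]] by simp
    then have "x \<in> {x\<in>g. \<forall>y\<in>c. br x y \<in> c}" using that(1) by blast
    then show ?thesis unfolding norm .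
  qed
qed

text \<open>If \<open>c\<close> were smaller than the null component \<open>?U\<close> of
  \<open>x\<close> in \<open>g\<close>, Engel's theorem for \<open>c\<close> acting on
  \<open>?U / c\<close> would produce an element outside \<open>c\<close> that normalizes
  \<open>c\<close>. The minimality of \<open>x\<close> refers to the larger algebra
  \<open>g'\<close>, so that one element controls the null components in both.\<close>

lemma cartan_regular:
  assumes g: "subalgebra g" and g': "subalgebra g'" and gg: "g \<subseteq> g'"
    and c: "cartan_subalgebra br g c"
    and x: "x \<in> c" and min: "\<And>y. y \<in> c \<Longrightarrow> dim (g' \<inter> ad0 x) \<le> dim (g' \<inter> ad0 y)"
  shows "g \<inter> ad0 x = c" "\<And>y. y \<in> c \<Longrightarrow> g' \<inter> ad0 x \<subseteq> ad0 y"
proof -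
  note cd = cartan_subalgebraD[OF c]
  have subc: "subspace c" by (rule subalgebra_subspace[OF cd(1)])
  show nil: "g' \<inter> ad0 x \<subseteq> ad0 y" if "y \<in> c" for y
    by (rule regular_ad0[OF g' _ subc x min cd(3)[OF x] that]) (use cd(2) gg in auto)
  let ?U = "g \<inter> ad0 x"
  have cU: "c \<subseteq> ?U" using cd(2) cd(3)[OF x] by blast
  have U: "subalgebra ?U" by (rule subalgebra_Int[OF g subalgebra_ad0])
  show "?U = c"
  proof (rule ccontr)
    assume "?U \<noteq> c"
    then have "c \<subset> ?U" using cU by blast
    have "\<exists>u\<in>?U - c. \<forall>y\<in>c. br y u \<in> c"
    proof (rule engel[OF cd(1) subalgebra_subspace[OF U] subc \<open>c \<subset> ?U\<close>])
      show "br y v \<in> ?U" if "y \<in> c" "v \<in> ?U" for y v by (rule subalgebra_br[OF U]) (use that cU in auto)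
      show "br y v \<in> c" if "y \<in> c" "v \<in> c" for y v by (rule subalgebra_br[OF cd(1) that])
      show "c \<union> ?U \<subseteq> ad0 y" if "y \<in> c" for y using nil[OF that] cU gg by blast
    qed
    then obtain u where "u \<in> ?U" "u \<notin> c" "\<And>y. y \<in> c \<Longrightarrow> br y u \<in> c" by blast
    then show False using cd(4)[of u] by blast
  qed
qed

lemma lie_rank_cartan:
  assumes g: "subalgebra g"
  obtains c where "cartan_subalgebra br g c" "dim c = lie_rank br g"
proof -
  have "\<exists>r c. cartan_subalgebra br g c \<and> dim c = r" using cartan_exists[OF g] by blast
  from LeastI_ex[OF this] show ?thesis unfolding lie_rank_def[symmetric] using that by blast
qed

end

context lie_algebra
begin

subsection \<open>The Killing form\<close>

abbreviation "KF \<equiv> killing_form br"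

lemma KF_def: "KF x y = linear_trace (\<lambda>v. br x (br y v))"
  by (simp add: killing_form_def o_def)

lemma KF_add_left: "KF (x + y) z = KF x z + KF y z"
  by (simp add: KF_def br_add_left linear_trace_add)
lemma KF_scale_left: "KF (c *\<^sub>R x) z = c * KF x z"
  by (simp add: KF_def br_scale_left linear_trace_scale)
lemma KF_commute: "KF x y = KF y x"
  unfolding KF_def by (rule linear_trace_comp_commute[OF lin lin])
lemma KF_add_right: "KF z (x + y) = KF z x + KF z y"
  unfolding KF_commute[of z] by (rule KF_add_left)
lemma KF_scale_right: "KF z (c *\<^sub>R x) = c * KF z x"
  unfolding KF_commute[of z] by (rule KF_scale_left)
lemma KF_0 [simp]: "KF 0 y = 0" "KF y 0 = 0"
  using KF_scale_left[of 0 0 y] KF_scale_right[of y 0 0] by simp_all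

lemma br_br: "br (br x y) v = br x (br y v) - br y (br x v)"
  using jacobi[of x y v] by simp

lemma lin2: "linear (\<lambda>v. br x (br y v))"
  using linear_compose[OF lin[of y] lin[of x]] by (simp add: o_def)

lemma KF_invariant: "KF (br x y) z = KF x (br y z)"
proof -
  have "KF (br x y) z = linear_trace (\<lambda>v. br x (br y (br z v))) - linear_trace (\<lambda>v. br y (br x (br z v)))"
    unfolding KF_def by (simp add: br_br linear_trace_diff)
  also have "linear_trace (\<lambda>v. br y (br x (br z v))) = linear_trace (\<lambda>v. br x (br z (br y v)))"
    using linear_trace_comp_commute[OF lin[of y] lin2[of x z]] .
  also have "linear_trace (\<lambda>v. br x (br y (br z v))) - linear_trace (\<lambda>v. br x (br z (br y v))) = KF x (br y z)"
    unfolding KF_def by (simp add: br_br br_diff linear_trace_diff)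
  finally show ?thesis .
qed

lemma KF_funpow: "KF ((br x ^^ n) y) w = (- 1) ^ n * KF y ((br x ^^ n) w)"
proof (induction n arbitrary: w)
  case (Suc n)
  have "KF (br x ((br x ^^ n) y)) w = - KF (br ((br x ^^ n) y) x) w"
    using KF_scale_left[of "-1" "br ((br x ^^ n) y) x" w] br_swap[of x "(br x ^^ n) y"] by simp
  also have "KF (br ((br x ^^ n) y) x) w = (- 1) ^ n * KF y ((br x ^^ n) (br x w))"
    unfolding KF_invariant by (rule Suc)
  finally show ?case by (simp add: funpow_swap1)
qed simp

text \<open>By invariance the power of \<open>ad x\<close> moves to the other argument up to sign,
  where it kills \<open>y\<close>. Thus the two Fitting components of \<open>ad x\<close> are
  orthogonal.\<close>

lemma KF_fitting:
  assumes "y \<in> ad0 x" shows "KF y ((br x ^^ DIM('e)) w) = 0"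
proof -
  have "(- 1) ^ DIM('e) * KF y ((br x ^^ DIM('e)) w) = 0"
    using KF_funpow[of "DIM('e)" x y w] unfolding ad0D[OF assms] by simp
  then show ?thesis by simp
qed

section \<open>Derived algebras and traces of adjoint maps\<close>

definition derived :: "'e set \<Rightarrow> 'e set" where
  "derived l = span {br a b | a b. a \<in> l \<and> b \<in> l}"

lemma subspace_derived: "subspace (derived l)"
  by (simp add: derived_def)
lemma br_derived: "a \<in> l \<Longrightarrow> b \<in> l \<Longrightarrow> br a b \<in> derived l"
  unfolding derived_def by (rule span_base) blast
lemma derived_subset: "subalgebra l \<Longrightarrow> derived l \<subseteq> l"
  unfolding derived_def by (rule span_minimal) (auto simp: subalgebra_def)

lemma commutator_ad: "(commutator (br y) ^^ k) (br b) = br ((br y ^^ k) b)"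
proof (induction k)
  case (Suc k)
  have "commutator (br y) (br ((br y ^^ k) b)) = br (br y ((br y ^^ k) b))"
    unfolding commutator_def by (rule ext) (simp only: br_br)
  then show ?case by (simp only: funpow.simps(2) o_apply Suc)
qed simp

text \<open>Split \<open>ad y' = S + N\<close>: \<open>S\<close> commutes with \<open>ad l\<close> and so has zero trace against \<open>ad [l, l]\<close>,
  while \<open>N\<close> is nilpotent and commutes with \<open>ad y\<close>.\<close>

lemma KF_derived_zero:
  assumes y: "y \<in> derived l" and l: "l \<subseteq> ad0 y'" and comm: "br y' y = 0"
  shows "KF y y' = 0"
proof -
  obtain s n where nil: "\<And>v. ((\<lambda>v. br y' v - pact s (br y') v) ^^ n) v = 0"
    and S: "\<And>X k v. linear X \<Longrightarrow> (commutator (br y') ^^ k) X = (\<lambda>v. 0) \<Longrightarrow> pact s (br y') (X v) = X (pact s (br y') v)"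
    by (rule semisimple_part_commutes[OF lin[of y']]) (rule that)
  let ?S = "pact s (br y')"
  let ?N = "\<lambda>v. br y' v - ?S v"
  have linS: "linear ?S" by (rule linear_pact[OF lin])
  have linN: "linear ?N" by (rule linear_compose_sub[OF lin linS])
  have Sl: "?S (br b v) = br b (?S v)" if "b \<in> ad0 y'" for b v
  proof (rule S[OF lin])
    have "br ((br y' ^^ DIM('e)) b) = (\<lambda>v. 0)" unfolding ad0D[OF that] by (rule ext) simp
    then show "(commutator (br y') ^^ DIM('e)) (br b) = (\<lambda>v. 0)" unfolding commutator_ad .
  qed
  have "linear_trace (\<lambda>v. br y (?S v)) = 0"
    using y unfolding derived_def
  proof (induction rule: span_induct)
    case base
    show ?case unfolding subspace_def
      by (simp add: br_add_left br_scale_left linear_trace_add linear_trace_scale)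
        (simp add: linear_trace_def)
  next
    case (step u)
    then obtain a b where ab: "u = br a b" "a \<in> l" "b \<in> l" by blast
    have linb: "linear (\<lambda>v. br b (?S v))" using linear_compose[OF linS lin[of b]] by (simp add: o_def)
    have "linear_trace (\<lambda>v. br u (?S v)) = linear_trace (\<lambda>v. br a (br b (?S v))) - linear_trace (\<lambda>v. br b (br a (?S v)))"
      unfolding ab br_br by (rule linear_trace_diff)
    also have "linear_trace (\<lambda>v. br a (br b (?S v))) = linear_trace (\<lambda>v. br b (?S (br a v)))"
      by (rule linear_trace_comp_commute[OF lin linb])
    also have "(\<lambda>v. br b (?S (br a v))) = (\<lambda>v. br b (br a (?S v)))"
      using Sl[of a] ab(2) l by (auto intro!: ext)
    finally show ?case by simp
  qed
  moreover have "linear_trace (\<lambda>v. br y (?N v)) = 0"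
  proof (rule linear_trace_nilpotent)
    show "linear (\<lambda>v. br y (?N v))" using linear_compose[OF linN lin[of y]] by (simp add: o_def)
    have "y \<in> ad0 y'" by (rule ad0I[where n = 1]) (simp add: comm)
    then have Ny: "?N (br y v) = br y (?N v)" for v
      using Sl[of y v] jacobi[of y' y v] comm by (simp add: br_diff)
    have Nyn: "(?N ^^ k) (br y v) = br y ((?N ^^ k) v)" for k v
      by (induction k) (simp_all only: funpow.simps id_apply o_apply Ny)
    have pow: "((\<lambda>v. br y (?N v)) ^^ k) v = (br y ^^ k) ((?N ^^ k) v)" for k v
    proof (induction k arbitrary: v)
      case (Suc k)
      have "((\<lambda>v. br y (?N v)) ^^ Suc k) v = ((\<lambda>v. br y (?N v)) ^^ k) (br y (?N v))"
        by (simp only: funpow_Suc_right o_apply)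
      also have "\<dots> = (br y ^^ k) (br y ((?N ^^ k) (?N v)))" unfolding Suc Nyn ..
      finally show ?case by (simp only: funpow_Suc_right o_apply)
    qed simp
    show "((\<lambda>v. br y (?N v)) ^^ n) v = 0" for v
      unfolding pow nil using linear_0[OF linear_funpow[OF lin]] .
  qed
  moreover have "(\<lambda>v. br y (br y' v)) = (\<lambda>v. br y (?S v) + br y (?N v))"
    by (rule ext) (simp add: br_diff)
  ultimately show ?thesis unfolding KF_def by (simp add: linear_trace_add)
qed

text \<open>On \<open>l'\<close> the traces of the powers of \<open>ad (y + t w)\<close> do not depend on \<open>t\<close>: their derivative
  vanishes wherever this map is invertible on \<open>l'\<close>, because \<open>w\<close> is then a bracket with \<open>y + t w\<close>.
  They vanish at \<open>t = 0\<close>, which contradicts invertibility at \<open>t = 1\<close>.\<close>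

lemma no_invertible_ad:
  assumes l': "subspace l'" and y: "l' \<subseteq> ad0 y" and w: "w \<in> l'"
    and yl: "\<And>v. v \<in> l' \<Longrightarrow> br y v \<in> l'" and ll: "\<And>u v. u \<in> l' \<Longrightarrow> v \<in> l' \<Longrightarrow> br u v \<in> l'"
    and inj: "\<And>v. v \<in> l' \<Longrightarrow> br (y + w) v = 0 \<Longrightarrow> v = 0"
  shows "l' = {0}"
proof -
  obtain Q where Q: "linear Q" "\<And>v. Q v \<in> l'" "\<And>v. v \<in> l' \<Longrightarrow> Q v = v"
    "\<And>v u. u \<in> l' \<Longrightarrow> (v - Q v) \<bullet> u = 0"
    by (rule orthogonal_projection[OF l']) (rule that)
  \<comment> \<open>\<open>A t\<close> is \<open>ad (y + t w)\<close> on \<open>l'\<close>,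
    precomposed with the projection so that its powers have traces.\<close>
  define A where "A t v = br y (Q v) + t *\<^sub>R br w (Q v)" for t :: real and v
  have A_alt: "A t v = br (y + t *\<^sub>R w) (Q v)" for t v by (simp add: A_def br_add_left br_scale_left)
  have linbQ: "linear (\<lambda>v. br x (Q v))" for x using linear_compose[OF Q(1) lin[of x]] by (simp add: o_def)
  have linA: "linear (A t)" for t unfolding A_alt[abs_def] by (rule linbQ)
  have Al: "A t v \<in> l'" for t v unfolding A_def
    by (intro subspace_add[OF l'] subspace_scale[OF l'] yl ll w Q(2))
  have AQ: "A t (Q v) = A t v" for t v unfolding A_def by (simp only: Q(3)[OF Q(2)])
  have linW: "linear (\<lambda>v. br w (Q v))" by (rule linbQ)
  define p where "p j t = linear_trace (A t ^^ j)" for j t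
  have pp: "poly_fun (p j)" for j
  proof -
    have "poly_fun (\<lambda>t. ((A t ^^ j) b) \<bullet> b)" for b
      using poly_vec_funpow[OF linbQ[of y] linW, of j b] unfolding poly_vec_def A_def[abs_def] by blast
    then have "poly_fun (\<lambda>t. \<Sum>b\<in>Basis. ((A t ^^ j) b) \<bullet> b)" by (intro poly_fun_sum)
    then show ?thesis unfolding p_def[abs_def] linear_trace_def .
  qed
  have der: "((\<lambda>t. (A t ^^ j) v) has_vector_derivative
     (\<Sum>i<j. (A t ^^ i) (br w (Q ((A t ^^ (j - Suc i)) v))))) (at t)" for j t v
  proof (induction j)
    case 0 then show ?case by simp
  next
    case (Suc j)
    let ?f = "\<lambda>t. (A t ^^ j) v"
    let ?d = "\<Sum>i<j. (A t ^^ i) (br w (Q ((A t ^^ (j - Suc i)) v)))"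
    have bl: "bounded_linear (\<lambda>v. br x (Q v))" for x using linbQ by (simp add: linear_conv_bounded_linear)
    have "((\<lambda>t. br y (Q (?f t)) + t *\<^sub>R br w (Q (?f t))) has_vector_derivative
        br y (Q ?d) + (t *\<^sub>R br w (Q ?d) + 1 *\<^sub>R br w (Q (?f t)))) (at t)"
      by (intro has_vector_derivative_add has_vector_derivative_scaleR bounded_linear.has_vector_derivative[OF bl] Suc DERIV_ident)
    then have "((\<lambda>t. (A t ^^ Suc j) v) has_vector_derivative A t ?d + br w (Q (?f t))) (at t)"
      by (simp add: A_def[abs_def] add.assoc)
    also have "A t ?d + br w (Q (?f t)) = (\<Sum>i<Suc j. (A t ^^ i) (br w (Q ((A t ^^ (Suc j - Suc i)) v))))"
      unfolding sum.lessThan_Suc_shift by (simp add: linear_sum[OF linA] add.commute)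
    finally show ?case .
  qed
  have dp: "(p j has_real_derivative real j * linear_trace (\<lambda>v. (A t ^^ (j - 1)) (br w (Q v)))) (at t)" for j t
  proof -
    have "((\<lambda>t. \<Sum>b\<in>Basis. ((A t ^^ j) b) \<bullet> b) has_real_derivative
       (\<Sum>b\<in>Basis. (\<Sum>i<j. (A t ^^ i) (br w (Q ((A t ^^ (j - Suc i)) b)))) \<bullet> b)) (at t)"
      by (intro DERIV_sum, unfold has_real_derivative_iff_has_vector_derivative,
          intro bounded_linear.has_vector_derivative[OF bounded_linear_inner_left] der)
    moreover have "(\<Sum>b\<in>Basis. (\<Sum>i<j. (A t ^^ i) (br w (Q ((A t ^^ (j - Suc i)) b)))) \<bullet> b)
        = (\<Sum>i<j. linear_trace (\<lambda>v. (A t ^^ i) (br w (Q ((A t ^^ (j - Suc i)) v)))))"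
      unfolding linear_trace_def inner_sum_left by (rule sum.swap)
    moreover have "linear_trace (\<lambda>v. (A t ^^ i) (br w (Q ((A t ^^ (j - Suc i)) v))))
        = linear_trace (\<lambda>v. (A t ^^ (j - 1)) (br w (Q v)))" if "i < j" for i
    proof -
      have l: "linear (\<lambda>v. (A t ^^ i) (br w (Q v)))"
        using linear_compose[OF linW linear_funpow[OF linA]] by (simp add: o_def)
      have "linear_trace (\<lambda>v. (A t ^^ i) (br w (Q ((A t ^^ (j - Suc i)) v))))
          = linear_trace (\<lambda>v. (A t ^^ (j - Suc i)) ((A t ^^ i) (br w (Q v))))"
        by (rule linear_trace_comp_commute[OF l linear_funpow[OF linA]])
      also have "(\<lambda>v. (A t ^^ (j - Suc i)) ((A t ^^ i) (br w (Q v)))) = (\<lambda>v. (A t ^^ (j - 1)) (br w (Q v)))"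
      proof
        fix v
        have "j - Suc i + i = j - 1" using that by simp
        then show "(A t ^^ (j - Suc i)) ((A t ^^ i) (br w (Q v))) = (A t ^^ (j - 1)) (br w (Q v))"
          by (metis comp_apply funpow_add)
      qed
      finally show ?thesis .
    qed
    ultimately show ?thesis unfolding p_def[abs_def] linear_trace_def[of "_ ^^ _"] by simp
  qed
  have bl: "bounded_linear (br x)" for x using lin by (simp add: linear_conv_bounded_linear)
  obtain e where e: "e > 0" "\<And>v. v \<in> l' \<Longrightarrow> e * norm v \<le> norm (br (y + w) v)"
    using injective_imp_isometric[OF closed_subspace[OF l'] l' bl[of "y + w"]] inj by (auto simp: mult.commute)
  obtain M where M: "M > 0" "\<And>v. norm (br w v) \<le> norm v * M"
    using bounded_linear.pos_bounded[OF bl[of w]] by blast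
  have injt: "v = 0" if t: "\<bar>t - 1\<bar> < e / M" and v: "v \<in> l'" "A t v = 0" for t v
  proof -
    have "br (y + w) v = (1 - t) *\<^sub>R br w v"
      using v Q(3)[OF v(1)] by (simp add: A_def br_add_left algebra_simps eq_neg_iff_add_eq_0)
    then have "e * norm v \<le> \<bar>1 - t\<bar> * (norm v * M)"
      using e(2)[OF v(1)] M(2)[of v] by (simp add: order_trans[OF _ mult_left_mono])
    moreover have "\<bar>1 - t\<bar> * M < e" using t M(1) by (simp add: pos_less_divide_eq abs_minus_commute)
    ultimately have "e * norm v \<le> (\<bar>1 - t\<bar> * M) * norm v" by (simp add: mult_ac)
    then show ?thesis using \<open>\<bar>1 - t\<bar> * M < e\<close>
      by (smt (verit) mult_strict_right_mono zero_less_norm_iff)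
  qed
  \<comment> \<open>Here \<open>w = [y + t w, a]\<close> for some \<open>a\<close> in
    \<open>l'\<close>, so that \<open>ad w\<close> is the commutator of \<open>A t\<close> with
    \<open>ad a\<close> on \<open>l'\<close>; cyclicity makes the trace of its product with any
    power of \<open>A t\<close> vanish.\<close>
  have zero_der: "linear_trace (\<lambda>v. (A t ^^ k) (br w (Q v))) = 0" if t: "\<bar>t - 1\<bar> < e / M" for t k
  proof -
    have "A t ` l' = l'"
      by (rule injective_on_subspace_surj[OF linA l']) (use Al injt[OF t] in auto)
    then obtain a where a: "a \<in> l'" "w = A t a" using w by blast
    have wa: "w = br (y + t *\<^sub>R w) a" using a(2) Q(3)[OF a(1)] by (simp add: A_alt)
    let ?E = "\<lambda>v. br a (Q v)"
    have linE: "linear ?E" by (rule linbQ)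
    have W: "br w (Q v) = A t (?E v) - ?E (A t v)" for v
    proof -
      have "br w (Q v) = br (y + t *\<^sub>R w) (br a (Q v)) - br a (br (y + t *\<^sub>R w) (Q v))"
        using br_br[of "y + t *\<^sub>R w" a "Q v"] unfolding wa[symmetric] .
      also have "br (y + t *\<^sub>R w) (br a (Q v)) = A t (?E v)"
        unfolding A_alt using Q(3)[OF ll[OF a(1) Q(2)]] by simp
      also have "br a (br (y + t *\<^sub>R w) (Q v)) = ?E (A t v)"
        using Q(3)[OF Al[of t v]] unfolding A_alt by simp
      finally show ?thesis .
    qed
    have lk: "linear (\<lambda>v. (A t ^^ k) (?E v))" using linear_compose[OF linE linear_funpow[OF linA]] by (simp add: o_def)
    have "linear_trace (\<lambda>v. (A t ^^ k) (br w (Q v)))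
        = linear_trace (\<lambda>v. (A t ^^ k) (A t (?E v))) - linear_trace (\<lambda>v. (A t ^^ k) (?E (A t v)))"
      unfolding W linear_diff[OF linear_funpow[OF linA]] by (rule linear_trace_diff)
    also have "linear_trace (\<lambda>v. (A t ^^ k) (?E (A t v))) = linear_trace (\<lambda>v. A t ((A t ^^ k) (?E v)))"
      by (rule linear_trace_comp_commute[OF lk linA])
    finally show ?thesis by (simp add: funpow_swap1)
  qed
  \<comment> \<open>The derivative is only known to vanish near \<open>t = 1\<close>; being
    polynomial in \<open>t\<close>, the trace is then constant everywhere, in particular down to
    \<open>t = 0\<close>.\<close>
  have p1: "p j 1 = p j 0" for j
  proof -
    let ?I = "{1 - e / M<..<1 + e / M}"
    have eM: "e / M > 0" using e(1) M(1) by simp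
    have "\<exists>c. \<forall>t\<in>?I. p j t = c"
    proof (rule has_field_derivative_zero_constant)
      fix t assume "t \<in> ?I"
      then have "\<bar>t - 1\<bar> < e / M" by auto
      then show "(p j has_real_derivative 0) (at t within ?I)"
        using dp[of j t] zero_der[of t "j - 1"] by (simp add: has_field_derivative_at_within)
    qed (rule convex_real_interval)
    then obtain c where c: "\<forall>t\<in>?I. p j t = c" ..
    have "1 \<in> ?I" using eM by simp
    then have "p j t - p j 1 = 0" if "t \<in> ?I" for t using bspec[OF c that] bspec[OF c, of 1] by simp
    then have "?I \<subseteq> {t. p j t - p j 1 = 0}" by (intro subsetI CollectI)
    moreover have "infinite ?I" using eM by (simp add: infinite_Ioo)
    ultimately have inf: "infinite {t. p j t - p j 1 = 0}" by (rule infinite_super)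
    have "poly_fun (\<lambda>t. p j t - p j 1)" by (intro poly_fun_diff pp poly_fun_const)
    from poly_fun_zeros[OF this, of 0] have "p j 0 - p j 1 \<noteq> 0 \<Longrightarrow> False" using inf by (rule notE[rotated])
    then have "p j 0 - p j 1 = 0" by (rule ccontr)
    then show ?thesis by simp
  qed
  have p0: "p (Suc j) 0 = 0" for j
    unfolding p_def
  proof (rule linear_trace_nilpotent[OF linear_funpow[OF linA], where n = "Suc (DIM('e))"])
    fix v
    have pow: "(A 0 ^^ Suc k) v = (br y ^^ Suc k) (Q v)" for k v
    proof (induction k)
      case (Suc k)
      have "(A 0 ^^ Suc (Suc k)) v = A 0 ((A 0 ^^ Suc k) v)" by simp
      also have "\<dots> = br y (Q ((A 0 ^^ Suc k) v))" by (simp add: A_def)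
      also have "Q ((A 0 ^^ Suc k) v) = (A 0 ^^ Suc k) v" by (rule Q(3)) (simp add: Al)
      finally show ?case unfolding Suc by simp
    qed (simp add: A_def)
    have "(br y ^^ DIM('e)) (Q v) = 0" by (rule ad0D) (rule subsetD[OF y Q(2)])
    then have "(A 0 ^^ Suc (DIM('e))) v = 0" unfolding pow by simp
    then have "(A 0 ^^ (Suc j * Suc (DIM('e)))) v = 0"
      by (rule funpow_zero_mono[OF linA]) simp
    then show "((A 0 ^^ Suc j) ^^ Suc (DIM('e))) v = 0" by (simp only: funpow_mult mult.commute)
  qed
  \<comment> \<open>Removing the powers of X from an annihilating polynomial leaves \<open>q\<close>
    with nonzero constant term, which still annihilates \<open>A 1\<close> on \<open>l'\<close>
    because \<open>A 1\<close> is injective there. As the positive powers are traceless, the trace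
    of q(A 1) on \<open>l'\<close> is \<open>coeff q 0\<close> times the trace of \<open>Q\<close>,
    and the latter is the dimension of \<open>l'\<close>.\<close>
  obtain P where P: "P \<noteq> 0" "\<And>v. pact P (A 1) v = 0" using annihilating_poly[OF linA] by blast
  from order_decomp[OF P(1), of 0] obtain q
    where qq: "P = [:- 0, 1:] ^ Polynomial.order 0 P * q \<and> \<not> [:- 0, 1:] dvd q" ..
  have q: "P = [:0, 1:] ^ Polynomial.order 0 P * q" using conjunct1[OF qq] by (simp only: minus_zero)
  have q0: "coeff q 0 \<noteq> 0"
  proof
    assume "coeff q 0 = 0"
    then have "poly q 0 = 0" by (simp only: poly_0_coeff_0)
    then have "[:- 0, 1:] dvd q" by (rule poly_eq_0_iff_dvd[THEN iffD1])
    then show False using conjunct2[OF qq] by (rule notE[rotated])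
  qed
  have A1inj: "v = 0" if "v \<in> l'" "(A 1 ^^ k) v = 0" for v k
    using that
  proof (induction k arbitrary: v)
    case (Suc k)
    have "A 1 v = 0" by (rule Suc.IH[OF Al]) (use Suc.prems(2) in \<open>simp add: funpow_swap1\<close>)
    then show ?case using injt[of 1 v] e(1) M(1) Suc.prems(1) by simp
  qed simp
  have qQ: "pact q (A 1) (Q v) = 0" for v
  proof (rule A1inj)
    show "pact q (A 1) (Q v) \<in> l'"
      unfolding poly_map_action_def
    proof (intro subspace_sum[OF l'] subspace_scale[OF l'])
      fix i show "(A 1 ^^ i) (Q v) \<in> l'" using funpow_invariant[of l' "A 1" "Q v" i] Al Q(2) by blast
    qed
    have "pact P (A 1) (Q v) = (A 1 ^^ Polynomial.order 0 P) (pact q (A 1) (Q v))"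
      by (subst q) (simp add: pact_mult[OF linA] pact_power[OF linA] pact_X[OF linA, abs_def])
    then show "(A 1 ^^ Polynomial.order 0 P) (pact q (A 1) (Q v)) = 0" unfolding P(2) by simp
  qed
  have trQ: "linear_trace (\<lambda>v. (A 1 ^^ i) (Q v)) = (if i = 0 then linear_trace Q else 0)" for i
  proof (cases i)
    case (Suc j)
    have "(\<lambda>v. (A 1 ^^ Suc j) (Q v)) = A 1 ^^ Suc j"
      by (rule ext) (simp only: funpow_Suc_right o_apply AQ)
    moreover have "linear_trace (A 1 ^^ Suc j) = 0" using p1[of "Suc j"] p0[of j] unfolding p_def by (rule trans)
    ultimately show ?thesis unfolding Suc by (simp del: funpow.simps)
  qed simp
  have "0 = linear_trace (\<lambda>v. pact q (A 1) (Q v))" by (simp add: qQ linear_trace_def)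
  also have "\<dots> = (\<Sum>b\<in>Basis. \<Sum>i\<le>degree q. coeff q i * ((A 1 ^^ i) (Q b) \<bullet> b))"
    by (simp add: linear_trace_def poly_map_action_def inner_sum_left)
  also have "\<dots> = (\<Sum>i\<le>degree q. coeff q i * linear_trace (\<lambda>v. (A 1 ^^ i) (Q v)))"
    unfolding linear_trace_def sum_distrib_left by (rule sum.swap)
  also have "\<dots> = coeff q 0 * linear_trace Q"
    unfolding trQ by (simp add: if_distrib[of "\<lambda>x. _ * x"] cong: if_cong)
  finally have "linear_trace Q = 0" using q0 by simp
  moreover have QQ: "Q v \<bullet> v = Q v \<bullet> Q v" for v using Q(4)[OF Q(2), of v v] by (simp add: inner_diff_left inner_commute[of v])
  ultimately have "(\<Sum>b\<in>Basis. Q b \<bullet> Q b) = 0" by (simp add: linear_trace_def)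
  then have "Q b = 0" if "b \<in> Basis" for b using that by (simp add: sum_nonneg_eq_0_iff)
  then have "Q v = 0" for v using linear_eq_0_on_span[of Q Basis v] Q(1) by simp
  then have "v = 0" if "v \<in> l'" for v using Q(3)[OF that] by simp
  then show ?thesis using subspace_0[OF l'] by blast
qed

end

context lie_algebra
begin

subsection \<open>Subalgebras of maximal rank\<close>

lemma ad0_automorphism:
  assumes T: "linear T" "inj T" and hom: "\<And>a b. T (br a b) = br (T a) (T b)"
  shows "T v \<in> ad0 (T y) \<longleftrightarrow> v \<in> ad0 y"
proof -
  have pow: "T ((br y ^^ n) v) = (br (T y) ^^ n) (T v)" for n by (induction n) (simp_all add: hom)
  have "T u = 0 \<longleftrightarrow> u = 0" for u using linear_injective_0[OF T(1)] T(2) linear_0[OF T(1)] by blast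
  then show ?thesis unfolding ad0_def by (simp add: pow[symmetric])
qed

text \<open>A power of \<open>ad z\<close> carries a basis of a complement \<open>W\<close> of the
  null component of \<open>z\<close> to an independent family. Along the line from \<open>x\<close>
  to \<open>z\<close> this family is polynomial in \<open>t\<close>, so it is independent for all
  but finitely many \<open>t\<close>, in particular for some small \<open>t > 0\<close>; there the
  null component meets \<open>W\<close> only in 0.\<close>

lemma regular_dense:
  assumes "\<epsilon> > 0"
  obtains y where "y \<in> ball x \<epsilon>" "dim (ad0 y) \<le> dim (ad0 z)"
proof -
  let ?N = "DIM('e)"
  define W where "W = {w. \<forall>v\<in>ad0 z. v \<bullet> w = 0}"
  have dW: "dim W + dim (ad0 z) = ?N"
    using dim_subspace_orthogonal_to_vectors[OF subspace_ad0[of z] subspace_UNIV subset_UNIV]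
    unfolding W_def orthogonal_def by simp
  have subW: "subspace W" unfolding W_def subspace_def by (simp add: inner_add_right)
  obtain I where I: "I \<subseteq> W" "independent I" "W \<subseteq> span I" "card I = dim W" using basis_exists[of W] by blast
  have fin: "finite I" using independent_imp_finite[OF I(2)] .
  have IW: "span I \<subseteq> W" using span_minimal[OF I(1) subW] .
  let ?y = "\<lambda>t. x + t *\<^sub>R (z - x)"
  define w where "w b t = (br (?y t) ^^ ?N) b" for b t
  have pw: "poly_vec (w b)" for b
  proof -
    have "br (?y t) = (\<lambda>u. br x u + t *\<^sub>R br (z - x) u)" for t
      by (rule ext) (simp add: br_add_left br_scale_left)
    then show ?thesis unfolding w_def[abs_def] using poly_vec_funpow[OF lin[of x] lin[of "z - x"], of ?N b] by simp
  qed
  have ws: "(\<Sum>b\<in>I. c b *\<^sub>R w b t) = (br (?y t) ^^ ?N) (\<Sum>b\<in>I. c b *\<^sub>R b)" for c t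
    unfolding w_def by (simp add: linear_sum[OF linear_funpow[OF lin]] linear_cmul[OF linear_funpow[OF lin]])
  have lincomb: "(\<Sum>b\<in>I. c b *\<^sub>R b) \<in> span I" for c
    by (intro span_sum span_scale span_base)
  have ind: "\<forall>b\<in>I. c b = 0" if "(\<Sum>b\<in>I. c b *\<^sub>R b) = 0" for c
    using independentD[OF I(2) fin subset_refl that] by blast
  have "finite {t. \<exists>c. (\<Sum>b\<in>I. c b *\<^sub>R w b t) = 0 \<and> (\<exists>b\<in>I. c b \<noteq> 0)}"
  proof (rule poly_vec_independent[OF fin pw, where ?t0.0 = 1])
    fix c assume "(\<Sum>b\<in>I. c b *\<^sub>R w b 1) = 0"
    then have "(\<Sum>b\<in>I. c b *\<^sub>R b) \<in> ad0 z" unfolding ws by (intro ad0I[where n = ?N]) simp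
    moreover have "(\<Sum>b\<in>I. c b *\<^sub>R b) \<in> W" using subsetD[OF IW lincomb] .
    ultimately have "(\<Sum>b\<in>I. c b *\<^sub>R b) \<bullet> (\<Sum>b\<in>I. c b *\<^sub>R b) = 0" unfolding W_def by simp
    then show "\<forall>b\<in>I. c b = 0" using ind by simp
  qed
  moreover define \<delta> where "\<delta> = \<epsilon> / (1 + norm (z - x))"
  have "\<delta> > 0" unfolding \<delta>_def using assms by (simp add: add_pos_nonneg)
  then have "infinite {0<..<\<delta>}" by (simp add: infinite_Ioo)
  ultimately have "\<not> {0<..<\<delta>} \<subseteq> {t. \<exists>c. (\<Sum>b\<in>I. c b *\<^sub>R w b t) = 0 \<and> (\<exists>b\<in>I. c b \<noteq> 0)}"
    using finite_subset by blast
  then obtain t where t: "t \<in> {0<..<\<delta>}"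
    "\<not> (\<exists>c. (\<Sum>b\<in>I. c b *\<^sub>R w b t) = 0 \<and> (\<exists>b\<in>I. c b \<noteq> 0))" by blast
  have int0: "u = 0" if u: "u \<in> ad0 (?y t)" "u \<in> W" for u
  proof -
    have "u \<in> span I" using u(2) I(3) by blast
    then obtain c where c: "u = (\<Sum>b\<in>I. c b *\<^sub>R b)" unfolding span_finite[OF fin] by blast
    have "(\<Sum>b\<in>I. c b *\<^sub>R w b t) = 0" unfolding ws c[symmetric] by (rule ad0D[OF u(1)])
    then have "\<forall>b\<in>I. c b = 0" using t(2) by blast
    then show ?thesis unfolding c by simp
  qed
  have "ad0 (?y t) \<inter> W = {0}" using int0 subspace_0[OF subspace_ad0] subspace_0[OF subW] by blast
  then have "dim (ad0 (?y t)) + dim W \<le> ?N"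
    using dim_sums_Int[OF subspace_ad0[of "?y t"] subW] dim_subset_UNIV[of "{u + v |u v. u \<in> ad0 (?y t) \<and> v \<in> W}"] by simp
  then have "dim (ad0 (?y t)) \<le> dim (ad0 z)" using dW by simp
  moreover have "?y t \<in> ball x \<epsilon>"
  proof -
    have "norm (t *\<^sub>R (z - x)) \<le> t * (1 + norm (z - x))" using t(1) by (simp add: mult_left_mono)
    also have "\<dots> < \<delta> * (1 + norm (z - x))" using t(1) by (intro mult_strict_right_mono) (auto simp: add_pos_nonneg)
    also have "\<dots> = \<epsilon>" unfolding \<delta>_def by (simp add: add_nonneg_eq_0_iff)
    finally show ?thesis by (simp add: dist_norm)
  qed
  ultimately show ?thesis using that by blast
qed

text \<open>The assumption \<open>conj\<close> isolates the contribution of the group: near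
  \<open>x\<close>, every element is the image of an element of \<open>l\<close> under an
  automorphism of the Lie algebra. It is supplied by the adjoint action in
  \<open>conjugates_open\<close>; the rest is algebra.\<close>

theorem equal_rank_orthogonal:
  assumes h: "subalgebra h" and m: "subspace m" and hm0: "h \<inter> m = {0}"
    and hm: "\<And>x y. x \<in> h \<Longrightarrow> y \<in> m \<Longrightarrow> br x y \<in> m"
    and nd: "nondegenerate_on h KF" and rank: "lie_rank br UNIV = lie_rank br h"
    and conj: "\<And>x l. subspace l \<Longrightarrow> (\<And>v. \<exists>a\<in>l. \<exists>b. v = a + br x b) \<Longrightarrow> x \<in> l \<Longrightarrow>
      \<exists>\<epsilon>>0. \<forall>z\<in>ball x \<epsilon>. \<exists>T y. linear T \<and> inj T \<and> (\<forall>a b. T (br a b) = br (T a) (T b)) \<and> y \<in> l \<and> z = T y"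
    and u: "u \<in> h" and v: "v \<in> m"
  shows "KF u v = 0"
proof -
  obtain c where c: "cartan_subalgebra br h c" "dim c = lie_rank br h" by (rule lie_rank_cartan[OF h])
  obtain q where q: "cartan_subalgebra br UNIV q" "dim q = lie_rank br UNIV" by (rule lie_rank_cartan[OF subalgebra_UNIV])
  note cd = cartan_subalgebraD[OF c(1)]
  have subc: "subspace c" by (rule subalgebra_subspace[OF cd(1)])
  have subh: "subspace h" by (rule subalgebra_subspace[OF h])
  obtain z0 where z0: "z0 \<in> q" "\<And>x. x \<in> q \<Longrightarrow> dim (UNIV \<inter> ad0 z0) \<le> dim (UNIV \<inter> ad0 x)"
    using ex_min_ad0[OF subalgebra_subspace[OF cartan_subalgebraD(1)[OF q(1)]], where g = UNIV] by blast
  have "UNIV \<inter> ad0 z0 = q" by (rule cartan_regular(1)[OF subalgebra_UNIV subalgebra_UNIV subset_refl q(1) z0])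
  then have dz0: "dim (ad0 z0) = dim c" using q(2) c(2) rank by simp
  obtain x where x: "x \<in> c" "\<And>y. y \<in> c \<Longrightarrow> dim (UNIV \<inter> ad0 x) \<le> dim (UNIV \<inter> ad0 y)"
    using ex_min_ad0[OF subc, where g = UNIV] by blast
  have hx: "h \<inter> ad0 x = c" by (rule cartan_regular(1)[OF h subalgebra_UNIV subset_UNIV c(1) x])
  define l where "l = ad0 x"
  have nil: "l \<subseteq> ad0 y" if "y \<in> c" for y
    using cartan_regular(2)[OF h subalgebra_UNIV subset_UNIV c(1) x that] unfolding l_def by simp
  have l: "subalgebra l" unfolding l_def by (rule subalgebra_ad0)
  have subl: "subspace l" by (rule subalgebra_subspace[OF l])
  have cl: "c \<subseteq> l" using hx unfolding l_def by blast
  have xl: "x \<in> l" using x(1) cl by blast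
  \<comment> \<open>The form stays non-degenerate on \<open>c\<close>: by Fitting, \<open>h\<close>
    is \<open>c\<close> plus the image of a power of \<open>ad x\<close>, and \<open>c\<close> is
    orthogonal to that image.\<close>
  have ndc: "y = 0" if y: "y \<in> c" "\<And>y'. y' \<in> c \<Longrightarrow> KF y y' = 0" for y
  proof -
    have "KF y w = 0" if w: "w \<in> h" for w
    proof -
      obtain a b where ab: "a \<in> h" "(br x ^^ DIM('e)) a = 0" "b \<in> h" "w = a + (br x ^^ DIM('e)) b"
        by (rule fitting_decomposition[OF lin subh _ w, of x "DIM('e)"])
          (use subalgebra_br[OF h] x(1) cd(2) in blast, rule that)
      have "a \<in> c" using hx ab(1) ad0I[OF ab(2)] by blast
      moreover have "KF y ((br x ^^ DIM('e)) b) = 0"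
        by (rule KF_fitting) (use y(1) cl in \<open>auto simp: l_def\<close>)
      ultimately show ?thesis using y(2) by (simp add: ab(4) KF_add_right)
    qed
    then show ?thesis using nd y(1) cd(2) unfolding nondegenerate_on_def by blast
  qed
  \<comment> \<open>Otherwise the last nonzero term of the lower central series lies in
    \<open>[c, c]\<close> and is central in \<open>c\<close>, so \<open>KF_derived_zero\<close>
    makes it orthogonal to \<open>c\<close>, against \<open>ndc\<close>.\<close>
  have abelian: "br y y' = 0" if "y \<in> c" "y' \<in> c" for y y'
  proof -
    have ex: "\<exists>n. lower_central br c n = {0}" using c(1) unfolding cartan_subalgebra_def by blast
    define n where "n = (LEAST n. lower_central br c n = {0})"
    have n: "lower_central br c n = {0}" unfolding n_def by (rule LeastI_ex[OF ex])
    have lc_sub: "lower_central br c k \<subseteq> c" for k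
    proof (induction k)
      case (Suc k)
      then show ?case using span_minimal[OF _ subc, of "{br x y | x y. x \<in> c \<and> y \<in> lower_central br c k}"]
        subalgebra_br[OF cd(1)] by auto
    qed simp
    have der: "lower_central br c (Suc k) \<subseteq> derived c" for k
      unfolding derived_def lower_central.simps by (rule span_mono) (use lc_sub[of k] in blast)
    have lc0: "0 \<in> lower_central br c k" for k using subspace_0[OF subc] by (cases k) (simp_all add: span_0)
    show ?thesis
    proof (cases n)
      case 0 then show ?thesis using n that by simp
    next
      case (Suc k)
      show ?thesis
      proof (cases k)
        case 0
        have "br y y' \<in> lower_central br c n" unfolding \<open>n = Suc k\<close> 0 by (simp, rule span_base) (use that in blast)
        then show ?thesis unfolding n by simp
      next
        case (Suc j)
        have "lower_central br c k \<noteq> {0}"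
          using not_less_Least[of k "\<lambda>n. lower_central br c n = {0}"] \<open>n = Suc k\<close> unfolding n_def[symmetric] by simp
        then obtain w where w: "w \<in> lower_central br c k" "w \<noteq> 0" using lc0 by blast
        have wc: "w \<in> c" using w(1) lc_sub by blast
        have "KF w y' = 0" if y': "y' \<in> c" for y'
        proof (rule KF_derived_zero[where l = c])
          show "w \<in> derived c" using w(1) der unfolding Suc by blast
          show "c \<subseteq> ad0 y'" by (rule cd(3)[OF y'])
          have "br y' w \<in> lower_central br c n"
            unfolding \<open>n = Suc k\<close> by (simp, rule span_base) (use y' w(1) in blast)
          then show "br y' w = 0" unfolding n by simp
        qed
        from ndc[OF wc this] w(2) show ?thesis by blast
      qed
    qed
  qed
  have cD: "y = 0" if y: "y \<in> c" "y \<in> derived l" for y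
    by (rule ndc[OF y(1)]) (rule KF_derived_zero[OF y(2) nil abelian[OF _ y(1)]])
  text \<open>An ideal of \<open>l\<close> complementary to \<open>c\<close>.\<close>
  define D where "D = derived l"
  have subD: "subspace D" unfolding D_def by (rule subspace_derived)
  have Dl: "D \<subseteq> l" unfolding D_def by (rule derived_subset[OF l])
  define F where "F = {a + b | a b. a \<in> c \<and> b \<in> D}"
  have subF: "subspace F" unfolding F_def by (rule subspace_sums[OF subc subD])
  have Fl: "F \<subseteq> l" unfolding F_def using cl Dl subspace_add[OF subl] by blast
  have DF: "D \<subseteq> F"
  proof
    fix b assume "b \<in> D"
    then have "0 + b \<in> F" unfolding F_def using subspace_0[OF subc] by blast
    then show "b \<in> F" by simp
  qed
  have cF: "c \<subseteq> F"
  proof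
    fix a assume "a \<in> c"
    then have "a + 0 \<in> F" unfolding F_def using subspace_0[OF subD] by blast
    then show "a \<in> F" by simp
  qed
  obtain Q where Q: "linear Q" "\<And>v. Q v \<in> F" "\<And>v. v \<in> F \<Longrightarrow> Q v = v" "\<And>v w. w \<in> F \<Longrightarrow> (v - Q v) \<bullet> w = 0"
    by (rule orthogonal_projection[OF subF]) (rule that)
  \<comment> \<open>This is \<open>[l, l]\<close> plus the orthogonal complement of
    \<open>c + [l, l]\<close> in \<open>l\<close>. It is an ideal because it contains
    \<open>[l, l]\<close>, and it meets \<open>c\<close> trivially because \<open>[l, l]\<close>
    does.\<close>
  define l' where "l' = {u\<in>l. Q u \<in> D}"
  have subl': "subspace l'" unfolding l'_def subspace_def
    using subspace_0[OF subl] subspace_add[OF subl] subspace_scale[OF subl]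
      subspace_0[OF subD] subspace_add[OF subD] subspace_scale[OF subD]
    by (auto simp: linear_add[OF Q(1)] linear_cmul[OF Q(1)] linear_0[OF Q(1)])
  have Dl': "D \<subseteq> l'" unfolding l'_def using Dl Q(3) DF by auto
  have cl': "c \<inter> l' = {0}"
  proof -
    have "y = 0" if "y \<in> c" "y \<in> l'" for y
      using that cD[of y] Q(3)[of y] cF unfolding l'_def D_def by auto
    then show ?thesis using subspace_0[OF subc] subspace_0[OF subl'] by blast
  qed
  have l_sum: "{a + b | a b. a \<in> c \<and> b \<in> l'} = l"
  proof (intro equalityI subsetI)
    fix u assume u: "u \<in> l"
    obtain a b where ab: "Q u = a + b" "a \<in> c" "b \<in> D" using Q(2)[of u] unfolding F_def by blast
    have "Q (u - a) = b" using ab cF Q(3)[of a] by (auto simp: linear_diff[OF Q(1)])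
    then have "u - a \<in> l'" unfolding l'_def using u ab cl subspace_diff[OF subl] by auto
    then show "u \<in> {a + b | a b. a \<in> c \<and> b \<in> l'}" using ab(2) by (intro CollectI exI[of _ a] exI[of _ "u - a"]) simp
  qed (use cl subspace_add[OF subl] in \<open>auto simp: l'_def\<close>)
  have brl': "br a b \<in> l'" if "a \<in> l" "b \<in> l" for a b
    using br_derived[OF that] Dl' unfolding D_def by blast
  have l'l: "l' \<subseteq> l" unfolding l'_def by blast
  have dl: "dim l = dim c + dim l'"
    using dim_sums_Int[OF subc subl'] unfolding l_sum cl' by simp
  obtain z where z: "z \<in> l" "dim (ad0 z) \<le> dim c"
  proof -
    have "\<exists>a\<in>l. \<exists>b. v = a + br x b" for v
    proof -
      obtain a b where "(br x ^^ DIM('e)) a = 0" "v = a + (br x ^^ 1) b"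
        by (rule fitting_decomposition[OF lin[of x] subspace_UNIV _ UNIV_I[of v], where n = 1]) (simp, rule that)
      then have "a \<in> l" "v = a + br x b" using ad0I[of "DIM('e)" x a] unfolding l_def by simp_all
      then show ?thesis by blast
    qed
    from conj[OF subl this xl] obtain \<epsilon> where e: "\<epsilon> > 0"
      "\<And>z. z \<in> ball x \<epsilon> \<Longrightarrow> \<exists>T y. linear T \<and> inj T \<and> (\<forall>a b. T (br a b) = br (T a) (T b)) \<and> y \<in> l \<and> z = T y" by blast
    obtain z' where z': "z' \<in> ball x \<epsilon>" "dim (ad0 z') \<le> dim (ad0 z0)" by (rule regular_dense[OF e(1)])
    obtain T y where T: "linear T" "inj T" "\<And>a b. T (br a b) = br (T a) (T b)" "y \<in> l" "z' = T y"
      using e(2)[OF z'(1)] by blast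
    have "T ` ad0 y \<subseteq> ad0 z'" unfolding T(5) using ad0_automorphism[OF T(1-3)] by blast
    then have "dim (T ` ad0 y) \<le> dim (ad0 z')" by (rule dim_subset)
    moreover have "dim (T ` ad0 y) = dim (ad0 y)" by (rule dim_image_eq[OF T(1)]) (rule inj_on_subset[OF T(2) subset_UNIV])
    ultimately show ?thesis using that[OF T(4)] z'(2) dz0 by simp
  qed
  have subz: "subspace (l \<inter> ad0 z)" by (rule subspace_inter[OF subl subspace_ad0])
  \<comment> \<open>Brackets with \<open>z\<close> fall into \<open>l'\<close>, so \<open>l\<close>
    is the sum of \<open>l'\<close> and the null part of \<open>z\<close> in \<open>l\<close>. The
    dimension of that part is at most \<open>dim c\<close>, the codimension of \<open>l'\<close> in
    \<open>l\<close>, which leaves no room for an intersection.\<close>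
  have zsum: "{a + b | a b. a \<in> l \<inter> ad0 z \<and> b \<in> l'} = l"
  proof (intro equalityI subsetI)
    fix u assume u: "u \<in> l"
    obtain a b where ab: "a \<in> l" "(br z ^^ DIM('e)) a = 0" "b \<in> l" "u = a + (br z ^^ 1) b"
      by (rule fitting_decomposition[OF lin subl _ u, of z 1]) (use subalgebra_br[OF l z(1)] in blast, rule that)
    then show "u \<in> {a + b | a b. a \<in> l \<inter> ad0 z \<and> b \<in> l'}"
      using ad0I[OF ab(2)] brl'[OF z(1) ab(3)] by auto
  qed (use l'l subspace_add[OF subl] in auto)
  have "dim ((l \<inter> ad0 z) \<inter> l') + dim l = dim (l \<inter> ad0 z) + dim l'"
    using dim_sums_Int[OF subz subl'] unfolding zsum by simp
  moreover have "dim (l \<inter> ad0 z) \<le> dim c" using dim_subset[of "l \<inter> ad0 z" "ad0 z"] z(2) by simp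
  ultimately have "dim ((l \<inter> ad0 z) \<inter> l') = 0" using dl by linarith
  then have zl': "(l \<inter> ad0 z) \<inter> l' \<subseteq> {0}" by (simp add: dim_eq_0)
  obtain y w where yw: "z = y + w" "y \<in> c" "w \<in> l'" using z(1) unfolding l_sum[symmetric] by blast
  have "l' = {0}"
  proof (rule no_invertible_ad[OF subl' _ yw(3)])
    show "l' \<subseteq> ad0 y" using nil[OF yw(2)] l'l by blast
    show "br y v \<in> l'" if "v \<in> l'" for v using brl' yw(2) cl l'l that by blast
    show "br u v \<in> l'" if "u \<in> l'" "v \<in> l'" for u v using brl' l'l that by blast
    show "v = 0" if "v \<in> l'" "br (y + w) v = 0" for v
    proof -
      have "v \<in> ad0 z" by (rule ad0I[where n = 1]) (simp add: yw(1) that(2))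
      then show ?thesis using zl' that(1) l'l by blast
    qed
  qed
  then have lc: "l = c" using l_sum by auto
  \<comment> \<open>\<open>m\<close> is stable under \<open>ad x\<close>, and the null component
    \<open>c\<close> of \<open>x\<close> meets it only in 0. So every element of \<open>m\<close> is
    in the image of a power of \<open>ad x\<close>, to which \<open>c\<close> is orthogonal.\<close>
  have cm: "KF y w = 0" if y: "y \<in> c" and w: "w \<in> m" for y w
  proof -
    obtain a b where ab: "a \<in> m" "(br x ^^ DIM('e)) a = 0" "w = a + (br x ^^ DIM('e)) b"
      by (rule fitting_decomposition[OF lin m _ w, of x "DIM('e)"]) (use hm x(1) cd(2) in blast, rule that)
    have "a \<in> c" using ad0I[OF ab(2)] lc unfolding l_def by simp
    then have "a = 0" using hm0 cd(2) ab(1) by blast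
    moreover have "KF y ((br x ^^ DIM('e)) b) = 0"
      by (rule KF_fitting) (use y cl in \<open>auto simp: l_def\<close>)
    ultimately show ?thesis unfolding ab(3) by simp
  qed
  obtain a b where ab: "a \<in> h" "(br x ^^ DIM('e)) a = 0" "b \<in> h" "u = a + (br x ^^ 1) b"
    by (rule fitting_decomposition[OF lin subh _ u, of x 1]) (use subalgebra_br[OF h] x(1) cd(2) in blast, rule that)
  have "a \<in> c" using hx ab(1) ad0I[OF ab(2)] by blast
  then have "KF a v = 0" using cm v by blast
  moreover have "KF (br x b) v = 0" unfolding KF_invariant by (rule cm[OF x(1) hm[OF ab(3) v]])
  ultimately show ?thesis unfolding ab(4) by (simp add: KF_add_left)
qed

end

subsection \<open>Calculus of smooth maps\<close>

lemma frechet_derivative_cong_open: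
  assumes "open S" "x \<in> S" "\<And>y. y \<in> S \<Longrightarrow> f y = g y"
  shows "frechet_derivative f (at x) = frechet_derivative g (at x)"
proof -
  have "(f has_derivative F) (at x) \<longleftrightarrow> (g has_derivative F) (at x)" for F
    using has_derivative_transform_within_open[of f F x UNIV S g] has_derivative_transform_within_open[of g F x UNIV S f] assms
    by auto
  then show ?thesis unfolding frechet_derivative_def by simp
qed

lemma differentiable_on_cong_open:
  assumes "open S" "\<And>y. y \<in> S \<Longrightarrow> f y = g y"
  shows "f differentiable_on S \<longleftrightarrow> g differentiable_on S"
proof -
  have "(f has_derivative F) (at x) \<longleftrightarrow> (g has_derivative F) (at x)" if "x \<in> S" for F x
    using has_derivative_transform_within_open[of f F x UNIV S g] has_derivative_transform_within_open[of g F x UNIV S f] assms that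
    by auto
  then show ?thesis using assms(1) unfolding differentiable_on_eq_differentiable_at[OF assms(1)] differentiable_def by simp
qed

lemma C_k_on_cong:
  assumes "open S" "\<And>x. x \<in> S \<Longrightarrow> f x = g x"
  shows "C_k_on k S f \<longleftrightarrow> C_k_on k S g"
  using assms(2)
proof (induction k arbitrary: f g)
  case 0 then show ?case using continuous_on_cong[of S S f g] by simp
next
  case (Suc k)
  have "C_k_on k S (\<lambda>x. frechet_derivative f (at x) v) \<longleftrightarrow> C_k_on k S (\<lambda>x. frechet_derivative g (at x) v)" for v
    by (rule Suc.IH) (use frechet_derivative_cong_open[OF assms(1) _ Suc.prems] in simp)
  then show ?case using differentiable_on_cong_open[OF assms(1) Suc.prems] by simp
qed

lemma C_k_on_subset:
  assumes "C_k_on k S f" "T \<subseteq> S" shows "C_k_on k T f"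
  using assms(1)
proof (induction k arbitrary: f)
  case 0 then show ?case using continuous_on_subset assms(2) by auto
next
  case (Suc k) then show ?case using differentiable_on_subset assms(2) by auto
qed

lemma C_k_on_SucI:
  assumes S: "open S" and f: "\<And>x. x \<in> S \<Longrightarrow> (f has_derivative f' x) (at x)"
    and f': "\<And>v. C_k_on k S (\<lambda>x. f' x v)"
  shows "C_k_on (Suc k) S f"
proof -
  have "frechet_derivative f (at x) = f' x" if "x \<in> S" for x
    using frechet_derivative_at[OF f[OF that]] by simp
  then have "C_k_on k S (\<lambda>x. frechet_derivative f (at x) v)" for v
    using C_k_on_cong[OF S, of "\<lambda>x. frechet_derivative f (at x) v" "\<lambda>x. f' x v" k] f' by simp
  moreover have "f differentiable_on S"
    unfolding differentiable_on_eq_differentiable_at[OF S] differentiable_def using f by blast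
  ultimately show ?thesis by simp
qed

lemma C_k_on_SucD:
  assumes "open S" "C_k_on (Suc k) S f"
  shows "\<And>x. x \<in> S \<Longrightarrow> (f has_derivative frechet_derivative f (at x)) (at x)"
    and "\<And>v. C_k_on k S (\<lambda>x. frechet_derivative f (at x) v)"
  using assms frechet_derivative_works by (auto simp: differentiable_on_eq_differentiable_at)

lemma C_k_on_Suc: "open S \<Longrightarrow> C_k_on (Suc k) S f \<Longrightarrow> C_k_on k S f"
proof (induction k arbitrary: f)
  case 0 then show ?case using differentiable_imp_continuous_on by auto
next
  case (Suc k)
  then have "C_k_on k S (\<lambda>x. frechet_derivative f (at x) v)" for v
    by (intro Suc.IH) simp_all
  moreover have "f differentiable_on S" using Suc.prems(2) by simp
  ultimately show ?case by simp
qed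

lemma C_k_on_const: "open S \<Longrightarrow> C_k_on k S (\<lambda>x. c)"
proof (induction k arbitrary: c)
  case (Suc k)
  show ?case by (rule C_k_on_SucI[OF Suc.prems has_derivative_const Suc.IH[OF Suc.prems]])
qed simp

lemma C_k_on_ident: "open S \<Longrightarrow> C_k_on k S (\<lambda>x. x)"
proof (cases k)
  case (Suc k)
  assume "open S"
  then show ?thesis unfolding Suc by (intro C_k_on_SucI[OF _ has_derivative_ident] C_k_on_const)
qed simp

lemma C_k_on_bounded_linear:
  assumes L: "bounded_linear L" and S: "open S" and f: "C_k_on k S f"
  shows "C_k_on k S (\<lambda>x. L (f x))"
  using f
proof (induction k arbitrary: f)
  case 0 then show ?case using bounded_linear.continuous_on[OF L] by auto
next
  case (Suc k)
  note d = C_k_on_SucD[OF S Suc.prems]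
  show ?case by (rule C_k_on_SucI[OF S bounded_linear.has_derivative[OF L d(1)] Suc.IH[OF d(2)]])
qed

lemma C_k_on_add:
  assumes S: "open S" and "C_k_on k S f" "C_k_on k S g"
  shows "C_k_on k S (\<lambda>x. f x + g x)"
  using assms(2,3)
proof (induction k arbitrary: f g)
  case 0 then show ?case by (simp add: continuous_on_add)
next
  case (Suc k)
  note f = C_k_on_SucD[OF S Suc.prems(1)] and g = C_k_on_SucD[OF S Suc.prems(2)]
  show ?case by (rule C_k_on_SucI[OF S has_derivative_add[OF f(1) g(1)] Suc.IH[OF f(2) g(2)]])
qed

lemma C_k_on_sum:
  assumes S: "open S" and "\<And>i. i \<in> I \<Longrightarrow> C_k_on k S (f i)"
  shows "C_k_on k S (\<lambda>x. \<Sum>i\<in>I. f i x)"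
  using assms(2) by (induction I rule: infinite_finite_induct) (auto intro: C_k_on_const[OF S] C_k_on_add[OF S])

lemma C_k_on_bilinear:
  assumes B: "bounded_bilinear B" and S: "open S" and "C_k_on k S f" "C_k_on k S g"
  shows "C_k_on k S (\<lambda>x. B (f x) (g x))"
  using assms(3,4)
proof (induction k arbitrary: f g)
  case 0 then show ?case using bounded_bilinear.continuous_on[OF B] by auto
next
  case (Suc k)
  note f = C_k_on_SucD[OF S Suc.prems(1)] and g = C_k_on_SucD[OF S Suc.prems(2)]
  note f0 = C_k_on_Suc[OF S Suc.prems(1)] and g0 = C_k_on_Suc[OF S Suc.prems(2)]
  show ?case
  proof (rule C_k_on_SucI[OF S])
    show "((\<lambda>x. B (f x) (g x)) has_derivative
        (\<lambda>h. B (f x) (frechet_derivative g (at x) h) + B (frechet_derivative f (at x) h) (g x))) (at x)"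
      if "x \<in> S" for x by (rule bounded_bilinear.FDERIV[OF B f(1)[OF that] g(1)[OF that]])
    show "C_k_on k S (\<lambda>x. B (f x) (frechet_derivative g (at x) v) + B (frechet_derivative f (at x) v) (g x))" for v
      by (rule C_k_on_add[OF S Suc.IH[OF f0 g(2)] Suc.IH[OF f(2) g0]])
  qed
qed

text \<open>\<open>C_k_on\<close> speaks of derivatives along fixed vectors only. The derivative of
  \<open>g\<close> is applied to the moving vector \<open>?f' x v\<close>, which is therefore
  expanded in the basis.\<close>

lemma C_k_on_compose:
  fixes f :: "'a::euclidean_space \<Rightarrow> 'b::euclidean_space"
  assumes S: "open S" and T: "open T" and fST: "f ` S \<subseteq> T" and "C_k_on k S f" "C_k_on k T g"
  shows "C_k_on k S (\<lambda>x. g (f x))"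
  using assms(4,5)
proof (induction k arbitrary: g)
  case 0 then show ?case using continuous_on_compose2[of T g S f] fST by auto
next
  case (Suc k)
  note f = C_k_on_SucD[OF S Suc.prems(1)] and g = C_k_on_SucD[OF T Suc.prems(2)]
  note f0 = C_k_on_Suc[OF S Suc.prems(1)]
  let ?f' = "\<lambda>x. frechet_derivative f (at x)" and ?g' = "\<lambda>x. frechet_derivative g (at x)"
  have lin: "linear (?g' (f x))" if "x \<in> S" for x using g(1)[of "f x"] that fST has_derivative_linear by blast
  have eq: "?g' (f x) (?f' x v) = (\<Sum>b\<in>Basis. (?f' x v \<bullet> b) *\<^sub>R ?g' (f x) b)" if "x \<in> S" for x v
  proof -
    have "?g' (f x) (?f' x v) = ?g' (f x) (\<Sum>b\<in>Basis. (?f' x v \<bullet> b) *\<^sub>R b)" by (simp add: euclidean_representation)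
    also have "\<dots> = (\<Sum>b\<in>Basis. (?f' x v \<bullet> b) *\<^sub>R ?g' (f x) b)"
      by (simp add: linear_sum[OF lin[OF that]] linear_cmul[OF lin[OF that]])
    finally show ?thesis .
  qed
  have "C_k_on k S (\<lambda>x. \<Sum>b\<in>Basis. (?f' x v \<bullet> b) *\<^sub>R ?g' (f x) b)" for v
    by (intro C_k_on_sum[OF S] C_k_on_bilinear[OF bounded_bilinear_scaleR S]
        C_k_on_bounded_linear[OF bounded_linear_inner_left S] f(2) Suc.IH f0 g(2))
  then have "C_k_on k S (\<lambda>x. ?g' (f x) (?f' x v))" for v
    by (subst C_k_on_cong[OF S eq]) 
  moreover have "((\<lambda>x. g (f x)) has_derivative (\<lambda>v. ?g' (f x) (?f' x v))) (at x)" if "x \<in> S" for x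
    by (rule has_derivative_compose[OF f(1)[OF that] g(1)]) (use that fST in blast)
  ultimately show ?case by (intro C_k_on_SucI[OF S])
qed

lemma smooth_on_open: "smooth_on S f \<Longrightarrow> open S"
  and smooth_on_C_k: "smooth_on S f \<Longrightarrow> C_k_on k S f"
  by (auto simp: smooth_on_def)

lemma smooth_on_cong:
  "(\<And>x. x \<in> S \<Longrightarrow> f x = g x) \<Longrightarrow> smooth_on S f \<longleftrightarrow> smooth_on S g"
  unfolding smooth_on_def using C_k_on_cong by blast

lemma smooth_on_subset: "smooth_on S f \<Longrightarrow> open T \<Longrightarrow> T \<subseteq> S \<Longrightarrow> smooth_on T f"
  unfolding smooth_on_def using C_k_on_subset by blast

lemma smooth_on_const: "open S \<Longrightarrow> smooth_on S (\<lambda>x. c)"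
  by (simp add: smooth_on_def C_k_on_const)
lemma smooth_on_ident: "open S \<Longrightarrow> smooth_on S (\<lambda>x. x)"
  by (simp add: smooth_on_def C_k_on_ident)
lemma smooth_on_bounded_linear: "bounded_linear L \<Longrightarrow> smooth_on S f \<Longrightarrow> smooth_on S (\<lambda>x. L (f x))"
  by (simp add: smooth_on_def C_k_on_bounded_linear)
lemma smooth_on_linear:
  fixes L :: "'b::euclidean_space \<Rightarrow> 'c::real_normed_vector"
  shows "linear L \<Longrightarrow> smooth_on S f \<Longrightarrow> smooth_on S (\<lambda>x. L (f x))"
  by (simp add: smooth_on_bounded_linear linear_conv_bounded_linear)
lemma smooth_on_add: "smooth_on S f \<Longrightarrow> smooth_on S g \<Longrightarrow> smooth_on S (\<lambda>x. f x + g x)"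
  by (simp add: smooth_on_def C_k_on_add)
lemma smooth_on_sum: "open S \<Longrightarrow> (\<And>i. i \<in> I \<Longrightarrow> smooth_on S (f i)) \<Longrightarrow> smooth_on S (\<lambda>x. \<Sum>i\<in>I. f i x)"
  by (simp add: smooth_on_def C_k_on_sum)
lemma smooth_on_bilinear: "bounded_bilinear B \<Longrightarrow> smooth_on S f \<Longrightarrow> smooth_on S g \<Longrightarrow> smooth_on S (\<lambda>x. B (f x) (g x))"
  by (simp add: smooth_on_def C_k_on_bilinear)
lemma smooth_on_scaleR: "smooth_on S f \<Longrightarrow> smooth_on S g \<Longrightarrow> smooth_on S (\<lambda>x. f x *\<^sub>R g x)"
  by (rule smooth_on_bilinear[OF bounded_bilinear_scaleR])
lemma smooth_on_diff: "smooth_on S f \<Longrightarrow> smooth_on S g \<Longrightarrow> smooth_on S (\<lambda>x. f x - g x)"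
  using smooth_on_add[of S f "\<lambda>x. - g x"] smooth_on_bounded_linear[OF bounded_linear_minus[OF bounded_linear_ident], of S g] by simp

lemma smooth_on_compose:
  fixes f :: "'a::euclidean_space \<Rightarrow> 'b::euclidean_space"
  shows "smooth_on S f \<Longrightarrow> smooth_on T g \<Longrightarrow> f ` S \<subseteq> T \<Longrightarrow> smooth_on S (\<lambda>x. g (f x))"
  unfolding smooth_on_def using C_k_on_compose[of S T f _ g] by blast

lemma smooth_on_Pair:
  assumes "smooth_on S f" "smooth_on S g" shows "smooth_on S (\<lambda>x. (f x, g x))"
proof -
  have "smooth_on S (\<lambda>x. (f x, 0) + (0, g x))"
    by (intro smooth_on_add smooth_on_bounded_linear[OF _ assms(1), where L = "\<lambda>x. (x, 0)"]
        smooth_on_bounded_linear[OF _ assms(2), where L = "\<lambda>x. (0, x)"])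
      (simp_all add: bounded_linear_Pair bounded_linear_ident bounded_linear_zero)
  then show ?thesis by simp
qed

lemma smooth_on_fst: "smooth_on S f \<Longrightarrow> smooth_on S (\<lambda>x. fst (f x))"
  by (rule smooth_on_bounded_linear[OF bounded_linear_fst])
lemma smooth_on_snd: "smooth_on S f \<Longrightarrow> smooth_on S (\<lambda>x. snd (f x))"
  by (rule smooth_on_bounded_linear[OF bounded_linear_snd])

lemma smooth_on_has_derivative:
  "smooth_on S f \<Longrightarrow> x \<in> S \<Longrightarrow> (f has_derivative frechet_derivative f (at x)) (at x)"
  using C_k_on_SucD(1)[OF smooth_on_open smooth_on_C_k] .

lemma smooth_on_frechet_derivative:
  "smooth_on S f \<Longrightarrow> smooth_on S (\<lambda>x. frechet_derivative f (at x) v)"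
  using C_k_on_SucD(2) unfolding smooth_on_def by blast

lemma smooth_on_continuous_on: "smooth_on S f \<Longrightarrow> continuous_on S f"
  using smooth_on_C_k[of S f 0] by simp

lemma smooth_on_frechet_derivative_comp:
  fixes f :: "'a::euclidean_space \<Rightarrow> 'b::euclidean_space" and g :: "'b \<Rightarrow> 'c::real_normed_vector"
  assumes g: "smooth_on T g" and f: "smooth_on S f" "f ` S \<subseteq> T" and v: "smooth_on S v"
  shows "smooth_on S (\<lambda>x. frechet_derivative g (at (f x)) (v x))"
proof -
  have lin: "linear (frechet_derivative g (at (f x)))" if "x \<in> S" for x
    using smooth_on_has_derivative[OF g] f(2) that has_derivative_linear by blast
  have 1: "smooth_on S (\<lambda>x. \<Sum>b\<in>Basis. (v x \<bullet> b) *\<^sub>R frechet_derivative g (at (f x)) b)"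
    by (intro smooth_on_sum[OF smooth_on_open[OF f(1)]] smooth_on_scaleR
        smooth_on_bounded_linear[OF bounded_linear_inner_left v]
        smooth_on_compose[OF f(1) smooth_on_frechet_derivative[OF g] f(2)])
  have 2: "(\<Sum>b\<in>Basis. (v x \<bullet> b) *\<^sub>R frechet_derivative g (at (f x)) b) = frechet_derivative g (at (f x)) (v x)" if "x \<in> S" for x
  proof -
    have "frechet_derivative g (at (f x)) (\<Sum>b\<in>Basis. (v x \<bullet> b) *\<^sub>R b) = (\<Sum>b\<in>Basis. (v x \<bullet> b) *\<^sub>R frechet_derivative g (at (f x)) b)"
      by (simp add: linear_sum[OF lin[OF that]] linear_cmul[OF lin[OF that]])
    then show ?thesis by (simp add: euclidean_representation)
  qed
  show ?thesis by (rule smooth_on_cong[THEN iffD1, OF 2 1])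
qed

section \<open>Linear equations with smooth coefficients and lifts through immersions\<close>

lemma has_derivative_epsilon:
  assumes "(f has_derivative f') (at x)" "e > 0"
  shows "\<exists>d>0. \<forall>y. norm (y - x) < d \<longrightarrow> norm (f y - f x - f' (y - x)) \<le> e * norm (y - x)"
  using assms unfolding has_derivative_at_alt by (elim conjE allE impE)

text \<open>A product rule with \<open>\<phi>\<close> merely continuous: since both factors vanish
  at \<open>x0\<close>, the product is of smaller order than the increment. It serves where the
  differentiability of one factor is still to be proved.\<close>

lemma has_derivative_mult_vanishing:
  fixes \<phi> :: "'a::real_normed_vector \<Rightarrow> real" and \<psi> :: "'a \<Rightarrow> 'b::real_normed_vector"
  assumes phi: "isCont \<phi> x0" "\<phi> x0 = 0" and psi: "(\<psi> has_derivative \<psi>') (at x0)" "\<psi> x0 = 0"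
  shows "((\<lambda>x. \<phi> x *\<^sub>R \<psi> x) has_derivative (\<lambda>h. 0)) (at x0)"
proof -
  obtain K where K: "\<And>h. norm (\<psi>' h) \<le> norm h * K"
    using bounded_linear.bounded[OF has_derivative_bounded_linear[OF psi(1)]] by blast
  have "\<exists>d>0. \<forall>y. norm (y - x0) < d \<longrightarrow> norm (\<phi> y *\<^sub>R \<psi> y - \<phi> x0 *\<^sub>R \<psi> x0 - 0) \<le> e * norm (y - x0)" if e: "e > 0" for e
  proof -
    obtain d1 where d1: "d1 > 0" "\<And>y. norm (y - x0) < d1 \<Longrightarrow> norm (\<psi> y - \<psi> x0 - \<psi>' (y - x0)) \<le> 1 * norm (y - x0)"
      using psi(1) unfolding has_derivative_at_alt by (meson zero_less_one)
    have "e / (\<bar>K\<bar> + 1) > 0" using e by simp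
    then obtain d2 where d2: "d2 > 0" "\<And>y. dist y x0 < d2 \<Longrightarrow> dist (\<phi> y) (\<phi> x0) < e / (\<bar>K\<bar> + 1)"
      using phi(1)[unfolded continuous_at_eps_delta, rule_format, OF \<open>e / (\<bar>K\<bar> + 1) > 0\<close>]
      by (elim exE conjE, rule_tac that) (assumption, simp)
    show ?thesis
    proof (intro exI[of _ "min d1 d2"] conjI allI impI)
      fix y assume y: "norm (y - x0) < min d1 d2"
      have "norm (\<psi> y) \<le> norm (\<psi> y - \<psi>' (y - x0)) + norm (\<psi>' (y - x0))"
        using norm_triangle_ineq[of "\<psi> y - \<psi>' (y - x0)" "\<psi>' (y - x0)"] by simp
      also have "\<dots> \<le> norm (y - x0) + norm (y - x0) * K" using d1(2)[of y] y K[of "y - x0"] psi(2) by simp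
      also have "\<dots> \<le> (\<bar>K\<bar> + 1) * norm (y - x0)"
        using mult_left_mono[OF abs_ge_self[of K] norm_ge_zero[of "y - x0"]] by (simp add: algebra_simps)
      finally have "norm (\<psi> y) \<le> (\<bar>K\<bar> + 1) * norm (y - x0)" .
      moreover have "\<bar>\<phi> y\<bar> \<le> e / (\<bar>K\<bar> + 1)" using d2(2)[of y] y phi(2) by (simp add: dist_norm)
      ultimately have "norm (\<phi> y *\<^sub>R \<psi> y) \<le> e / (\<bar>K\<bar> + 1) * ((\<bar>K\<bar> + 1) * norm (y - x0))"
        unfolding norm_scaleR by (intro mult_mono) auto
      also have "\<dots> = e * norm (y - x0)" using abs_ge_zero[of K] by (simp add: add_nonneg_eq_0_iff)
      finally show "norm (\<phi> y *\<^sub>R \<psi> y - \<phi> x0 *\<^sub>R \<psi> x0 - 0) \<le> e * norm (y - x0)" using phi(2) by simp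
    qed (use d1 d2 in simp)
  qed
  then show ?thesis unfolding has_derivative_at_alt by (simp add: bounded_linear_zero)
qed

lemma linear_basis_sum:
  fixes f :: "'b::euclidean_space \<Rightarrow> 'c::real_vector"
  assumes "linear f" shows "f w = (\<Sum>b\<in>Basis. (w \<bullet> b) *\<^sub>R f b)"
proof -
  have "f (\<Sum>b\<in>Basis. (w \<bullet> b) *\<^sub>R b) = (\<Sum>b\<in>Basis. (w \<bullet> b) *\<^sub>R f b)"
    by (simp add: linear_sum[OF assms] linear_cmul[OF assms])
  then show ?thesis by (simp add: euclidean_representation)
qed

text \<open>The lower bound \<open>e * norm w\<close> for \<open>M x0 w\<close> survives as
  \<open>e / 2 * norm w\<close> for \<open>M x w\<close> with \<open>x\<close> near
  \<open>x0\<close>, so that \<open>u x - u x0\<close> is controlled by the residual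
  \<open>y x - M x (u x0)\<close>.\<close>

lemma injective_family_continuous:
  fixes M :: "'a::euclidean_space \<Rightarrow> 'b::euclidean_space \<Rightarrow> 'c::euclidean_space"
  assumes S: "open S" "x0 \<in> S" and lin: "\<And>x. x \<in> S \<Longrightarrow> linear (M x)" and inj: "inj (M x0)"
    and cont: "\<And>v. continuous_on S (\<lambda>x. M x v)" and y: "continuous_on S y"
    and eq: "\<And>x. x \<in> S \<Longrightarrow> M x (u x) = y x"
  shows "isCont u x0"
proof -
  obtain e where e: "e > 0" "\<And>w. e * norm w \<le> norm (M x0 w)"
    using linear_inj_bounded_below_pos[OF lin[OF S(2)] inj] by blast
  define h where "h x = (\<Sum>b\<in>Basis. norm (M x b - M x0 b))" for x
  have contM: "isCont (\<lambda>x. M x v) x0" for v using cont S continuous_on_eq_continuous_at by blast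
  have conty: "isCont y x0" using y S continuous_on_eq_continuous_at by blast
  have hM: "norm (M x w - M x0 w) \<le> norm w * h x" if "x \<in> S" for x w
  proof -
    have "M x w - M x0 w = (\<Sum>b\<in>Basis. (w \<bullet> b) *\<^sub>R (M x b - M x0 b))"
      by (subst (1 2) linear_basis_sum) (use lin that S(2) in \<open>simp_all add: scaleR_diff_right sum_subtractf\<close>)
    also have "norm \<dots> \<le> (\<Sum>b\<in>Basis. norm w * norm (M x b - M x0 b))"
      by (rule sum_norm_le) (simp add: Basis_le_norm mult_right_mono)
    finally show ?thesis by (simp add: h_def sum_distrib_left)
  qed
  have "isCont h x0" unfolding h_def[abs_def] using contM by (intro continuous_intros)
  then have "(h \<longlongrightarrow> 0) (at x0)" by (simp add: isCont_def h_def)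
  then have ev1: "eventually (\<lambda>x. h x < e / 2) (at x0)" using order_tendstoD(2)[of h 0 "at x0" "e / 2"] e(1) by simp
  have ev2: "eventually (\<lambda>x. x \<in> S) (at x0)" using S by (rule eventually_at_in_open')
  have ev: "eventually (\<lambda>x. norm (u x - u x0) \<le> 2 / e * norm (y x - M x (u x0))) (at x0)"
    using ev1 ev2
  proof eventually_elim
    case (elim x)
    let ?w = "u x - u x0"
    have "e * norm ?w \<le> norm (M x ?w) + norm (M x ?w - M x0 ?w)"
      using e(2)[of ?w] norm_triangle_ineq4[of "M x ?w" "M x ?w - M x0 ?w"] by simp
    also have "\<dots> \<le> norm (M x ?w) + norm ?w * (e / 2)"
      using hM[OF elim(2), of ?w] mult_left_mono[OF less_imp_le[OF elim(1)] norm_ge_zero[of ?w]] by simp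
    finally have "e / 2 * norm ?w \<le> norm (M x ?w)" by (simp add: mult.commute)
    moreover have "M x ?w = y x - M x (u x0)" using eq[OF elim(2)] lin[OF elim(2)] by (simp add: linear_diff)
    ultimately show ?case using e(1) by (simp add: field_simps)
  qed
  have "((\<lambda>x. 2 / e * norm (y x - M x (u x0))) \<longlongrightarrow> 2 / e * norm (y x0 - M x0 (u x0))) (at x0)"
    using conty contM[of "u x0"] unfolding isCont_def by (intro tendsto_intros)
  then have lim: "((\<lambda>x. 2 / e * norm (y x - M x (u x0))) \<longlongrightarrow> 0) (at x0)" using eq[OF S(2)] by simp
  have "((\<lambda>x. norm (u x - u x0)) \<longlongrightarrow> 0) (at x0)"
    by (rule tendsto_sandwich[OF _ ev tendsto_const lim]) (simp add: always_eventually)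
  then show ?thesis unfolding isCont_def by (simp add: tendsto_norm_zero_iff LIM_zero_iff)
qed

text \<open>With \<open>L\<close> a left inverse of \<open>M x0\<close>, the equation becomes
  \<open>u x = u x0 + L (?R x + (y x - M x (u x0)))\<close>. The remainder \<open>?R x\<close>,
  which is \<open>M x0 - M x\<close> applied to \<open>u x - u x0\<close>, has derivative zero by
  \<open>has_derivative_mult_vanishing\<close>, although only continuity of \<open>u\<close> is
  known.\<close>

lemma injective_family_derivative:
  fixes M :: "'a::euclidean_space \<Rightarrow> 'b::euclidean_space \<Rightarrow> 'c::euclidean_space"
  assumes S: "open S" "x0 \<in> S" and lin: "\<And>x. x \<in> S \<Longrightarrow> linear (M x)" and inj: "inj (M x0)"
    and M': "\<And>v. ((\<lambda>x. M x v) has_derivative (\<lambda>h. M' h v)) (at x0)" and y': "(y has_derivative y') (at x0)"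
    and u: "isCont u x0" and eq: "\<And>x. x \<in> S \<Longrightarrow> M x (u x) = y x"
  obtains u' where "(u has_derivative u') (at x0)"
    "\<And>h. M x0 (u' h) = y' h - (\<Sum>b\<in>Basis. (u x0 \<bullet> b) *\<^sub>R M' h b)"
proof -
  obtain L where L: "linear L" "L \<circ> M x0 = id" using linear_injective_left_inverse[OF lin[OF S(2)] inj] by blast
  have LM: "L (M x0 w) = w" for w using fun_cong[OF L(2), of w] by simp
  have blL: "bounded_linear L" using L(1) by (simp add: linear_conv_bounded_linear)
  let ?R = "\<lambda>x. \<Sum>b\<in>Basis. ((u x - u x0) \<bullet> b) *\<^sub>R (M x0 b - M x b)"
  have R: "(?R has_derivative (\<lambda>h. \<Sum>b\<in>(Basis::'b set). 0)) (at x0)"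
  proof (intro has_derivative_sum has_derivative_mult_vanishing)
    fix b :: 'b
    show "isCont (\<lambda>x. (u x - u x0) \<bullet> b) x0" using u by (intro continuous_intros)
    show "((\<lambda>x. M x0 b - M x b) has_derivative (\<lambda>h. 0 - M' h b)) (at x0)"
      by (intro has_derivative_diff has_derivative_const M')
  qed simp_all
  define g' where "g' h = y' h - M' h (u x0)" for h
  have g: "((\<lambda>x. y x - M x (u x0)) has_derivative g') (at x0)"
    unfolding g'_def by (intro has_derivative_diff y' M')
  define u' where "u' h = L (g' h)" for h
  have 1: "((\<lambda>x. u x0 + L (?R x + (y x - M x (u x0)))) has_derivative (\<lambda>h. 0 + L ((\<Sum>b\<in>(Basis::'b set). 0) + g' h))) (at x0)"
    by (intro has_derivative_add has_derivative_const bounded_linear.has_derivative[OF blL] R g)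
  have 2: "u x0 + L (?R x + (y x - M x (u x0))) = u x" if x: "x \<in> S" for x
  proof -
    let ?w = "u x - u x0"
    have "?R x = M x0 ?w - M x ?w"
      unfolding linear_basis_sum[OF lin[OF S(2)], of ?w] linear_basis_sum[OF lin[OF x], of ?w]
      by (simp add: scaleR_diff_right sum_subtractf)
    also have "M x ?w = y x - M x (u x0)" using eq[OF x] by (simp add: linear_diff[OF lin[OF x]])
    finally have "?R x + (y x - M x (u x0)) = M x0 ?w" by simp
    then show ?thesis by (simp add: LM)
  qed
  have der: "(u has_derivative u') (at x0)"
    using has_derivative_transform_within_open[OF 1 S 2] unfolding u'_def by simp
  have 3: "((\<lambda>x. \<Sum>b\<in>Basis. (u x \<bullet> b) *\<^sub>R M x b) has_derivative
      (\<lambda>h. \<Sum>b\<in>Basis. (u x0 \<bullet> b) *\<^sub>R M' h b + (u' h \<bullet> b) *\<^sub>R M x0 b)) (at x0)"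
    by (intro has_derivative_sum has_derivative_scaleR has_derivative_inner_left der M')
  have 4: "(\<Sum>b\<in>Basis. (u x \<bullet> b) *\<^sub>R M x b) = y x" if "x \<in> S" for x
    using linear_basis_sum[OF lin[OF that], of "u x"] eq[OF that] by simp
  have "(y has_derivative (\<lambda>h. \<Sum>b\<in>Basis. (u x0 \<bullet> b) *\<^sub>R M' h b + (u' h \<bullet> b) *\<^sub>R M x0 b)) (at x0)"
    by (rule has_derivative_transform_within_open[OF 3 S 4])
  from has_derivative_unique[OF y' this]
  have "M x0 (u' h) = y' h - (\<Sum>b\<in>Basis. (u x0 \<bullet> b) *\<^sub>R M' h b)" for h
    using linear_basis_sum[OF lin[OF S(2)], of "u' h"] by (simp add: sum.distrib fun_eq_iff)
  with der show ?thesis by (rule that)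
qed

lemma C_k_on_continuous_on: "open S \<Longrightarrow> C_k_on k S f \<Longrightarrow> continuous_on S f"
  by (cases k) (simp_all add: differentiable_imp_continuous_on)

text \<open>Implicit differentiation: the derivative of \<open>u\<close> solves an equation with the
  same \<open>M\<close> and a right side that is C^k if \<open>u\<close> is. The maps
  \<open>M x\<close> are injective but may go into a larger space, as is the case for differentials
  of immersions.\<close>

lemma C_k_on_solve:
  fixes M :: "'a::euclidean_space \<Rightarrow> 'b::euclidean_space \<Rightarrow> 'c::euclidean_space"
  assumes S: "open S" and lin: "\<And>x. x \<in> S \<Longrightarrow> linear (M x)" and inj: "\<And>x. x \<in> S \<Longrightarrow> inj (M x)"
    and M: "\<And>v. C_k_on k S (\<lambda>x. M x v)" and y: "C_k_on k S y"
    and eq: "\<And>x. x \<in> S \<Longrightarrow> M x (u x) = y x"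
  shows "C_k_on k S u"
  using M y eq
proof (induction k arbitrary: y u)
  case 0
  have "isCont u x" if "x \<in> S" for x
    by (rule injective_family_continuous[where M = M and y = y, OF S that lin inj[OF that]]) (use 0 in auto)
  then show ?case using S by (simp add: continuous_on_eq_continuous_at)
next
  case (Suc k)
  note M = C_k_on_SucD[OF S Suc.prems(1)] and y = C_k_on_SucD[OF S Suc.prems(2)] and eq = Suc.prems(3)
  note M0 = C_k_on_Suc[OF S Suc.prems(1)]
  let ?M' = "\<lambda>x h v. frechet_derivative (\<lambda>x. M x v) (at x) h"
  have u: "C_k_on k S u" by (rule Suc.IH[OF M0 C_k_on_Suc[OF S Suc.prems(2)] eq])
  have ex: "\<exists>u'. (u has_derivative u') (at x) \<and>
      (\<forall>h. M x (u' h) = frechet_derivative y (at x) h - (\<Sum>b\<in>Basis. (u x \<bullet> b) *\<^sub>R ?M' x h b))" if x: "x \<in> S" for x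
  proof -
    have cont: "isCont u x"
      using C_k_on_continuous_on[OF S u] S x continuous_on_eq_continuous_at by blast
    obtain u' where "(u has_derivative u') (at x)"
      "\<And>h. M x (u' h) = frechet_derivative y (at x) h - (\<Sum>b\<in>Basis. (u x \<bullet> b) *\<^sub>R ?M' x h b)"
      by (rule injective_family_derivative[where M = M and y = y and u = u and M' = "?M' x",
            OF S x lin inj[OF x] M(1)[OF x] y(1)[OF x] cont eq]) (assumption | rule that)+
    then show ?thesis by blast
  qed
  have "\<exists>u'. \<forall>x\<in>S. (u has_derivative u' x) (at x) \<and>
      (\<forall>h. M x (u' x h) = frechet_derivative y (at x) h - (\<Sum>b\<in>Basis. (u x \<bullet> b) *\<^sub>R ?M' x h b))"
    by (rule bchoice) (intro ballI ex)
  then obtain u' where "\<forall>x\<in>S. (u has_derivative u' x) (at x) \<and>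
      (\<forall>h. M x (u' x h) = frechet_derivative y (at x) h - (\<Sum>b\<in>Basis. (u x \<bullet> b) *\<^sub>R ?M' x h b))" ..
  then have u': "\<And>x. x \<in> S \<Longrightarrow> (u has_derivative u' x) (at x)"
    "\<And>x h. x \<in> S \<Longrightarrow> M x (u' x h) = frechet_derivative y (at x) h - (\<Sum>b\<in>Basis. (u x \<bullet> b) *\<^sub>R ?M' x h b)"
    by simp_all
  have Cu': "C_k_on k S (\<lambda>x. u' x h)" for h
  proof (rule Suc.IH[OF M0 _ u'(2)])
    have "C_k_on k S (\<lambda>x. frechet_derivative y (at x) h + (-1) *\<^sub>R (\<Sum>b\<in>Basis. (u x \<bullet> b) *\<^sub>R ?M' x h b))"
      by (intro C_k_on_add[OF S] y(2) C_k_on_bounded_linear[OF bounded_linear_scaleR_right S] C_k_on_sum[OF S]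
          C_k_on_bilinear[OF bounded_bilinear_scaleR S] C_k_on_bounded_linear[OF bounded_linear_inner_left S] u M(2))
    then show "C_k_on k S (\<lambda>x. frechet_derivative y (at x) h - (\<Sum>b\<in>Basis. (u x \<bullet> b) *\<^sub>R ?M' x h b))" by simp
  qed
  show ?case by (rule C_k_on_SucI[OF S]) (fact u'(1), fact Cu')
qed

lemma smooth_on_solve:
  fixes M :: "'a::euclidean_space \<Rightarrow> 'b::euclidean_space \<Rightarrow> 'c::euclidean_space"
  assumes "\<And>x. x \<in> S \<Longrightarrow> linear (M x)" "\<And>x. x \<in> S \<Longrightarrow> inj (M x)"
    and "\<And>v. smooth_on S (\<lambda>x. M x v)" "smooth_on S y" "\<And>x. x \<in> S \<Longrightarrow> M x (u x) = y x"
  shows "smooth_on S u"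
  unfolding smooth_on_def
proof (intro conjI allI)
  show S: "open S" using assms(4) by (rule smooth_on_open)
  show "C_k_on k S u" for k
    by (rule C_k_on_solve[OF S assms(1,2) smooth_on_C_k[OF assms(3)] smooth_on_C_k[OF assms(4)] assms(5)])
qed

text \<open>For \<open>w = Z x - Z x0\<close> and a left inverse \<open>L\<close> of
  \<open>\<sigma>'\<close>, \<open>w\<close> equals \<open>L (f x - f x0)\<close> up to
  \<open>L\<close> of the linearization error of \<open>\<sigma>\<close>, which is small compared
  with \<open>w\<close>. Absorbing this error bounds \<open>w\<close> by a multiple of
  \<open>x - x0\<close>, after which the error is small compared with \<open>x - x0\<close> as
  well.\<close>

lemma lift_derivative:
  fixes \<sigma> :: "'b::euclidean_space \<Rightarrow> 'c::euclidean_space" and Z :: "'a::euclidean_space \<Rightarrow> 'b"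
  assumes sig: "(\<sigma> has_derivative \<sigma>') (at (Z x0))" and Z: "isCont Z x0" and f: "(f has_derivative f') (at x0)"
    and S: "open S" "x0 \<in> S" "\<And>x. x \<in> S \<Longrightarrow> \<sigma> (Z x) = f x"
    and L: "linear L" "\<And>w. L (\<sigma>' w) = w"
  shows "(Z has_derivative (\<lambda>h. L (f' h))) (at x0)"
proof -
  let ?z = "Z x0"
  have bl: "bounded_linear L" using L(1) by (simp add: linear_conv_bounded_linear)
  obtain K where K: "K > 0" "\<And>w. norm (L w) \<le> norm w * K" using bounded_linear.pos_bounded[OF bl] by blast
  obtain B where B: "B > 0" "\<And>h. norm (f' h) \<le> norm h * B"
    using bounded_linear.pos_bounded[OF has_derivative_bounded_linear[OF f]] by blast
  have f0: "f x0 = \<sigma> ?z" using S(2,3) by simp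
  have "\<exists>d>0. \<forall>x. norm (x - x0) < d \<longrightarrow> norm (Z x - Z x0 - L (f' (x - x0))) \<le> e * norm (x - x0)" if e: "e > 0" for e
  proof -
    \<comment> \<open>Tolerance for \<open>\<sigma>\<close>. The first bound makes its error at most
      half of \<open>norm w\<close> after applying \<open>L\<close>, so that it can be absorbed; the
      second makes it contribute at most \<open>e / 2\<close> once \<open>norm w\<close> is at most
      \<open>2 * K * (B + 1) * norm h\<close>.\<close>
    define e3 where "e3 = min (1 / (2 * K)) (e / (4 * K * K * (B + 1)))"
    have e3: "e3 > 0" "e3 * K \<le> 1 / 2" "e3 * (2 * K * (B + 1)) * K \<le> e / 2"
    proof -
      show "e3 > 0" using K(1) B(1) e by (simp add: e3_def)
      have "e3 * K \<le> 1 / (2 * K) * K" using K(1) by (intro mult_right_mono) (simp_all add: e3_def)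
      then show "e3 * K \<le> 1 / 2" using K(1) by simp
      have "e3 * (2 * K * (B + 1) * K) \<le> e / (4 * K * K * (B + 1)) * (2 * K * (B + 1) * K)"
        using K(1) B(1) by (intro mult_right_mono) (simp_all add: e3_def)
      also have "\<dots> = e / 2"
      proof -
        define c where "c = B + 1"
        have "c > 0" using B(1) by (simp add: c_def)
        then show ?thesis unfolding c_def[symmetric] using K(1) by (simp add: field_simps)
      qed
      finally show "e3 * (2 * K * (B + 1)) * K \<le> e / 2" by (simp add: mult.assoc)
    qed
    \<comment> \<open>Tolerance for \<open>f\<close>: the bound 1 gives the factor
      \<open>B + 1\<close> for the increment of \<open>f\<close>, and \<open>e / (2 * K)\<close>
      accounts for the other half of \<open>e\<close>.\<close>
    define e2 where "e2 = min 1 (e / (2 * K))"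
    have e2: "e2 > 0" "e2 \<le> 1" "e2 * K \<le> e / 2"
    proof -
      have "e2 * K \<le> e / (2 * K) * K" using K(1) by (intro mult_right_mono) (simp_all add: e2_def)
      then show "e2 * K \<le> e / 2" using K(1) by simp
    qed (use K(1) e in \<open>simp_all add: e2_def\<close>)
    obtain d1 where d1: "d1 > 0" "\<And>z. norm (z - ?z) < d1 \<Longrightarrow> norm (\<sigma> z - \<sigma> ?z - \<sigma>' (z - ?z)) \<le> e3 * norm (z - ?z)"
      using has_derivative_epsilon[OF sig e3(1)] by (elim exE conjE, rule_tac that) (assumption, simp)
    obtain d2 where d2: "d2 > 0" "\<And>x. norm (x - x0) < d2 \<Longrightarrow> norm (f x - f x0 - f' (x - x0)) \<le> e2 * norm (x - x0)"
      using has_derivative_epsilon[OF f e2(1)] by (elim exE conjE, rule_tac that) (assumption, simp)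
    obtain d3 where d3: "d3 > 0" "\<And>x. dist x x0 < d3 \<Longrightarrow> dist (Z x) ?z < d1"
      using Z[unfolded continuous_at_eps_delta, rule_format, OF d1(1)] by (elim exE conjE, rule_tac that) (assumption, simp)
    obtain d4 where d4: "d4 > 0" "ball x0 d4 \<subseteq> S" using S(1,2) openE by blast
    show ?thesis
    proof (intro exI[of _ "min d2 (min d3 d4)"] conjI allI impI)
      fix x assume x: "norm (x - x0) < min d2 (min d3 d4)"
      define h where "h = x - x0"
      define w where "w = Z x - ?z"
      have "x \<in> S" using d4(2) x by (auto simp: dist_norm norm_minus_commute)
      then have fx: "f x = \<sigma> (Z x)" using S(3) by simp
      have "norm w < d1" using d3(2)[of x] x by (simp add: w_def dist_norm)
      then have r: "norm (f x - f x0 - \<sigma>' w) \<le> e3 * norm w" using d1(2)[of "Z x"] unfolding w_def fx f0 by simp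
      have s: "norm (f x - f x0 - f' h) \<le> e2 * norm h" using d2(2)[of x] x unfolding h_def by simp
      have wL: "w = L (f x - f x0) - L (f x - f x0 - \<sigma>' w)" by (simp add: linear_diff[OF L(1)] L(2))
      have N: "norm (f x - f x0) \<le> (B + 1) * norm h"
      proof -
        have "norm (f x - f x0) \<le> norm (f x - f x0 - f' h) + norm (f' h)"
          using norm_triangle_ineq[of "f x - f x0 - f' h" "f' h"] by simp
        also have "\<dots> \<le> 1 * norm h + norm h * B"
          using s B(2)[of h] mult_right_mono[OF e2(2) norm_ge_zero[of h]] by linarith
        finally show ?thesis by (simp add: algebra_simps)
      qed
      have Lr: "norm (L (f x - f x0 - \<sigma>' w)) \<le> e3 * norm w * K"
        by (rule order_trans[OF K(2) mult_right_mono[OF r less_imp_le[OF K(1)]]])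
      have KN: "norm (L (f x - f x0)) \<le> (B + 1) * norm h * K"
        by (rule order_trans[OF K(2) mult_right_mono[OF N less_imp_le[OF K(1)]]])
      have "norm w \<le> norm (L (f x - f x0)) + norm (L (f x - f x0 - \<sigma>' w))"
        using wL norm_triangle_ineq4[of "L (f x - f x0)" "L (f x - f x0 - \<sigma>' w)"] by simp
      also have "\<dots> \<le> (B + 1) * norm h * K + 1 / 2 * norm w"
        using KN Lr mult_right_mono[OF e3(2) norm_ge_zero[of w]] by (simp add: mult_ac)
      finally have "norm w \<le> 2 * ((B + 1) * norm h * K)" by linarith
      then have w: "norm w \<le> 2 * K * (B + 1) * norm h" by (simp only: mult_ac)
      have "w - L (f' h) = L (f x - f x0 - f' h) - L (f x - f x0 - \<sigma>' w)"
        by (simp add: linear_diff[OF L(1)] L(2))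
      then have "norm (w - L (f' h)) \<le> norm (L (f x - f x0 - f' h)) + norm (L (f x - f x0 - \<sigma>' w))"
        by (metis norm_triangle_ineq4)
      also have "\<dots> \<le> e2 * norm h * K + e3 * (2 * K * (B + 1) * norm h) * K"
      proof (rule add_mono)
        show "norm (L (f x - f x0 - f' h)) \<le> e2 * norm h * K"
          by (rule order_trans[OF K(2) mult_right_mono[OF s less_imp_le[OF K(1)]]])
        have "e3 * norm w * K \<le> e3 * (2 * K * (B + 1) * norm h) * K"
          using w e3(1) K(1) by (intro mult_right_mono mult_left_mono) auto
        then show "norm (L (f x - f x0 - \<sigma>' w)) \<le> e3 * (2 * K * (B + 1) * norm h) * K" using Lr by linarith
      qed
      also have "\<dots> = (e2 * K + e3 * (2 * K * (B + 1)) * K) * norm h" by (simp add: algebra_simps)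
      also have "\<dots> \<le> e * norm h" using e2(3) e3(3) by (intro mult_right_mono) auto
      finally show "norm (Z x - Z x0 - L (f' (x - x0))) \<le> e * norm (x - x0)" unfolding w_def h_def .
    qed (use d2 d3 d4 in simp)
  qed
  moreover have "bounded_linear (\<lambda>h. L (f' h))"
    using bounded_linear_compose[OF bl has_derivative_bounded_linear[OF f]] .
  ultimately show ?thesis unfolding has_derivative_at_alt by blast
qed

text \<open>Bootstrapping: the derivative of the lift solves a linear equation whose coefficients,
  the derivative of \<open>\<sigma>\<close> at \<open>Z x\<close>, are C^k as soon as
  \<open>Z\<close> is. Then \<open>C_k_on_solve\<close> makes this derivative C^k and hence
  \<open>Z\<close> one degree better.\<close>

lemma smooth_on_lift:
  fixes \<sigma> :: "'b::euclidean_space \<Rightarrow> 'c::euclidean_space" and Z :: "'a::euclidean_space \<Rightarrow> 'b"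
  assumes sig: "smooth_on T \<sigma>" and inj: "\<And>z. z \<in> T \<Longrightarrow> inj (frechet_derivative \<sigma> (at z))"
    and Z: "continuous_on S Z" "Z ` S \<subseteq> T" and f: "smooth_on S f" and eq: "\<And>x. x \<in> S \<Longrightarrow> \<sigma> (Z x) = f x"
  shows "smooth_on S Z"
proof -
  have S: "open S" by (rule smooth_on_open[OF f])
  let ?D = "\<lambda>x. frechet_derivative \<sigma> (at (Z x))"
  have ZT: "Z x \<in> T" if "x \<in> S" for x using Z(2) that by blast
  have linD: "linear (?D x)" if "x \<in> S" for x
    using smooth_on_has_derivative[OF sig ZT[OF that]] has_derivative_linear by blast
  have ex: "\<exists>Z'. (Z has_derivative Z') (at x) \<and> (\<forall>h. ?D x (Z' h) = frechet_derivative f (at x) h)" if x: "x \<in> S" for x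
  proof -
    obtain L where L: "linear L" "L \<circ> ?D x = id"
      using linear_injective_left_inverse[OF linD[OF x] inj[OF ZT[OF x]]] by blast
    have cont: "isCont Z x" using Z(1) S x continuous_on_eq_continuous_at by blast
    have der: "(Z has_derivative (\<lambda>h. L (frechet_derivative f (at x) h))) (at x)"
      by (rule lift_derivative[OF smooth_on_has_derivative[OF sig ZT[OF x]] cont smooth_on_has_derivative[OF f x] S x eq L(1)])
        (use fun_cong[OF L(2)] in simp_all)
    have "((\<lambda>x. \<sigma> (Z x)) has_derivative (\<lambda>h. ?D x (L (frechet_derivative f (at x) h)))) (at x)"
      by (rule has_derivative_compose[OF der smooth_on_has_derivative[OF sig ZT[OF x]]])
    then have "(f has_derivative (\<lambda>h. ?D x (L (frechet_derivative f (at x) h)))) (at x)"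
      by (rule has_derivative_transform_within_open[OF _ S x]) (rule eq)
    from has_derivative_unique[OF smooth_on_has_derivative[OF f x] this]
    have "?D x (L (frechet_derivative f (at x) h)) = frechet_derivative f (at x) h" for h by (simp add: fun_eq_iff)
    with der show ?thesis by (intro exI[of _ "\<lambda>h. L (frechet_derivative f (at x) h)"] conjI allI)
  qed
  have "\<exists>Z'. \<forall>x\<in>S. (Z has_derivative Z' x) (at x) \<and> (\<forall>h. ?D x (Z' x h) = frechet_derivative f (at x) h)"
    by (rule bchoice) (intro ballI ex)
  then obtain Z' where "\<forall>x\<in>S. (Z has_derivative Z' x) (at x) \<and> (\<forall>h. ?D x (Z' x h) = frechet_derivative f (at x) h)" ..
  then have Z': "\<And>x. x \<in> S \<Longrightarrow> (Z has_derivative Z' x) (at x)"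
    "\<And>x h. x \<in> S \<Longrightarrow> ?D x (Z' x h) = frechet_derivative f (at x) h" by simp_all
  have "C_k_on k S Z" for k
  proof (induction k)
    case 0 then show ?case using Z(1) by simp
  next
    case (Suc k)
    have CD: "C_k_on k S (\<lambda>x. ?D x b)" for b
      by (rule C_k_on_compose[OF S smooth_on_open[OF sig] Z(2) Suc smooth_on_C_k[OF smooth_on_frechet_derivative[OF sig]]])
    show ?case
    proof (rule C_k_on_SucI[OF S Z'(1)])
      fix h
      show "C_k_on k S (\<lambda>x. Z' x h)"
        by (rule C_k_on_solve[OF S linD inj[OF ZT] CD smooth_on_C_k[OF smooth_on_frechet_derivative[OF f]] Z'(2)])
    qed
  qed
  then show ?thesis using S by (simp add: smooth_on_def)
qed

section \<open>Symmetry of second derivatives\<close>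

lemma has_real_derivative_along_line:
  fixes F :: "'a::euclidean_space \<Rightarrow> real"
  assumes "smooth_on S F" "p + t *\<^sub>R v \<in> S"
  shows "((\<lambda>t. F (p + t *\<^sub>R v)) has_real_derivative frechet_derivative F (at (p + t *\<^sub>R v)) v) (at t)"
proof -
  let ?D = "frechet_derivative F (at (p + t *\<^sub>R v))"
  have D: "(F has_derivative ?D) (at (p + t *\<^sub>R v))" by (rule smooth_on_has_derivative[OF assms])
  have "((\<lambda>t. p + t *\<^sub>R v) has_derivative (\<lambda>h. 0 + h *\<^sub>R v)) (at t)"
    by (intro has_derivative_add has_derivative_const has_derivative_scaleR_left has_derivative_ident)
  from has_derivative_compose[OF this D]
  have "((\<lambda>t. F (p + t *\<^sub>R v)) has_derivative (\<lambda>h. ?D (h *\<^sub>R v))) (at t)" by simp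
  moreover have "(\<lambda>h. ?D (h *\<^sub>R v)) = (*) (?D v)"
    using linear_cmul[OF has_derivative_linear[OF D]] by (auto simp: fun_eq_iff)
  ultimately show ?thesis by (simp add: has_field_derivative_def)
qed

text \<open>The mean value theorem twice: for the increment of \<open>F\<close> along
  \<open>v\<close> as a function of the step along \<open>w\<close>, and then along \<open>v\<close>
  for the derivative in direction \<open>w\<close>. The second difference is symmetric in
  \<open>v\<close> and \<open>w\<close>, so it can be expanded in either order.\<close>

lemma second_difference:
  fixes F :: "'a::euclidean_space \<Rightarrow> real"
  assumes F: "smooth_on S F" and s: "s > 0"
    and in_S: "\<And>\<sigma> \<theta>. 0 \<le> \<sigma> \<Longrightarrow> \<sigma> \<le> s \<Longrightarrow> 0 \<le> \<theta> \<Longrightarrow> \<theta> \<le> s \<Longrightarrow> x0 + \<sigma> *\<^sub>R v + \<theta> *\<^sub>R w \<in> S"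
  shows "\<exists>\<sigma> \<theta>. 0 < \<sigma> \<and> \<sigma> < s \<and> 0 < \<theta> \<and> \<theta> < s \<and>
    F (x0 + s *\<^sub>R v + s *\<^sub>R w) - F (x0 + s *\<^sub>R w) - F (x0 + s *\<^sub>R v) + F x0
     = s * (s * frechet_derivative (\<lambda>x. frechet_derivative F (at x) w) (at (x0 + \<sigma> *\<^sub>R v + \<theta> *\<^sub>R w)) v)"
proof -
  let ?D = "\<lambda>x. frechet_derivative F (at x) w"
  let ?u = "\<lambda>t. F ((x0 + s *\<^sub>R v) + t *\<^sub>R w) - F (x0 + t *\<^sub>R w)"
  have "\<exists>\<theta>>0. \<theta> < s \<and> ?u s - ?u 0 = (s - 0) * (?D ((x0 + s *\<^sub>R v) + \<theta> *\<^sub>R w) - ?D (x0 + \<theta> *\<^sub>R w))"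
  proof (rule MVT2[OF s])
    fix t assume t: "0 \<le> t" "t \<le> s"
    show "(?u has_real_derivative (?D ((x0 + s *\<^sub>R v) + t *\<^sub>R w) - ?D (x0 + t *\<^sub>R w))) (at t)"
      using in_S[of s t] in_S[of 0 t] t s by (intro DERIV_diff has_real_derivative_along_line[OF F]) simp_all
  qed
  then obtain \<theta> where th: "0 < \<theta>" "\<theta> < s" "?u s - ?u 0 = s * (?D ((x0 + s *\<^sub>R v) + \<theta> *\<^sub>R w) - ?D (x0 + \<theta> *\<^sub>R w))" by auto
  let ?\<psi> = "\<lambda>t. ?D ((x0 + \<theta> *\<^sub>R w) + t *\<^sub>R v)"
  have "\<exists>\<sigma>>0. \<sigma> < s \<and> ?\<psi> s - ?\<psi> 0 = (s - 0) * frechet_derivative ?D (at ((x0 + \<theta> *\<^sub>R w) + \<sigma> *\<^sub>R v)) v"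
  proof (rule MVT2[OF s])
    fix t assume t: "0 \<le> t" "t \<le> s"
    have "(x0 + \<theta> *\<^sub>R w) + t *\<^sub>R v \<in> S" using in_S[of t \<theta>] t th by (simp add: algebra_simps)
    then show "(?\<psi> has_real_derivative frechet_derivative ?D (at ((x0 + \<theta> *\<^sub>R w) + t *\<^sub>R v)) v) (at t)"
      by (rule has_real_derivative_along_line[OF smooth_on_frechet_derivative[OF F]])
  qed
  then obtain \<sigma> where si: "0 < \<sigma>" "\<sigma> < s" "?\<psi> s - ?\<psi> 0 = s * frechet_derivative ?D (at ((x0 + \<theta> *\<^sub>R w) + \<sigma> *\<^sub>R v)) v" by auto
  have p: "(x0 + \<theta> *\<^sub>R w) + \<sigma> *\<^sub>R v = x0 + \<sigma> *\<^sub>R v + \<theta> *\<^sub>R w" "(x0 + \<theta> *\<^sub>R w) + s *\<^sub>R v = (x0 + s *\<^sub>R v) + \<theta> *\<^sub>R w"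
    by (simp_all add: algebra_simps)
  have "?u s - ?u 0 = s * (s * frechet_derivative ?D (at (x0 + \<sigma> *\<^sub>R v + \<theta> *\<^sub>R w)) v)"
    using th(3) si(3) unfolding p by simp
  then show ?thesis using th(1,2) si(1,2) by (intro exI[of _ \<sigma>] exI[of _ \<theta>]) simp
qed

lemma mixed_derivative_symmetric_real:
  fixes F :: "'a::euclidean_space \<Rightarrow> real"
  assumes F: "smooth_on S F" and x0: "x0 \<in> S"
  shows "frechet_derivative (\<lambda>x. frechet_derivative F (at x) w) (at x0) v
       = frechet_derivative (\<lambda>x. frechet_derivative F (at x) v) (at x0) w"
proof -
  define P where "P x = frechet_derivative (\<lambda>x. frechet_derivative F (at x) w) (at x) v" for x
  define Q where "Q x = frechet_derivative (\<lambda>x. frechet_derivative F (at x) v) (at x) w" for x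
  have S: "open S" by (rule smooth_on_open[OF F])
  have "isCont P x0" "isCont Q x0"
    unfolding P_def[abs_def] Q_def[abs_def]
    using smooth_on_continuous_on[OF smooth_on_frechet_derivative[OF smooth_on_frechet_derivative[OF F]]] S x0
    by (auto simp: continuous_on_eq_continuous_at)
  have "dist (P x0) (Q x0) < e" if e: "e > 0" for e
  proof -
    have e2: "e / 2 > 0" using e by simp
    obtain d1 where d1: "d1 > 0" "\<And>y. dist y x0 < d1 \<Longrightarrow> dist (P y) (P x0) < e / 2"
      using \<open>isCont P x0\<close>[unfolded continuous_at_eps_delta, rule_format, OF e2] by (elim exE conjE, rule_tac that) (assumption, simp)
    obtain d2 where d2: "d2 > 0" "\<And>y. dist y x0 < d2 \<Longrightarrow> dist (Q y) (Q x0) < e / 2"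
      using \<open>isCont Q x0\<close>[unfolded continuous_at_eps_delta, rule_format, OF e2] by (elim exE conjE, rule_tac that) (assumption, simp)
    obtain d3 where d3: "d3 > 0" "ball x0 d3 \<subseteq> S" using S x0 openE by blast
    define d where "d = min d1 (min d2 d3)"
    have d: "d > 0" using d1 d2 d3 by (simp add: d_def)
    \<comment> \<open>Keeps the parallelogram spanned by \<open>s *\<^sub>R v\<close> and
      \<open>s *\<^sub>R w\<close> within distance \<open>d\<close>; the summand 1 covers the case
      \<open>v = w = 0\<close>.\<close>
    define s where "s = d / (norm v + norm w + 1)"
    have vw: "norm v + norm w + 1 > 0" using norm_ge_zero[of v] norm_ge_zero[of w] by linarith
    have s: "s > 0" using d vw by (simp add: s_def)
    have near: "dist (x0 + \<sigma> *\<^sub>R v + \<theta> *\<^sub>R w) x0 < d" if "0 \<le> \<sigma>" "\<sigma> \<le> s" "0 \<le> \<theta>" "\<theta> \<le> s" for \<sigma> \<theta>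
    proof -
      have "norm (\<sigma> *\<^sub>R v + \<theta> *\<^sub>R w) \<le> \<sigma> * norm v + \<theta> * norm w"
        using norm_triangle_ineq[of "\<sigma> *\<^sub>R v" "\<theta> *\<^sub>R w"] that by simp
      also have "\<dots> \<le> s * norm v + s * norm w" using that by (intro add_mono mult_right_mono) auto
      also have "\<dots> < s * (norm v + norm w + 1)" using s by (simp add: algebra_simps)
      also have "\<dots> = d" using vw by (simp add: s_def)
      finally show ?thesis by (simp add: dist_norm add.assoc)
    qed
    have in_S: "x0 + \<sigma> *\<^sub>R v + \<theta> *\<^sub>R w \<in> S" if "0 \<le> \<sigma>" "\<sigma> \<le> s" "0 \<le> \<theta>" "\<theta> \<le> s" for \<sigma> \<theta>
      using near[OF that] d3(2) by (auto simp: d_def dist_commute)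
    have in_S': "x0 + \<sigma> *\<^sub>R w + \<theta> *\<^sub>R v \<in> S" if "0 \<le> \<sigma>" "\<sigma> \<le> s" "0 \<le> \<theta>" "\<theta> \<le> s" for \<sigma> \<theta>
      using in_S[of \<theta> \<sigma>] that by (simp add: algebra_simps)
    from second_difference[OF F s in_S] obtain \<sigma> \<theta> where 1: "0 < \<sigma>" "\<sigma> < s" "0 < \<theta>" "\<theta> < s"
      "F (x0 + s *\<^sub>R v + s *\<^sub>R w) - F (x0 + s *\<^sub>R w) - F (x0 + s *\<^sub>R v) + F x0 = s * (s * P (x0 + \<sigma> *\<^sub>R v + \<theta> *\<^sub>R w))"
      unfolding P_def by auto
    from second_difference[OF F s in_S'] obtain \<sigma>' \<theta>' where 2: "0 < \<sigma>'" "\<sigma>' < s" "0 < \<theta>'" "\<theta>' < s"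
      "F (x0 + s *\<^sub>R w + s *\<^sub>R v) - F (x0 + s *\<^sub>R v) - F (x0 + s *\<^sub>R w) + F x0 = s * (s * Q (x0 + \<sigma>' *\<^sub>R w + \<theta>' *\<^sub>R v))"
      unfolding Q_def by auto
    have c: "x0 + s *\<^sub>R v + s *\<^sub>R w = x0 + s *\<^sub>R w + s *\<^sub>R v" by (simp add: algebra_simps)
    have "s * (s * P (x0 + \<sigma> *\<^sub>R v + \<theta> *\<^sub>R w)) = s * (s * Q (x0 + \<sigma>' *\<^sub>R w + \<theta>' *\<^sub>R v))"
      using 1(5) 2(5) unfolding c by linarith
    then have eq: "P (x0 + \<sigma> *\<^sub>R v + \<theta> *\<^sub>R w) = Q (x0 + \<theta>' *\<^sub>R v + \<sigma>' *\<^sub>R w)" using s by (simp add: algebra_simps)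
    have "dist (P (x0 + \<sigma> *\<^sub>R v + \<theta> *\<^sub>R w)) (P x0) < e / 2" by (rule d1(2)) (use near[of \<sigma> \<theta>] 1 in \<open>simp add: d_def\<close>)
    moreover have "dist (Q (x0 + \<theta>' *\<^sub>R v + \<sigma>' *\<^sub>R w)) (Q x0) < e / 2" by (rule d2(2)) (use near[of \<theta>' \<sigma>'] 2 in \<open>simp add: d_def\<close>)
    ultimately show ?thesis unfolding eq by (rule dist_triangle_half_r)
  qed
  then have "\<not> 0 < dist (P x0) (Q x0)" by blast
  then show ?thesis unfolding P_def Q_def by simp
qed

lemma mixed_derivative_symmetric:
  fixes F :: "'a::euclidean_space \<Rightarrow> 'b::euclidean_space"
  assumes F: "smooth_on S F" and x0: "x0 \<in> S"
  shows "frechet_derivative (\<lambda>x. frechet_derivative F (at x) w) (at x0) v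
       = frechet_derivative (\<lambda>x. frechet_derivative F (at x) v) (at x0) w"
proof (rule euclidean_eqI)
  fix b :: 'b
  note bl = bounded_linear_inner_left[of b]
  have S: "open S" by (rule smooth_on_open[OF F])
  have 1: "frechet_derivative (\<lambda>x. F x \<bullet> b) (at x) u = frechet_derivative F (at x) u \<bullet> b" if "x \<in> S" for x u
    using fun_cong[OF frechet_derivative_at[OF bounded_linear.has_derivative[OF bl smooth_on_has_derivative[OF F that]]], of u] by simp
  have 2: "frechet_derivative (\<lambda>x. frechet_derivative (\<lambda>x. F x \<bullet> b) (at x) u) (at x0) h
      = frechet_derivative (\<lambda>x. frechet_derivative F (at x) u) (at x0) h \<bullet> b" for u h
  proof -
    have "frechet_derivative (\<lambda>x. frechet_derivative (\<lambda>x. F x \<bullet> b) (at x) u) (at x0)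
        = frechet_derivative (\<lambda>x. frechet_derivative F (at x) u \<bullet> b) (at x0)"
      by (rule frechet_derivative_cong_open[OF S x0 1])
    then show ?thesis
      using fun_cong[OF frechet_derivative_at[OF bounded_linear.has_derivative[OF bl smooth_on_has_derivative[OF smooth_on_frechet_derivative[OF F] x0, of u]]], of h]
      by simp
  qed
  show "frechet_derivative (\<lambda>x. frechet_derivative F (at x) w) (at x0) v \<bullet> b
      = frechet_derivative (\<lambda>x. frechet_derivative F (at x) v) (at x0) w \<bullet> b"
    unfolding 2[symmetric] by (rule mixed_derivative_symmetric_real[OF smooth_on_bounded_linear[OF bl F] x0])
qed

section \<open>Local inverses and partial derivatives\<close>

text \<open>The inverse function theorem yields a continuous local inverse; as a lift of the
  identity through \<open>f\<close> it is smooth by \<open>smooth_on_lift\<close>.\<close>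

lemma local_inverse:
  fixes f :: "'a::euclidean_space \<Rightarrow> 'a"
  assumes f: "smooth_on S f" and x0: "x0 \<in> S" and inj: "inj (frechet_derivative f (at x0))"
  obtains U V g where "open U" "x0 \<in> U" "U \<subseteq> S" "open V" "f x0 \<in> V"
    "\<And>x. x \<in> U \<Longrightarrow> f x \<in> V" "\<And>x. x \<in> U \<Longrightarrow> g (f x) = x"
    "\<And>y. y \<in> V \<Longrightarrow> g y \<in> U" "\<And>y. y \<in> V \<Longrightarrow> f (g y) = y" "smooth_on V g"
proof -
  let ?f' = "\<lambda>x. Blinfun (frechet_derivative f (at x))"
  have S: "open S" by (rule smooth_on_open[OF f])
  have bl: "bounded_linear (frechet_derivative f (at x))" if "x \<in> S" for x
    by (rule has_derivative_bounded_linear[OF smooth_on_has_derivative[OF f that]])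
  have app: "blinfun_apply (?f' x) = frechet_derivative f (at x)" if "x \<in> S" for x
    by (rule bounded_linear_Blinfun_apply[OF bl[OF that]])
  have der: "(f has_derivative blinfun_apply (?f' x)) (at x)" if "x \<in> S" for x
    unfolding app[OF that] by (rule smooth_on_has_derivative[OF f that])
  have "continuous_on S ?f'"
  proof (rule continuous_on_blinfun_componentwise)
    fix i :: 'a
    have "continuous_on S (\<lambda>x. frechet_derivative f (at x) i)"
      by (rule smooth_on_continuous_on[OF smooth_on_frechet_derivative[OF f]])
    then show "continuous_on S (\<lambda>x. blinfun_apply (?f' x) i)"
      by (rule continuous_on_eq) (simp add: app)
  qed
  obtain L where L: "linear L" "L \<circ> frechet_derivative f (at x0) = id"
    using linear_injective_left_inverse[OF _ inj] bl[OF x0] by (auto simp: linear_conv_bounded_linear)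
  have inv: "Blinfun L o\<^sub>L ?f' x0 = id_blinfun"
  proof (rule blinfun_eqI)
    fix i
    have "blinfun_apply (Blinfun L) = L" using L(1) by (intro bounded_linear_Blinfun_apply) (simp add: linear_conv_bounded_linear)
    then show "blinfun_apply (Blinfun L o\<^sub>L ?f' x0) i = blinfun_apply id_blinfun i"
      using fun_cong[OF L(2), of i] by (simp add: app[OF x0])
  qed
  obtain U V g g' where g: "open U" "U \<subseteq> S" "x0 \<in> U" "open V" "f x0 \<in> V" "homeomorphism U V f g"
    and bij: "\<And>y. y \<in> V \<Longrightarrow> bij (blinfun_apply (?f' (g y)))"
    by (rule inverse_function_theorem[OF S der \<open>continuous_on S ?f'\<close> x0 inv])
      (assumption | rule that)+
  have 1: "f x \<in> V" "g (f x) = x" if "x \<in> U" for x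
    using homeomorphism_image1[OF g(6)] homeomorphism_apply1[OF g(6) that] that by blast+
  have 2: "g y \<in> U" "f (g y) = y" if "y \<in> V" for y
    using homeomorphism_image2[OF g(6)] homeomorphism_apply2[OF g(6) that] that by blast+
  have "smooth_on V g"
  proof (rule smooth_on_lift[where \<sigma> = f and T = U and f = "\<lambda>y. y"])
    show "smooth_on U f" by (rule smooth_on_subset[OF f g(1,2)])
    show "inj (frechet_derivative f (at z))" if "z \<in> U" for z
      using bij[OF 1(1)[OF that]] 1(2)[OF that] app[of z] g(2) that by (auto simp: bij_def)
    show "continuous_on V g" by (rule homeomorphism_cont2[OF g(6)])
    show "g ` V \<subseteq> U" using 2(1) by blast
    show "smooth_on V (\<lambda>y. y)" by (rule smooth_on_ident[OF g(4)])
  qed (rule 2(2))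
  from that[OF g(1,3,2,4,5) 1 2 this] show ?thesis by blast
qed

lemma has_derivative_partial_snd:
  assumes "smooth_on S c" "(x, y) \<in> S"
  shows "((\<lambda>y. c (x, y)) has_derivative (\<lambda>v. frechet_derivative c (at (x, y)) (0, v))) (at y)"
proof -
  have "((\<lambda>y. (x, y)) has_derivative (\<lambda>v. (0, v))) (at y)"
    by (intro has_derivative_Pair has_derivative_const has_derivative_ident)
  from has_derivative_compose[OF this smooth_on_has_derivative[OF assms]] show ?thesis .
qed

lemma has_derivative_partial_fst:
  assumes "smooth_on S c" "(x, y) \<in> S"
  shows "((\<lambda>x. c (x, y)) has_derivative (\<lambda>v. frechet_derivative c (at (x, y)) (v, 0))) (at x)"
proof -
  have "((\<lambda>x. (x, y)) has_derivative (\<lambda>v. (v, 0))) (at x)"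
    by (intro has_derivative_Pair has_derivative_const has_derivative_ident)
  from has_derivative_compose[OF this smooth_on_has_derivative[OF assms]] show ?thesis .
qed

lemma has_derivative_in_subspace:
  fixes f :: "'a::real_normed_vector \<Rightarrow> 'b::euclidean_space"
  assumes f: "(f has_derivative f') (at x0)" and S: "open S" "x0 \<in> S" and V: "subspace V"
    and fV: "\<And>x. x \<in> S \<Longrightarrow> f x \<in> V"
  shows "f' h \<in> V"
proof -
  obtain y z where yz: "y \<in> span V" "\<And>w. w \<in> span V \<Longrightarrow> orthogonal z w" "f' h = y + z"
    using orthogonal_subspace_decomp_exists[of V "f' h"] by blast
  have sV: "span V = V" using V span_eq_iff by blast
  have 1: "((\<lambda>x. f x \<bullet> z) has_derivative (\<lambda>h. f' h \<bullet> z)) (at x0)"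
    by (rule bounded_linear.has_derivative[OF bounded_linear_inner_left f])
  have "f x \<bullet> z = 0" if "x \<in> S" for x
    using yz(2)[of "f x"] fV[OF that] sV by (simp add: orthogonal_def inner_commute)
  then have 2: "((\<lambda>x. 0) has_derivative (\<lambda>h. f' h \<bullet> z)) (at x0)"
    by (rule has_derivative_transform_within_open[OF 1 S])
  have "f' h \<bullet> z = 0" using has_derivative_unique[OF 2 has_derivative_const] by (simp add: fun_eq_iff)
  moreover have "y \<bullet> z = 0" using yz(1,2) by (simp add: orthogonal_def inner_commute)
  ultimately have "z \<bullet> z = 0" by (simp add: yz(3) inner_add_left)
  then show ?thesis using yz(1,3) sV by simp
qed

subsection \<open>Smooth maps from Euclidean spaces into manifolds\<close>

text \<open>All maps between manifolds are handled through their compositions with parametrizations,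
  i.e. through maps from open sets of Euclidean spaces into manifolds. The tangent vectors of
  these maps are computed in the distinguished chart at the image point.\<close>

definition smooth_into :: "('p, 'e::euclidean_space) atlas \<Rightarrow> ('a::euclidean_space \<Rightarrow> 'p) \<Rightarrow> 'a \<Rightarrow> bool" where
  "smooth_into B F x0 \<longleftrightarrow> F x0 \<in> points B \<and>
     (\<forall>V \<psi>. (V, \<psi>) \<in> B \<longrightarrow> F x0 \<in> V \<longrightarrow> (\<exists>S. open S \<and> x0 \<in> S \<and> F ` S \<subseteq> V \<and> smooth_on S (\<lambda>x. \<psi> (F x))))"

definition velocity :: "('p, 'e::euclidean_space) atlas \<Rightarrow> ('a::euclidean_space \<Rightarrow> 'p) \<Rightarrow> 'a \<Rightarrow> 'a \<Rightarrow> 'e" where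
  "velocity B F x0 = frechet_derivative (\<lambda>x. coord B (F x0) (F x)) (at x0)"

text \<open>The one property of the source atlas that composition requires. It passes to products
  and restrictions without establishing the manifold axioms for them.\<close>

definition inj_atlas :: "('p, 'e) atlas \<Rightarrow> bool" where
  "inj_atlas A \<longleftrightarrow> (\<forall>U \<phi>. (U, \<phi>) \<in> A \<longrightarrow> inj_on \<phi> U)"

lemma smooth_intoD:
  assumes "smooth_into B F x0" "(V, \<psi>) \<in> B" "F x0 \<in> V"
  obtains S where "open S" "x0 \<in> S" "\<And>x. x \<in> S \<Longrightarrow> F x \<in> V" "smooth_on S (\<lambda>x. \<psi> (F x))"
proof -
  obtain S where "open S \<and> x0 \<in> S \<and> F ` S \<subseteq> V \<and> smooth_on S (\<lambda>x. \<psi> (F x))"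
    using assms unfolding smooth_into_def by blast
  then show ?thesis by (intro that[of S]) auto
qed

lemma smooth_into_points: "smooth_into B F x0 \<Longrightarrow> F x0 \<in> points B"
  by (simp add: smooth_into_def)

lemma smooth_manifold_inj: "smooth_manifold A \<Longrightarrow> inj_atlas A"
  unfolding smooth_manifold_def inj_atlas_def by blast

lemma chart_points: "(U, \<phi>) \<in> A \<Longrightarrow> p \<in> U \<Longrightarrow> p \<in> points A"
  unfolding points_def by blast

lemma points_chart:
  assumes "p \<in> points A" obtains U \<phi> where "(U, \<phi>) \<in> A" "p \<in> U"
  using assms unfolding points_def by auto

lemma smooth_manifold_open: "smooth_manifold A \<Longrightarrow> (U, \<phi>) \<in> A \<Longrightarrow> open (\<phi> ` U)"
  unfolding smooth_manifold_def by blast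

lemma smooth_manifold_transition:
  assumes "smooth_manifold A" "(U, \<phi>) \<in> A" "(V, \<psi>) \<in> A"
  shows "smooth_on (\<phi> ` (U \<inter> V)) (\<lambda>x. \<psi> (inv_into U \<phi> x))"
proof -
  have "\<forall>(U, \<phi>)\<in>A. \<forall>(V, \<psi>)\<in>A. smooth_on (\<phi> ` (U \<inter> V)) (\<psi> \<circ> inv_into U \<phi>)"
    using assms(1) unfolding smooth_manifold_def by (elim conjE)
  from bspec[OF this assms(2)] have "\<forall>(V, \<psi>)\<in>A. smooth_on (\<phi> ` (U \<inter> V)) (\<psi> \<circ> inv_into U \<phi>)" by simp
  from bspec[OF this assms(3)] show ?thesis by (simp add: o_def)
qed

lemma inj_atlas_inv: "inj_atlas A \<Longrightarrow> (U, \<phi>) \<in> A \<Longrightarrow> p \<in> U \<Longrightarrow> inv_into U \<phi> (\<phi> p) = p"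
  unfolding inj_atlas_def by (simp add: inv_into_f_f)

lemma smooth_intoI:
  assumes B: "smooth_manifold B" and V: "(V, \<psi>) \<in> B" and S: "x0 \<in> S" "\<And>x. x \<in> S \<Longrightarrow> F x \<in> V"
    and sm: "smooth_on S (\<lambda>x. \<psi> (F x))"
  shows "smooth_into B F x0"
  unfolding smooth_into_def
proof (intro conjI allI impI)
  have oS: "open S" by (rule smooth_on_open[OF sm])
  show "F x0 \<in> points B" using chart_points[OF V] S by blast
  fix V' \<psi>' assume V': "(V', \<psi>') \<in> B" "F x0 \<in> V'"
  let ?W = "\<psi> ` (V \<inter> V')"
  note tr = smooth_manifold_transition[OF B V V'(1)]
  define T where "T = S \<inter> (\<lambda>x. \<psi> (F x)) -` ?W"
  have oT: "open T" unfolding T_def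
    using continuous_open_preimage[OF smooth_on_continuous_on[OF sm] oS smooth_on_open[OF tr]] .
  have FT: "F x \<in> V'" if "x \<in> T" for x
  proof -
    have "F x \<in> V" "\<psi> (F x) \<in> ?W" using that S(2) unfolding T_def by auto
    then obtain q where "q \<in> V" "q \<in> V'" "\<psi> (F x) = \<psi> q" by blast
    then have "F x = q" using smooth_manifold_inj[OF B] V \<open>F x \<in> V\<close> unfolding inj_atlas_def inj_on_def by blast
    then show ?thesis using \<open>q \<in> V'\<close> by simp
  qed
  have 1: "smooth_on T (\<lambda>x. \<psi>' (inv_into V \<psi> (\<psi> (F x))))"
    by (rule smooth_on_compose[OF smooth_on_subset[OF sm oT] tr]) (auto simp: T_def)
  have 2: "\<psi>' (inv_into V \<psi> (\<psi> (F x))) = \<psi>' (F x)" if "x \<in> T" for x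
    using inj_atlas_inv[OF smooth_manifold_inj[OF B] V, of "F x"] S(2)[of x] that by (simp add: T_def)
  have "smooth_on T (\<lambda>x. \<psi>' (F x))" by (rule smooth_on_cong[THEN iffD1, OF 2 1])
  moreover have "x0 \<in> T" using S V'(2) unfolding T_def by auto
  ultimately show "\<exists>S. open S \<and> x0 \<in> S \<and> F ` S \<subseteq> V' \<and> smooth_on S (\<lambda>x. \<psi>' (F x))"
    using oT FT by (intro exI[of _ T]) auto
qed

lemma smooth_into_nbhd:
  assumes B: "smooth_manifold B" and F: "smooth_into B F x0"
  obtains S where "open S" "x0 \<in> S" "\<And>x. x \<in> S \<Longrightarrow> smooth_into B F x"
proof -
  obtain V \<psi> where V: "(V, \<psi>) \<in> B" "F x0 \<in> V" using points_chart[OF smooth_into_points[OF F]] by blast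
  obtain S where S: "open S" "x0 \<in> S" "\<And>x. x \<in> S \<Longrightarrow> F x \<in> V" "smooth_on S (\<lambda>x. \<psi> (F x))"
    by (rule smooth_intoD[OF F V]) (rule that)
  show ?thesis by (rule that[OF S(1,2)]) (rule smooth_intoI[OF B V(1) _ S(3,4)])
qed

lemma smooth_into_cong:
  assumes F: "smooth_into B F x0" and S: "open S" "x0 \<in> S" "\<And>x. x \<in> S \<Longrightarrow> F x = G x"
  shows "smooth_into B G x0"
  unfolding smooth_into_def
proof (intro conjI allI impI)
  show "G x0 \<in> points B" using smooth_into_points[OF F] S by simp
  fix V \<psi> assume V: "(V, \<psi>) \<in> B" "G x0 \<in> V"
  then have "F x0 \<in> V" using S by simp
  obtain T where T: "open T" "x0 \<in> T" "\<And>x. x \<in> T \<Longrightarrow> F x \<in> V" "smooth_on T (\<lambda>x. \<psi> (F x))"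
    by (rule smooth_intoD[OF F V(1) \<open>F x0 \<in> V\<close>]) (rule that)
  have o: "open (S \<inter> T)" using S T by blast
  have "smooth_on (S \<inter> T) (\<lambda>x. \<psi> (F x))" by (rule smooth_on_subset[OF T(4) o]) blast
  then have "smooth_on (S \<inter> T) (\<lambda>x. \<psi> (G x))"
    by (rule smooth_on_cong[THEN iffD1, rotated]) (simp add: S(3))
  moreover have "G x \<in> V" if "x \<in> S \<inter> T" for x using T(3)[of x] S(3)[of x] that by simp
  ultimately show "\<exists>S. open S \<and> x0 \<in> S \<and> G ` S \<subseteq> V \<and> smooth_on S (\<lambda>x. \<psi> (G x))"
    using o S(2) T(2) by (intro exI[of _ "S \<inter> T"]) auto
qed

lemma smooth_into_chart_inv:
  assumes B: "smooth_manifold B" and U: "(U, \<phi>) \<in> B" "x \<in> \<phi> ` U"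
  shows "smooth_into B (inv_into U \<phi>) x"
proof (rule smooth_intoI[OF B U(1,2)])
  show "inv_into U \<phi> y \<in> U" if "y \<in> \<phi> ` U" for y using that by (rule inv_into_into)
  have "smooth_on (\<phi> ` U) (\<lambda>x. x)" by (rule smooth_on_ident[OF smooth_manifold_open[OF B U(1)]])
  then show "smooth_on (\<phi> ` U) (\<lambda>x. \<phi> (inv_into U \<phi> x))"
    by (rule smooth_on_cong[THEN iffD1, rotated]) (simp add: f_inv_into_f)
qed

lemma smooth_into_precompose:
  assumes F: "smooth_into B F (g x0)" and g: "smooth_on S g" "x0 \<in> S"
  shows "smooth_into B (\<lambda>x. F (g x)) x0"
  unfolding smooth_into_def
proof (intro conjI allI impI)
  show "F (g x0) \<in> points B" by (rule smooth_into_points[OF F])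
  fix V \<psi> assume V: "(V, \<psi>) \<in> B" "F (g x0) \<in> V"
  obtain T where T: "open T" "g x0 \<in> T" "\<And>x. x \<in> T \<Longrightarrow> F x \<in> V" "smooth_on T (\<lambda>x. \<psi> (F x))"
    by (rule smooth_intoD[OF F V]) (rule that)
  let ?S = "S \<inter> g -` T"
  have o: "open ?S"
    by (rule continuous_open_preimage[OF smooth_on_continuous_on[OF g(1)] smooth_on_open[OF g(1)] T(1)])
  have "smooth_on ?S (\<lambda>x. \<psi> (F (g x)))"
    by (rule smooth_on_compose[OF smooth_on_subset[OF g(1) o] T(4)]) auto
  then show "\<exists>S. open S \<and> x0 \<in> S \<and> (\<lambda>x. F (g x)) ` S \<subseteq> V \<and> smooth_on S (\<lambda>x. \<psi> (F (g x)))"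
    using o g(2) T(2,3) by (intro exI[of _ ?S]) auto
qed

lemma smooth_into_compose:
  assumes A: "inj_atlas A" and f: "smooth_map A B f" and F: "smooth_into A F x0"
  shows "smooth_into B (\<lambda>x. f (F x)) x0"
  unfolding smooth_into_def
proof (intro conjI allI impI)
  show "f (F x0) \<in> points B" using f smooth_into_points[OF F] unfolding smooth_map_def by blast
  obtain U \<phi> where U: "(U, \<phi>) \<in> A" "F x0 \<in> U" using points_chart[OF smooth_into_points[OF F]] by blast
  fix V \<psi> assume V: "(V, \<psi>) \<in> B" "f (F x0) \<in> V"
  have "\<forall>(U, \<phi>)\<in>A. \<forall>(V, \<psi>)\<in>B. smooth_on (\<phi> ` (U \<inter> f -` V)) (\<psi> \<circ> f \<circ> inv_into U \<phi>)"
    using f unfolding smooth_map_def by (elim conjE)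
  from bspec[OF this U(1)] have "\<forall>(V, \<psi>)\<in>B. smooth_on (\<phi> ` (U \<inter> f -` V)) (\<psi> \<circ> f \<circ> inv_into U \<phi>)" by simp
  from bspec[OF this V(1)] have sm: "smooth_on (\<phi> ` (U \<inter> f -` V)) (\<lambda>x. \<psi> (f (inv_into U \<phi> x)))" by (simp add: o_def)
  obtain S where S: "open S" "x0 \<in> S" "\<And>x. x \<in> S \<Longrightarrow> F x \<in> U" "smooth_on S (\<lambda>x. \<phi> (F x))"
    by (rule smooth_intoD[OF F U]) (rule that)
  let ?W = "\<phi> ` (U \<inter> f -` V)"
  define T where "T = S \<inter> (\<lambda>x. \<phi> (F x)) -` ?W"
  have oT: "open T" unfolding T_def
    by (rule continuous_open_preimage[OF smooth_on_continuous_on[OF S(4)] S(1) smooth_on_open[OF sm]])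
  have FT: "f (F x) \<in> V" if "x \<in> T" for x
  proof -
    have "F x \<in> U" "\<phi> (F x) \<in> ?W" using that S(3) unfolding T_def by auto
    then obtain q where "q \<in> U" "f q \<in> V" "\<phi> (F x) = \<phi> q" by blast
    then have "F x = q" using A U(1) \<open>F x \<in> U\<close> unfolding inj_atlas_def inj_on_def by blast
    then show ?thesis using \<open>f q \<in> V\<close> by simp
  qed
  have 1: "smooth_on T (\<lambda>x. \<psi> (f (inv_into U \<phi> (\<phi> (F x)))))"
    by (rule smooth_on_compose[OF smooth_on_subset[OF S(4) oT] sm]) (auto simp: T_def)
  have 2: "\<psi> (f (inv_into U \<phi> (\<phi> (F x)))) = \<psi> (f (F x))" if "x \<in> T" for x
    using inj_atlas_inv[OF A U(1), of "F x"] S(3)[of x] that by (simp add: T_def)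
  have 3: "smooth_on T (\<lambda>x. \<psi> (f (F x)))" by (rule smooth_on_cong[THEN iffD1, OF 2 1])
  have "x0 \<in> T" using S(2) U(2) V(2) unfolding T_def by auto
  then show "\<exists>S. open S \<and> x0 \<in> S \<and> (\<lambda>x. f (F x)) ` S \<subseteq> V \<and> smooth_on S (\<lambda>x. \<psi> (f (F x)))"
    using oT FT 3 by (intro exI[of _ T]) auto
qed

lemma points_product: "points (product_atlas A B) = points A \<times> points B"
proof (intro equalityI subsetI)
  fix z assume "z \<in> points A \<times> points B"
  then obtain p q where z: "z = (p, q)" "p \<in> points A" "q \<in> points B" by blast
  obtain U \<phi> where U: "(U, \<phi>) \<in> A" "p \<in> U" using z(2) by (rule points_chart)
  obtain V \<psi> where V: "(V, \<psi>) \<in> B" "q \<in> V" using z(3) by (rule points_chart)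
  have "(U \<times> V, map_prod \<phi> \<psi>) \<in> product_atlas A B" unfolding product_atlas_def using U V by blast
  then show "z \<in> points (product_atlas A B)" by (rule chart_points) (use U V z in simp)
qed (auto simp: points_def product_atlas_def)

lemma inj_atlas_product: "inj_atlas A \<Longrightarrow> inj_atlas B \<Longrightarrow> inj_atlas (product_atlas A B)"
  unfolding inj_atlas_def product_atlas_def by (auto intro: map_prod_inj_on)

lemma smooth_into_Pair:
  assumes F: "smooth_into A F x0" and G: "smooth_into B G x0"
  shows "smooth_into (product_atlas A B) (\<lambda>x. (F x, G x)) x0"
  unfolding smooth_into_def
proof (intro conjI allI impI)
  show "(F x0, G x0) \<in> points (product_atlas A B)"
    using smooth_into_points[OF F] smooth_into_points[OF G] by (simp add: points_product)
  fix W \<xi> assume W: "(W, \<xi>) \<in> product_atlas A B" "(F x0, G x0) \<in> W"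
  obtain U \<phi> V \<psi> where UV: "W = U \<times> V" "\<xi> = map_prod \<phi> \<psi>" "(U, \<phi>) \<in> A" "(V, \<psi>) \<in> B"
    using W(1) unfolding product_atlas_def by blast
  have FU: "F x0 \<in> U" "G x0 \<in> V" using W(2) UV(1) by auto
  obtain S where S: "open S" "x0 \<in> S" "\<And>x. x \<in> S \<Longrightarrow> F x \<in> U" "smooth_on S (\<lambda>x. \<phi> (F x))"
    by (rule smooth_intoD[OF F UV(3) FU(1)]) (rule that)
  obtain T where T: "open T" "x0 \<in> T" "\<And>x. x \<in> T \<Longrightarrow> G x \<in> V" "smooth_on T (\<lambda>x. \<psi> (G x))"
    by (rule smooth_intoD[OF G UV(4) FU(2)]) (rule that)
  have o: "open (S \<inter> T)" using S T by blast
  have "smooth_on (S \<inter> T) (\<lambda>x. (\<phi> (F x), \<psi> (G x)))"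
    by (rule smooth_on_Pair) (auto intro: smooth_on_subset[OF S(4) o] smooth_on_subset[OF T(4) o])
  then show "\<exists>S. open S \<and> x0 \<in> S \<and> (\<lambda>x. (F x, G x)) ` S \<subseteq> W \<and> smooth_on S (\<lambda>x. \<xi> (F x, G x))"
    using o S(2,3) T(2,3) UV by (intro exI[of _ "S \<inter> T"]) auto
qed

lemma smooth_into_compose2:
  assumes "inj_atlas A" "inj_atlas B" "smooth_map (product_atlas A B) C (\<lambda>(x, y). f x y)"
    and "smooth_into A F x0" "smooth_into B G x0"
  shows "smooth_into C (\<lambda>x. f (F x) (G x)) x0"
  using smooth_into_compose[OF inj_atlas_product[OF assms(1,2)] assms(3) smooth_into_Pair[OF assms(4,5)]] by simp

subsection \<open>Differentials\<close>

lemma chart_at: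
  assumes "p \<in> points A" shows "chart_at A p \<in> A" "p \<in> fst (chart_at A p)"
proof -
  obtain U \<phi> where "(U, \<phi>) \<in> A" "p \<in> U" using assms by (rule points_chart)
  then have "\<exists>c. c \<in> A \<and> p \<in> fst c" by (intro exI[of _ "(U, \<phi>)"]) simp
  from someI_ex[OF this] show "chart_at A p \<in> A" "p \<in> fst (chart_at A p)" unfolding chart_at_def by auto
qed

lemma chart_at': "p \<in> points A \<Longrightarrow> (fst (chart_at A p), coord A p) \<in> A"
  using chart_at[of p A] by (simp add: coord_def)

lemma coord_inv_coord:
  assumes "inj_atlas A" "p \<in> points A" shows "coord_inv A p (coord A p p) = p"
  unfolding coord_inv_def using inj_atlas_inv[OF assms(1) chart_at'[OF assms(2)] chart_at(2)[OF assms(2)]] .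

lemma velocity_works:
  assumes "smooth_into B F x0"
  shows "((\<lambda>x. coord B (F x0) (F x)) has_derivative velocity B F x0) (at x0)"
proof -
  note p = smooth_into_points[OF assms]
  obtain S where S: "open S" "x0 \<in> S" "\<And>x. x \<in> S \<Longrightarrow> F x \<in> fst (chart_at B (F x0))" "smooth_on S (\<lambda>x. coord B (F x0) (F x))"
    by (rule smooth_intoD[OF assms chart_at'[OF p] chart_at(2)[OF p]]) (rule that)
  show ?thesis unfolding velocity_def by (rule smooth_on_has_derivative[OF S(4,2)])
qed

lemma linear_velocity: "smooth_into B F x0 \<Longrightarrow> linear (velocity B F x0)"
  using velocity_works has_derivative_linear by blast

lemma velocity_cong:
  assumes "open S" "x0 \<in> S" "\<And>x. x \<in> S \<Longrightarrow> F x = G x"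
  shows "velocity B F x0 = velocity B G x0"
  unfolding velocity_def using assms by (intro frechet_derivative_cong_open[OF assms(1,2)]) simp

lemma velocity_precompose:
  assumes F: "smooth_into B F (g x0)" and g: "(g has_derivative g') (at x0)"
  shows "velocity B (\<lambda>x. F (g x)) x0 h = velocity B F (g x0) (g' h)"
proof -
  have "((\<lambda>x. coord B (F (g x0)) (F (g x))) has_derivative (\<lambda>h. velocity B F (g x0) (g' h))) (at x0)"
    by (rule has_derivative_compose[OF g velocity_works[OF F]])
  from fun_cong[OF frechet_derivative_at[OF this], of h] show ?thesis unfolding velocity_def by simp
qed

lemma smooth_into_coord_inv:
  assumes B: "smooth_manifold B" and p: "p \<in> points B"
  shows "smooth_into B (coord_inv B p) (coord B p p)"
  unfolding coord_inv_def
  by (rule smooth_into_chart_inv[OF B chart_at'[OF p]]) (use chart_at(2)[OF p] in blast)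

lemma mderiv_velocity:
  assumes A: "inj_atlas A" "p \<in> points A"
  shows "mderiv A B f p = velocity B (\<lambda>x. f (coord_inv A p x)) (coord A p p)"
  unfolding mderiv_def velocity_def by (simp add: coord_inv_coord[OF A] o_def)

lemma mderiv_cong:
  assumes A: "smooth_manifold A" and p: "p \<in> points A" and eq: "\<And>x. x \<in> points A \<Longrightarrow> f x = g x"
  shows "mderiv A B f p = mderiv A B g p"
proof -
  obtain S where S: "open S" "coord A p p \<in> S" "\<And>x. x \<in> S \<Longrightarrow> smooth_into A (coord_inv A p) x"
    by (rule smooth_into_nbhd[OF A smooth_into_coord_inv[OF A p]]) (rule that)
  show ?thesis unfolding mderiv_velocity[OF smooth_manifold_inj[OF A] p]
    by (rule velocity_cong[OF S(1,2)]) (rule eq[OF smooth_into_points[OF S(3)]])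
qed

text \<open>Smoothness near one point. Translations and their lifts to frames are shown to be smooth
  only near given points, so the chain rule is formulated with this notion instead of
  \<open>smooth_map\<close>.\<close>

definition smooth_at :: "('p, 'e::euclidean_space) atlas \<Rightarrow> ('q, 'f::euclidean_space) atlas \<Rightarrow> ('p \<Rightarrow> 'q) \<Rightarrow> 'p \<Rightarrow> bool" where
  "smooth_at A B f p \<longleftrightarrow> p \<in> points A \<and> smooth_into B (\<lambda>x. f (coord_inv A p x)) (coord A p p)"

lemma smooth_map_smooth_at:
  assumes "smooth_manifold A" "smooth_map A B f" "p \<in> points A"
  shows "smooth_at A B f p"
  unfolding smooth_at_def
  using smooth_into_compose[OF smooth_manifold_inj[OF assms(1)] assms(2) smooth_into_coord_inv[OF assms(1,3)]] assms(3)
  by simp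

lemma velocity_coord_nbhd:
  assumes A: "inj_atlas A" and F: "smooth_into A F x0"
  obtains S where "open S" "x0 \<in> S" "smooth_on S (\<lambda>x. coord A (F x0) (F x))"
    "\<And>x. x \<in> S \<Longrightarrow> coord_inv A (F x0) (coord A (F x0) (F x)) = F x"
proof -
  note p = smooth_into_points[OF F]
  obtain S where S: "open S" "x0 \<in> S" "\<And>x. x \<in> S \<Longrightarrow> F x \<in> fst (chart_at A (F x0))" "smooth_on S (\<lambda>x. coord A (F x0) (F x))"
    by (rule smooth_intoD[OF F chart_at'[OF p] chart_at(2)[OF p]]) (rule that)
  show ?thesis
    by (rule that[OF S(1,2,4)]) (simp add: coord_inv_def inj_atlas_inv[OF A chart_at'[OF p] S(3)])
qed

lemma smooth_at_compose:
  assumes A: "inj_atlas A" and f: "smooth_at A B f (F x0)" and F: "smooth_into A F x0"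
  shows "smooth_into B (\<lambda>x. f (F x)) x0"
    and "velocity B (\<lambda>x. f (F x)) x0 h = mderiv A B f (F x0) (velocity A F x0 h)"
proof -
  let ?p = "F x0"
  have f': "smooth_into B (\<lambda>x. f (coord_inv A ?p x)) (coord A ?p ?p)" "?p \<in> points A"
    using f unfolding smooth_at_def by auto
  obtain S where S: "open S" "x0 \<in> S" "smooth_on S (\<lambda>x. coord A ?p (F x))"
    "\<And>x. x \<in> S \<Longrightarrow> coord_inv A ?p (coord A ?p (F x)) = F x"
    by (rule velocity_coord_nbhd[OF A F]) (rule that)
  have eq: "f (coord_inv A ?p (coord A ?p (F x))) = f (F x)" if "x \<in> S" for x using S(4)[OF that] by simp
  have "smooth_into B (\<lambda>x. f (coord_inv A ?p (coord A ?p (F x)))) x0"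
    using smooth_into_precompose[where F = "\<lambda>x. f (coord_inv A ?p x)" and g = "\<lambda>x. coord A ?p (F x)", OF f'(1) S(3,2)] .
  then show "smooth_into B (\<lambda>x. f (F x)) x0" by (rule smooth_into_cong[OF _ S(1,2) eq])
  have "velocity B (\<lambda>x. f (F x)) x0 h = velocity B (\<lambda>x. f (coord_inv A ?p (coord A ?p (F x)))) x0 h"
    using velocity_cong[OF S(1,2) eq, where B = B] by simp
  also have "\<dots> = velocity B (\<lambda>x. f (coord_inv A ?p x)) (coord A ?p ?p) (velocity A F x0 h)"
    using velocity_precompose[where F = "\<lambda>x. f (coord_inv A ?p x)" and g = "\<lambda>x. coord A ?p (F x)", OF f'(1) velocity_works[OF F]] .
  also have "\<dots> = mderiv A B f ?p (velocity A F x0 h)" unfolding mderiv_velocity[OF A f'(2)] ..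
  finally show "velocity B (\<lambda>x. f (F x)) x0 h = mderiv A B f (F x0) (velocity A F x0 h)" .
qed

lemma smooth_at_comp:
  assumes A: "inj_atlas A" and B: "inj_atlas B" and f: "smooth_at A B f p" and g: "smooth_at B C g (f p)"
  shows "smooth_at A C (\<lambda>x. g (f x)) p" and "mderiv A C (\<lambda>x. g (f x)) p h = mderiv B C g (f p) (mderiv A B f p h)"
proof -
  have p: "p \<in> points A" "smooth_into B (\<lambda>x. f (coord_inv A p x)) (coord A p p)" using f unfolding smooth_at_def by auto
  have g': "smooth_at B C g (f (coord_inv A p (coord A p p)))" using g by (simp add: coord_inv_coord[OF A p(1)])
  note c = smooth_at_compose[where F = "\<lambda>x. f (coord_inv A p x)", OF B g' p(2)]
  show "smooth_at A C (\<lambda>x. g (f x)) p" unfolding smooth_at_def using p(1) c(1) by simp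
  show "mderiv A C (\<lambda>x. g (f x)) p h = mderiv B C g (f p) (mderiv A B f p h)"
    unfolding mderiv_velocity[OF A p(1)] c(2) by (simp add: coord_inv_coord[OF A p(1)])
qed

lemma linear_mderiv:
  assumes "inj_atlas A" "smooth_at A B f p" shows "linear (mderiv A B f p)"
proof -
  have p: "p \<in> points A" "smooth_into B (\<lambda>x. f (coord_inv A p x)) (coord A p p)" using assms(2) unfolding smooth_at_def by auto
  show ?thesis unfolding mderiv_velocity[OF assms(1) p(1)] by (rule linear_velocity[OF p(2)])
qed

lemma velocity_coord_inv:
  assumes B: "smooth_manifold B" and p: "p \<in> points B"
  shows "velocity B (coord_inv B p) (coord B p p) h = h"
proof -
  note ch = chart_at'[OF p]
  have "((\<lambda>x. coord B p (coord_inv B p x)) has_derivative (\<lambda>h. h)) (at (coord B p p))"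
  proof (rule has_derivative_transform_within_open[OF has_derivative_ident smooth_manifold_open[OF B ch]])
    show "coord B p p \<in> coord B p ` fst (chart_at B p)" using chart_at(2)[OF p] by blast
    show "x = coord B p (coord_inv B p x)" if "x \<in> coord B p ` fst (chart_at B p)" for x
      unfolding coord_inv_def using f_inv_into_f[OF that] by simp
  qed
  from fun_cong[OF frechet_derivative_at[OF this], of h] show ?thesis
    unfolding velocity_def coord_inv_coord[OF smooth_manifold_inj[OF B] p] by simp
qed

lemma chart_derivative:
  assumes B: "smooth_manifold B" and V: "(V, \<psi>) \<in> B" "F x0 \<in> V" and F: "smooth_into B F x0"
  shows "((\<lambda>x. \<psi> (F x)) has_derivative (\<lambda>h. chart_diff B \<psi> (F x0) (velocity B F x0 h))) (at x0)"
proof -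
  let ?p = "F x0"
  have p: "?p \<in> points B" by (rule smooth_into_points[OF F])
  obtain T where T: "open T" "coord B ?p ?p \<in> T" "\<And>x. x \<in> T \<Longrightarrow> coord_inv B ?p x \<in> V" "smooth_on T (\<lambda>x. \<psi> (coord_inv B ?p x))"
    by (rule smooth_intoD[OF smooth_into_coord_inv[OF B p] V(1)]) (simp add: coord_inv_coord[OF smooth_manifold_inj[OF B] p] V(2), rule that)
  have cd: "((\<lambda>x. \<psi> (coord_inv B ?p x)) has_derivative chart_diff B \<psi> ?p) (at (coord B ?p ?p))"
    unfolding chart_diff_def o_def by (rule smooth_on_has_derivative[OF T(4,2)])
  obtain S where S: "open S" "x0 \<in> S" "smooth_on S (\<lambda>x. coord B ?p (F x))"
    "\<And>x. x \<in> S \<Longrightarrow> coord_inv B ?p (coord B ?p (F x)) = F x"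
    by (rule velocity_coord_nbhd[OF smooth_manifold_inj[OF B] F]) (rule that)
  from has_derivative_compose[OF velocity_works[OF F] cd]
  have "((\<lambda>x. \<psi> (coord_inv B ?p (coord B ?p (F x)))) has_derivative (\<lambda>h. chart_diff B \<psi> ?p (velocity B F x0 h))) (at x0)" .
  then show ?thesis by (rule has_derivative_transform_within_open[OF _ S(1,2)]) (simp add: S(4))
qed

lemma chart_diff_inverse:
  assumes B: "smooth_manifold B" and V: "(V, \<psi>) \<in> B" "p \<in> V"
  shows "velocity B (inv_into V \<psi>) (\<psi> p) (chart_diff B \<psi> p h) = h" and "linear (chart_diff B \<psi> p)"
    and "chart_diff B \<psi> p (velocity B (inv_into V \<psi>) (\<psi> p) h) = h"
proof -
  have p: "p \<in> points B" by (rule chart_points[OF V])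
  have inv: "inv_into V \<psi> (\<psi> p) = p" by (rule inj_atlas_inv[OF smooth_manifold_inj[OF B] V])
  have si: "smooth_into B (inv_into V \<psi>) (\<psi> p)" by (rule smooth_into_chart_inv[OF B V(1)]) (use V(2) in blast)
  have ci: "coord_inv B p (coord B p p) = p" by (rule coord_inv_coord[OF smooth_manifold_inj[OF B] p])
  note sc = smooth_into_coord_inv[OF B p]
  have cdd: "((\<lambda>x. \<psi> (coord_inv B p x)) has_derivative (\<lambda>h. chart_diff B \<psi> p h)) (at (coord B p p))"
    using chart_derivative[OF B V(1) _ sc] V(2) unfolding ci velocity_coord_inv[OF B p] by simp
  show "linear (chart_diff B \<psi> p)" using has_derivative_linear[OF cdd] by simp
  obtain T where T: "open T" "coord B p p \<in> T" "\<And>x. x \<in> T \<Longrightarrow> coord_inv B p x \<in> V" "smooth_on T (\<lambda>x. \<psi> (coord_inv B p x))"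
    by (rule smooth_intoD[OF sc V(1)]) (simp add: ci V(2), rule that)
  have eq: "inv_into V \<psi> (\<psi> (coord_inv B p x)) = coord_inv B p x" if "x \<in> T" for x
    by (rule inj_atlas_inv[OF smooth_manifold_inj[OF B] V(1) T(3)[OF that]])
  have "h = velocity B (coord_inv B p) (coord B p p) h" by (simp add: velocity_coord_inv[OF B p])
  also have "\<dots> = velocity B (\<lambda>x. inv_into V \<psi> (\<psi> (coord_inv B p x))) (coord B p p) h"
    using velocity_cong[OF T(1,2) eq, where B = B] by simp
  also have "\<dots> = velocity B (inv_into V \<psi>) (\<psi> p) (chart_diff B \<psi> p h)"
    using velocity_precompose[where F = "inv_into V \<psi>" and g = "\<lambda>x. \<psi> (coord_inv B p x)" and ?x0.0 = "coord B p p", unfolded ci, OF si cdd] .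
  finally show "velocity B (inv_into V \<psi>) (\<psi> p) (chart_diff B \<psi> p h) = h" by simp
  have "((\<lambda>x. \<psi> (inv_into V \<psi> x)) has_derivative (\<lambda>h. chart_diff B \<psi> p (velocity B (inv_into V \<psi>) (\<psi> p) h))) (at (\<psi> p))"
    using chart_derivative[OF B V(1) _ si] V(2) unfolding inv by simp
  moreover have "((\<lambda>x. \<psi> (inv_into V \<psi> x)) has_derivative (\<lambda>h. h)) (at (\<psi> p))"
    by (rule has_derivative_transform_within_open[OF has_derivative_ident smooth_manifold_open[OF B V(1)]])
      (use V(2) in \<open>auto simp: f_inv_into_f\<close>)
  ultimately have "(\<lambda>h. chart_diff B \<psi> p (velocity B (inv_into V \<psi>) (\<psi> p) h)) = (\<lambda>h. h)" by (rule has_derivative_unique)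
  then show "chart_diff B \<psi> p (velocity B (inv_into V \<psi>) (\<psi> p) h) = h" by (rule fun_cong)
qed

text \<open>Links the two ways in which a form is evaluated: through chart coefficients, by which
  the exterior derivative is defined, and on velocities, by which invariance is expressed.\<close>

lemma form_in_chart_velocity:
  assumes P: "smooth_manifold P" and U: "(U, \<phi>) \<in> P" "F x0 \<in> U" and F: "smooth_into P F x0"
    and D: "((\<lambda>x. \<phi> (F x)) has_derivative D) (at x0)"
  shows "form_in_chart P U \<phi> \<omega> (\<phi> (F x0)) (D h) = \<omega> (F x0) (velocity P F x0 h)"
proof -
  let ?p = "F x0"
  have inv: "inv_into U \<phi> (\<phi> ?p) = ?p" by (rule inj_atlas_inv[OF smooth_manifold_inj[OF P] U])
  have "D h = chart_diff P \<phi> ?p (velocity P F x0 h)"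
    using fun_cong[OF has_derivative_unique[OF D chart_derivative[OF P U F]]] .
  then have "velocity P (inv_into U \<phi>) (\<phi> ?p) (D h) = velocity P F x0 h"
    using chart_diff_inverse(1)[OF P U] by simp
  then show ?thesis unfolding form_in_chart_def velocity_def inv Let_def o_def by simp
qed

text \<open>A product rule for a varying linear map applied to a varying vector, where
  \<open>M\<close> is only known to be differentiable at each fixed vector; expansion in the basis
  leaves finitely many of these.\<close>

lemma has_derivative_family:
  fixes M :: "'a::euclidean_space \<Rightarrow> 'b::euclidean_space \<Rightarrow> 'c::euclidean_space"
  assumes S: "open S" "x0 \<in> S" and lin: "\<And>x. x \<in> S \<Longrightarrow> linear (M x)"
    and M': "\<And>v. ((\<lambda>x. M x v) has_derivative (\<lambda>h. M' h v)) (at x0)" and u: "(u has_derivative u') (at x0)"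
  shows "((\<lambda>x. M x (u x)) has_derivative (\<lambda>h. M x0 (u' h) + M' h (u x0))) (at x0)"
proof -
  have 1: "((\<lambda>x. \<Sum>b\<in>Basis. (w x \<bullet> b) *\<^sub>R M x b) has_derivative
      (\<lambda>h. \<Sum>b\<in>Basis. (w x0 \<bullet> b) *\<^sub>R M' h b + (w' h \<bullet> b) *\<^sub>R M x0 b)) (at x0)"
    if "(w has_derivative w') (at x0)" for w w'
    by (intro has_derivative_sum has_derivative_scaleR has_derivative_inner_left that M')
  have 2: "(\<Sum>b\<in>Basis. (w x \<bullet> b) *\<^sub>R M x b) = M x (w x)" if "x \<in> S" for x and w :: "'a \<Rightarrow> 'b"
    using linear_basis_sum[OF lin[OF that], of "w x"] by simp
  have 3: "((\<lambda>x. M x (w x)) has_derivative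
      (\<lambda>h. \<Sum>b\<in>Basis. (w x0 \<bullet> b) *\<^sub>R M' h b + (w' h \<bullet> b) *\<^sub>R M x0 b)) (at x0)"
    if "(w has_derivative w') (at x0)" for w w'
    by (rule has_derivative_transform_within_open[OF 1[OF that] S]) (rule 2)
  have "((\<lambda>x. M x (u x0)) has_derivative (\<lambda>h. \<Sum>b\<in>Basis. (u x0 \<bullet> b) *\<^sub>R M' h b + (0 \<bullet> b) *\<^sub>R M x0 b)) (at x0)"
    by (rule 3[OF has_derivative_const])
  note e = has_derivative_unique[OF M'[of "u x0"] this]
  have M'u: "M' h (u x0) = (\<Sum>b\<in>Basis. (u x0 \<bullet> b) *\<^sub>R M' h b)" for h
    using fun_cong[OF e, of h] by simp
  have "((\<lambda>x. M x (u x)) has_derivative (\<lambda>h. \<Sum>b\<in>Basis. (u x0 \<bullet> b) *\<^sub>R M' h b + (u' h \<bullet> b) *\<^sub>R M x0 b)) (at x0)"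
    by (rule 3[OF u])
  moreover have "(\<lambda>h. \<Sum>b\<in>Basis. (u x0 \<bullet> b) *\<^sub>R M' h b + (u' h \<bullet> b) *\<^sub>R M x0 b) = (\<lambda>h. M x0 (u' h) + M' h (u x0))"
  proof
    fix h
    show "(\<Sum>b\<in>Basis. (u x0 \<bullet> b) *\<^sub>R M' h b + (u' h \<bullet> b) *\<^sub>R M x0 b) = M x0 (u' h) + M' h (u x0)"
      unfolding sum.distrib M'u[symmetric] linear_basis_sum[OF lin[OF S(2)], symmetric] by (rule add.commute)
  qed
  ultimately show ?thesis by simp
qed

subsection \<open>The Lie algebra of a Lie group\<close>

locale lie_grp = group K for K :: "'k monoid" (structure) +
  fixes A :: "('k, 'e::euclidean_space) atlas"
  assumes lg: "lie_group K A"
begin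

lemma manifold: "smooth_manifold A" and points: "points A = carrier K"
  and mult_smooth: "smooth_map (product_atlas A A) A (\<lambda>(x, y). x \<otimes> y)" and inv_smooth: "smooth_map A A (\<lambda>x. inv x)"
  using lg unfolding lie_group_def by auto

lemma inj: "inj_atlas A" by (rule smooth_manifold_inj[OF manifold])

text \<open>The chosen chart sends the identity to \<open>e0\<close>, which need not be the origin,
  and \<open>\<kappa>\<close> parametrizes the group near the identity.\<close>

abbreviation "e0 \<equiv> coord A \<one> \<one>"
abbreviation "\<kappa> \<equiv> coord_inv A \<one>"

lemma one_points: "\<one> \<in> points A" by (simp add: points)
lemma \<kappa>_e0: "\<kappa> e0 = \<one>" by (rule coord_inv_coord[OF inj one_points])
lemma smooth_\<kappa>: "smooth_into A \<kappa> e0" by (rule smooth_into_coord_inv[OF manifold one_points])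
lemma velocity_\<kappa>: "velocity A \<kappa> e0 h = h" by (rule velocity_coord_inv[OF manifold one_points])

lemma smooth_into_carrier: "smooth_into A F x \<Longrightarrow> F x \<in> carrier K"
  using smooth_into_points points by blast

lemma smooth_into_mult: "smooth_into A F x \<Longrightarrow> smooth_into A G x \<Longrightarrow> smooth_into A (\<lambda>x. F x \<otimes> G x) x"
  by (rule smooth_into_compose2[OF inj inj mult_smooth])
lemma smooth_into_inv: "smooth_into A F x \<Longrightarrow> smooth_into A (\<lambda>x. inv (F x)) x"
  by (rule smooth_into_compose[OF inj inv_smooth])

lemma smooth_into_const:
  assumes "a \<in> carrier K" shows "smooth_into A (\<lambda>x. a) x0"
proof -
  have "a \<in> points A" using assms points by simp
  then obtain U \<phi> where "(U, \<phi>) \<in> A" "a \<in> U" by (rule points_chart)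
  then show ?thesis using smooth_intoI[OF manifold, of U \<phi> x0 UNIV "\<lambda>x. a"] by (simp add: smooth_on_const)
qed

lemma conj_smooth_at:
  assumes "a \<in> carrier K" shows "smooth_at A A (\<lambda>x. a \<otimes> x \<otimes> inv a) \<one>"
  unfolding smooth_at_def using one_points
  by (intro conjI smooth_into_mult smooth_into_const smooth_\<kappa>) (use assms in simp_all)

lemma Ad_velocity: "Ad K A a = velocity A (\<lambda>y. a \<otimes> \<kappa> y \<otimes> inv a) e0"
  unfolding Ad_def mderiv_velocity[OF inj one_points] ..

lemma linear_Ad: "a \<in> carrier K \<Longrightarrow> linear (Ad K A a)"
  unfolding Ad_def by (rule linear_mderiv[OF inj conj_smooth_at])

lemma conj_one: "a \<in> carrier K \<Longrightarrow> a \<otimes> \<one> \<otimes> inv a = \<one>" by simp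

lemma Ad_mult:
  assumes a: "a \<in> carrier K" and b: "b \<in> carrier K"
  shows "Ad K A (a \<otimes> b) Y = Ad K A a (Ad K A b Y)"
proof -
  have 1: "smooth_at A A (\<lambda>x. a \<otimes> x \<otimes> inv a) (b \<otimes> \<one> \<otimes> inv b)" using conj_smooth_at[OF a] b by simp
  have eq: "(a \<otimes> b) \<otimes> x \<otimes> inv (a \<otimes> b) = a \<otimes> (b \<otimes> x \<otimes> inv b) \<otimes> inv a" if "x \<in> points A" for x
    using that a b by (simp add: points inv_mult_group m_assoc)
  have "Ad K A (a \<otimes> b) Y = mderiv A A (\<lambda>x. a \<otimes> (b \<otimes> x \<otimes> inv b) \<otimes> inv a) \<one> Y"
    unfolding Ad_def using mderiv_cong[OF manifold one_points eq, where B = A] by simp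
  also have "\<dots> = mderiv A A (\<lambda>x. a \<otimes> x \<otimes> inv a) (b \<otimes> \<one> \<otimes> inv b) (mderiv A A (\<lambda>x. b \<otimes> x \<otimes> inv b) \<one> Y)"
    by (rule smooth_at_comp(2)[OF inj inj conj_smooth_at[OF b] 1])
  finally show ?thesis unfolding Ad_def conj_one[OF b] .
qed

lemma Ad_one: "Ad K A \<one> Y = Y"
proof -
  have "Ad K A \<one> = mderiv A A (\<lambda>x. x) \<one>"
    unfolding Ad_def by (rule mderiv_cong[OF manifold one_points]) (simp add: points)
  then show ?thesis by (simp add: mderiv_velocity[OF inj one_points] velocity_\<kappa>)
qed

lemma inj_Ad:
  assumes a: "a \<in> carrier K" shows "inj (Ad K A a)"
proof (rule inj_on_inverseI)
  fix Y show "Ad K A (inv a) (Ad K A a Y) = Y"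
    using Ad_mult[of "inv a" a Y] a by (simp add: Ad_one)
qed

lemma smooth_\<kappa>_fst: "smooth_into A (\<lambda>z::'e \<times> 'e. \<kappa> (fst z)) (e0, e0)"
  by (rule smooth_into_precompose[where g = fst and S = UNIV]) (simp_all add: smooth_\<kappa> smooth_on_fst smooth_on_ident)
lemma smooth_\<kappa>_snd: "smooth_into A (\<lambda>z::'e \<times> 'e. \<kappa> (snd z)) (e0, e0)"
  by (rule smooth_into_precompose[where g = snd and S = UNIV]) (simp_all add: smooth_\<kappa> smooth_on_snd smooth_on_ident)

lemma chart_one:
  assumes F: "smooth_into A F x0" "F x0 = \<one>"
  obtains S where "open S" "x0 \<in> S" "smooth_on S (\<lambda>x. coord A \<one> (F x))" "\<And>x. x \<in> S \<Longrightarrow> \<kappa> (coord A \<one> (F x)) = F x"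
    "\<And>x. x \<in> S \<Longrightarrow> F x \<in> carrier K"
proof -
  obtain S where S: "open S" "x0 \<in> S" "smooth_on S (\<lambda>x. coord A (F x0) (F x))"
    "\<And>x. x \<in> S \<Longrightarrow> coord_inv A (F x0) (coord A (F x0) (F x)) = F x"
    by (rule velocity_coord_nbhd[OF inj F(1)]) (rule that)
  obtain T where T: "open T" "x0 \<in> T" "\<And>x. x \<in> T \<Longrightarrow> smooth_into A F x"
    by (rule smooth_into_nbhd[OF manifold F(1)]) (rule that)
  have o: "open (S \<inter> T)" using S T by blast
  show ?thesis
  proof (rule that[OF o])
    show "smooth_on (S \<inter> T) (\<lambda>x. coord A \<one> (F x))" using smooth_on_subset[OF S(3) o] unfolding F(2) by blast
  qed (use S(2,4) T(2) smooth_into_carrier[OF T(3)] F(2) in auto)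
qed

text \<open>Conjugation is smooth in both variables jointly, and in the chart at the identity
  \<open>Ad (\<kappa> x) Y\<close> is its partial derivative at \<open>(x, e0)\<close> in direction
  \<open>(0, Y)\<close>.\<close>

lemma Ad_smooth:
  obtains S where "open S" "e0 \<in> S" "\<And>x. x \<in> S \<Longrightarrow> \<kappa> x \<in> carrier K" "\<And>Y. smooth_on S (\<lambda>x. Ad K A (\<kappa> x) Y)"
    "\<And>x. x \<in> S \<Longrightarrow> coord A \<one> (\<kappa> x) = x"
proof -
  define F where "F z = \<kappa> (fst z) \<otimes> \<kappa> (snd z) \<otimes> inv (\<kappa> (fst z))" for z
  have F: "smooth_into A F (e0, e0)" unfolding F_def[abs_def]
    by (intro smooth_into_mult smooth_into_inv smooth_\<kappa>_fst smooth_\<kappa>_snd)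
  obtain T where T: "open T" "(e0, e0) \<in> T" "smooth_on T (\<lambda>x. coord A \<one> (F x))"
    by (rule chart_one[OF F]) (simp add: F_def \<kappa>_e0, rule that)
  obtain S1 where S1: "open S1" "e0 \<in> S1" "\<And>x. x \<in> S1 \<Longrightarrow> smooth_into A \<kappa> x"
    by (rule smooth_into_nbhd[OF manifold smooth_\<kappa>]) (rule that)
  let ?O = "coord A \<one> ` fst (chart_at A \<one>)"
  have oO: "open ?O" by (rule smooth_manifold_open[OF manifold chart_at'[OF one_points]])
  have e0O: "e0 \<in> ?O" using chart_at(2)[OF one_points] by blast
  define S where "S = S1 \<inter> ?O \<inter> (\<lambda>x. (x, e0)) -` T"
  have "open ((\<lambda>x. (x, e0)) -` T)" by (rule open_vimage[OF T(1)]) (intro continuous_intros)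
  then have oS: "open S" unfolding S_def using S1(1) oO by (simp add: open_Int)
  show ?thesis
  proof (rule that[OF oS])
    show "e0 \<in> S" using S1(2) e0O T(2) by (simp add: S_def)
    show c: "\<kappa> x \<in> carrier K" if "x \<in> S" for x using smooth_into_carrier[OF S1(3)] that by (simp add: S_def)
    show "coord A \<one> (\<kappa> x) = x" if "x \<in> S" for x
      unfolding coord_inv_def using that by (simp add: S_def f_inv_into_f)
    fix Y
    let ?c = "\<lambda>z. coord A \<one> (F z)"
    have 1: "smooth_on S (\<lambda>x. frechet_derivative ?c (at (x, e0)) (0, Y))"
      by (rule smooth_on_frechet_derivative_comp[OF T(3) smooth_on_Pair[OF smooth_on_ident[OF oS] smooth_on_const[OF oS]]
            _ smooth_on_const[OF oS]]) (auto simp: S_def)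
    have 2: "frechet_derivative ?c (at (x, e0)) (0, Y) = Ad K A (\<kappa> x) Y" if "x \<in> S" for x
    proof -
      have "(x, e0) \<in> T" using that by (simp add: S_def)
      from has_derivative_partial_snd[OF T(3) this]
      have d: "((\<lambda>y. coord A \<one> (\<kappa> x \<otimes> \<kappa> y \<otimes> inv (\<kappa> x))) has_derivative (\<lambda>v. frechet_derivative ?c (at (x, e0)) (0, v))) (at e0)"
        by (simp add: F_def)
      have e: "\<kappa> x \<otimes> \<kappa> e0 \<otimes> inv (\<kappa> x) = \<one>" using c[OF that] by (simp add: \<kappa>_e0)
      show ?thesis unfolding Ad_velocity velocity_def e using fun_cong[OF frechet_derivative_at[OF d], of Y] .
    qed
    show "smooth_on S (\<lambda>x. Ad K A (\<kappa> x) Y)" by (rule smooth_on_cong[THEN iffD1, OF 2 1])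
  qed
qed

abbreviation "br \<equiv> lie_bracket K A"

lemma bracket_derivative: "((\<lambda>x. Ad K A (\<kappa> x) Y) has_derivative (\<lambda>X. br X Y)) (at e0)"
proof -
  obtain S where S: "open S" "e0 \<in> S" "\<And>Y. smooth_on S (\<lambda>x. Ad K A (\<kappa> x) Y)" by (rule Ad_smooth) (rule that)
  have "coord vector_space_atlas q = (\<lambda>x. x)" for q :: 'e
    using chart_at'[of q vector_space_atlas] unfolding vector_space_atlas_def points_def by auto
  then have "br X Y = frechet_derivative (\<lambda>x. Ad K A (\<kappa> x) Y) (at e0) X" for X
    unfolding lie_bracket_def mderiv_def by (simp add: o_def)
  then show ?thesis using smooth_on_has_derivative[OF S(3) S(2), of Y] by simp
qed

lemma bracket_derivative_curve:
  assumes F: "smooth_into A F x0" "F x0 = \<one>"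
  shows "((\<lambda>x. Ad K A (F x) Y) has_derivative (\<lambda>h. br (velocity A F x0 h) Y)) (at x0)"
proof -
  obtain S where S: "open S" "x0 \<in> S" "\<And>x. x \<in> S \<Longrightarrow> \<kappa> (coord A \<one> (F x)) = F x"
    by (rule chart_one[OF F]) (rule that)
  have a: "((\<lambda>x. coord A \<one> (F x)) has_derivative velocity A F x0) (at x0)"
    using velocity_works[OF F(1)] unfolding F(2) .
  have b: "((\<lambda>x. Ad K A (\<kappa> x) Y) has_derivative (\<lambda>X. br X Y)) (at (coord A \<one> (F x0)))"
    unfolding F(2) by (rule bracket_derivative)
  have "((\<lambda>x. Ad K A (\<kappa> (coord A \<one> (F x))) Y) has_derivative (\<lambda>h. br (velocity A F x0 h) Y)) (at x0)"
    by (rule has_derivative_compose[OF a b])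
  then show ?thesis by (rule has_derivative_transform_within_open[OF _ S(1,2)]) (simp add: S(3))
qed

lemma bilinear_bracket: "bilinear br"
  unfolding bilinear_def
proof (intro conjI allI)
  show "linear (\<lambda>X. br X Y)" for Y using has_derivative_linear[OF bracket_derivative] .
  obtain S where S: "open S" "e0 \<in> S" "\<And>x. x \<in> S \<Longrightarrow> \<kappa> x \<in> carrier K" by (rule Ad_smooth) (rule that)
  note lin = linear_Ad[OF S(3)]
  show "linear (br X)" for X
  proof (rule linearI)
    fix Y Z
    have "((\<lambda>x. Ad K A (\<kappa> x) Y + Ad K A (\<kappa> x) Z) has_derivative (\<lambda>X. br X Y + br X Z)) (at e0)"
      by (intro has_derivative_add bracket_derivative)
    then have "((\<lambda>x. Ad K A (\<kappa> x) (Y + Z)) has_derivative (\<lambda>X. br X Y + br X Z)) (at e0)"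
      by (rule has_derivative_transform_within_open[OF _ S(1,2)]) (simp add: linear_add[OF lin])
    from fun_cong[OF has_derivative_unique[OF bracket_derivative this]] show "br X (Y + Z) = br X Y + br X Z" .
  next
    fix c Y
    have "((\<lambda>x. c *\<^sub>R Ad K A (\<kappa> x) Y) has_derivative (\<lambda>X. c *\<^sub>R br X Y)) (at e0)"
      by (intro has_derivative_scaleR_right bracket_derivative)
    then have "((\<lambda>x. Ad K A (\<kappa> x) (c *\<^sub>R Y)) has_derivative (\<lambda>X. c *\<^sub>R br X Y)) (at e0)"
      by (rule has_derivative_transform_within_open[OF _ S(1,2)]) (simp add: linear_cmul[OF lin])
    from fun_cong[OF has_derivative_unique[OF bracket_derivative this]] show "br X (c *\<^sub>R Y) = c *\<^sub>R br X Y" .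
  qed
qed

text \<open>Derivative in \<open>a\<close> at the identity of the relation
  \<open>Ad g (Ad a Y) = Ad (g a g^-1) (Ad g Y)\<close>.\<close>

lemma Ad_bracket:
  assumes g: "g \<in> carrier K" shows "Ad K A g (br X Y) = br (Ad K A g X) (Ad K A g Y)"
proof -
  let ?F = "\<lambda>x. g \<otimes> \<kappa> x \<otimes> inv g"
  obtain S where S: "open S" "e0 \<in> S" "\<And>x. x \<in> S \<Longrightarrow> \<kappa> x \<in> carrier K" by (rule Ad_smooth) (rule that)
  have F: "smooth_into A ?F e0" "?F e0 = \<one>"
    using conj_smooth_at[OF g] g unfolding smooth_at_def by (simp_all add: \<kappa>_e0)
  have 1: "((\<lambda>x. Ad K A (?F x) (Ad K A g Y)) has_derivative (\<lambda>X. br (Ad K A g X) (Ad K A g Y))) (at e0)"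
    using bracket_derivative_curve[OF F] unfolding Ad_velocity[symmetric] .
  have "bounded_linear (Ad K A g)" using linear_Ad[OF g] by (simp add: linear_conv_bounded_linear)
  then have "((\<lambda>x. Ad K A g (Ad K A (\<kappa> x) Y)) has_derivative (\<lambda>X. Ad K A g (br X Y))) (at e0)"
    by (rule bounded_linear.has_derivative[OF _ bracket_derivative])
  moreover have "Ad K A g (Ad K A (\<kappa> x) Y) = Ad K A (?F x) (Ad K A g Y)" if "x \<in> S" for x
    using g S(3)[OF that] by (simp add: Ad_mult Ad_mult[of "inv g" g, symmetric] Ad_one)
  ultimately have "((\<lambda>x. Ad K A (?F x) (Ad K A g Y)) has_derivative (\<lambda>X. Ad K A g (br X Y))) (at e0)"
    by (rule has_derivative_transform_within_open[OF _ S(1,2)])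
  from fun_cong[OF has_derivative_unique[OF this 1]] show ?thesis .
qed

text \<open>Derivative in \<open>a\<close> at the identity of the relation
  \<open>Ad a [Y, Z] = [Ad a Y, Ad a Z]\<close>.\<close>

lemma jacobi_bracket: "br X (br Y Z) = br (br X Y) Z + br Y (br X Z)"
proof -
  obtain S where S: "open S" "e0 \<in> S" "\<And>x. x \<in> S \<Longrightarrow> \<kappa> x \<in> carrier K" by (rule Ad_smooth) (rule that)
  have bb: "bounded_bilinear br" using bilinear_bracket by (simp add: bilinear_conv_bounded_bilinear)
  have "((\<lambda>x. br (Ad K A (\<kappa> x) Y) (Ad K A (\<kappa> x) Z)) has_derivative
      (\<lambda>X. br (Ad K A (\<kappa> e0) Y) (br X Z) + br (br X Y) (Ad K A (\<kappa> e0) Z))) (at e0)"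
    by (rule bounded_bilinear.FDERIV[OF bb bracket_derivative bracket_derivative])
  then have "((\<lambda>x. Ad K A (\<kappa> x) (br Y Z)) has_derivative
      (\<lambda>X. br (Ad K A (\<kappa> e0) Y) (br X Z) + br (br X Y) (Ad K A (\<kappa> e0) Z))) (at e0)"
    by (rule has_derivative_transform_within_open[OF _ S(1,2)]) (simp add: Ad_bracket[OF S(3)])
  from fun_cong[OF has_derivative_unique[OF bracket_derivative this], of X] show ?thesis
    by (simp add: \<kappa>_e0 Ad_one add.commute)
qed

text \<open>With \<open>\<mu>\<close> the multiplication in the chart at the identity, differentiating
  \<open>\<mu> (x y x\<^sup>-\<^sup>1, x) = \<mu> (x, y)\<close> gives the bracket as the antisymmetrized mixed derivative of \<open>\<mu>\<close>.\<close>

definition \<mu> :: "'e \<times> 'e \<Rightarrow> 'e" where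
  "\<mu> z = coord A \<one> (\<kappa> (fst z) \<otimes> \<kappa> (snd z))"

definition mixed :: "'e \<Rightarrow> 'e \<Rightarrow> 'e" where
  "mixed X Y = frechet_derivative (\<lambda>z. frechet_derivative \<mu> (at z) (0, Y)) (at (e0, e0)) (X, 0)"

lemma \<mu>_smooth:
  obtains S where "open S" "(e0, e0) \<in> S" "smooth_on S \<mu>" "\<And>z. z \<in> S \<Longrightarrow> \<kappa> (\<mu> z) = \<kappa> (fst z) \<otimes> \<kappa> (snd z)"
proof -
  have F: "smooth_into A (\<lambda>z. \<kappa> (fst z) \<otimes> \<kappa> (snd z)) (e0, e0)"
    by (intro smooth_into_mult smooth_\<kappa>_fst smooth_\<kappa>_snd)
  obtain S where S: "open S" "(e0, e0) \<in> S" "smooth_on S (\<lambda>z. coord A \<one> (\<kappa> (fst z) \<otimes> \<kappa> (snd z)))"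
    "\<And>z. z \<in> S \<Longrightarrow> \<kappa> (coord A \<one> (\<kappa> (fst z) \<otimes> \<kappa> (snd z))) = \<kappa> (fst z) \<otimes> \<kappa> (snd z)"
    by (rule chart_one[OF F]) (simp add: \<kappa>_e0, rule that)
  show ?thesis by (rule that[OF S(1,2)]) (simp_all add: \<mu>_def[abs_def] S(3,4))
qed

lemma \<mu>_partial:
  "((\<lambda>x. \<mu> (x, e0)) has_derivative (\<lambda>h. h)) (at e0)" "((\<lambda>y. \<mu> (e0, y)) has_derivative (\<lambda>h. h)) (at e0)"
proof -
  obtain S where S: "open S" "e0 \<in> S" "\<And>x. x \<in> S \<Longrightarrow> \<kappa> x \<in> carrier K" "\<And>x. x \<in> S \<Longrightarrow> coord A \<one> (\<kappa> x) = x"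
    by (rule Ad_smooth) (rule that)
  show "((\<lambda>x. \<mu> (x, e0)) has_derivative (\<lambda>h. h)) (at e0)"
    by (rule has_derivative_transform_within_open[OF has_derivative_ident S(1,2)])
      (simp add: \<mu>_def \<kappa>_e0 S(3,4))
  show "((\<lambda>y. \<mu> (e0, y)) has_derivative (\<lambda>h. h)) (at e0)"
    by (rule has_derivative_transform_within_open[OF has_derivative_ident S(1,2)])
      (simp add: \<mu>_def \<kappa>_e0 S(3,4))
qed

lemma bracket_mixed: "br X Y = mixed X Y - mixed Y X"
proof -
  obtain T where T: "open T" "(e0, e0) \<in> T" "smooth_on T \<mu>" by (rule \<mu>_smooth) (rule that)
  obtain S where S: "open S" "e0 \<in> S" "\<And>x. x \<in> S \<Longrightarrow> \<kappa> x \<in> carrier K" "\<And>x. x \<in> S \<Longrightarrow> coord A \<one> (\<kappa> x) = x"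
    by (rule Ad_smooth) (rule that)
  let ?D = "\<lambda>z. frechet_derivative \<mu> (at z)"
  define W where "W = S \<inter> (\<lambda>x. (x, e0)) -` T \<inter> (\<lambda>x. (e0, x)) -` T"
  have "open ((\<lambda>x. (x, e0)) -` T)" "open ((\<lambda>x. (e0, x)) -` T)"
    by (rule open_vimage[OF T(1)], intro continuous_intros)+
  then have oW: "open W" unfolding W_def using S(1) by (simp add: open_Int)
  have e0W: "e0 \<in> W" using S(2) T(2) by (simp add: W_def)
  have D_lin: "linear (?D z)" if "z \<in> T" for z by (rule has_derivative_linear[OF smooth_on_has_derivative[OF T(3) that]])
  have key: "?D (e0, x) (Ad K A (\<kappa> x) Y, 0) = ?D (x, e0) (0, Y)" if x: "x \<in> W" for x
  proof -
    have xT: "(x, e0) \<in> T" "(e0, x) \<in> T" and kx: "\<kappa> x \<in> carrier K" using x S(3) by (auto simp: W_def)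
    let ?F = "\<lambda>y. \<kappa> x \<otimes> \<kappa> y \<otimes> inv (\<kappa> x)"
    have F: "smooth_into A ?F e0" "?F e0 = \<one>"
      using conj_smooth_at[OF kx] kx unfolding smooth_at_def by (simp_all add: \<kappa>_e0)
    obtain R where R: "open R" "e0 \<in> R" "\<And>y. y \<in> R \<Longrightarrow> \<kappa> (coord A \<one> (?F y)) = ?F y"
      by (rule chart_one[OF F]) (rule that)
    have "((\<lambda>y. coord A \<one> (?F y)) has_derivative Ad K A (\<kappa> x)) (at e0)"
      using velocity_works[OF F(1)] unfolding F(2) Ad_velocity[symmetric] .
    then have "((\<lambda>y. (coord A \<one> (?F y), x)) has_derivative (\<lambda>h. (Ad K A (\<kappa> x) h, 0))) (at e0)"
      by (intro has_derivative_Pair has_derivative_const)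
    moreover have "(\<mu> has_derivative ?D (coord A \<one> (?F e0), x)) (at (coord A \<one> (?F e0), x))"
      unfolding F(2) by (rule smooth_on_has_derivative[OF T(3) xT(2)])
    ultimately have "((\<lambda>y. \<mu> (coord A \<one> (?F y), x)) has_derivative (\<lambda>h. ?D (coord A \<one> (?F e0), x) (Ad K A (\<kappa> x) h, 0))) (at e0)"
      by (rule has_derivative_compose)
    then have 1: "((\<lambda>y. \<mu> (coord A \<one> (?F y), x)) has_derivative (\<lambda>h. ?D (e0, x) (Ad K A (\<kappa> x) h, 0))) (at e0)"
      unfolding F(2) .
    have 2: "((\<lambda>y. \<mu> (x, y)) has_derivative (\<lambda>h. ?D (x, e0) (0, h))) (at e0)"
      by (rule has_derivative_partial_snd[OF T(3) xT(1)])
    have RS: "open (R \<inter> S)" "e0 \<in> R \<inter> S" using R S by auto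
    have eq: "\<mu> (x, y) = \<mu> (coord A \<one> (?F y), x)" if "y \<in> R \<inter> S" for y
      using kx S(3)[of y] R(3)[of y] that by (simp add: \<mu>_def m_assoc)
    have "((\<lambda>y. \<mu> (coord A \<one> (?F y), x)) has_derivative (\<lambda>h. ?D (x, e0) (0, h))) (at e0)"
      by (rule has_derivative_transform_within_open[OF 2 RS eq])
    from fun_cong[OF has_derivative_unique[OF 1 this]] show ?thesis .
  qed
  let ?z = "(e0, e0)"
  have second: "((\<lambda>z. ?D z v) has_derivative frechet_derivative (\<lambda>z. ?D z v) (at ?z)) (at ?z)" for v
    by (rule smooth_on_has_derivative[OF smooth_on_frechet_derivative[OF T(3)] T(2)])
  have i1: "((\<lambda>x. (x, e0)) has_derivative (\<lambda>h. (h, 0))) (at e0)" and i2: "((\<lambda>x. (e0, x)) has_derivative (\<lambda>h. (0, h))) (at e0)"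
    by (intro has_derivative_Pair has_derivative_const has_derivative_ident)+
  have rhs: "((\<lambda>x. ?D (x, e0) (0, Y)) has_derivative (\<lambda>X. mixed X Y)) (at e0)"
    using has_derivative_compose[OF i1 second] unfolding mixed_def .
  have fam: "((\<lambda>x. ?D (e0, x) (v, 0)) has_derivative (\<lambda>h. frechet_derivative (\<lambda>z. ?D z (v, 0)) (at ?z) (0, h))) (at e0)" for v
    using has_derivative_compose[OF i2 second] .
  have linM: "linear (\<lambda>v. ?D (e0, x) (v, 0))" if "x \<in> W" for x
  proof -
    have l: "linear (?D (e0, x))" using D_lin that by (simp add: W_def)
    have "linear (\<lambda>v. (v, 0::'e))" by (rule linearI) simp_all
    from linear_compose[OF this l] show ?thesis by (simp add: o_def)
  qed
  \<comment> \<open>The left side of \<open>key\<close> depends on \<open>x\<close> twice: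
    differentiating \<open>Ad\<close> gives the bracket, and differentiating the point at which the
    derivative of \<open>\<mu>\<close> is taken gives the mixed derivative in the opposite
    order.\<close>
  have "((\<lambda>x. ?D (e0, x) (Ad K A (\<kappa> x) Y, 0)) has_derivative
      (\<lambda>h. ?D (e0, e0) (br h Y, 0) + frechet_derivative (\<lambda>z. ?D z (Ad K A (\<kappa> e0) Y, 0)) (at ?z) (0, h))) (at e0)"
    by (rule has_derivative_family[where M = "\<lambda>x v. ?D (e0, x) (v, 0)" and u = "\<lambda>x. Ad K A (\<kappa> x) Y"
        and M' = "\<lambda>h v. frechet_derivative (\<lambda>z. ?D z (v, 0)) (at ?z) (0, h)", OF oW e0W linM fam bracket_derivative])
  then have lhs: "((\<lambda>x. ?D (x, e0) (0, Y)) has_derivative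
      (\<lambda>h. ?D (e0, e0) (br h Y, 0) + frechet_derivative (\<lambda>z. ?D z (Ad K A (\<kappa> e0) Y, 0)) (at ?z) (0, h))) (at e0)"
    by (rule has_derivative_transform_within_open[OF _ oW e0W]) (rule key)
  have "mixed X Y = ?D (e0, e0) (br X Y, 0) + frechet_derivative (\<lambda>z. ?D z (Y, 0)) (at ?z) (0, X)"
    using fun_cong[OF has_derivative_unique[OF rhs lhs], of X] by (simp add: \<kappa>_e0 Ad_one)
  moreover have "?D (e0, e0) (br X Y, 0) = br X Y"
    using fun_cong[OF has_derivative_unique[OF has_derivative_partial_fst[OF T(3,2)] \<mu>_partial(1)]] .
  moreover have "frechet_derivative (\<lambda>z. ?D z (Y, 0)) (at ?z) (0, X) = mixed Y X"
    unfolding mixed_def by (rule mixed_derivative_symmetric[OF T(3,2)])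
  ultimately show ?thesis by simp
qed

text \<open>Antisymmetry is not visible in the definition of the bracket through \<open>Ad\<close>;
  it is read off from \<open>bracket_mixed\<close>.\<close>

lemma lie_algebra: "lie_algebra br"
  by unfold_locales (simp_all add: bilinear_bracket jacobi_bracket[symmetric] bracket_mixed[of X X for X])

text \<open>The map that sends a group element \<open>a\<close> and an element \<open>y\<close> of
  \<open>l\<close> to \<open>Ad a y\<close> has at the identity and \<open>x\<close> the
  differential \<open>(b, y) \<mapsto> y + [b, x]\<close>. This is onto by the assumption
  \<open>sum\<close>, so the image contains a neighbourhood of \<open>x\<close>.\<close>

lemma conjugates_open:
  assumes l: "subspace l" and sum: "\<And>v. \<exists>a\<in>l. \<exists>b. v = a + br x b" and x: "x \<in> l"
  shows "\<exists>\<epsilon>>0. \<forall>z\<in>ball x \<epsilon>. \<exists>T y. linear T \<and> inj T \<and> (\<forall>a b. T (br a b) = br (T a) (T b)) \<and> y \<in> l \<and> z = T y"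
proof -
  interpret L: lie_algebra br by (rule lie_algebra)
  obtain S where S: "open S" "e0 \<in> S" "\<And>x. x \<in> S \<Longrightarrow> \<kappa> x \<in> carrier K" "\<And>Y. smooth_on S (\<lambda>x. Ad K A (\<kappa> x) Y)"
    by (rule Ad_smooth) (rule that)
  obtain Q where Q: "linear Q" "\<And>v. Q v \<in> l" "\<And>v. v \<in> l \<Longrightarrow> Q v = v"
    by (rule orthogonal_projection[OF l]) (rule that)
  \<comment> \<open>The projection \<open>Q\<close> replaces the factor \<open>l\<close> by the
    whole space, so that \<open>F\<close> lives on an open subset of a Euclidean space.\<close>
  define F where "F z = Ad K A (\<kappa> (fst z)) (Q (snd z))" for z
  let ?S = "S \<times> (UNIV :: 'e set)"
  have oS: "open ?S" using S(1) by (simp add: open_Times)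
  have lin: "linear (\<lambda>v. Ad K A (\<kappa> (fst z)) v)" if "z \<in> ?S" for z using linear_Ad[OF S(3)] that by auto
  have smQ: "smooth_on ?S (\<lambda>z. Q (snd z))"
    by (intro smooth_on_linear[OF Q(1)] smooth_on_snd smooth_on_ident oS)
  have F_sum: "F z = (\<Sum>b\<in>Basis. (Q (snd z) \<bullet> b) *\<^sub>R Ad K A (\<kappa> (fst z)) b)" if "z \<in> ?S" for z
    unfolding F_def by (rule linear_basis_sum[OF lin[OF that]])
  have "smooth_on ?S (\<lambda>z. \<Sum>b\<in>Basis. (Q (snd z) \<bullet> b) *\<^sub>R Ad K A (\<kappa> (fst z)) b)"
    by (intro smooth_on_sum[OF oS] smooth_on_scaleR smooth_on_bounded_linear[OF bounded_linear_inner_left smQ]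
        smooth_on_compose[OF smooth_on_fst[OF smooth_on_ident[OF oS]] S(4)]) auto
  then have smF: "smooth_on ?S F" by (rule smooth_on_cong[THEN iffD1, rotated]) (simp add: F_sum)
  have z0: "(e0, x) \<in> ?S" using S(2) by simp
  have Mder: "((\<lambda>z. Ad K A (\<kappa> (fst z)) v) has_derivative (\<lambda>h. br (fst h) v)) (at (e0, x))" for v
    using has_derivative_compose[OF has_derivative_fst[OF has_derivative_ident], of "\<lambda>x. Ad K A (\<kappa> x) v" _ "(e0, x)"]
      bracket_derivative[of v] by simp
  have blQ: "bounded_linear Q" using Q(1) by (simp add: linear_conv_bounded_linear)
  have Qder: "((\<lambda>z. Q (snd z)) has_derivative (\<lambda>h. Q (snd h))) (at (e0, x))"
    by (rule bounded_linear.has_derivative[OF blQ has_derivative_snd[OF has_derivative_ident]])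
  have "(F has_derivative (\<lambda>h. Ad K A (\<kappa> (fst (e0, x))) (Q (snd h)) + br (fst h) (Q (snd (e0, x))))) (at (e0, x))"
    unfolding F_def[abs_def]
    by (rule has_derivative_family[where M = "\<lambda>z v. Ad K A (\<kappa> (fst z)) v" and M' = "\<lambda>h v. br (fst h) v" and u = "\<lambda>z. Q (snd z)",
        OF oS z0 lin Mder Qder])
  then have der: "(F has_derivative (\<lambda>h. Q (snd h) + br (fst h) x)) (at (e0, x))"
    by (simp add: \<kappa>_e0 Ad_one Q(3)[OF x])
  have surj: "surj (\<lambda>h. Q (snd h) + br (fst h) x)"
  proof (rule surjI)
    fix v
    have "\<exists>h. Q (snd h) + br (fst h) x = v"
    proof -
      obtain a b where ab: "a \<in> l" "v = a + br x b" using sum[of v] by blast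
      show ?thesis by (rule exI[of _ "(- b, a)"]) (simp add: Q(3) ab L.br_swap[of "- b" x] L.br_neg)
    qed
    then show "Q (snd (SOME h. Q (snd h) + br (fst h) x = v)) + br (fst (SOME h. Q (snd h) + br (fst h) x = v)) x = v"
      by (rule someI_ex)
  qed
  obtain g' where g': "linear g'" "(\<lambda>h. Q (snd h) + br (fst h) x) \<circ> g' = id"
    using linear_surjective_right_inverse[OF has_derivative_linear[OF der] surj] by blast
  have "F (e0, x) \<in> interior (F ` ?S)"
    by (rule sussmann_open_mapping[OF oS smooth_on_continuous_on[OF smF] z0 der _ g'(2) subset_refl])
      (use g'(1) oS z0 in \<open>simp_all add: linear_conv_bounded_linear interior_open\<close>)
  then have "x \<in> interior (F ` ?S)" by (simp add: F_def \<kappa>_e0 Ad_one Q(3)[OF x])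
  then obtain \<epsilon> where e: "\<epsilon> > 0" "ball x \<epsilon> \<subseteq> F ` ?S" unfolding mem_interior by blast
  have "\<exists>T y. linear T \<and> inj T \<and> (\<forall>a b. T (br a b) = br (T a) (T b)) \<and> y \<in> l \<and> z = T y" if z: "z \<in> ball x \<epsilon>" for z
  proof -
    obtain w where w: "w \<in> ?S" "z = F w" using e(2) z by blast
    have k: "\<kappa> (fst w) \<in> carrier K" using S(3) w(1) by auto
    show ?thesis
      using linear_Ad[OF k] inj_Ad[OF k] Ad_bracket[OF k] Q(2)[of "snd w"] w(2) unfolding F_def
      by (intro exI[of _ "Ad K A (\<kappa> (fst w))"] exI[of _ "Q (snd w)"]) simp
  qed
  then show ?thesis using e(1) by (intro exI[of _ \<epsilon>]) simp
qed

end

lemma lie_grpI: "lie_group K A \<Longrightarrow> lie_grp K A"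
  unfolding lie_grp_def lie_grp_axioms_def lie_group_def by simp

subsection \<open>Open subsets of manifolds\<close>

lemma smooth_into_restrict:
  assumes F: "smooth_into A F x0" and S: "open S" "x0 \<in> S" "\<And>x. x \<in> S \<Longrightarrow> F x \<in> N"
  shows "smooth_into (restrict_atlas A N) F x0"
  unfolding smooth_into_def
proof (intro conjI allI impI)
  obtain U \<phi> where U: "(U, \<phi>) \<in> A" "F x0 \<in> U" using smooth_into_points[OF F] by (rule points_chart)
  have "(U \<inter> N, \<phi>) \<in> restrict_atlas A N" using U(1) unfolding restrict_atlas_def by force
  then show "F x0 \<in> points (restrict_atlas A N)" by (rule chart_points) (use U(2) S(2,3) in blast)
  fix V \<psi> assume V: "(V, \<psi>) \<in> restrict_atlas A N" "F x0 \<in> V"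
  then obtain W where W: "(W, \<psi>) \<in> A" "V = W \<inter> N" unfolding restrict_atlas_def by auto
  have "F x0 \<in> W" using V(2) W(2) by simp
  obtain T where T: "open T" "x0 \<in> T" "\<And>x. x \<in> T \<Longrightarrow> F x \<in> W" "smooth_on T (\<lambda>x. \<psi> (F x))"
    by (rule smooth_intoD[OF F W(1) \<open>F x0 \<in> W\<close>]) (rule that)
  have o: "open (S \<inter> T)" using S T by blast
  have "smooth_on (S \<inter> T) (\<lambda>x. \<psi> (F x))" by (rule smooth_on_subset[OF T(4) o]) blast
  then show "\<exists>S. open S \<and> x0 \<in> S \<and> F ` S \<subseteq> V \<and> smooth_on S (\<lambda>x. \<psi> (F x))"
    using o S(2,3) T(2,3) W(2) by (intro exI[of _ "S \<inter> T"]) auto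
qed

lemma smooth_into_unrestrict:
  assumes F: "smooth_into (restrict_atlas A N) F x0"
  shows "smooth_into A F x0"
proof -
  obtain U \<phi> where "(U, \<phi>) \<in> restrict_atlas A N" "F x0 \<in> U" using smooth_into_points[OF F] by (rule points_chart)
  then obtain W where W: "(W, \<phi>) \<in> A" "F x0 \<in> W" "F x0 \<in> N" unfolding restrict_atlas_def by auto
  show "smooth_into A F x0" unfolding smooth_into_def
  proof (intro conjI allI impI)
    show "F x0 \<in> points A" by (rule chart_points[OF W(1,2)])
    fix V \<psi> assume V: "(V, \<psi>) \<in> A" "F x0 \<in> V"
    have V': "(V \<inter> N, \<psi>) \<in> restrict_atlas A N" using V(1) unfolding restrict_atlas_def by force
    obtain T where T: "open T" "x0 \<in> T" "\<And>x. x \<in> T \<Longrightarrow> F x \<in> V \<inter> N" "smooth_on T (\<lambda>x. \<psi> (F x))"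
      by (rule smooth_intoD[OF F V']) (use V(2) W(3) in blast, rule that)
    then show "\<exists>S. open S \<and> x0 \<in> S \<and> F ` S \<subseteq> V \<and> smooth_on S (\<lambda>x. \<psi> (F x))"
      by (intro exI[of _ T]) auto
  qed
qed

lemma inj_atlas_restrict: "inj_atlas A \<Longrightarrow> inj_atlas (restrict_atlas A N)"
  unfolding inj_atlas_def restrict_atlas_def by (auto intro: inj_on_subset)

lemma points_restrict: "points (restrict_atlas A N) = points A \<inter> N"
  unfolding points_def restrict_atlas_def by auto

lemma smooth_into_product:
  assumes F: "smooth_into (product_atlas A B) F x0"
  shows "smooth_into A (\<lambda>x. fst (F x)) x0" "smooth_into B (\<lambda>x. snd (F x)) x0"
proof -
  have p: "fst (F x0) \<in> points A" "snd (F x0) \<in> points B"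
    using smooth_into_points[OF F] by (auto simp: points_product)
  obtain U \<phi> where U: "(U, \<phi>) \<in> A" "fst (F x0) \<in> U" using p(1) by (rule points_chart)
  obtain V \<psi> where V: "(V, \<psi>) \<in> B" "snd (F x0) \<in> V" using p(2) by (rule points_chart)
  have *: "\<exists>T. open T \<and> x0 \<in> T \<and> (\<forall>x\<in>T. fst (F x) \<in> U' \<and> snd (F x) \<in> V') \<and>
      smooth_on T (\<lambda>x. \<phi>' (fst (F x))) \<and> smooth_on T (\<lambda>x. \<psi>' (snd (F x)))"
    if c: "(U', \<phi>') \<in> A" "(V', \<psi>') \<in> B" "fst (F x0) \<in> U'" "snd (F x0) \<in> V'" for U' \<phi>' V' \<psi>'
  proof -
    have "(U' \<times> V', map_prod \<phi>' \<psi>') \<in> product_atlas A B" using c unfolding product_atlas_def by blast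
    moreover have "F x0 \<in> U' \<times> V'" using c by (simp add: mem_Times_iff)
    ultimately obtain T where T: "open T" "x0 \<in> T" "\<And>x. x \<in> T \<Longrightarrow> F x \<in> U' \<times> V'"
      "smooth_on T (\<lambda>x. map_prod \<phi>' \<psi>' (F x))"
      by (rule smooth_intoD[OF F]) (rule that)
    show ?thesis using T smooth_on_fst[OF T(4)] smooth_on_snd[OF T(4)] by (intro exI[of _ T]) (auto simp: mem_Times_iff)
  qed
  show "smooth_into A (\<lambda>x. fst (F x)) x0" unfolding smooth_into_def
  proof (intro conjI allI impI p)
    fix U' \<phi>' assume "(U', \<phi>') \<in> A" "fst (F x0) \<in> U'"
    from *[OF this(1) V(1) this(2) V(2)] obtain T where T: "open T" "x0 \<in> T"
      "\<forall>x\<in>T. fst (F x) \<in> U' \<and> snd (F x) \<in> V" "smooth_on T (\<lambda>x. \<phi>' (fst (F x)))" by (elim exE conjE) (rule that)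
    then show "\<exists>S. open S \<and> x0 \<in> S \<and> (\<lambda>x. fst (F x)) ` S \<subseteq> U' \<and> smooth_on S (\<lambda>x. \<phi>' (fst (F x)))"
      by (intro exI[of _ T]) auto
  qed
  show "smooth_into B (\<lambda>x. snd (F x)) x0" unfolding smooth_into_def
  proof (intro conjI allI impI p)
    fix V' \<psi>' assume "(V', \<psi>') \<in> B" "snd (F x0) \<in> V'"
    from *[OF U(1) this(1) U(2) this(2)] obtain T where T: "open T" "x0 \<in> T"
      "\<forall>x\<in>T. fst (F x) \<in> U \<and> snd (F x) \<in> V'" "smooth_on T (\<lambda>x. \<psi>' (snd (F x)))" by (elim exE conjE) (rule that)
    then show "\<exists>S. open S \<and> x0 \<in> S \<and> (\<lambda>x. snd (F x)) ` S \<subseteq> V' \<and> smooth_on S (\<lambda>x. \<psi>' (snd (F x)))"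
      by (intro exI[of _ T]) auto
  qed
qed

lemma smooth_into_openin:
  assumes A: "smooth_manifold A" and U: "openin (manifold_topology A) U" and F: "smooth_into A F x0" "F x0 \<in> U"
  obtains S where "open S" "x0 \<in> S" "\<And>x. x \<in> S \<Longrightarrow> F x \<in> U" "\<And>x. x \<in> S \<Longrightarrow> smooth_into A F x"
proof -
  obtain V \<psi> where V: "(V, \<psi>) \<in> A" "F x0 \<in> V" using smooth_into_points[OF F(1)] by (rule points_chart)
  obtain T where T: "open T" "x0 \<in> T" "\<And>x. x \<in> T \<Longrightarrow> F x \<in> V" "smooth_on T (\<lambda>x. \<psi> (F x))"
    by (rule smooth_intoD[OF F(1) V]) (rule that)
  obtain R where R: "open R" "x0 \<in> R" "\<And>x. x \<in> R \<Longrightarrow> smooth_into A F x"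
    by (rule smooth_into_nbhd[OF A F(1)]) (rule that)
  have oU: "open (\<psi> ` (U \<inter> V))" using U V(1) unfolding openin_manifold_topology[OF A] by blast
  define S where "S = (T \<inter> (\<lambda>x. \<psi> (F x)) -` (\<psi> ` (U \<inter> V))) \<inter> R"
  have "open S" unfolding S_def
    by (intro open_Int[OF continuous_open_preimage[OF smooth_on_continuous_on[OF T(4)] T(1) oU] R(1)])
  moreover have "x0 \<in> S" using T(2) R(2) F(2) V(2) unfolding S_def by auto
  moreover have "F x \<in> U" if "x \<in> S" for x
  proof -
    have "F x \<in> V" "\<psi> (F x) \<in> \<psi> ` (U \<inter> V)" using that T(3) unfolding S_def by auto
    then obtain q where "q \<in> U" "q \<in> V" "\<psi> (F x) = \<psi> q" by blast
    then have "F x = q" using smooth_manifold_inj[OF A] V(1) \<open>F x \<in> V\<close> unfolding inj_atlas_def inj_on_def by blast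
    then show ?thesis using \<open>q \<in> U\<close> by simp
  qed
  moreover have "smooth_into A F x" if "x \<in> S" for x using that R(3) by (simp add: S_def)
  ultimately show ?thesis by (rule that)
qed

text \<open>Inverses of charts are themselves smooth maps into the manifold, so openness may be
  tested along such maps, without reference to the chart in which \<open>N\<close> was
  described.\<close>

lemma openin_manifold_topologyI:
  assumes A: "smooth_manifold A" and N: "N \<subseteq> points A"
    and nb: "\<And>(F :: 'e \<Rightarrow> 'p) x. smooth_into A F x \<Longrightarrow> F x \<in> N \<Longrightarrow> \<exists>S. open S \<and> x \<in> S \<and> F ` S \<subseteq> N"
  shows "openin (manifold_topology (A :: ('p, 'e::euclidean_space) atlas)) N"
  unfolding openin_manifold_topology[OF A]
proof (intro conjI N ballI, clarify)
  fix W \<phi> assume W: "(W, \<phi>) \<in> A"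
  show "open (\<phi> ` (N \<inter> W))"
  proof (subst open_subopen, clarify)
    fix q assume q: "q \<in> N" "q \<in> W"
    have inv: "inv_into W \<phi> (\<phi> q) = q" by (rule inj_atlas_inv[OF smooth_manifold_inj[OF A] W q(2)])
    have "smooth_into A (inv_into W \<phi>) (\<phi> q)" by (rule smooth_into_chart_inv[OF A W]) (use q in blast)
    from nb[OF this] q inv obtain S where S: "open S" "\<phi> q \<in> S" "inv_into W \<phi> ` S \<subseteq> N" by auto
    have "S \<inter> \<phi> ` W \<subseteq> \<phi> ` (N \<inter> W)"
    proof
      fix y assume y: "y \<in> S \<inter> \<phi> ` W"
      then have "inv_into W \<phi> y \<in> N" "inv_into W \<phi> y \<in> W" "\<phi> (inv_into W \<phi> y) = y"
        using S(3) by (auto simp: inv_into_into f_inv_into_f)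
      then show "y \<in> \<phi> ` (N \<inter> W)" by (intro image_eqI[of _ _ "inv_into W \<phi> y"]) auto
    qed
    then show "\<exists>T. open T \<and> \<phi> q \<in> T \<and> T \<subseteq> \<phi> ` (N \<inter> W)"
      using S q by (intro exI[of _ "S \<inter> \<phi> ` W"]) (auto intro: open_Int smooth_manifold_open[OF A W])
  qed
qed

text \<open>Each member of the disjoint family contains a nonempty set from a countable base, and
  distinct members contain distinct ones.\<close>

lemma countable_disjoint_openin:
  assumes X: "second_countable X" and N: "\<And>c. c \<in> C \<Longrightarrow> openin X (N c)" "\<And>c. c \<in> C \<Longrightarrow> N c \<noteq> {}"
    and disj: "\<And>c d p. c \<in> C \<Longrightarrow> d \<in> C \<Longrightarrow> p \<in> N c \<Longrightarrow> p \<in> N d \<Longrightarrow> c = d"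
  shows "countable C"
proof -
  obtain \<B> where B: "countable \<B>" "\<And>U x. openin X U \<Longrightarrow> x \<in> U \<Longrightarrow> \<exists>V\<in>\<B>. x \<in> V \<and> V \<subseteq> U"
    using X unfolding second_countable_def by auto
  have "\<forall>c\<in>C. \<exists>V. V \<in> \<B> \<and> V \<noteq> {} \<and> V \<subseteq> N c"
  proof
    fix c assume c: "c \<in> C"
    obtain p where "p \<in> N c" using N(2)[OF c] by blast
    then show "\<exists>V. V \<in> \<B> \<and> V \<noteq> {} \<and> V \<subseteq> N c" using B(2)[OF N(1)[OF c]] by blast
  qed
  from bchoice[OF this] obtain f where f: "\<forall>c\<in>C. f c \<in> \<B> \<and> f c \<noteq> {} \<and> f c \<subseteq> N c" by (elim exE)
  have "inj_on f C"
  proof (rule inj_onI)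
    fix c d assume cd: "c \<in> C" "d \<in> C" "f c = f d"
    obtain p where "p \<in> f c" using f cd(1) by blast
    then have "p \<in> N c" "p \<in> N d" using f[rule_format, OF cd(1)] f[rule_format, OF cd(2)] cd(3) by auto
    then show "c = d" by (rule disj[OF cd(1,2)])
  qed
  moreover have "f ` C \<subseteq> \<B>" using f by blast
  ultimately show ?thesis using countable_image_inj_on[OF countable_subset[OF _ B(1)]] by simp
qed

subsection \<open>Lie subgroups of the general linear group\<close>

lemma bilinear_matrix_mult: "bilinear ((**) :: real^'n^'m \<Rightarrow> real^'p^'n \<Rightarrow> real^'p^'m)"
  unfolding bilinear_def
  by (intro conjI allI linearI)
    (simp_all add: matrix_matrix_mult_def vec_eq_iff sum.distrib ring_distribs sum_distrib_left mult_ac)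

lemma bounded_bilinear_matrix_mult: "bounded_bilinear ((**) :: real^'n^'m \<Rightarrow> real^'p^'n \<Rightarrow> real^'p^'m)"
  using bilinear_matrix_mult by (simp add: bilinear_conv_bounded_bilinear)

lemma smooth_on_matrix_mult:
  fixes f :: "'a::euclidean_space \<Rightarrow> real^'n^'m" and g :: "'a \<Rightarrow> real^'p^'n"
  shows "smooth_on S f \<Longrightarrow> smooth_on S g \<Longrightarrow> smooth_on S (\<lambda>x. f x ** g x)"
  by (rule smooth_on_bilinear[OF bounded_bilinear_matrix_mult])

lemma matrix_inv_works:
  fixes a :: "real^'n^'n" assumes "invertible a" shows "a ** matrix_inv a = mat 1" "matrix_inv a ** a = mat 1"
  using assms someI_ex[of "\<lambda>b. a ** b = mat 1 \<and> b ** a = mat 1"] unfolding invertible_def matrix_inv_def by auto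

lemma points_GL: "points GL_atlas = {u. invertible u}"
  unfolding points_def GL_atlas_def by simp

lemma coord_GL: "invertible u \<Longrightarrow> coord GL_atlas u = (\<lambda>u. u)"
  using chart_at'[of u GL_atlas] unfolding points_GL by (simp add: GL_atlas_def)

lemma smooth_into_GL:
  assumes "smooth_into GL_atlas F x0"
  obtains S where "open S" "x0 \<in> S" "\<And>x. x \<in> S \<Longrightarrow> invertible (F x)" "smooth_on S F"
proof -
  have 1: "F x0 \<in> {u. invertible u}" using smooth_into_points[OF assms] by (simp add: points_GL)
  have 2: "({u. invertible u}, \<lambda>u. u) \<in> GL_atlas" by (simp add: GL_atlas_def)
  obtain S where S: "open S" "x0 \<in> S" "\<And>x. x \<in> S \<Longrightarrow> F x \<in> {u. invertible u}" "smooth_on S (\<lambda>x. F x)"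
    by (rule smooth_intoD[OF assms 2 1]) (rule that)
  show ?thesis by (rule that[OF S(1,2) _ S(4)]) (use S(3) in simp)
qed

lemma mult_GL: "x \<otimes>\<^bsub>GL\<^esub> y = x ** y" and one_GL: "\<one>\<^bsub>GL\<^esub> = mat 1"
  by (simp_all add: GL_def)

locale matrix_group =
  fixes G :: "(real^'n^'n) set" and AG :: "(real^'n^'n, 'g::euclidean_space) atlas"
  assumes sub: "lie_subgroup GL GL_atlas G AG"
begin

lemma lg: "lie_group (GL\<lparr>carrier := G\<rparr>) AG" and incl_smooth: "smooth_map AG GL_atlas (\<lambda>x. x)"
  and incl_inj: "x \<in> G \<Longrightarrow> inj (mderiv AG GL_atlas (\<lambda>x. x) x)"
  using sub unfolding lie_subgroup_def by auto

sublocale Gr: lie_grp "GL\<lparr>carrier := G\<rparr>" AG by (rule lie_grpI[OF lg])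

lemma mult_eq: "x \<otimes>\<^bsub>GL\<lparr>carrier := G\<rparr>\<^esub> y = x ** y"
  and points_AG: "points AG = G"
  by (simp_all add: Gr.points) (simp_all add: GL_def)

lemma one_closed: "mat 1 \<in> G" using Gr.one_closed by (simp add: one_GL)
lemma mult_closed: "x \<in> G \<Longrightarrow> y \<in> G \<Longrightarrow> x ** y \<in> G" using Gr.m_closed[of x y] by (simp add: mult_GL)

lemma invertible: "x \<in> G \<Longrightarrow> invertible x"
  using incl_smooth unfolding smooth_map_def points_GL points_AG by blast

lemma inverse:
  assumes "x \<in> G" shows "inv\<^bsub>GL\<lparr>carrier := G\<rparr>\<^esub> x = matrix_inv x" "matrix_inv x \<in> G"
proof -
  let ?y = "inv\<^bsub>GL\<lparr>carrier := G\<rparr>\<^esub> x"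
  have y: "?y \<in> G" "?y ** x = mat 1" using Gr.inv_closed[of x] Gr.l_inv[of x] assms by (simp_all add: one_GL mult_GL)
  have "?y = ?y ** (x ** matrix_inv x)" by (simp add: matrix_inv_works invertible[OF assms])
  also have "\<dots> = matrix_inv x" by (simp add: matrix_mul_assoc y(2))
  finally show "?y = matrix_inv x" .
  then show "matrix_inv x \<in> G" using y(1) by simp
qed

lemma smooth_into_mult: "smooth_into AG F x \<Longrightarrow> smooth_into AG F' x \<Longrightarrow> smooth_into AG (\<lambda>x. F x ** F' x) x"
  using Gr.smooth_into_mult unfolding mult_eq .

lemma smooth_into_const: "a \<in> G \<Longrightarrow> smooth_into AG (\<lambda>x. a) x0"
  by (rule Gr.smooth_into_const) simp

text \<open>Near the identity the translates \<open>\<sigma> ** (mat 1 + c)\<close> of the image of a parametrization \<open>\<sigma>\<close> of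
  \<open>G\<close> are disjoint and open in \<open>G\<close>. So only countably many of them occur, and a continuous curve
  of matrices in \<open>G\<close> stays in one of them.\<close>

lemma smooth_into_if_smooth_on:
  fixes f :: "'a::euclidean_space \<Rightarrow> real^'n^'n"
  assumes f: "smooth_on S f" and x0: "x0 \<in> S" and fG: "\<And>x. x \<in> S \<Longrightarrow> f x \<in> G"
  shows "smooth_into AG f x0"
proof -
  let ?\<sigma> = "coord_inv AG (mat 1)" and ?z = "coord AG (mat 1) (mat 1)"
  have p1: "mat 1 \<in> points AG" by (simp add: points_AG one_closed)
  have s\<sigma>: "smooth_into AG ?\<sigma> ?z" by (rule smooth_into_coord_inv[OF Gr.manifold p1])
  have \<sigma>1: "?\<sigma> ?z = mat 1" by (rule coord_inv_coord[OF Gr.inj p1])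
  obtain R where R: "open R" "?z \<in> R" "\<And>x. x \<in> R \<Longrightarrow> smooth_into AG ?\<sigma> x"
    by (rule smooth_into_nbhd[OF Gr.manifold s\<sigma>]) (rule that)
  obtain R' where R': "open R'" "?z \<in> R'" "smooth_on R' ?\<sigma>"
    by (rule smooth_into_GL[OF smooth_into_compose[OF Gr.inj incl_smooth s\<sigma>]]) (rule that)
  let ?O = "coord AG (mat 1) ` fst (chart_at AG (mat 1))"
  define T where "T = R \<inter> R' \<inter> ?O"
  have oT: "open T" unfolding T_def using R(1) R'(1) smooth_manifold_open[OF Gr.manifold chart_at'[OF p1]] by blast
  have zT: "?z \<in> T" unfolding T_def using R(2) R'(2) chart_at(2)[OF p1] by blast
  have \<sigma>T: "smooth_on T ?\<sigma>" by (rule smooth_on_subset[OF R'(3) oT]) (auto simp: T_def)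
  have siT: "smooth_into AG ?\<sigma> x" if "x \<in> T" for x using R(3) that by (simp add: T_def)
  have \<sigma>G: "?\<sigma> x \<in> G" if "x \<in> T" for x using smooth_into_points[OF siT[OF that]] by (simp add: points_AG)
  have \<sigma>D: "?\<sigma> x \<in> fst (chart_at AG (mat 1))" "coord AG (mat 1) (?\<sigma> x) = x" if "x \<in> T" for x
    using that unfolding coord_inv_def T_def by (auto simp: inv_into_into f_inv_into_f)
  define A where "A = frechet_derivative ?\<sigma> (at ?z)"
  have A_der: "(?\<sigma> has_derivative A) (at ?z)" unfolding A_def by (rule smooth_on_has_derivative[OF \<sigma>T zT])
  have linA: "linear A" by (rule has_derivative_linear[OF A_der])
  have injA: "inj A" using incl_inj[OF one_closed]
    unfolding mderiv_def A_def coord_GL[OF invertible[OF one_closed]] by (simp add: o_def)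
  obtain L where L: "linear L" "\<And>w. L (A w) = w"
    using linear_injective_left_inverse[OF linA injA] unfolding o_def id_def by (metis)
  define Q where "Q X = X - A (L X)" for X
  have linQ: "linear Q" unfolding Q_def[abs_def]
    by (intro linear_compose_sub linear_ident linear_compose[OF L(1) linA, unfolded o_def])
  have LQ: "L (Q X) = 0" for X by (simp add: Q_def linear_diff[OF L(1)] L(2))
  \<comment> \<open>Coordinates along \<open>G\<close> and across it: \<open>A (L X)\<close> is the
    part of \<open>X\<close> tangent to \<open>G\<close> and \<open>Q X\<close> the transversal
    part. The derivative of \<open>F\<close> at 0 is the sum of both, the identity.\<close>
  define F where "F X = ?\<sigma> (?z + L X) ** (mat 1 + Q X)" for X
  define S0 where "S0 = (\<lambda>X. ?z + L X) -` T"
  have contL: "continuous_on UNIV (\<lambda>X. ?z + L X)"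
    by (intro continuous_intros linear_continuous_on) (use L(1) in \<open>simp add: linear_conv_bounded_linear\<close>)
  have oS0: "open S0" unfolding S0_def by (rule open_vimage[OF oT contL])
  have S00: "0 \<in> S0" using zT by (simp add: S0_def linear_0[OF L(1)])
  have smL: "smooth_on S0 (\<lambda>X. ?z + L X)"
    by (intro smooth_on_add smooth_on_const smooth_on_linear[OF L(1)] smooth_on_ident oS0)
  have smF: "smooth_on S0 F" unfolding F_def[abs_def]
    by (intro smooth_on_matrix_mult smooth_on_compose[OF smL \<sigma>T] smooth_on_add smooth_on_const
        smooth_on_linear[OF linQ] smooth_on_ident oS0) (auto simp: S0_def)
  have blL: "bounded_linear L" and blQ: "bounded_linear Q" using L(1) linQ by (simp_all add: linear_conv_bounded_linear)
  have z0: "?z + L 0 = ?z" by (simp add: linear_0[OF L(1)])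
  have dL: "((\<lambda>X. ?z + L X) has_derivative L) (at 0)"
    using has_derivative_add[OF has_derivative_const[of ?z "at 0"] bounded_linear_imp_has_derivative[OF blL, of "at 0"]] by simp
  have d1: "((\<lambda>X. ?\<sigma> (?z + L X)) has_derivative (\<lambda>h. A (L h))) (at 0)"
    by (rule has_derivative_compose[OF dL]) (simp add: z0 A_der)
  have d2: "((\<lambda>X. mat 1 + Q X) has_derivative Q) (at 0)"
    using has_derivative_add[OF has_derivative_const[of "mat 1" "at 0"] bounded_linear_imp_has_derivative[OF blQ, of "at 0"]] by simp
  have "(F has_derivative (\<lambda>h. ?\<sigma> (?z + L 0) ** Q h + A (L h) ** (mat 1 + Q 0))) (at 0)"
    unfolding F_def[abs_def] by (rule bounded_bilinear.FDERIV[OF bounded_bilinear_matrix_mult d1 d2])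
  then have dF: "(F has_derivative (\<lambda>h. h)) (at 0)" by (simp add: z0 \<sigma>1 linear_0[OF linQ]) (simp add: Q_def)
  have injF: "inj (frechet_derivative F (at 0))" unfolding frechet_derivative_at[OF dF, symmetric] by (rule injI)
  obtain U V g where g: "open U" "0 \<in> U" "U \<subseteq> S0" "open V" "F 0 \<in> V" "\<And>x. x \<in> U \<Longrightarrow> F x \<in> V"
    "\<And>x. x \<in> U \<Longrightarrow> g (F x) = x" "\<And>y. y \<in> V \<Longrightarrow> g y \<in> U" "\<And>y. y \<in> V \<Longrightarrow> F (g y) = y" "smooth_on V g"
    by (rule local_inverse[OF smF S00 injF]) (rule that)
  have F0: "F 0 = mat 1" by (simp add: F_def z0 \<sigma>1 linear_0[OF linQ])
  \<comment> \<open>\<open>C\<close> collects the transversal parameters whose slice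
    \<open>N c\<close> lies in \<open>G\<close>; the slices are disjoint because \<open>F\<close> is
    injective on \<open>U\<close>.\<close>
  define C where "C = {Q X | X. X \<in> U \<and> mat 1 + Q X \<in> G}"
  define N where "N c = {F X | X. X \<in> U \<and> Q X = c}" for c
  have countC: "countable C"
  proof (rule countable_disjoint_openin)
    show "second_countable (manifold_topology AG)" using Gr.manifold unfolding smooth_manifold_def by blast
    show "N c \<noteq> {}" if "c \<in> C" for c using that unfolding C_def N_def by blast
    show "c = d" if "p \<in> N c" "p \<in> N d" for c d p
    proof -
      obtain X Y where "X \<in> U" "Q X = c" "p = F X" "Y \<in> U" "Q Y = d" "p = F Y" using \<open>p \<in> N c\<close> \<open>p \<in> N d\<close> unfolding N_def by blast
      then show ?thesis using g(7)[of X] g(7)[of Y] by simp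
    qed
    fix c assume c: "c \<in> C"
    then have cG: "mat 1 + c \<in> G" and Lc: "L c = 0" unfolding C_def using LQ by auto
    let ?b = "matrix_inv (mat 1 + c)"
    note b = inverse(2)[OF cG] matrix_inv_works[OF invertible[OF cG]]
    show "openin (manifold_topology AG) (N c)"
    proof (rule openin_manifold_topologyI[OF Gr.manifold])
      show "N c \<subseteq> points AG" unfolding N_def points_AG F_def
        using g(3) cG by (auto intro!: mult_closed \<sigma>G simp: S0_def)
      fix f :: "'g \<Rightarrow> real^'n^'n" and x assume f: "smooth_into AG f x" "f x \<in> N c"
      obtain X where X: "X \<in> U" "Q X = c" "f x = F X" using f(2) unfolding N_def by blast
      have XT: "?z + L X \<in> T" using X(1) g(3) by (auto simp: S0_def)
      have fb: "f x ** ?b = ?\<sigma> (?z + L X)" unfolding X(3) F_def X(2) by (simp add: matrix_mul_assoc[symmetric] b)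
      have sfb: "smooth_into AG (\<lambda>y. f y ** ?b) x" by (rule smooth_into_mult[OF f(1) smooth_into_const[OF b(1)]])
      obtain W where W: "open W" "x \<in> W" "\<And>y. y \<in> W \<Longrightarrow> f y ** ?b \<in> fst (chart_at AG (mat 1))"
        "smooth_on W (\<lambda>y. coord AG (mat 1) (f y ** ?b))"
        by (rule smooth_intoD[OF sfb chart_at'[OF p1]]) (simp add: fb \<sigma>D(1)[OF XT], rule that)
      \<comment> \<open>The parameter of a point \<open>f y\<close> is recovered from the chart of
        \<open>G\<close> after multiplication by \<open>?b\<close>. It depends continuously on
        \<open>y\<close>, so that nearby points remain in the same slice.\<close>
      let ?X = "\<lambda>y. A (coord AG (mat 1) (f y ** ?b) - ?z) + c"
      have "continuous_on W ?X"
        by (intro continuous_intros continuous_on_compose2[OF linear_continuous_on[of A UNIV]] smooth_on_continuous_on[OF W(4)])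
          (use linA in \<open>auto simp: linear_conv_bounded_linear\<close>)
      then have o: "open (W \<inter> ?X -` U)" by (rule continuous_open_preimage[OF _ W(1) g(1)])
      have "?X x = X" unfolding fb \<sigma>D(2)[OF XT] using X(2) by (auto simp: Q_def)
      then have "x \<in> W \<inter> ?X -` U" using W(2) X(1) by simp
      moreover have "f y \<in> N c" if y: "y \<in> W \<inter> ?X -` U" for y
      proof -
        let ?Y = "?X y"
        have LY: "L ?Y = coord AG (mat 1) (f y ** ?b) - ?z" by (simp add: linear_add[OF L(1)] L(2) Lc)
        then have QY: "Q ?Y = c" by (simp add: Q_def)
        have "?\<sigma> (coord AG (mat 1) (f y ** ?b)) = f y ** ?b"
          unfolding coord_inv_def using inj_atlas_inv[OF Gr.inj chart_at'[OF p1] W(3)[of y]] y by simp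
        then have "F ?Y = f y" unfolding F_def QY LY by (simp add: matrix_mul_assoc[symmetric] b)
        then show ?thesis using y QY unfolding N_def by (intro CollectI exI[of _ ?Y]) auto
      qed
      ultimately show "\<exists>S. open S \<and> x \<in> S \<and> f ` S \<subseteq> N c" using o by (intro exI[of _ "W \<inter> ?X -` U"]) auto
    qed
  qed
  let ?a = "f x0" and ?b = "matrix_inv (f x0)"
  note fx = fG[OF x0]
  note b = inverse(2)[OF fx] matrix_inv_works[OF invertible[OF fx]]
  \<comment> \<open>Left translation moves the point \<open>f x0\<close> to the identity, around
    which the slices were constructed.\<close>
  define f0 where "f0 x = ?b ** f x" for x
  have oS: "open S" by (rule smooth_on_open[OF f])
  have sf0: "smooth_on S f0" unfolding f0_def[abs_def] by (rule smooth_on_matrix_mult[OF smooth_on_const[OF oS] f])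
  have f0x: "f0 x0 = mat 1" by (simp add: f0_def b)
  have oSV: "open (S \<inter> f0 -` V)" by (rule continuous_open_preimage[OF smooth_on_continuous_on[OF sf0] oS g(4)])
  have "x0 \<in> S \<inter> f0 -` V" using x0 g(5) by (simp add: f0x F0)
  then obtain \<epsilon> where e: "\<epsilon> > 0" "ball x0 \<epsilon> \<subseteq> S \<inter> f0 -` V" using oSV openE by blast
  let ?B = "ball x0 \<epsilon>"
  define X where "X x = g (f0 x)" for x
  have smX: "smooth_on ?B X" unfolding X_def[abs_def]
    by (rule smooth_on_compose[OF smooth_on_subset[OF sf0 open_ball] g(10)]) (use e(2) in auto)
  have XU: "X x \<in> U" "F (X x) = f0 x" if "x \<in> ?B" for x using g(8,9)[of "f0 x"] e(2) that by (auto simp: X_def)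
  have XT: "?z + L (X x) \<in> T" if "x \<in> ?B" for x using XU(1)[OF that] g(3) by (auto simp: S0_def)
  have QC: "Q (X x) \<in> C" if x: "x \<in> ?B" for x
  proof -
    note s = \<sigma>G[OF XT[OF x]]
    have "f0 x \<in> G" using e(2) x fG b(1) by (auto simp: f0_def intro!: mult_closed)
    moreover have "mat 1 + Q (X x) = matrix_inv (?\<sigma> (?z + L (X x))) ** f0 x"
      unfolding XU(2)[OF x, symmetric] F_def by (simp add: matrix_mul_assoc matrix_inv_works invertible[OF s])
    ultimately have "mat 1 + Q (X x) \<in> G" using inverse(2)[OF s] by (simp add: mult_closed)
    then show ?thesis unfolding C_def using XU(1)[OF x] by blast
  qed
  have X0: "X x0 = 0" using g(7)[OF g(2)] by (simp add: X_def f0x F0)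
  have Q0: "Q (X x) = 0" if x: "x \<in> ?B" for x
  proof (rule ccontr)
    assume ne: "Q (X x) \<noteq> 0"
    \<comment> \<open>A connected set with a second point besides 0 is uncountable, whereas the
      transversal parameters that occur in \<open>G\<close> form a countable set.\<close>
    have "connected ((\<lambda>x. Q (X x)) ` ?B)"
      by (rule connected_continuous_image[OF smooth_on_continuous_on[OF smooth_on_linear[OF linQ smX]] connected_ball])
    moreover have "0 \<in> (\<lambda>x. Q (X x)) ` ?B" using e(1) X0 linear_0[OF linQ] by (intro image_eqI[of _ _ x0]) auto
    moreover have "Q (X x) \<in> (\<lambda>x. Q (X x)) ` ?B" using x by blast
    ultimately have "uncountable ((\<lambda>x. Q (X x)) ` ?B)" using connected_uncountable ne by metis
    moreover have "(\<lambda>x. Q (X x)) ` ?B \<subseteq> C" using QC by blast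
    ultimately show False using countC countable_subset by blast
  qed
  have xB: "x0 \<in> ?B" using e(1) by simp
  have "smooth_into AG (\<lambda>x. ?a ** ?\<sigma> (?z + L (X x))) x0"
  proof (rule smooth_into_mult[OF smooth_into_const[OF fx]])
    show "smooth_into AG (\<lambda>x. ?\<sigma> (?z + L (X x))) x0"
      by (rule smooth_into_precompose[where g = "\<lambda>x. ?z + L (X x)", OF siT[OF XT[OF xB]] _ xB])
        (intro smooth_on_add smooth_on_const smooth_on_linear[OF L(1)] smX open_ball)
  qed
  moreover have "?a ** ?\<sigma> (?z + L (X x)) = f x" if x: "x \<in> ?B" for x
  proof -
    have "?a ** f0 x = f x" by (simp add: f0_def matrix_mul_assoc b)
    then show ?thesis using XU(2)[OF x] by (simp add: F_def Q0[OF x])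
  qed
  ultimately show ?thesis by (rule smooth_into_cong[OF _ open_ball xB])
qed

end

subsection \<open>Reductions of the frame bundle\<close>

lemma points_frames: "points (frame_atlas M) = points M \<times> {u. invertible u}"
  unfolding points_def frame_atlas_def by auto

lemma frame_chart: "(U, \<phi>) \<in> M \<Longrightarrow>
    (U \<times> {u. invertible u}, \<lambda>(p, u). (\<phi> p, matrix (chart_diff M \<phi> p) ** u)) \<in> frame_atlas M"
  unfolding frame_atlas_def by force

lemma invertible_chart_diff:
  fixes M :: "('p, real^'n) atlas"
  assumes "smooth_manifold M" "(U, \<phi>) \<in> M" "p \<in> U"
  shows "invertible (matrix (chart_diff M \<phi> p))"
proof -
  note c = chart_diff_inverse[OF assms]
  have "inj (chart_diff M \<phi> p)" by (rule inj_on_inverseI) (rule c(1))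
  moreover have "(*v) (matrix (chart_diff M \<phi> p)) = chart_diff M \<phi> p" by (intro ext matrix_works) (use c(2) in \<open>simp add: linear_matrix_vector_mul_eq\<close>)
  ultimately show ?thesis unfolding invertible_left_inverse matrix_left_invertible_injective by simp
qed

lemma smooth_into_frames:
  assumes M: "smooth_manifold M" and F: "smooth_into (frame_atlas M) F x0"
  shows "smooth_into M (\<lambda>x. fst (F x)) x0"
  unfolding smooth_into_def
proof (intro conjI allI impI)
  have p: "fst (F x0) \<in> points M" "invertible (snd (F x0))" using smooth_into_points[OF F] by (auto simp: points_frames)
  show "fst (F x0) \<in> points M" by (rule p(1))
  fix V \<psi> assume V: "(V, \<psi>) \<in> M" "fst (F x0) \<in> V"
  obtain T where T: "open T" "x0 \<in> T" "\<And>x. x \<in> T \<Longrightarrow> F x \<in> V \<times> {u. invertible u}"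
    "smooth_on T (\<lambda>x. (\<lambda>(p, u). (\<psi> p, matrix (chart_diff M \<psi> p) ** u)) (F x))"
    by (rule smooth_intoD[OF F frame_chart[OF V(1)]]) (use V(2) p(2) in \<open>simp add: mem_Times_iff\<close>, rule that)
  show "\<exists>S. open S \<and> x0 \<in> S \<and> (\<lambda>x. fst (F x)) ` S \<subseteq> V \<and> smooth_on S (\<lambda>x. \<psi> (fst (F x)))"
    using T(1,2,3) smooth_on_fst[OF T(4)] by (intro exI[of _ T]) (auto simp: mem_Times_iff split_beta)
qed

lemma smooth_into_framesD:
  assumes F: "smooth_into (frame_atlas M) F x0" and V: "(V, \<psi>) \<in> M" "fst (F x0) \<in> V"
  obtains T where "open T" "x0 \<in> T" "\<And>x. x \<in> T \<Longrightarrow> fst (F x) \<in> V" "\<And>x. x \<in> T \<Longrightarrow> invertible (snd (F x))"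
    "smooth_on T (\<lambda>x. matrix (chart_diff M \<psi> (fst (F x))) ** snd (F x))"
proof -
  have p: "invertible (snd (F x0))" using smooth_into_points[OF F] by (auto simp: points_frames)
  obtain T where T: "open T" "x0 \<in> T" "\<And>x. x \<in> T \<Longrightarrow> F x \<in> V \<times> {u. invertible u}"
    "smooth_on T (\<lambda>x. (\<lambda>(p, u). (\<psi> p, matrix (chart_diff M \<psi> p) ** u)) (F x))"
    by (rule smooth_intoD[OF F frame_chart[OF V(1)]]) (use V(2) p in \<open>simp add: mem_Times_iff\<close>, rule that)
  show ?thesis
    by (rule that[OF T(1,2)]) (use T(3) smooth_on_snd[OF T(4)] in \<open>auto simp: mem_Times_iff split_beta\<close>)
qed

locale g_structure = matrix_group G AG
  for G :: "(real^'n^'n) set" and AG :: "(real^'n^'n, 'g::euclidean_space) atlas" +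
  fixes M :: "('p, real^'n) atlas" and P :: "(('p, 'n) frame, 'q::euclidean_space) atlas"
  assumes gs: "G_structure M G AG P"
begin

lemma pb: "principal_bundle P M (GL\<lparr>carrier := G\<rparr>) AG frame_act fst"
  and frames_smooth: "smooth_map P (frame_atlas M) (\<lambda>u. u)"
  using gs unfolding G_structure_def by auto

lemma manifold: "smooth_manifold P" and base_manifold: "smooth_manifold M"
  and act_smooth: "smooth_map (product_atlas P AG) P (\<lambda>(u, g). frame_act u g)" and proj_smooth: "smooth_map P M fst"
  using pb unfolding principal_bundle_def by blast+

lemma inj: "inj_atlas P" by (rule smooth_manifold_inj[OF manifold])
lemma base_inj: "inj_atlas M" by (rule smooth_manifold_inj[OF base_manifold])

lemma act_one: "frame_act u (mat 1) = u" by (simp add: frame_act_def)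
lemma act_act: "frame_act (frame_act u g) g' = frame_act u (g ** g')" by (simp add: frame_act_def matrix_mul_assoc)
lemma fst_act: "fst (frame_act u g) = fst u" by (simp add: frame_act_def)

lemma smooth_into_act: "smooth_into P F x \<Longrightarrow> smooth_into AG g x \<Longrightarrow> smooth_into P (\<lambda>x. frame_act (F x) (g x)) x"
  by (rule smooth_into_compose2[OF inj Gr.inj act_smooth])
lemma smooth_into_fst: "smooth_into P F x \<Longrightarrow> smooth_into M (\<lambda>x. fst (F x)) x"
  by (rule smooth_into_compose[OF inj proj_smooth])
lemma smooth_into_frame: "smooth_into P F x \<Longrightarrow> smooth_into (frame_atlas M) F x"
  using smooth_into_compose[OF inj frames_smooth] .

lemma points_sub: "u \<in> points P \<Longrightarrow> fst u \<in> points M" "u \<in> points P \<Longrightarrow> invertible (snd u)"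
  using frames_smooth unfolding smooth_map_def points_frames by auto

lemma smooth_into_point: "u \<in> points P \<Longrightarrow> smooth_into P (\<lambda>x. u) x0"
proof -
  assume "u \<in> points P"
  then obtain U \<phi> where "(U, \<phi>) \<in> P" "u \<in> U" by (rule points_chart)
  then show ?thesis using smooth_intoI[OF manifold, of U \<phi> x0 UNIV "\<lambda>x. u"] by (simp add: smooth_on_const)
qed

lemma act_closed: "u \<in> points P \<Longrightarrow> g \<in> G \<Longrightarrow> frame_act u g \<in> points P"
  using act_smooth unfolding smooth_map_def points_product points_AG by auto

text \<open>\<open>s q\<close> corresponds to \<open>(q, mat 1)\<close> in a local trivialization,
  and \<open>\<psi> u\<close> measures \<open>u\<close> against this section. Smoothness of both is
  stated along maps from Euclidean spaces, the form in which it is applied.\<close>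

lemma local_section:
  assumes p: "p \<in> points M"
  obtains U \<psi> s where "openin (manifold_topology M) U" "p \<in> U"
    "\<And>q. q \<in> U \<Longrightarrow> s q \<in> points P \<and> fst (s q) = q"
    "\<And>u. u \<in> points P \<Longrightarrow> fst u \<in> U \<Longrightarrow> \<psi> u \<in> G \<and> u = frame_act (s (fst u)) (\<psi> u)"
    "\<And>(F :: 'q \<Rightarrow> ('p, 'n) frame) x. smooth_into P F x \<Longrightarrow> fst (F x) \<in> U \<Longrightarrow> smooth_into AG (\<lambda>x. \<psi> (F x)) x"
    "\<And>(f :: 'a::euclidean_space \<Rightarrow> 'p) x. smooth_into M f x \<Longrightarrow> f x \<in> U \<Longrightarrow> smooth_into P (\<lambda>x. s (f x)) x"
proof -
  have "\<forall>p\<in>points M. \<exists>U \<psi>. openin (manifold_topology M) U \<and> p \<in> U \<and>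
        diffeomorphism (restrict_atlas P {u\<in>points P. fst u \<in> U})
          (product_atlas (restrict_atlas M U) AG) (\<lambda>u. (fst u, \<psi> u)) \<and>
        (\<forall>u\<in>points P. \<forall>g\<in>G. fst u \<in> U \<longrightarrow> \<psi> (frame_act u g) = \<psi> u ** g)"
    using pb unfolding principal_bundle_def by (auto simp: mult_GL)
  from bspec[OF this p] obtain U \<psi> where oU: "openin (manifold_topology M) U" and pU: "p \<in> U"
    and dif: "diffeomorphism (restrict_atlas P {u\<in>points P. fst u \<in> U}) (product_atlas (restrict_atlas M U) AG) (\<lambda>u. (fst u, \<psi> u))"
    and eqv: "\<forall>u\<in>points P. \<forall>g\<in>G. fst u \<in> U \<longrightarrow> \<psi> (frame_act u g) = \<psi> u ** g"
    by (elim exE conjE) (rule that)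
  let ?N = "{u\<in>points P. fst u \<in> U}" and ?D = "\<lambda>u. (fst u, \<psi> u)"
  let ?E = "inv_into ?N ?D"
  have UM: "U \<subseteq> points M" using oU unfolding openin_manifold_topology[OF base_manifold] by blast
  have pN: "points (restrict_atlas P ?N) = ?N" by (auto simp: points_restrict)
  have pD: "points (product_atlas (restrict_atlas M U) AG) = U \<times> G"
    using UM by (auto simp: points_restrict points_product points_AG)
  have D: "smooth_map (restrict_atlas P ?N) (product_atlas (restrict_atlas M U) AG) ?D" "bij_betw ?D ?N (U \<times> G)"
    "smooth_map (product_atlas (restrict_atlas M U) AG) (restrict_atlas P ?N) ?E"
    using dif unfolding diffeomorphism_def pN pD by blast+
  define s where "s q = ?E (q, mat 1)" for q
  have s: "s q \<in> points P" "fst (s q) = q" "\<psi> (s q) = mat 1" if "q \<in> U" for q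
  proof -
    have 1: "(q, mat 1) \<in> ?D ` ?N" using D(2) that one_closed unfolding bij_betw_def by auto
    show "s q \<in> points P" "fst (s q) = q" "\<psi> (s q) = mat 1"
      using inv_into_into[OF 1] f_inv_into_f[OF 1] unfolding s_def by auto
  qed
  have G\<psi>: "\<psi> u \<in> G" if "u \<in> points P" "fst u \<in> U" for u using D(2) that unfolding bij_betw_def by auto
  have dec: "u = frame_act (s (fst u)) (\<psi> u)" if u: "u \<in> points P" "fst u \<in> U" for u
  proof -
    let ?v = "frame_act (s (fst u)) (\<psi> u)"
    have v: "?v \<in> points P" "fst ?v = fst u" using s[OF u(2)] act_closed G\<psi>[OF u] by (simp_all add: fst_act)
    have "\<psi> ?v = \<psi> u" using eqv s[OF u(2)] G\<psi>[OF u] u(2) by simp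
    then have "?D u = ?D ?v" using v(2) by simp
    then show ?thesis using D(2) u v unfolding bij_betw_def inj_on_def by (metis (mono_tags, lifting) mem_Collect_eq)
  qed
  have sm\<psi>: "smooth_into AG (\<lambda>x. \<psi> (F x)) x"
    if F: "smooth_into P F x" "fst (F x) \<in> U" for F :: "'q \<Rightarrow> ('p, 'n) frame" and x
  proof -
    obtain S where S: "open S" "x \<in> S" "\<And>y. y \<in> S \<Longrightarrow> fst (F y) \<in> U"
      by (rule smooth_into_openin[OF base_manifold oU smooth_into_fst[OF F(1)] F(2)]) (rule that)
    obtain R where R: "open R" "x \<in> R" "\<And>y. y \<in> R \<Longrightarrow> smooth_into P F y"
      by (rule smooth_into_nbhd[OF manifold F(1)]) (rule that)
    have "smooth_into (restrict_atlas P ?N) F x"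
      by (rule smooth_into_restrict[OF F(1) open_Int[OF S(1) R(1)]])
        (use S(2,3) R(2) smooth_into_points[OF R(3)] in auto)
    from smooth_into_product(2)[OF smooth_into_compose[OF inj_atlas_restrict[OF inj] D(1) this]] show ?thesis by simp
  qed
  have sms: "smooth_into P (\<lambda>x. s (f x)) x"
    if f: "smooth_into M f x" "f x \<in> U" for f :: "'z::euclidean_space \<Rightarrow> 'p" and x
  proof -
    obtain S where S: "open S" "x \<in> S" "\<And>y. y \<in> S \<Longrightarrow> f y \<in> U"
      by (rule smooth_into_openin[OF base_manifold oU f]) (rule that)
    have "smooth_into (product_atlas (restrict_atlas M U) AG) (\<lambda>x. (f x, mat 1)) x"
      by (rule smooth_into_Pair[OF smooth_into_restrict[OF f(1) S] smooth_into_const[OF one_closed]])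
    from smooth_into_unrestrict[OF smooth_into_compose[OF
      inj_atlas_product[OF inj_atlas_restrict[OF base_inj] Gr.inj] D(3) this]] show ?thesis unfolding s_def .
  qed
  have s2: "s q \<in> points P \<and> fst (s q) = q" if "q \<in> U" for q using s(1,2)[OF that] by blast
  have dec2: "\<psi> u \<in> G \<and> u = frame_act (s (fst u)) (\<psi> u)" if "u \<in> points P" "fst u \<in> U" for u
    using G\<psi>[OF that] dec[OF that] by blast
  from that[where U = U and s = s and \<psi> = \<psi>, OF oU pU s2 dec2 sm\<psi> sms] show ?thesis .
qed

lemma fibre_transitive:
  assumes "u \<in> points P" "w \<in> points P" "fst u = fst w"
  shows "\<exists>g\<in>G. w = frame_act u g"
proof -
  obtain U \<psi> s where s: "fst w \<in> U" "\<And>u. u \<in> points P \<Longrightarrow> fst u \<in> U \<Longrightarrow> \<psi> u \<in> G \<and> u = frame_act (s (fst u)) (\<psi> u)"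
    by (rule local_section[OF points_sub(1)[OF assms(2)]]) (rule that)
  have u: "\<psi> u \<in> G" "u = frame_act (s (fst u)) (\<psi> u)" and w: "\<psi> w \<in> G" "w = frame_act (s (fst u)) (\<psi> w)"
    using s(2)[OF assms(1)] s(2)[OF assms(2) s(1)] s(1) assms(3) by auto
  let ?g = "matrix_inv (\<psi> u) ** \<psi> w"
  have g: "?g \<in> G" by (intro mult_closed inverse u w)
  have "frame_act u ?g = frame_act (s (fst u)) (\<psi> u ** ?g)" by (subst u(2)) (rule act_act)
  also have "\<psi> u ** ?g = \<psi> w" by (simp add: matrix_mul_assoc matrix_inv_works invertible[OF u(1)])
  also have "frame_act (s (fst u)) (\<psi> w) = w" using w(2) by simp
  finally have "w = frame_act u ?g" by (rule sym)
  then show ?thesis using g by (intro bexI)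
qed

lemma inj_matrix_mult: "invertible (a :: real^'n^'n) \<Longrightarrow> inj (\<lambda>v :: real^'n^'n. a ** v)"
  by (rule inj_on_inverseI[where g = "\<lambda>v. matrix_inv a ** v"]) (simp add: matrix_mul_assoc matrix_inv_works)

text \<open>Relative to a local section, \<open>F\<close> is given by the matrix function
  \<open>\<psi> (F x)\<close>, which solves a linear equation with smooth coefficients in a chart of
  the base and is therefore smooth. It takes values in \<open>G\<close>, and
  \<open>smooth_into_if_smooth_on\<close> makes it smooth into \<open>G\<close>, although
  \<open>P\<close> and \<open>G\<close> may have finer topologies than the ambient spaces.\<close>

lemma smooth_into_reduction:
  fixes F :: "'a::euclidean_space \<Rightarrow> ('p, 'n) frame"
  assumes F: "smooth_into (frame_atlas M) F x0" and S: "open S" "x0 \<in> S" "\<And>x. x \<in> S \<Longrightarrow> F x \<in> points P"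
  shows "smooth_into P F x0"
proof -
  note fF = smooth_into_frames[OF base_manifold F]
  note p = smooth_into_points[OF fF]
  obtain U \<psi> s where s: "openin (manifold_topology M) U" "fst (F x0) \<in> U"
    "\<And>q. q \<in> U \<Longrightarrow> s q \<in> points P \<and> fst (s q) = q"
    "\<And>u. u \<in> points P \<Longrightarrow> fst u \<in> U \<Longrightarrow> \<psi> u \<in> G \<and> u = frame_act (s (fst u)) (\<psi> u)"
    "\<And>(f :: 'a \<Rightarrow> 'p) x. smooth_into M f x \<Longrightarrow> f x \<in> U \<Longrightarrow> smooth_into P (\<lambda>x. s (f x)) x"
    by (rule local_section[OF p, where 'a = 'a]) (rule that)
  note sF = s(5)[OF fF s(2)]
  obtain R where R: "open R" "x0 \<in> R" "\<And>x. x \<in> R \<Longrightarrow> fst (F x) \<in> U"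
    by (rule smooth_into_openin[OF base_manifold s(1) fF s(2)]) (rule that)
  obtain V \<phi> where V: "(V, \<phi>) \<in> M" "fst (F x0) \<in> V" using p by (rule points_chart)
  have V': "fst (s (fst (F x0))) \<in> V" using s(3)[OF s(2)] V(2) by simp
  obtain T where T: "open T" "x0 \<in> T" "\<And>x. x \<in> T \<Longrightarrow> fst (F x) \<in> V"
    "smooth_on T (\<lambda>x. matrix (chart_diff M \<phi> (fst (F x))) ** snd (F x))"
    by (rule smooth_into_framesD[OF F V]) (rule that)
  obtain T' where T': "open T'" "x0 \<in> T'" "\<And>x. x \<in> T' \<Longrightarrow> invertible (snd (s (fst (F x))))"
    "smooth_on T' (\<lambda>x. matrix (chart_diff M \<phi> (fst (s (fst (F x))))) ** snd (s (fst (F x))))"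
    by (rule smooth_into_framesD[OF smooth_into_frame[OF sF] V(1) V']) (rule that)
  define W where "W = S \<inter> R \<inter> T \<inter> T'"
  have oW: "open W" unfolding W_def by (intro open_Int S R T T')
  have xW: "x0 \<in> W" unfolding W_def using S R T T' by blast
  let ?a = "\<lambda>x. matrix (chart_diff M \<phi> (fst (F x))) ** snd (s (fst (F x)))"
  let ?y = "\<lambda>x. matrix (chart_diff M \<phi> (fst (F x))) ** snd (F x)"
  have dec: "\<psi> (F x) \<in> G" "F x = frame_act (s (fst (F x))) (\<psi> (F x))" if "x \<in> W" for x
    using s(4)[of "F x"] S(3)[of x] R(3)[of x] that unfolding W_def by auto
  have sa: "smooth_on W ?a"
  proof (rule smooth_on_cong[THEN iffD1, OF _ smooth_on_subset[OF T'(4) oW]])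
    show "matrix (chart_diff M \<phi> (fst (s (fst (F x))))) ** snd (s (fst (F x))) = ?a x" if "x \<in> W" for x
      using s(3)[of "fst (F x)"] R(3)[of x] that unfolding W_def by simp
  qed (simp add: W_def)
  have sy: "smooth_on W ?y" by (rule smooth_on_subset[OF T(4) oW]) (auto simp: W_def)
  have inv: "invertible (?a x)" if "x \<in> W" for x
    by (rule invertible_mult[OF invertible_chart_diff[OF base_manifold V(1) T(3)] T'(3)]) (use that in \<open>auto simp: W_def\<close>)
  have sg: "smooth_on W (\<lambda>x. \<psi> (F x))"
  proof (rule smooth_on_solve[where M = "\<lambda>x (v :: real^'n^'n). ?a x ** v"])
    show "linear (\<lambda>v :: real^'n^'n. ?a x ** v)" for x using bilinear_matrix_mult unfolding bilinear_def by blast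
    show "inj (\<lambda>v :: real^'n^'n. ?a x ** v)" if "x \<in> W" for x by (rule inj_matrix_mult[OF inv[OF that]])
    show "smooth_on W (\<lambda>x. ?a x ** v)" for v :: "real^'n^'n" by (rule smooth_on_matrix_mult[OF sa smooth_on_const[OF oW]])
    show "smooth_on W ?y" by (rule sy)
    show "?a x ** \<psi> (F x) = ?y x" if "x \<in> W" for x
    proof -
      have "snd (F x) = snd (s (fst (F x))) ** \<psi> (F x)" using arg_cong[OF dec(2)[OF that], of snd] by (simp add: frame_act_def)
      then show ?thesis by (simp add: matrix_mul_assoc)
    qed
  qed
  have "smooth_into AG (\<lambda>x. \<psi> (F x)) x0" by (rule smooth_into_if_smooth_on[OF sg xW dec(1)])
  from smooth_into_act[OF sF this] show ?thesis
    by (rule smooth_into_cong[OF _ oW xW]) (rule dec(2)[symmetric])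
qed

lemma act_smooth_at: "u \<in> points P \<Longrightarrow> smooth_at AG P (\<lambda>g. frame_act u g) (mat 1)"
  unfolding smooth_at_def
  using smooth_into_act[OF smooth_into_point smooth_into_coord_inv[OF Gr.manifold, of "mat 1"]] by (simp add: points_AG one_closed)

lemma linear_fundamental_vector: "u \<in> points P \<Longrightarrow> linear (fundamental_vector AG P u)"
  unfolding fundamental_vector_def[abs_def] by (rule linear_mderiv[OF Gr.inj act_smooth_at])

lemma fundamental_vector_velocity:
  assumes "u \<in> points P" "smooth_into AG g x0" "g x0 = mat 1"
  shows "velocity P (\<lambda>x. frame_act u (g x)) x0 h = fundamental_vector AG P u (velocity AG g x0 h)"
  unfolding fundamental_vector_def
  using smooth_at_compose(2)[where f = "\<lambda>g. frame_act u g" and F = g, OF Gr.inj _ assms(2)] act_smooth_at[OF assms(1)] assms(3) by simp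

text \<open>Near \<open>u\<close> every frame is \<open>s' (fst w)\<close> acted on by
  \<open>\<theta> w\<close>, where \<open>\<theta> u\<close> is the identity. \<open>\<Psi>\<close>
  separates the two occurrences of the frame \<open>w\<close>: along the first one the velocity
  vanishes because \<open>\<xi>\<close> is vertical, along the second one it is fundamental, and on
  the diagonal it is \<open>\<xi>\<close>.\<close>

lemma vertical_fundamental:
  assumes u: "u \<in> points P" and ker: "mderiv P M fst u \<xi> = 0"
  shows "\<exists>Z. \<xi> = fundamental_vector AG P u Z"
proof -
  obtain U \<psi> s where s: "openin (manifold_topology M) U" "fst u \<in> U"
    "\<And>q. q \<in> U \<Longrightarrow> s q \<in> points P \<and> fst (s q) = q"
    "\<And>u. u \<in> points P \<Longrightarrow> fst u \<in> U \<Longrightarrow> \<psi> u \<in> G \<and> u = frame_act (s (fst u)) (\<psi> u)"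
    "\<And>(F :: 'q \<Rightarrow> ('p, 'n) frame) x. smooth_into P F x \<Longrightarrow> fst (F x) \<in> U \<Longrightarrow> smooth_into AG (\<lambda>x. \<psi> (F x)) x"
    "\<And>(f :: real^'n \<Rightarrow> 'p) x. smooth_into M f x \<Longrightarrow> f x \<in> U \<Longrightarrow> smooth_into P (\<lambda>x. s (f x)) x"
    by (rule local_section[OF points_sub(1)[OF u], where 'a = "real^'n"]) (rule that)
  let ?a = "\<psi> u" and ?\<kappa> = "coord_inv P u" and ?e = "coord P u u"
  have aG: "?a \<in> G" and uu: "u = frame_act (s (fst u)) ?a" using s(4)[OF u s(2)] by blast+
  note ia = inverse(2)[OF aG] matrix_inv_works[OF invertible[OF aG]]
  have \<kappa>e: "?\<kappa> ?e = u" by (rule coord_inv_coord[OF inj u])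
  have s\<kappa>: "smooth_into P ?\<kappa> ?e" by (rule smooth_into_coord_inv[OF manifold u])
  define s' where "s' q = frame_act (s q) ?a" for q
  define \<theta> where "\<theta> w = matrix_inv ?a ** \<psi> w" for w
  have s'u: "s' (fst u) = u" using uu by (simp add: s'_def)
  have \<theta>u: "\<theta> u = mat 1" by (simp add: \<theta>_def ia)
  have sat: "smooth_at M P s' (fst u)" unfolding smooth_at_def s'_def
  proof (intro conjI points_sub(1)[OF u] smooth_into_act smooth_into_const[OF aG])
    show "smooth_into P (\<lambda>x. s (coord_inv M (fst u) x)) (coord M (fst u) (fst u))"
      by (rule s(6)[OF smooth_into_coord_inv[OF base_manifold points_sub(1)[OF u]]])
        (simp add: coord_inv_coord[OF base_inj points_sub(1)[OF u]] s(2))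
  qed
  have f\<kappa>: "smooth_into M (\<lambda>x. fst (?\<kappa> x)) ?e" by (rule smooth_into_fst[OF s\<kappa>])
  have sat': "smooth_at M P s' (fst (?\<kappa> ?e))" by (simp add: \<kappa>e sat)
  note s'\<kappa> = smooth_at_compose[where F = "\<lambda>x. fst (?\<kappa> x)", OF base_inj sat' f\<kappa>]
  have \<theta>\<kappa>: "smooth_into AG (\<lambda>x. \<theta> (?\<kappa> x)) ?e" unfolding \<theta>_def
    by (rule smooth_into_mult[OF smooth_into_const[OF ia(1)] s(5)[OF s\<kappa>]]) (simp add: \<kappa>e s(2))
  obtain R where R: "open R" "?e \<in> R" "\<And>x. x \<in> R \<Longrightarrow> fst (?\<kappa> x) \<in> U"
    by (rule smooth_into_openin[OF base_manifold s(1) f\<kappa>]) (simp add: \<kappa>e s(2), rule that)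
  obtain R' where R': "open R'" "?e \<in> R'" "\<And>x. x \<in> R' \<Longrightarrow> smooth_into P ?\<kappa> x"
    by (rule smooth_into_nbhd[OF manifold s\<kappa>]) (rule that)
  define \<Psi> where "\<Psi> z = frame_act (s' (fst (?\<kappa> (fst z)))) (\<theta> (?\<kappa> (snd z)))" for z :: "'q \<times> 'q"
  have s\<Psi>: "smooth_into P \<Psi> (?e, ?e)" unfolding \<Psi>_def[abs_def]
  proof (rule smooth_into_act)
    show "smooth_into P (\<lambda>z. s' (fst (?\<kappa> (fst z)))) (?e, ?e)"
      by (rule smooth_into_precompose[where g = fst and S = UNIV]) (simp_all add: s'\<kappa> smooth_on_fst smooth_on_ident)
    show "smooth_into AG (\<lambda>z. \<theta> (?\<kappa> (snd z))) (?e, ?e)"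
      by (rule smooth_into_precompose[where g = snd and S = UNIV]) (simp_all add: \<theta>\<kappa> smooth_on_snd smooth_on_ident)
  qed
  have v: "velocity P (\<lambda>x. \<Psi> (L x)) ?e \<xi> = velocity P \<Psi> (?e, ?e) (L' \<xi>)" if "(L has_derivative L') (at ?e)" "L ?e = (?e, ?e)" for L L'
    using velocity_precompose[where F = \<Psi> and g = L and ?x0.0 = ?e, unfolded that(2), OF s\<Psi> that(1)] .
  have v1: "velocity P (\<lambda>x. \<Psi> (x, ?e)) ?e \<xi> = velocity P \<Psi> (?e, ?e) (\<xi>, 0)"
    by (rule v) (auto intro!: derivative_eq_intros)
  have v2: "velocity P (\<lambda>x. \<Psi> (?e, x)) ?e \<xi> = velocity P \<Psi> (?e, ?e) (0, \<xi>)"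
    by (rule v) (auto intro!: derivative_eq_intros)
  have v3: "velocity P (\<lambda>x. \<Psi> (x, x)) ?e \<xi> = velocity P \<Psi> (?e, ?e) (\<xi>, \<xi>)"
    by (rule v) (auto intro!: derivative_eq_intros)
  have RR: "open (R \<inter> R')" "?e \<in> R \<inter> R'" using R R' by auto
  have "\<Psi> (x, x) = ?\<kappa> x" if x: "x \<in> R \<inter> R'" for x
  proof -
    have w: "?\<kappa> x \<in> points P" "fst (?\<kappa> x) \<in> U" using smooth_into_points[OF R'(3)] R(3) x by auto
    show ?thesis using s(4)[OF w] by (simp add: \<Psi>_def s'_def \<theta>_def act_act matrix_mul_assoc ia)
  qed
  from velocity_cong[OF RR this, where B = P] have "velocity P (\<lambda>x. \<Psi> (x, x)) ?e \<xi> = \<xi>"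
    by (simp add: velocity_coord_inv[OF manifold u])
  moreover have "velocity P (\<lambda>x. \<Psi> (x, ?e)) ?e \<xi> = 0"
  proof -
    have "velocity P (\<lambda>x. \<Psi> (x, ?e)) ?e \<xi> = velocity P (\<lambda>x. s' (fst (?\<kappa> x))) ?e \<xi>" by (simp add: \<Psi>_def \<kappa>e \<theta>u act_one)
    also have "\<dots> = mderiv M P s' (fst (?\<kappa> ?e)) (velocity M (\<lambda>x. fst (?\<kappa> x)) ?e \<xi>)" by (rule s'\<kappa>(2))
    also have "velocity M (\<lambda>x. fst (?\<kappa> x)) ?e \<xi> = 0" using ker unfolding mderiv_velocity[OF inj u] .
    finally show ?thesis using linear_0[OF linear_mderiv[OF base_inj sat']] by simp
  qed
  moreover have "velocity P (\<lambda>x. \<Psi> (?e, x)) ?e \<xi> = fundamental_vector AG P u (velocity AG (\<lambda>x. \<theta> (?\<kappa> x)) ?e \<xi>)"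
  proof -
    have "velocity P (\<lambda>x. \<Psi> (?e, x)) ?e \<xi> = velocity P (\<lambda>x. frame_act u (\<theta> (?\<kappa> x))) ?e \<xi>" by (simp add: \<Psi>_def \<kappa>e s'u)
    also have "\<dots> = fundamental_vector AG P u (velocity AG (\<lambda>x. \<theta> (?\<kappa> x)) ?e \<xi>)"
      by (rule fundamental_vector_velocity[OF u \<theta>\<kappa>]) (simp add: \<kappa>e \<theta>u)
    finally show ?thesis .
  qed
  moreover have "velocity P \<Psi> (?e, ?e) (\<xi>, \<xi>) = velocity P \<Psi> (?e, ?e) (\<xi>, 0) + velocity P \<Psi> (?e, ?e) (0, \<xi>)"
    using linear_add[OF linear_velocity[OF s\<Psi>], of "(\<xi>, 0)" "(0, \<xi>)"] by simp
  ultimately show ?thesis using v1 v2 v3 by (intro exI[of _ "velocity AG (\<lambda>x. \<theta> (?\<kappa> x)) ?e \<xi>"]) simp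
qed

end

subsection \<open>Homogeneous spaces\<close>

locale homogeneous = lie_grp K A for K :: "'k monoid" (structure) and A :: "('k, 'e::euclidean_space) atlas" +
  fixes H :: "'k set" and AH :: "('k, 'd::euclidean_space) atlas" and M :: "('k set, 'b::euclidean_space) atlas"
  assumes closed: "closed_lie_subgroup K A H AH" and hom: "homogeneous_space K A H M"
begin

lemma sub: "subgroup H K" and lgH: "lie_group (K\<lparr>carrier := H\<rparr>) AH" and incl_smooth: "smooth_map AH A (\<lambda>x. x)"
  and incl_inj: "x \<in> H \<Longrightarrow> inj (mderiv AH A (\<lambda>x. x) x)"
  and top_H: "manifold_topology AH = subtopology (manifold_topology A) H"
  using closed unfolding closed_lie_subgroup_def lie_subgroup_def by auto

sublocale Hg: lie_grp "K\<lparr>carrier := H\<rparr>" AH by (rule lie_grpI[OF lgH])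

lemma base_manifold: "smooth_manifold M" and base_points: "points M = lcosets H"
  and proj_smooth: "smooth_map A M (\<lambda>a. a <# H)" and proj_surj: "a \<in> carrier K \<Longrightarrow> surj (mderiv A M (\<lambda>a. a <# H) a)"
  using hom unfolding homogeneous_space_def by auto

lemma base_inj: "inj_atlas M" by (rule smooth_manifold_inj[OF base_manifold])

lemma H_carrier: "a \<in> H \<Longrightarrow> a \<in> carrier K" by (rule subgroup.mem_carrier[OF sub])
lemma one_coset: "\<one> <# H = H" by (rule lcos_mult_one[OF subgroup.subset[OF sub]])
lemma mult_coset: "a \<in> carrier K \<Longrightarrow> b \<in> carrier K \<Longrightarrow> translation K a (b <# H) = (a \<otimes> b) <# H"
  unfolding translation_def by (rule lcos_m_assoc[OF subgroup.subset[OF sub]])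
lemma coset_H: "a \<in> H \<Longrightarrow> a <# H = H" by (rule coset_join3[OF H_carrier sub])
lemma coset_eq_H: "a \<in> carrier K \<Longrightarrow> a <# H = H \<Longrightarrow> a \<in> H" using lcos_self[OF _ sub, of a] by simp
lemma base_point: "H \<in> points M" unfolding base_points LCOSETS_def using one_coset by auto

lemma smooth_into_proj: "smooth_into A F x \<Longrightarrow> smooth_into M (\<lambda>x. F x <# H) x"
  by (rule smooth_into_compose[OF inj proj_smooth])

abbreviation "d\<pi> \<equiv> mderiv A M (\<lambda>a. a <# H) \<one>"

lemma proj_smooth_at: "smooth_at A M (\<lambda>a. a <# H) \<one>" by (rule smooth_map_smooth_at[OF manifold proj_smooth one_points])
lemma linear_d\<pi>: "linear d\<pi>" by (rule linear_mderiv[OF inj proj_smooth_at])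

abbreviation "y0 \<equiv> coord M H H"

text \<open>With \<open>R\<close> a right inverse of \<open>d\<pi>\<close>, the map \<open>E x = R (\<pi> x) + (x - R (d\<pi> x))\<close> (in coordinates) has the
  identity as its differential. In the coordinates given by \<open>E\<close> the projection is the linear map \<open>d\<pi>\<close>.\<close>

lemma straightening:
  obtains V g E0 where "open V" "smooth_on V g" "\<And>y. y \<in> V \<Longrightarrow> smooth_into A \<kappa> (g y)"
    "\<And>y. y \<in> V \<Longrightarrow> coord M H (\<kappa> (g y) <# H) = d\<pi> y" "\<And>y. y \<in> V \<Longrightarrow> \<kappa> (g y) <# H \<in> fst (chart_at M H)"
    "E0 \<in> V" "d\<pi> E0 = y0" "g E0 = e0" "(g has_derivative (\<lambda>h. h)) (at E0)"
proof -
  obtain R where R: "linear R" "d\<pi> \<circ> R = id"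
    using linear_surjective_right_inverse[OF linear_d\<pi> proj_surj[OF one_closed]] by blast
  have R': "d\<pi> (R w) = w" for w using fun_cong[OF R(2), of w] by simp
  let ?f = "\<lambda>x. coord M H (\<kappa> x <# H)"
  have s: "smooth_into M (\<lambda>x. \<kappa> x <# H) e0" by (rule smooth_into_proj[OF smooth_\<kappa>])
  have fe: "\<kappa> e0 <# H = H" by (simp add: \<kappa>_e0 one_coset)
  have "\<kappa> e0 <# H \<in> fst (chart_at M H)" using chart_at(2)[OF base_point] by (simp add: fe)
  then obtain S where S: "open S" "e0 \<in> S" "\<And>x. x \<in> S \<Longrightarrow> \<kappa> x <# H \<in> fst (chart_at M H)" "smooth_on S ?f"
    by (rule smooth_intoD[OF s chart_at'[OF base_point]]) (rule that)
  obtain S' where S': "open S'" "e0 \<in> S'" "\<And>x. x \<in> S' \<Longrightarrow> smooth_into A \<kappa> x"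
    by (rule smooth_into_nbhd[OF manifold smooth_\<kappa>]) (rule that)
  define T where "T = S \<inter> S'"
  have oT: "open T" and eT: "e0 \<in> T" using S S' by (auto simp: T_def)
  define E where "E x = R (?f x) + (x - R (d\<pi> x))" for x
  have smE: "smooth_on T E" unfolding E_def[abs_def]
    by (intro smooth_on_add smooth_on_diff smooth_on_linear[OF R(1)] smooth_on_linear[OF linear_d\<pi>] smooth_on_ident oT
        smooth_on_subset[OF S(4) oT]) (simp add: T_def)
  have df: "(?f has_derivative d\<pi>) (at e0)"
    using velocity_works[OF s] unfolding fe mderiv_velocity[OF inj one_points] .
  have bl: "bounded_linear R" "bounded_linear d\<pi>" using R(1) linear_d\<pi> by (simp_all add: linear_conv_bounded_linear)
  have dE: "(E has_derivative (\<lambda>h. R (d\<pi> h) + (h - R (d\<pi> h)))) (at e0)" unfolding E_def[abs_def]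
    by (intro has_derivative_add has_derivative_diff has_derivative_ident bounded_linear.has_derivative[OF bl(1)]
        bounded_linear.has_derivative[OF bl(2)] df)
  then have dE: "(E has_derivative (\<lambda>h. h)) (at e0)" by simp
  have injE: "inj (frechet_derivative E (at e0))" unfolding frechet_derivative_at[OF dE, symmetric] by (rule injI)
  obtain U V g where g: "open U" "e0 \<in> U" "U \<subseteq> T" "open V" "E e0 \<in> V" "\<And>x. x \<in> U \<Longrightarrow> E x \<in> V"
    "\<And>x. x \<in> U \<Longrightarrow> g (E x) = x" "\<And>y. y \<in> V \<Longrightarrow> g y \<in> U" "\<And>y. y \<in> V \<Longrightarrow> E (g y) = y" "smooth_on V g"
    by (rule local_inverse[OF smE eT injE]) (rule that)
  have d\<pi>E: "d\<pi> (E x) = ?f x" for x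
    unfolding E_def by (simp add: linear_add[OF linear_d\<pi>] linear_diff[OF linear_d\<pi>] R')
  have gE: "g (E e0) = e0" by (rule g(7)[OF g(2)])
  have dg: "(g has_derivative frechet_derivative g (at (E e0))) (at (E e0))" by (rule smooth_on_has_derivative[OF g(10,5)])
  have "((\<lambda>x. g (E x)) has_derivative (\<lambda>h. frechet_derivative g (at (E e0)) h)) (at e0)"
    by (rule has_derivative_compose[OF dE dg])
  moreover have "((\<lambda>x. g (E x)) has_derivative (\<lambda>h. h)) (at e0)"
    by (rule has_derivative_transform_within_open[OF has_derivative_ident g(1,2)]) (simp add: g(7))
  ultimately have "(\<lambda>h. frechet_derivative g (at (E e0)) h) = (\<lambda>h. h)" by (rule has_derivative_unique)
  then have dg': "(g has_derivative (\<lambda>h. h)) (at (E e0))" using dg by simp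
  have gT: "g y \<in> S" "g y \<in> S'" if "y \<in> V" for y using g(8)[OF that] g(3) by (auto simp: T_def)
  have c: "coord M H (\<kappa> (g y) <# H) = d\<pi> y" if "y \<in> V" for y using d\<pi>E[of "g y"] g(9)[OF that] by simp
  have d0: "d\<pi> (E e0) = y0" by (simp add: d\<pi>E fe)
  show ?thesis by (rule that[OF g(4) g(10) S'(3)[OF gT(2)] c S(3)[OF gT(1)] g(5) d0 gE dg'])
qed

text \<open>In straightened coordinates the projection is linear, so an affine right inverse of
  \<open>d\<pi>\<close> is a section; the shift \<open>?c\<close> makes it pass through
  \<open>E0\<close> and thus through the identity.\<close>

lemma local_section:
  obtains W \<sigma> where "open W" "y0 \<in> W" "\<sigma> y0 = \<one>" "\<And>y. y \<in> W \<Longrightarrow> smooth_into A \<sigma> y"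
    "\<And>y. y \<in> W \<Longrightarrow> \<sigma> y <# H = coord_inv M H y" "W \<subseteq> coord M H ` fst (chart_at M H)"
proof -
  obtain V g E0 where g: "open V" "smooth_on V g" "\<And>y. y \<in> V \<Longrightarrow> smooth_into A \<kappa> (g y)"
    "\<And>y. y \<in> V \<Longrightarrow> coord M H (\<kappa> (g y) <# H) = d\<pi> y" "\<And>y. y \<in> V \<Longrightarrow> \<kappa> (g y) <# H \<in> fst (chart_at M H)"
    "E0 \<in> V" "d\<pi> E0 = y0" "g E0 = e0"
    by (rule straightening) (rule that)
  obtain R where R: "linear R" "d\<pi> \<circ> R = id"
    using linear_surjective_right_inverse[OF linear_d\<pi> proj_surj[OF one_closed]] by blast
  have R': "d\<pi> (R w) = w" for w using fun_cong[OF R(2), of w] by simp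
  let ?c = "E0 - R y0"
  have dc: "d\<pi> ?c = 0" by (simp add: linear_diff[OF linear_d\<pi>] g(7) R')
  let ?L = "\<lambda>y. R y + ?c"
  have smL: "smooth_on UNIV ?L" by (intro smooth_on_add smooth_on_linear[OF R(1)] smooth_on_ident smooth_on_const open_UNIV)
  define W where "W = ?L -` V"
  have oW: "open W" unfolding W_def
    by (rule continuous_open_vimage[OF g(1) ]) (use smooth_on_continuous_on[OF smL] in \<open>simp add: continuous_on_eq_continuous_at\<close>)
  have y0: "?L y0 = E0" by simp
  have yW: "y0 \<in> W" using g(6) by (simp add: W_def)
  have co: "coord M H (\<kappa> (g (?L y)) <# H) = y" if "y \<in> W" for y
    using g(4)[of "?L y"] that by (simp add: W_def linear_add[OF linear_d\<pi>] R' dc)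
  show ?thesis
  proof (rule that[where \<sigma> = "\<lambda>y. \<kappa> (g (?L y))", OF oW yW])
    show "\<kappa> (g (?L y0)) = \<one>" unfolding y0 g(8) by (rule \<kappa>_e0)
    show "smooth_into A (\<lambda>y. \<kappa> (g (?L y))) y" if y: "y \<in> W" for y
    proof (rule smooth_into_precompose[where g = "\<lambda>y. g (?L y)", OF _ _ y])
      show "smooth_into A \<kappa> (g (?L y))" by (rule g(3)) (use y in \<open>simp add: W_def\<close>)
      show "smooth_on W (\<lambda>y. g (?L y))"
        by (rule smooth_on_compose[OF smooth_on_subset[OF smL oW] g(2)]) (auto simp: W_def)
    qed
    show "\<kappa> (g (?L y)) <# H = coord_inv M H y" if y: "y \<in> W" for y
    proof -
      have "coord_inv M H (coord M H (\<kappa> (g (?L y)) <# H)) = \<kappa> (g (?L y)) <# H"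
        unfolding coord_inv_def[of M] by (rule inj_atlas_inv[OF base_inj chart_at'[OF base_point] g(5)]) (use y in \<open>simp add: W_def\<close>)
      then show ?thesis unfolding co[OF y] by (rule sym)
    qed
    show "W \<subseteq> coord M H ` fst (chart_at M H)"
    proof
      fix y assume y: "y \<in> W"
      show "y \<in> coord M H ` fst (chart_at M H)"
        using imageI[OF g(5)[of "?L y"], of "coord M H"] y unfolding co[OF y] by (simp add: W_def)
    qed
  qed
qed

section \<open>The Lie algebra of the isotropy group\<close>

abbreviation "\<iota> \<equiv> subgroup_algebra_inclusion K A AH"
abbreviation "\<h> \<equiv> subgroup_algebra K A AH"
abbreviation "\<kappa>H \<equiv> coord_inv AH \<one>"
abbreviation "eH \<equiv> coord AH \<one> \<one>"

lemma one_H: "\<one> \<in> points AH" using Hg.one_points by simp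
lemma \<kappa>H_eH: "\<kappa>H eH = \<one>" using Hg.\<kappa>_e0 by simp
lemma smooth_\<kappa>H: "smooth_into AH \<kappa>H eH" using Hg.smooth_\<kappa> by simp
lemma smooth_\<kappa>H': "smooth_into A \<kappa>H eH" by (rule smooth_into_compose[OF Hg.inj incl_smooth smooth_\<kappa>H])
lemma velocity_\<kappa>H: "velocity A \<kappa>H eH Y = \<iota> Y"
  unfolding subgroup_algebra_inclusion_def mderiv_velocity[OF Hg.inj one_H] ..
lemma linear_\<iota>: "linear \<iota>" using linear_velocity[OF smooth_\<kappa>H'] unfolding velocity_\<kappa>H[abs_def] .
lemma inj_\<iota>: "inj \<iota>" using incl_inj[OF subgroup.one_closed[OF sub]] unfolding subgroup_algebra_inclusion_def .

lemma \<kappa>H_nbhd: obtains S where "open S" "eH \<in> S" "\<And>x. x \<in> S \<Longrightarrow> \<kappa>H x \<in> H"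
proof -
  obtain S where S: "open S" "eH \<in> S" "\<And>x. x \<in> S \<Longrightarrow> smooth_into AH \<kappa>H x"
    by (rule smooth_into_nbhd[OF Hg.manifold smooth_\<kappa>H]) (rule that)
  show ?thesis by (rule that[OF S(1,2)]) (use Hg.smooth_into_carrier[OF S(3)] in simp)
qed

lemma subspace_\<h>: "subspace \<h>" unfolding subgroup_algebra_def
  using linear_subspace_image[OF linear_\<iota> subspace_UNIV] .

lemma d\<pi>_\<iota>: "d\<pi> (\<iota> Y) = 0"
proof -
  have *: "smooth_at A M (\<lambda>a. a <# H) (\<kappa>H eH)" by (simp add: \<kappa>H_eH proj_smooth_at)
  obtain S where S: "open S" "eH \<in> S" "\<And>x. x \<in> S \<Longrightarrow> \<kappa>H x \<in> H" by (rule \<kappa>H_nbhd) (rule that)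
  have "velocity M (\<lambda>x. \<kappa>H x <# H) eH Y = velocity M (\<lambda>x. H) eH Y"
    using velocity_cong[OF S(1,2) coset_H[OF S(3)], where B = M] by simp
  also have "\<dots> = 0" unfolding velocity_def by simp
  finally show ?thesis using smooth_at_compose(2)[OF inj * smooth_\<kappa>H', of Y] by (simp add: \<kappa>H_eH velocity_\<kappa>H)
qed

text \<open>In straightened coordinates the line through \<open>E0\<close> in direction
  \<open>X\<close> projects to the base point, which makes it a curve \<open>\<gamma>\<close> in
  \<open>H\<close> with velocity \<open>X\<close>. For \<open>X\<close> to be tangent to
  \<open>H\<close>, this curve has to be differentiable as a curve into \<open>H\<close>;
  \<open>lift_derivative\<close> provides this once it is continuous there.\<close>

lemma ker_d\<pi>:
  assumes X: "d\<pi> X = 0" shows "X \<in> \<h>"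
proof -
  obtain V g E0 where g: "open V" "smooth_on V g" "\<And>y. y \<in> V \<Longrightarrow> smooth_into A \<kappa> (g y)"
    "\<And>y. y \<in> V \<Longrightarrow> coord M H (\<kappa> (g y) <# H) = d\<pi> y" "\<And>y. y \<in> V \<Longrightarrow> \<kappa> (g y) <# H \<in> fst (chart_at M H)"
    "E0 \<in> V" "d\<pi> E0 = y0" "g E0 = e0" "(g has_derivative (\<lambda>h. h)) (at E0)"
    by (rule straightening) (rule that)
  let ?l = "\<lambda>t::real. E0 + t *\<^sub>R X"
  have l0: "?l 0 = E0" by simp
  have sml: "smooth_on UNIV ?l" by (intro smooth_on_add smooth_on_const smooth_on_scaleR smooth_on_ident open_UNIV)
  define T where "T = ?l -` V"
  have oT: "open T" unfolding T_def
    by (rule continuous_open_vimage[OF g(1)]) (use smooth_on_continuous_on[OF sml] in \<open>simp add: continuous_on_eq_continuous_at\<close>)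
  have T0: "0 \<in> T" using g(6) by (simp add: T_def)
  define \<gamma> where "\<gamma> t = \<kappa> (g (?l t))" for t
  have smgl: "smooth_on T (\<lambda>t. g (?l t))" by (rule smooth_on_compose[OF smooth_on_subset[OF sml oT] g(2)]) (auto simp: T_def)
  have s\<gamma>: "smooth_into A \<gamma> t" if t: "t \<in> T" for t unfolding \<gamma>_def[abs_def]
    by (rule smooth_into_precompose[where g = "\<lambda>t. g (?l t)", OF g(3) smgl t]) (use t in \<open>simp add: T_def\<close>)
  have \<gamma>H: "\<gamma> t \<in> H" if t: "t \<in> T" for t
  proof (rule coset_eq_H[OF smooth_into_carrier[OF s\<gamma>[OF t]]])
    have tV: "?l t \<in> V" using t by (simp add: T_def)
    have "coord M H (\<gamma> t <# H) = y0" unfolding \<gamma>_def g(4)[OF tV]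
      by (simp add: linear_add[OF linear_d\<pi>] linear_cmul[OF linear_d\<pi>] X g(7))
    then show "\<gamma> t <# H = H" using base_inj chart_at'[OF base_point] g(5)[OF tV] chart_at(2)[OF base_point]
      unfolding inj_atlas_def inj_on_def \<gamma>_def by blast
  qed
  have \<gamma>0: "\<gamma> 0 = \<one>" by (simp add: \<gamma>_def g(8) \<kappa>_e0)
  let ?Z = "\<lambda>t. coord AH \<one> (\<gamma> t)"
  let ?D = "fst (chart_at AH \<one>)"
  \<comment> \<open>Here the closedness of \<open>H\<close> enters, through the fact that it carries
    the subspace topology: a chart neighbourhood in \<open>H\<close> is cut out by an open set of
    the group, so a curve continuous in the group is continuous in \<open>H\<close>.\<close>
  have near: "\<exists>s. open s \<and> 0 \<in> s \<and> (\<forall>t\<in>s. \<gamma> t \<in> ?D \<and> ?Z t \<in> B)" if B: "open B" "eH \<in> B" for B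
  proof -
    define N where "N = {p \<in> ?D. coord AH \<one> p \<in> B}"
    have "openin (manifold_topology AH) N"
    proof (rule openin_manifold_topologyI[OF Hg.manifold])
      show "N \<subseteq> points AH" unfolding N_def using chart_points[OF chart_at'[OF one_H]] by blast
      fix F :: "'d \<Rightarrow> 'k" and x assume F: "smooth_into AH F x" "F x \<in> N"
      have "F x \<in> ?D" using F(2) by (simp add: N_def)
      then obtain S where S: "open S" "x \<in> S" "\<And>y. y \<in> S \<Longrightarrow> F y \<in> ?D" "smooth_on S (\<lambda>y. coord AH \<one> (F y))"
        by (rule smooth_intoD[OF F(1) chart_at'[OF one_H]]) (rule that)
      show "\<exists>S. open S \<and> x \<in> S \<and> F ` S \<subseteq> N"
        by (intro exI[of _ "S \<inter> (\<lambda>y. coord AH \<one> (F y)) -` B"])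
          (use continuous_open_preimage[OF smooth_on_continuous_on[OF S(4)] S(1) B(1)] S(2,3) F(2) in \<open>auto simp: N_def\<close>)
    qed
    then obtain N' where N': "openin (manifold_topology A) N'" "N = N' \<inter> H" unfolding top_H openin_subtopology by blast
    have "\<one> \<in> N" using chart_at(2)[OF one_H] B(2) by (simp add: N_def)
    then have "\<gamma> 0 \<in> N'" using N'(2) \<gamma>0 by simp
    then obtain S where S: "open S" "0 \<in> S" "\<And>x. x \<in> S \<Longrightarrow> \<gamma> x \<in> N'"
      by (rule smooth_into_openin[OF manifold N'(1) s\<gamma>[OF T0]]) (rule that)
    have "\<gamma> t \<in> N" if "t \<in> S \<inter> T" for t using S(3)[of t] \<gamma>H[of t] that N'(2) by blast
    then show ?thesis using S(1,2) oT T0 by (intro exI[of _ "S \<inter> T"]) (auto simp: N_def)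
  qed
  have contZ: "isCont ?Z 0" unfolding continuous_at_open
  proof (intro allI impI)
    fix B assume "open B \<and> ?Z 0 \<in> B"
    then obtain s where "open s" "0 \<in> s" "\<forall>t\<in>s. \<gamma> t \<in> ?D \<and> ?Z t \<in> B" using near[of B] by (auto simp: \<gamma>0)
    then show "\<exists>s. open s \<and> 0 \<in> s \<and> (\<forall>t\<in>s. ?Z t \<in> B)" by (intro exI[of _ s]) simp
  qed
  obtain S where S: "open S" "0 \<in> S" "\<forall>t\<in>S. \<gamma> t \<in> ?D \<and> ?Z t \<in> UNIV" using near[of UNIV] by (auto simp: \<gamma>0)
  have v\<kappa>: "((\<lambda>z. coord A \<one> (\<kappa>H z)) has_derivative \<iota>) (at (?Z 0))"
    using velocity_works[OF smooth_\<kappa>H'] unfolding \<kappa>H_eH velocity_\<kappa>H[abs_def] \<gamma>0 .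
  have dgl: "((\<lambda>t. g (?l t)) has_derivative (\<lambda>t. t *\<^sub>R X)) (at 0)"
  proof -
    have "(?l has_derivative (\<lambda>t. t *\<^sub>R X)) (at 0)" by (auto intro!: derivative_eq_intros)
    from has_derivative_compose[OF this, of g "\<lambda>h. h"] show ?thesis using g(9) by simp
  qed
  have v\<gamma>: "((\<lambda>t. coord A \<one> (\<gamma> t)) has_derivative (\<lambda>t. t *\<^sub>R X)) (at 0)"
  proof -
    have s0: "smooth_into A \<kappa> (g (?l 0))" by (rule g(3)) (simp add: g(6))
    have "velocity A \<gamma> 0 t = velocity A \<kappa> (g (?l 0)) (t *\<^sub>R X)" for t
      unfolding \<gamma>_def[abs_def] by (rule velocity_precompose[where g = "\<lambda>t. g (?l t)", OF s0 dgl])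
    then have "velocity A \<gamma> 0 = (\<lambda>t. t *\<^sub>R X)" by (simp add: fun_eq_iff g(8) velocity_\<kappa>)
    then show ?thesis using velocity_works[OF s\<gamma>[OF T0]] by (simp add: \<gamma>0)
  qed
  obtain L where L: "linear L" "L \<circ> \<iota> = id" using linear_injective_left_inverse[OF linear_\<iota> inj_\<iota>] by blast
  have L': "L (\<iota> w) = w" for w using fun_cong[OF L(2), of w] by simp
  have \<kappa>Z: "\<kappa>H (?Z t) = \<gamma> t" if "t \<in> S" for t
    unfolding coord_inv_def by (rule inj_atlas_inv[OF Hg.inj chart_at'[OF one_H]]) (use S(3) that in blast)
  have dZ: "(?Z has_derivative (\<lambda>t. L (t *\<^sub>R X))) (at 0)"
    by (rule lift_derivative[where \<sigma> = "\<lambda>z. coord A \<one> (\<kappa>H z)", OF v\<kappa> contZ v\<gamma> S(1,2) _ L(1) L']) (simp add: \<kappa>Z)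
  have "((\<lambda>t. coord A \<one> (\<kappa>H (?Z t))) has_derivative (\<lambda>t. \<iota> (L (t *\<^sub>R X)))) (at 0)"
    by (rule has_derivative_compose[OF dZ v\<kappa>])
  then have "((\<lambda>t. coord A \<one> (\<gamma> t)) has_derivative (\<lambda>t. \<iota> (L (t *\<^sub>R X)))) (at 0)"
    by (rule has_derivative_transform_within_open[OF _ S(1,2)]) (simp add: \<kappa>Z)
  from fun_cong[OF has_derivative_unique[OF v\<gamma> this], of 1] have "X = \<iota> (L X)" by simp
  then show ?thesis unfolding subgroup_algebra_def by (rule range_eqI)
qed

lemma Ad_\<iota>:
  assumes a: "a \<in> H" shows "Ad K A a (\<iota> Y) = \<iota> (Ad (K\<lparr>carrier := H\<rparr>) AH a Y)"
proof -
  have aK: "a \<in> carrier K" by (rule H_carrier[OF a])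
  have cK: "smooth_at A A (\<lambda>x. a \<otimes> x \<otimes> inv a) \<one>" by (rule conj_smooth_at[OF aK])
  have inc: "smooth_at AH A (\<lambda>x. x) \<one>" by (rule smooth_map_smooth_at[OF Hg.manifold incl_smooth one_H])
  have cH: "smooth_at AH AH (\<lambda>x. a \<otimes> x \<otimes> inv a) \<one>"
    using Hg.conj_smooth_at[of a] a by (simp add: m_inv_consistent[OF sub a])
  have c1: "smooth_at AH A (\<lambda>x. x) (a \<otimes> \<one> \<otimes> inv a)" using inc aK by simp
  have "Ad K A a (\<iota> Y) = mderiv AH A (\<lambda>x. a \<otimes> x \<otimes> inv a) \<one> Y"
    using smooth_at_comp(2)[OF Hg.inj inj inc cK] unfolding Ad_def subgroup_algebra_inclusion_def by simp
  also have "\<dots> = mderiv AH A (\<lambda>x. x) \<one> (mderiv AH AH (\<lambda>x. a \<otimes> x \<otimes> inv a) \<one> Y)"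
    using smooth_at_comp(2)[OF Hg.inj Hg.inj cH c1] aK by simp
  finally show ?thesis unfolding Ad_def subgroup_algebra_inclusion_def by (simp add: m_inv_consistent[OF sub a])
qed

text \<open>Along \<open>H\<close> the vectors \<open>Ad a y\<close> stay in \<open>V\<close>, hence
  so does the derivative in \<open>a\<close> at the identity. It is applied to the complement
  \<open>m\<close> and to the isotropy algebra itself.\<close>

lemma bracket_invariant:
  assumes V: "subspace V" "\<And>a. a \<in> H \<Longrightarrow> Ad K A a ` V \<subseteq> V" and x: "x \<in> \<h>" and y: "y \<in> V"
  shows "br x y \<in> V"
proof -
  obtain S where S: "open S" "eH \<in> S" "\<And>x. x \<in> S \<Longrightarrow> \<kappa>H x \<in> H" by (rule \<kappa>H_nbhd) (rule that)
  obtain X where X: "x = \<iota> X" using x unfolding subgroup_algebra_def by blast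
  have "((\<lambda>x. Ad K A (\<kappa>H x) y) has_derivative (\<lambda>h. br (\<iota> h) y)) (at eH)"
    using bracket_derivative_curve[OF smooth_\<kappa>H' \<kappa>H_eH] unfolding velocity_\<kappa>H .
  from has_derivative_in_subspace[OF this S(1,2) V(1), of X] show ?thesis
    using V(2)[OF S(3)] y X by blast
qed

lemma subalgebra_\<h>: "x \<in> \<h> \<Longrightarrow> y \<in> \<h> \<Longrightarrow> br x y \<in> \<h>"
  by (rule bracket_invariant[OF subspace_\<h>]) (auto simp: subgroup_algebra_def Ad_\<iota>)

end

lemma smooth_on_matrix:
  fixes L :: "'a::euclidean_space \<Rightarrow> real^'n \<Rightarrow> real^'m"
  assumes S: "open S" and L: "\<And>v. smooth_on S (\<lambda>x. L x v)"
  shows "smooth_on S (\<lambda>x. matrix (L x))"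
proof -
  have "smooth_on S (\<lambda>x. matrix (L x) \<bullet> b)" if b: "b \<in> Basis" for b
  proof -
    obtain i j where b: "b = axis i (axis j 1)" using b by (auto simp: Basis_vec_def)
    have "matrix (L x) \<bullet> b = L x (axis j 1) \<bullet> axis i 1" for x
      by (simp add: b inner_axis matrix_def)
    then show ?thesis using smooth_on_bounded_linear[OF bounded_linear_inner_left L] by simp
  qed
  then have "smooth_on S (\<lambda>x. \<Sum>b\<in>Basis. (matrix (L x) \<bullet> b) *\<^sub>R b)"
    by (intro smooth_on_sum[OF S] smooth_on_scaleR smooth_on_const[OF S])
  then show ?thesis by (simp only: euclidean_representation)
qed

subsection \<open>Invariant structures on homogeneous spaces\<close>

locale invariant_structure = homogeneous K A H AH M + Pb: g_structure G AG M P
  for K :: "'k monoid" (structure) and A :: "('k, 'e::euclidean_space) atlas"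
    and H :: "'k set" and AH :: "('k, 'd::euclidean_space) atlas"
    and M :: "('k set, real^'n) atlas"
    and G :: "(real^'n^'n) set" and AG :: "(real^'n^'n, 'g::euclidean_space) atlas"
    and P :: "(('k set, 'n) frame, 'q::euclidean_space) atlas" +
  fixes u0 :: "real^'n^'n"
  assumes invariant: "invariant_G_structure K M P" and u0: "(H, u0) \<in> points P"
begin

abbreviation "\<tau> \<equiv> translation K"
abbreviation "lift a \<equiv> frame_lift M (\<tau> a)"
definition "orbit a = lift a (H, u0)"

lemma lift_points: "a \<in> carrier K \<Longrightarrow> u \<in> points P \<Longrightarrow> lift a u \<in> points P"
  using invariant unfolding invariant_G_structure_def by blast

lemma orbit_points: "a \<in> carrier K \<Longrightarrow> orbit a \<in> points P"
  unfolding orbit_def by (rule lift_points[OF _ u0])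

lemma translation_one: "p \<in> points M \<Longrightarrow> \<tau> \<one> p = p"
  unfolding base_points LCOSETS_def using mult_coset[OF one_closed] by auto

lemma translation_mult: "a \<in> carrier K \<Longrightarrow> b \<in> carrier K \<Longrightarrow> p \<in> points M \<Longrightarrow> \<tau> (a \<otimes> b) p = \<tau> a (\<tau> b p)"
  unfolding base_points LCOSETS_def by (auto simp: mult_coset m_assoc)

lemma translation_H: "a \<in> carrier K \<Longrightarrow> \<tau> a H = a <# H" by (simp add: translation_def)

text \<open>The action on the base near the identity and the base point, with coordinates on the
  source side only, so that it is a map from a Euclidean space into \<open>M\<close>.\<close>

definition act_local :: "'e \<times> (real^'n) \<Rightarrow> 'k set" where
  "act_local z = \<tau> (\<kappa> (fst z)) (coord_inv M H (snd z))"

lemma act_local_base: "act_local (e0, y0) = H"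
  by (simp add: act_local_def \<kappa>_e0 coord_inv_coord[OF base_inj base_point] translation_one base_point)

text \<open>With a local section \<open>\<sigma>\<close> of the projection, the action is the
  projection of the product \<open>\<kappa> x \<otimes> \<sigma> y\<close>.\<close>

lemma smooth_act_local: "smooth_into M act_local (e0, y0)"
proof -
  obtain W \<sigma> where W: "open W" "y0 \<in> W" "\<sigma> y0 = \<one>" "\<And>y. y \<in> W \<Longrightarrow> smooth_into A \<sigma> y"
    "\<And>y. y \<in> W \<Longrightarrow> \<sigma> y <# H = coord_inv M H y"
    by (rule local_section) (rule that)
  obtain S where S: "open S" "e0 \<in> S" "\<And>x. x \<in> S \<Longrightarrow> \<kappa> x \<in> carrier K" by (rule Ad_smooth) (rule that)
  have o: "open (S \<times> W)" and z: "(e0, y0) \<in> S \<times> W" using S W by (auto simp: open_Times)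
  have 1: "smooth_into A (\<lambda>z. \<kappa> (fst z)) (e0, y0)"
    by (rule smooth_into_precompose[where g = fst and S = UNIV]) (simp_all add: smooth_\<kappa> smooth_on_fst smooth_on_ident)
  have 2: "smooth_into A (\<lambda>z. \<sigma> (snd z)) (e0, y0)"
    by (rule smooth_into_precompose[where g = snd and S = UNIV]) (simp_all add: W(2,4) smooth_on_snd smooth_on_ident)
  have "(\<kappa> (fst z) \<otimes> \<sigma> (snd z)) <# H = act_local z" if "z \<in> S \<times> W" for z
    using that W(5)[of "snd z"] S(3)[of "fst z"] smooth_into_carrier[OF W(4)[of "snd z"]]
    by (auto simp: act_local_def mult_coset[symmetric])
  then show ?thesis by (rule smooth_into_cong[OF smooth_into_proj[OF smooth_into_mult[OF 1 2]] o z])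
qed

text \<open>The differential of a translation refers to the distinguished charts at \<open>p\<close>
  and at its image, which vary with the point in no regular way. Composing with
  \<open>chart_diff\<close> passes to fixed charts, where it becomes the partial derivative of
  \<open>act_local\<close> and so depends smoothly on the group element and on
  \<open>p\<close>.\<close>

lemma mderiv_translation:
  assumes p: "p \<in> fst (chart_at M H)" and b: "smooth_into M act_local (x, coord M H p)"
  shows "smooth_at M M (\<tau> (\<kappa> x)) p" (is ?sm)
    and "\<And>V \<phi> B h. (V, \<phi>) \<in> M \<Longrightarrow> \<tau> (\<kappa> x) p \<in> V \<Longrightarrow>
      ((\<lambda>s. \<phi> (act_local (x, s))) has_derivative B) (at (coord M H p)) \<Longrightarrow>
      chart_diff M \<phi> (\<tau> (\<kappa> x) p) (mderiv M M (\<tau> (\<kappa> x)) p h) = B (chart_diff M (coord M H) p h)"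
proof -
  let ?c = "coord M H" and ?D = "fst (chart_at M H)" and ?s0 = "coord M p p"
  note ch = chart_at'[OF base_point]
  have pM: "p \<in> points M" by (rule chart_points[OF ch p])
  let ?i = "coord_inv M p"
  have ip: "?i ?s0 = p" by (rule coord_inv_coord[OF base_inj pM])
  have si: "smooth_into M ?i ?s0" by (rule smooth_into_coord_inv[OF base_manifold pM])
  obtain T where T: "open T" "?s0 \<in> T" "\<And>s. s \<in> T \<Longrightarrow> ?i s \<in> ?D" "smooth_on T (\<lambda>s. ?c (?i s))"
    by (rule smooth_intoD[OF si ch]) (simp add: ip p, rule that)
  have eq: "act_local (x, ?c (?i s)) = \<tau> (\<kappa> x) (?i s)" if "s \<in> T" for s
    using inj_atlas_inv[OF base_inj ch T(3)[OF that]] by (simp add: act_local_def coord_inv_def[of M H])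
  have b': "smooth_into M act_local (x, ?c (?i ?s0))" by (simp add: ip b)
  have "smooth_into M (\<lambda>s. act_local (x, ?c (?i s))) ?s0"
    by (rule smooth_into_precompose[where g = "\<lambda>s. (x, ?c (?i s))", OF b' smooth_on_Pair[OF smooth_on_const[OF T(1)] T(4)] T(2)])
  then have sF: "smooth_into M (\<lambda>s. \<tau> (\<kappa> x) (?i s)) ?s0" by (rule smooth_into_cong[OF _ T(1,2) eq])
  then show ?sm unfolding smooth_at_def using pM by simp
  fix V \<phi> B h assume V: "(V, \<phi>) \<in> M" "\<tau> (\<kappa> x) p \<in> V"
    and B: "((\<lambda>s. \<phi> (act_local (x, s))) has_derivative B) (at (?c p))"
  have d1: "((\<lambda>s. \<phi> (\<tau> (\<kappa> x) (?i s))) has_derivative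
      (\<lambda>h. chart_diff M \<phi> (\<tau> (\<kappa> x) p) (mderiv M M (\<tau> (\<kappa> x)) p h))) (at ?s0)"
    using chart_derivative[OF base_manifold V(1) _ sF] V(2) unfolding ip mderiv_velocity[OF base_inj pM] by blast
  have d2: "((\<lambda>s. ?c (?i s)) has_derivative (\<lambda>h. chart_diff M ?c p h)) (at ?s0)"
    using chart_derivative[OF base_manifold ch _ si] p unfolding ip velocity_coord_inv[OF base_manifold pM] by blast
  have B': "((\<lambda>s. \<phi> (act_local (x, s))) has_derivative B) (at (?c (?i ?s0)))" by (simp add: ip B)
  have "((\<lambda>s. \<phi> (act_local (x, ?c (?i s)))) has_derivative (\<lambda>h. B (chart_diff M ?c p h))) (at ?s0)"
    by (rule has_derivative_compose[OF d2 B'])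
  then have "((\<lambda>s. \<phi> (\<tau> (\<kappa> x) (?i s))) has_derivative (\<lambda>h. B (chart_diff M ?c p h))) (at ?s0)"
    by (rule has_derivative_transform_within_open[OF _ T(1,2)]) (simp add: eq)
  from fun_cong[OF has_derivative_unique[OF d1 this]]
  show "chart_diff M \<phi> (\<tau> (\<kappa> x) p) (mderiv M M (\<tau> (\<kappa> x)) p h) = B (chart_diff M ?c p h)" .
qed

text \<open>Joint smoothness in the group element and the frame, near the identity and over the base
  point. It is checked in the charts of the frame bundle and then transferred to \<open>P\<close> by
  \<open>smooth_into_reduction\<close>, as the lifts preserve \<open>P\<close>.\<close>

lemma smooth_into_lift:
  fixes w :: "'a::euclidean_space \<Rightarrow> ('k set, 'n) frame"
  assumes w: "smooth_into P w t0" "fst (w t0) = H" and k: "smooth_into A k t0" "k t0 = \<one>"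
  shows "smooth_into P (\<lambda>t. lift (k t) (w t)) t0"
proof -
  let ?c = "coord M H" and ?D = "fst (chart_at M H)"
  note ch = chart_at'[OF base_point]
  obtain S1 where S1: "open S1" "t0 \<in> S1" "smooth_on S1 (\<lambda>t. coord A \<one> (k t))" "\<And>t. t \<in> S1 \<Longrightarrow> \<kappa> (coord A \<one> (k t)) = k t"
    "\<And>t. t \<in> S1 \<Longrightarrow> k t \<in> carrier K"
    by (rule chart_one[OF k]) (rule that)
  have HD: "fst (w t0) \<in> ?D" using chart_at(2)[OF base_point] by (simp add: w(2))
  obtain S2 where S2: "open S2" "t0 \<in> S2" "\<And>t. t \<in> S2 \<Longrightarrow> fst (w t) \<in> ?D" "smooth_on S2 (\<lambda>t. ?c (fst (w t)))"
    by (rule smooth_intoD[OF Pb.smooth_into_fst[OF w(1)] ch HD]) (rule that)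
  obtain S3 where S3: "open S3" "t0 \<in> S3" "\<And>t. t \<in> S3 \<Longrightarrow> fst (w t) \<in> ?D"
    "smooth_on S3 (\<lambda>t. matrix (chart_diff M ?c (fst (w t))) ** snd (w t))"
    by (rule smooth_into_framesD[OF Pb.smooth_into_frame[OF w(1)] ch HD]) (rule that)
  obtain S4 where S4: "open S4" "t0 \<in> S4" "\<And>t. t \<in> S4 \<Longrightarrow> smooth_into P w t"
    by (rule smooth_into_nbhd[OF Pb.manifold w(1)]) (rule that)
  have inP: "lift (k t) (w t) \<in> points P" if "t \<in> S1 \<inter> S4" for t
    using that S1(5) smooth_into_points[OF S4(3)] by (intro lift_points) auto
  have o14: "open (S1 \<inter> S4)" and t14: "t0 \<in> S1 \<inter> S4" using S1 S4 by auto
  obtain N where N: "open N" "(e0, y0) \<in> N" "\<And>z. z \<in> N \<Longrightarrow> smooth_into M act_local z"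
    by (rule smooth_into_nbhd[OF base_manifold smooth_act_local]) (rule that)
  have base0: "fst (lift (k t0) (w t0)) = H"
    using translation_one[OF base_point] by (simp add: frame_lift_def k(2) w(2))
  have "smooth_into (frame_atlas M) (\<lambda>t. lift (k t) (w t)) t0" unfolding smooth_into_def
  proof (intro conjI allI impI)
    show "lift (k t0) (w t0) \<in> points (frame_atlas M)"
      using Pb.points_sub[OF inP[OF t14]] by (simp add: points_frames mem_Times_iff)
    fix X \<xi> assume X: "(X, \<xi>) \<in> frame_atlas M" "lift (k t0) (w t0) \<in> X"
    then obtain V \<phi> where V: "(V, \<phi>) \<in> M" and X_eq: "X = V \<times> {u. invertible u}"
      "\<xi> = (\<lambda>(p, u). (\<phi> p, matrix (chart_diff M \<phi> p) ** u))" unfolding frame_atlas_def by auto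
    have HV: "H \<in> V" using X(2) base0 unfolding X_eq by (simp add: mem_Times_iff)
    obtain R where R: "open R" "(e0, y0) \<in> R" "\<And>z. z \<in> R \<Longrightarrow> act_local z \<in> V" "smooth_on R (\<lambda>z. \<phi> (act_local z))"
      by (rule smooth_intoD[OF smooth_act_local V]) (simp add: act_local_base HV, rule that)
    let ?z = "\<lambda>t. (coord A \<one> (k t), ?c (fst (w t)))"
    have o12: "open (S1 \<inter> S2)" using S1 S2 by blast
    have smz: "smooth_on (S1 \<inter> S2) ?z"
      by (rule smooth_on_Pair[OF smooth_on_subset[OF S1(3) o12] smooth_on_subset[OF S2(4) o12]]) auto
    define T where "T = ((S1 \<inter> S2) \<inter> ?z -` (R \<inter> N)) \<inter> (S3 \<inter> S4)"
    have oT: "open T" unfolding T_def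
      by (intro open_Int[OF continuous_open_preimage[OF smooth_on_continuous_on[OF smz] o12 open_Int[OF R(1) N(1)]] open_Int[OF S3(1) S4(1)]])
    have tT: "t0 \<in> T" using S1(2) S2(2) S3(2) S4(2) R(2) N(2) by (simp add: T_def k(2) w(2))
    have zT: "smooth_on T ?z" by (rule smooth_on_subset[OF smz oT]) (auto simp: T_def)
    have zR: "?z t \<in> R" "?z t \<in> N" "fst (w t) \<in> ?D" "\<kappa> (fst (?z t)) = k t" if "t \<in> T" for t
      using that S2(3) S1(4) by (auto simp: T_def)
    let ?f = "\<lambda>z. \<phi> (act_local z)"
    define B where "B t v = frechet_derivative ?f (at (?z t)) (0, v)" for t v
    have b_eq: "act_local (?z t) = \<tau> (k t) (fst (w t))" if "t \<in> T" for t
      using inj_atlas_inv[OF base_inj ch zR(3)[OF that]] zR(4)[OF that] by (simp add: act_local_def coord_inv_def[of M H])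
    have Bd: "((\<lambda>s. \<phi> (act_local (fst (?z t), s))) has_derivative B t) (at (?c (fst (w t))))" if "t \<in> T" for t
      unfolding B_def[abs_def] using has_derivative_partial_snd[OF R(4), of "fst (?z t)" "snd (?z t)"] zR(1)[OF that] by simp
    \<comment> \<open>Replaces the differential of the translation by the matrix of
      \<open>B t\<close>, which is taken in fixed charts and varies smoothly with
      \<open>t\<close>.\<close>
    have mat: "matrix (chart_diff M \<phi> (\<tau> (k t) (fst (w t)))) ** (matrix (mderiv M M (\<tau> (k t)) (fst (w t))) ** snd (w t))
        = matrix (B t) ** (matrix (chart_diff M ?c (fst (w t))) ** snd (w t))" if t: "t \<in> T" for t
    proof -
      let ?p = "fst (w t)" and ?q = "\<tau> (k t) (fst (w t))"
      have N': "smooth_into M act_local (fst (?z t), ?c ?p)" using N(3)[OF zR(2)[OF t]] by simp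
      have qV: "?q \<in> V" using R(3)[OF zR(1)[OF t]] b_eq[OF t] by simp
      note md = mderiv_translation[OF zR(3)[OF t] N', unfolded zR(4)[OF t]]
      have l1: "linear (mderiv M M (\<tau> (k t)) ?p)" by (rule linear_mderiv[OF base_inj md(1)])
      have l2: "linear (chart_diff M \<phi> ?q)" by (rule chart_diff_inverse(2)[OF base_manifold V qV])
      have l3: "linear (chart_diff M ?c ?p)" by (rule chart_diff_inverse(2)[OF base_manifold ch zR(3)[OF t]])
      have l4: "linear (B t)" by (rule has_derivative_linear[OF Bd[OF t]])
      have "chart_diff M \<phi> ?q \<circ> mderiv M M (\<tau> (k t)) ?p = B t \<circ> chart_diff M ?c ?p"
        using md(2)[OF V qV Bd[OF t]] by (simp add: fun_eq_iff)
      then have "matrix (chart_diff M \<phi> ?q) ** matrix (mderiv M M (\<tau> (k t)) ?p) = matrix (B t) ** matrix (chart_diff M ?c ?p)"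
        using matrix_compose[OF l1 l2] matrix_compose[OF l3 l4] by simp
      then show ?thesis by (simp add: matrix_mul_assoc)
    qed
    have smB: "smooth_on T (\<lambda>t. B t v)" for v unfolding B_def
      by (rule smooth_on_frechet_derivative_comp[OF R(4) zT _ smooth_on_const[OF oT]]) (use zR(1) in auto)
    have sm2: "smooth_on T (\<lambda>t. matrix (B t) ** (matrix (chart_diff M ?c (fst (w t))) ** snd (w t)))"
      by (rule smooth_on_matrix_mult[OF smooth_on_matrix[OF oT smB] smooth_on_subset[OF S3(4) oT]]) (auto simp: T_def)
    have sm1: "smooth_on T (\<lambda>t. \<phi> (act_local (?z t)))"
      by (rule smooth_on_compose[OF zT R(4)]) (use zR(1) in auto)
    have sm: "smooth_on T (\<lambda>t. \<xi> (lift (k t) (w t)))"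
      by (rule smooth_on_cong[THEN iffD1, OF _ smooth_on_Pair[OF sm1 sm2]]) (simp add: X_eq frame_lift_def mat b_eq)
    have "lift (k t) (w t) \<in> X" if t: "t \<in> T" for t
    proof -
      have "t \<in> S1 \<inter> S4" using t by (auto simp: T_def)
      then show ?thesis using Pb.points_sub(2)[OF inP] R(3)[OF zR(1)[OF t]] b_eq[OF t]
        by (simp add: X_eq mem_Times_iff) (simp add: frame_lift_def)
    qed
    then show "\<exists>S. open S \<and> t0 \<in> S \<and> (\<lambda>t. lift (k t) (w t)) ` S \<subseteq> X \<and> smooth_on S (\<lambda>t. \<xi> (lift (k t) (w t)))"
      using oT tT sm by (intro exI[of _ T]) auto
  qed
  then show ?thesis by (rule Pb.smooth_into_reduction[OF _ o14 t14 inP])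
qed

lemma lift_one:
  assumes "fst u \<in> points M" shows "lift \<one> u = u"
proof -
  have "mderiv M M (\<tau> \<one>) (fst u) = mderiv M M (\<lambda>p. p) (fst u)"
    by (rule mderiv_cong[OF base_manifold assms translation_one])
  also have "\<dots> = (\<lambda>h. h)" unfolding mderiv_velocity[OF base_inj assms] by (rule ext) (rule velocity_coord_inv[OF base_manifold assms])
  finally have "matrix (mderiv M M (\<tau> \<one>) (fst u)) = mat 1" using matrix_id_mat_1 unfolding id_def by simp
  then show ?thesis using translation_one[OF assms] by (simp add: frame_lift_def)
qed

lemma lift_mult:
  assumes ab: "a \<in> carrier K" "b \<in> carrier K" and u: "fst u \<in> points M"
    and sm: "smooth_at M M (\<tau> b) (fst u)" "smooth_at M M (\<tau> a) (\<tau> b (fst u))"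
  shows "lift (a \<otimes> b) u = lift a (lift b u)"
proof -
  have "mderiv M M (\<tau> (a \<otimes> b)) (fst u) = mderiv M M (\<lambda>p. \<tau> a (\<tau> b p)) (fst u)"
    by (rule mderiv_cong[OF base_manifold u translation_mult[OF ab]])
  also have "\<dots> = mderiv M M (\<tau> a) (\<tau> b (fst u)) \<circ> mderiv M M (\<tau> b) (fst u)"
    by (rule ext) (simp add: smooth_at_comp(2)[OF base_inj base_inj sm])
  finally have "matrix (mderiv M M (\<tau> (a \<otimes> b)) (fst u)) =
      matrix (mderiv M M (\<tau> a) (\<tau> b (fst u))) ** matrix (mderiv M M (\<tau> b) (fst u))"
    by (simp add: matrix_compose linear_mderiv[OF base_inj] sm)
  then show ?thesis by (simp add: frame_lift_def translation_mult ab u matrix_mul_assoc)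
qed

lemma orbit_one: "orbit \<one> = (H, u0)" unfolding orbit_def by (rule lift_one) (simp add: base_point)

lemma smooth_orbit: "smooth_into A k t0 \<Longrightarrow> k t0 = \<one> \<Longrightarrow> smooth_into P (\<lambda>t. orbit (k t)) t0"
  unfolding orbit_def by (rule smooth_into_lift[OF Pb.smooth_into_point[OF u0]]) simp_all

text \<open>Cuts a neighbourhood of the identity down until everything required for differentiating
  along orbits holds on it at once. In the multiplicative law two translations have to be
  differentiable, one at \<open>H\<close> and one at the moved point, whence the product
  neighbourhood \<open>Q1 \<times> Q2\<close>.\<close>

lemma orbit_nbhd:
  obtains S where "open S" "e0 \<in> S" "\<And>x. x \<in> S \<Longrightarrow> \<kappa> x \<in> carrier K" "\<And>x. x \<in> S \<Longrightarrow> coord A \<one> (\<kappa> x) = x"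
    "\<And>x. x \<in> S \<Longrightarrow> smooth_into P (\<lambda>x. orbit (\<kappa> x)) x"
    "\<And>x. x \<in> S \<Longrightarrow> smooth_at P P (lift (\<kappa> x)) (H, u0)"
    "\<And>x y. x \<in> S \<Longrightarrow> y \<in> S \<Longrightarrow> orbit (\<kappa> x \<otimes> \<kappa> y) = lift (\<kappa> x) (orbit (\<kappa> y))"
proof -
  let ?o = "(H, u0)" and ?c = "coord M H" and ?D = "fst (chart_at M H)"
  note ch = chart_at'[OF base_point]
  obtain S1 where S1: "open S1" "e0 \<in> S1" "\<And>x. x \<in> S1 \<Longrightarrow> \<kappa> x \<in> carrier K" "\<And>x. x \<in> S1 \<Longrightarrow> coord A \<one> (\<kappa> x) = x"
    by (rule Ad_smooth) (rule that)
  obtain S2 where S2: "open S2" "e0 \<in> S2" "\<And>x. x \<in> S2 \<Longrightarrow> smooth_into P (\<lambda>x. orbit (\<kappa> x)) x"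
    by (rule smooth_into_nbhd[OF Pb.manifold smooth_orbit[OF smooth_\<kappa> \<kappa>_e0]]) (rule that)
  let ?p0 = "coord P ?o ?o"
  have ip: "coord_inv P ?o ?p0 = ?o" by (rule coord_inv_coord[OF Pb.inj u0])
  have "smooth_into P (\<lambda>z. lift (\<kappa> (fst z)) (coord_inv P ?o (snd z))) (e0, ?p0)"
  proof (rule smooth_into_lift)
    show "smooth_into P (\<lambda>z. coord_inv P ?o (snd z)) (e0, ?p0)"
      by (rule smooth_into_precompose[where g = snd and S = UNIV])
        (simp_all add: smooth_into_coord_inv[OF Pb.manifold u0] smooth_on_snd smooth_on_ident)
    show "smooth_into A (\<lambda>z. \<kappa> (fst z)) (e0, ?p0)"
      by (rule smooth_into_precompose[where g = fst and S = UNIV]) (simp_all add: smooth_\<kappa> smooth_on_fst smooth_on_ident)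
  qed (simp_all add: ip \<kappa>_e0)
  then obtain N where N: "open N" "(e0, ?p0) \<in> N" "\<And>z. z \<in> N \<Longrightarrow> smooth_into P (\<lambda>z. lift (\<kappa> (fst z)) (coord_inv P ?o (snd z))) z"
    by (rule smooth_into_nbhd[OF Pb.manifold]) (rule that)
  define S3 where "S3 = (\<lambda>x. (x, ?p0)) -` N"
  have S3: "open S3" "e0 \<in> S3" unfolding S3_def using N(2) by (auto intro!: open_vimage[OF N(1)] continuous_intros)
  have lift_at: "smooth_at P P (lift (\<kappa> x)) ?o" if "x \<in> S3" for x unfolding smooth_at_def
  proof (intro conjI u0)
    have xN: "(x, ?p0) \<in> N" using that by (simp add: S3_def)
    have "smooth_on UNIV (\<lambda>s. (x, s))" by (intro smooth_on_Pair smooth_on_const smooth_on_ident open_UNIV)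
    from smooth_into_precompose[where g = "\<lambda>s. (x, s)" and ?x0.0 = ?p0, OF N(3)[OF xN] this UNIV_I]
    show "smooth_into P (\<lambda>s. lift (\<kappa> x) (coord_inv P ?o s)) ?p0" by simp
  qed
  obtain B where B: "open B" "(e0, y0) \<in> B" "\<And>z. z \<in> B \<Longrightarrow> smooth_into M act_local z"
    by (rule smooth_into_nbhd[OF base_manifold smooth_act_local]) (rule that)
  have so: "smooth_into M (\<lambda>x. fst (orbit (\<kappa> x))) e0" by (rule Pb.smooth_into_fst[OF smooth_orbit[OF smooth_\<kappa> \<kappa>_e0]])
  have o0: "fst (orbit (\<kappa> e0)) = H" by (simp add: \<kappa>_e0 orbit_one)
  obtain S4 where S4: "open S4" "e0 \<in> S4" "\<And>x. x \<in> S4 \<Longrightarrow> fst (orbit (\<kappa> x)) \<in> ?D" "smooth_on S4 (\<lambda>x. ?c (fst (orbit (\<kappa> x))))"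
    by (rule smooth_intoD[OF so ch]) (simp add: o0 chart_at(2)[OF base_point], rule that)
  let ?g = "\<lambda>z. (fst z, ?c (fst (orbit (\<kappa> (snd z)))))"
  have oU: "open (UNIV \<times> S4)" using S4 by (simp add: open_Times)
  have smg: "smooth_on (UNIV \<times> S4) ?g"
    by (intro smooth_on_Pair smooth_on_fst smooth_on_compose[OF smooth_on_snd[OF smooth_on_ident] S4(4)] smooth_on_ident oU) auto
  have oQ: "open ((UNIV \<times> S4) \<inter> ?g -` B)" (is "open ?Q")
    by (rule continuous_open_preimage[OF smooth_on_continuous_on[OF smg] oU B(1)])
  have "(e0, e0) \<in> ?Q" using S4(2) B(2) by (simp add: o0)
  with oQ obtain Q1 Q2 where Q: "open Q1" "open Q2" "(e0, e0) \<in> Q1 \<times> Q2" "Q1 \<times> Q2 \<subseteq> ?Q"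
    by (rule open_prod_elim)
  define S5 where "S5 = (\<lambda>x. (x, y0)) -` B"
  have S5: "open S5" "e0 \<in> S5" unfolding S5_def using B(2) by (auto intro!: open_vimage[OF B(1)] continuous_intros)
  define S where "S = S1 \<inter> S2 \<inter> S3 \<inter> S5 \<inter> Q1 \<inter> Q2"
  have mult: "orbit (\<kappa> x \<otimes> \<kappa> y) = lift (\<kappa> x) (orbit (\<kappa> y))" if "x \<in> S" "y \<in> S" for x y
    unfolding orbit_def
  proof (rule lift_mult)
    have xy: "(x, y) \<in> ?Q" using that Q(4) by (auto simp: S_def)
    have y: "(y, y0) \<in> B" using that by (simp add: S_def S5_def)
    show "\<kappa> x \<in> carrier K" "\<kappa> y \<in> carrier K" using that S1(3) by (auto simp: S_def)
    show "fst ?o \<in> points M" by (simp add: base_point)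
    show "smooth_at M M (\<tau> (\<kappa> y)) (fst ?o)"
      using mderiv_translation(1)[OF chart_at(2)[OF base_point] B(3)[OF y]] by simp
    have f: "fst (orbit (\<kappa> y)) = \<tau> (\<kappa> y) (fst ?o)" by (simp add: orbit_def frame_lift_def)
    have "fst (orbit (\<kappa> y)) \<in> ?D" "(x, ?c (fst (orbit (\<kappa> y)))) \<in> B" using xy S4(3) by auto
    from mderiv_translation(1)[OF this(1) B(3)[OF this(2)]]
    show "smooth_at M M (\<tau> (\<kappa> x)) (\<tau> (\<kappa> y) (fst ?o))" unfolding f .
  qed
  show ?thesis
  proof (rule that[OF _ _ _ _ _ _ mult])
    show "open S" unfolding S_def by (intro open_Int S1 S2 S3 S5 Q)
    show "e0 \<in> S" unfolding S_def using S1 S2 S3 S5 Q(3) by simp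
  qed (auto simp: S_def S1(3,4) S2(3) lift_at)
qed

end

section \<open>The differential of the orbit map and the curvature of the canonical
  connection\<close>

context invariant_structure
begin

abbreviation "u\<^sub>H \<equiv> (H, u0)"
definition "d_orbit = mderiv A P orbit \<one>"
abbreviation "isotropy \<equiv> isotropy_rep K M u\<^sub>H"

lemma orbit_smooth_at: "smooth_at A P orbit \<one>"
  unfolding smooth_at_def using one_points smooth_orbit[OF smooth_\<kappa> \<kappa>_e0] by simp

lemma linear_d_orbit: "linear d_orbit"
  unfolding d_orbit_def by (rule linear_mderiv[OF inj orbit_smooth_at])

lemma d_orbit_velocity: "d_orbit = velocity P (\<lambda>x. orbit (\<kappa> x)) e0"
  unfolding d_orbit_def mderiv_velocity[OF inj one_points] ..

lemma proj_d_orbit: "mderiv P M fst u\<^sub>H (d_orbit X) = d\<pi> X"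
proof -
  have f: "smooth_at P M fst (orbit \<one>)" unfolding orbit_one by (rule smooth_map_smooth_at[OF Pb.manifold Pb.proj_smooth u0])
  have "d\<pi> X = mderiv A M (\<lambda>a. fst (orbit a)) \<one> X"
    by (rule arg_cong[where f = "\<lambda>f. f X", OF mderiv_cong[OF manifold one_points]])
      (simp add: points orbit_def frame_lift_def translation_def)
  also have "\<dots> = mderiv P M fst u\<^sub>H (d_orbit X)"
    using smooth_at_comp(2)[OF inj Pb.inj orbit_smooth_at f] unfolding orbit_one d_orbit_def .
  finally show ?thesis by (rule sym)
qed

text \<open>For \<open>a\<close> in \<open>H\<close> the frame \<open>(H, u0)\<close> and its lift
  both lie in \<open>P\<close> over the same point, so they differ by an element of
  \<open>G\<close>.\<close>

lemma orbit_isotropy: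
  assumes a: "a \<in> H" shows "orbit a = frame_act u\<^sub>H (isotropy a)" and "isotropy a \<in> G"
proof -
  have iu: "invertible u0" using Pb.points_sub(2)[OF u0] by simp
  have \<tau>H: "\<tau> a H = H" using translation_H[OF H_carrier[OF a]] coset_H[OF a] by simp
  show eq: "orbit a = frame_act u\<^sub>H (isotropy a)"
    by (simp add: orbit_def frame_lift_def frame_act_def isotropy_rep_def \<tau>H matrix_mul_assoc matrix_inv_works[OF iu])
  have "fst u\<^sub>H = fst (orbit a)" unfolding eq by (simp add: frame_act_def)
  from Pb.fibre_transitive[OF u0 orbit_points[OF H_carrier[OF a]] this]
  obtain g where g: "g \<in> G" "orbit a = frame_act u\<^sub>H g" by (elim bexE) (rule that)
  have "u0 ** g = u0 ** isotropy a" using g(2) unfolding eq by (simp add: frame_act_def)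
  then have "matrix_inv u0 ** (u0 ** g) = matrix_inv u0 ** (u0 ** isotropy a)" by simp
  then have "g = isotropy a" by (simp add: matrix_mul_assoc matrix_inv_works[OF iu])
  then show "isotropy a \<in> G" using g(1) by simp
qed

text \<open>Derivative along \<open>H\<close> of the relation in \<open>orbit_isotropy\<close>. What
  has to be checked is that \<open>isotropy\<close> is smooth into \<open>G\<close>: its matrix is
  recovered from the frame coordinates of the orbit, and \<open>smooth_into_if_smooth_on\<close>
  lifts it to \<open>G\<close>.\<close>

lemma isotropy_derivative: "d_orbit (\<iota> Y) = fundamental_vector AG P u\<^sub>H (mderiv AH AG isotropy \<one> Y)"
proof -
  let ?c = "coord M H"
  note ch = chart_at'[OF base_point]
  have iu: "invertible u0" using Pb.points_sub(2)[OF u0] by simp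
  obtain S where S: "open S" "eH \<in> S" "\<And>x. x \<in> S \<Longrightarrow> \<kappa>H x \<in> H" by (rule \<kappa>H_nbhd) (rule that)
  have so: "smooth_into P (\<lambda>z. orbit (\<kappa>H z)) eH" by (rule smooth_orbit[OF smooth_\<kappa>H' \<kappa>H_eH])
  have HD: "fst (orbit (\<kappa>H eH)) \<in> fst (chart_at M H)" using chart_at(2)[OF base_point] by (simp add: \<kappa>H_eH orbit_one)
  obtain T where T: "open T" "eH \<in> T" "smooth_on T (\<lambda>z. matrix (chart_diff M ?c (fst (orbit (\<kappa>H z)))) ** snd (orbit (\<kappa>H z)))"
    by (rule smooth_into_framesD[OF Pb.smooth_into_frame[OF so] ch HD]) (rule that)
  have oST: "open (S \<inter> T)" and eST: "eH \<in> S \<inter> T" using S T by auto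
  let ?C = "matrix (chart_diff M ?c H)"
  have iC: "invertible ?C" by (rule invertible_chart_diff[OF base_manifold ch chart_at(2)[OF base_point]])
  have sm: "smooth_on (S \<inter> T) (\<lambda>z. isotropy (\<kappa>H z))"
  proof (rule smooth_on_cong[THEN iffD1])
    show "smooth_on (S \<inter> T) (\<lambda>z. (matrix_inv u0 ** matrix_inv ?C) **
        (matrix (chart_diff M ?c (fst (orbit (\<kappa>H z)))) ** snd (orbit (\<kappa>H z))))"
      by (rule smooth_on_matrix_mult[OF smooth_on_const[OF oST] smooth_on_subset[OF T(3) oST]]) simp
    fix z assume z: "z \<in> S \<inter> T"
    have o: "fst (orbit (\<kappa>H z)) = H" "snd (orbit (\<kappa>H z)) = u0 ** isotropy (\<kappa>H z)"
      using orbit_isotropy(1)[OF S(3)] z by (simp_all add: frame_act_def)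
    have "(matrix_inv u0 ** matrix_inv ?C) ** (?C ** (u0 ** isotropy (\<kappa>H z)))
        = matrix_inv u0 ** ((matrix_inv ?C ** ?C) ** (u0 ** isotropy (\<kappa>H z)))" by (simp only: matrix_mul_assoc)
    also have "\<dots> = isotropy (\<kappa>H z)" by (simp add: matrix_inv_works iC iu matrix_mul_assoc)
    finally show "(matrix_inv u0 ** matrix_inv ?C) ** (matrix (chart_diff M ?c (fst (orbit (\<kappa>H z)))) ** snd (orbit (\<kappa>H z)))
        = isotropy (\<kappa>H z)" unfolding o .
  qed
  have sG: "smooth_into AG (\<lambda>z. isotropy (\<kappa>H z)) eH"
    by (rule Pb.smooth_into_if_smooth_on[OF sm eST]) (use orbit_isotropy(2)[OF S(3)] in simp)
  have "u0 ** isotropy (\<kappa>H eH) = u0"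
    using orbit_isotropy(1)[OF S(3)[OF S(2)]] by (simp add: \<kappa>H_eH orbit_one frame_act_def)
  then have "matrix_inv u0 ** (u0 ** isotropy (\<kappa>H eH)) = matrix_inv u0 ** u0" by simp
  then have i1: "isotropy (\<kappa>H eH) = mat 1" by (simp add: matrix_mul_assoc matrix_inv_works[OF iu])
  have o1: "smooth_at A P orbit (\<kappa>H eH)" by (simp add: \<kappa>H_eH orbit_smooth_at)
  have "d_orbit (\<iota> Y) = velocity P (\<lambda>z. orbit (\<kappa>H z)) eH Y"
    using smooth_at_compose(2)[OF inj o1 smooth_\<kappa>H'] by (simp add: d_orbit_def \<kappa>H_eH velocity_\<kappa>H)
  also have "\<dots> = velocity P (\<lambda>z. frame_act u\<^sub>H (isotropy (\<kappa>H z))) eH Y"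
    by (rule arg_cong[where f = "\<lambda>f. f Y", OF velocity_cong[OF S(1,2)]]) (rule orbit_isotropy(1)[OF S(3)])
  also have "\<dots> = fundamental_vector AG P u\<^sub>H (velocity AG (\<lambda>z. isotropy (\<kappa>H z)) eH Y)"
    by (rule Pb.fundamental_vector_velocity[OF u0 sG i1])
  also have "velocity AG (\<lambda>z. isotropy (\<kappa>H z)) eH = mderiv AH AG isotropy \<one>"
    by (rule mderiv_velocity[OF Hg.inj one_H, symmetric])
  finally show ?thesis .
qed

lemma isotropy_algebra_rep_\<iota>: "isotropy_algebra_rep K A AH M AG u\<^sub>H (\<iota> Y) = mderiv AH AG isotropy \<one> Y"
  unfolding isotropy_algebra_rep_def by (simp add: the_inv_f_f[OF inj_\<iota>])

lemma Lambda_map_d_orbit: "Lambda_map K A M P u\<^sub>H \<omega> X = \<omega> u\<^sub>H (d_orbit X)"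
  unfolding Lambda_map_def d_orbit_def orbit_def[abs_def] ..

text \<open>The pull-back of an invariant connection form along the orbit map is left invariant, whence its
  exterior derivative is computed by the structure equation.\<close>

lemma ext_deriv_orbit:
  fixes \<omega> :: "('k set, 'n) frame \<Rightarrow> 'q \<Rightarrow> 'g"
  assumes form: "smooth_one_form P \<omega>" and invf: "invariant_form K M P \<omega>"
  shows "ext_deriv P \<omega> u\<^sub>H (d_orbit X) (d_orbit Y) = - \<omega> u\<^sub>H (d_orbit (br X Y))"
proof -
  let ?U = "fst (chart_at P u\<^sub>H)" and ?\<phi> = "coord P u\<^sub>H"
  let ?W = "form_in_chart P ?U ?\<phi> \<omega>" and ?q = "coord P u\<^sub>H u\<^sub>H"
  note ch = chart_at'[OF u0]
  define p where "p x = ?\<phi> (orbit (\<kappa> x))" for x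
  have so: "smooth_into P (\<lambda>x. orbit (\<kappa> x)) e0" by (rule smooth_orbit[OF smooth_\<kappa> \<kappa>_e0])
  have o0: "orbit (\<kappa> e0) = u\<^sub>H" by (simp add: \<kappa>_e0 orbit_one)
  have pe: "p e0 = ?q" by (simp add: p_def o0)
  obtain S where S: "open S" "e0 \<in> S" "\<And>x. x \<in> S \<Longrightarrow> \<kappa> x \<in> carrier K" "\<And>x. x \<in> S \<Longrightarrow> coord A \<one> (\<kappa> x) = x"
    "\<And>x. x \<in> S \<Longrightarrow> smooth_into P (\<lambda>x. orbit (\<kappa> x)) x"
    "\<And>x. x \<in> S \<Longrightarrow> smooth_at P P (lift (\<kappa> x)) u\<^sub>H"
    "\<And>x y. x \<in> S \<Longrightarrow> y \<in> S \<Longrightarrow> orbit (\<kappa> x \<otimes> \<kappa> y) = lift (\<kappa> x) (orbit (\<kappa> y))"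
    by (rule orbit_nbhd) (rule that)
  obtain S' where S': "open S'" "e0 \<in> S'" "\<And>x. x \<in> S' \<Longrightarrow> orbit (\<kappa> x) \<in> ?U" "smooth_on S' (\<lambda>x. ?\<phi> (orbit (\<kappa> x)))"
    by (rule smooth_intoD[OF so ch]) (simp add: o0 chart_at(2)[OF u0], rule that)
  have smp: "smooth_on S' p" unfolding p_def[abs_def] by (rule S'(4))
  let ?Dp = "\<lambda>x. frechet_derivative p (at x)"
  have dp: "(p has_derivative ?Dp x) (at x)" if "x \<in> S'" for x by (rule smooth_on_has_derivative[OF smp that])
  have Dp0: "?Dp e0 = d_orbit" unfolding d_orbit_velocity velocity_def o0 p_def[abs_def] ..
  obtain T where T: "open T" "(e0, e0) \<in> T" "smooth_on T \<mu>" "\<And>z. z \<in> T \<Longrightarrow> \<kappa> (\<mu> z) = \<kappa> (fst z) \<otimes> \<kappa> (snd z)"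
    by (rule \<mu>_smooth) (rule that)
  \<comment> \<open>\<open>?\<nu> Y\<close> is the left invariant vector field with value
    \<open>Y\<close> at the identity, in the chart.\<close>
  let ?\<nu> = "\<lambda>Y x. frechet_derivative \<mu> (at (x, e0)) (0, Y)"
  define Z where "Z = S \<inter> S' \<inter> (\<lambda>x. (x, e0)) -` T"
  have "open ((\<lambda>x. (x, e0)) -` T)" by (rule open_vimage[OF T(1)]) (intro continuous_intros)
  then have oZ: "open Z" unfolding Z_def using S(1) S'(1) by (simp add: open_Int)
  have eZ: "e0 \<in> Z" using S(2) S'(2) T(2) by (simp add: Z_def)
  \<comment> \<open>Under the orbit map, left multiplication corresponds to the lift of a
    translation, which preserves \<open>\<omega>\<close>; hence the pulled-back form is constant on
    left invariant fields.\<close>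
  have left_invariant: "?W (p x) (?Dp x (?\<nu> Y x)) = \<omega> u\<^sub>H (d_orbit Y)" if x: "x \<in> Z" for x Y
  proof -
    have xS: "x \<in> S" "x \<in> S'" and xT: "(x, e0) \<in> T" using x by (auto simp: Z_def)
    let ?F = "\<lambda>y. lift (\<kappa> x) (orbit (\<kappa> y))"
    have F0: "?F e0 = orbit (\<kappa> x)" unfolding o0 by (simp add: orbit_def)
    have FU: "?F e0 \<in> ?U" unfolding F0 by (rule S'(3)[OF xS(2)])
    have l0: "smooth_at P P (lift (\<kappa> x)) (orbit (\<kappa> e0))" unfolding o0 by (rule S(6)[OF xS(1)])
    note F = smooth_at_compose[where F = "\<lambda>y. orbit (\<kappa> y)", OF Pb.inj l0 so]
    have inv: "\<omega> (?F e0) (velocity P ?F e0 Y) = \<omega> u\<^sub>H (d_orbit Y)"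
      using invf u0 S(3)[OF xS(1)] unfolding F(2) invariant_form_def o0 d_orbit_velocity by blast
    define Q where "Q = S \<inter> (\<lambda>y. (x, y)) -` T"
    have "open ((\<lambda>y. (x, y)) -` T)" by (rule open_vimage[OF T(1)]) (intro continuous_intros)
    then have oQ: "open Q" and eQ: "e0 \<in> Q" unfolding Q_def using S(1,2) xT by (auto simp: open_Int)
    have \<mu>x: "\<mu> (x, e0) = x" using S(3,4)[OF xS(1)] by (simp add: \<mu>_def \<kappa>_e0)
    have "((\<lambda>y. p (\<mu> (x, y))) has_derivative (\<lambda>h. ?Dp x (?\<nu> h x))) (at e0)"
      by (rule has_derivative_compose[OF has_derivative_partial_snd[OF T(3) xT]]) (simp add: \<mu>x dp[OF xS(2)])
    then have D: "((\<lambda>y. ?\<phi> (?F y)) has_derivative (\<lambda>h. ?Dp x (?\<nu> h x))) (at e0)"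
    proof (rule has_derivative_transform_within_open[OF _ oQ eQ])
      fix y assume y: "y \<in> Q"
      show "p (\<mu> (x, y)) = ?\<phi> (?F y)"
        using T(4)[of "(x, y)"] S(7)[OF xS(1), of y] y by (simp add: p_def Q_def)
    qed
    from form_in_chart_velocity[OF Pb.manifold ch FU F(1) D, of \<omega> Y] show ?thesis
      unfolding inv unfolding F0 p_def .
  qed
  have \<nu>0: "?\<nu> Y e0 = Y" for Y
    using fun_cong[OF has_derivative_unique[OF has_derivative_partial_snd[OF T(3,2)] \<mu>_partial(2)]] .
  have d\<nu>: "((\<lambda>x. ?\<nu> Y x) has_derivative (\<lambda>h. mixed h Y)) (at e0)" for Y
    unfolding mixed_def by (rule has_derivative_partial_fst[OF smooth_on_frechet_derivative[OF T(3)] T(2)])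
  let ?D2 = "\<lambda>h v. frechet_derivative (\<lambda>x. ?Dp x v) (at e0) h"
  have lp: "linear (?Dp x)" if "x \<in> Z" for x using has_derivative_linear[OF dp] that by (auto simp: Z_def)
  have du: "((\<lambda>x. ?Dp x (?\<nu> Y x)) has_derivative (\<lambda>h. ?Dp e0 (mixed h Y) + ?D2 h (?\<nu> Y e0))) (at e0)" for Y
    by (rule has_derivative_family[where M = "\<lambda>x v. ?Dp x v", OF oZ eZ lp _ d\<nu>])
      (assumption, rule smooth_on_has_derivative[OF smooth_on_frechet_derivative[OF smp] S'(2)])
  have smW: "smooth_on (?\<phi> ` ?U) (\<lambda>y. ?W y w)" for w using form ch unfolding smooth_one_form_def by blast
  have linW: "linear (?W q)" if q: "q \<in> ?\<phi> ` ?U" for q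
  proof -
    let ?i = "inv_into ?U ?\<phi>"
    have si: "smooth_into P ?i q" by (rule smooth_into_chart_inv[OF Pb.manifold ch q])
    have "linear (\<omega> (?i q))" using form smooth_into_points[OF si] unfolding smooth_one_form_def by blast
    moreover have "?W q = \<omega> (?i q) \<circ> velocity P ?i q"
      by (simp add: fun_eq_iff form_in_chart_def velocity_def Let_def o_def)
    ultimately show ?thesis using linear_compose[OF linear_velocity[OF si]] by simp
  qed
  have pU: "p x \<in> ?\<phi> ` ?U" if "x \<in> Z" for x using S'(3) that unfolding p_def Z_def by blast
  let ?DW = "\<lambda>w. frechet_derivative (\<lambda>y. ?W y w) (at ?q)"
  have dW: "((\<lambda>x. ?W (p x) w) has_derivative (\<lambda>h. ?DW w (?Dp e0 h))) (at e0)" for w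
  proof (rule has_derivative_compose[OF dp[OF S'(2)]])
    show "((\<lambda>y. ?W y w) has_derivative ?DW w) (at (p e0))"
      unfolding pe by (rule smooth_on_has_derivative[OF smW]) (use pU[OF eZ] pe in simp)
  qed
  have "((\<lambda>x. ?W (p x) (?Dp x (?\<nu> Y x))) has_derivative
      (\<lambda>h. ?W (p e0) (?Dp e0 (mixed h Y) + ?D2 h (?\<nu> Y e0)) + ?DW (?Dp e0 (?\<nu> Y e0)) (?Dp e0 h))) (at e0)" for Y
    by (rule has_derivative_family[where M = "\<lambda>x v. ?W (p x) v" and M' = "\<lambda>h w. ?DW w (?Dp e0 h)", OF oZ eZ linW[OF pU] dW du]) assumption
  then have "((\<lambda>x. \<omega> u\<^sub>H (d_orbit Y)) has_derivative
      (\<lambda>h. ?W ?q (d_orbit (mixed h Y) + ?D2 h Y) + ?DW (d_orbit Y) (d_orbit h))) (at e0)" for Y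
    unfolding \<nu>0 pe Dp0 by (rule has_derivative_transform_within_open[OF _ oZ eZ]) (rule left_invariant)
  from fun_cong[OF has_derivative_unique[OF this has_derivative_const]]
  have zero: "?W ?q (d_orbit (mixed X Y) + ?D2 X Y) + ?DW (d_orbit Y) (d_orbit X) = 0" for X Y .
  \<comment> \<open>The second derivatives of \<open>p\<close> cancel when the relations
    \<open>zero\<close> for \<open>(X, Y)\<close> and \<open>(Y, X)\<close> are subtracted. What
    survives is the difference of the mixed derivatives of \<open>\<mu>\<close>, that is, the
    bracket.\<close>
  have sym: "?D2 X Y = ?D2 Y X" by (rule mixed_derivative_symmetric[OF smp S'(2)])
  have lW: "linear (?W ?q)" using linW[OF pU[OF eZ]] unfolding pe .
  have W\<omega>: "?W ?q w = \<omega> u\<^sub>H w" for w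
  proof -
    have iq: "inv_into ?U ?\<phi> ?q = u\<^sub>H" by (rule inj_atlas_inv[OF Pb.inj ch chart_at(2)[OF u0]])
    have "frechet_derivative (coord P u\<^sub>H \<circ> inv_into ?U ?\<phi>) (at ?q) w = velocity P (coord_inv P u\<^sub>H) ?q w"
      unfolding velocity_def coord_inv_coord[OF Pb.inj u0] by (simp add: coord_inv_def o_def)
    then show ?thesis by (simp add: form_in_chart_def iq velocity_coord_inv[OF Pb.manifold u0])
  qed
  have "?DW (d_orbit Y) (d_orbit X) - ?DW (d_orbit X) (d_orbit Y)
      = ?W ?q (d_orbit (mixed Y X) + ?D2 Y X) - ?W ?q (d_orbit (mixed X Y) + ?D2 X Y)"
    using zero[of X Y] zero[of Y X] by (simp add: algebra_simps add_eq_0_iff)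
  also have "\<dots> = - ?W ?q (d_orbit (mixed X Y) - d_orbit (mixed Y X))"
    unfolding sym by (simp add: linear_add[OF lW] linear_diff[OF lW])
  also have "d_orbit (mixed X Y) - d_orbit (mixed Y X) = d_orbit (br X Y)"
    unfolding bracket_mixed by (simp add: linear_diff[OF linear_d_orbit])
  finally show ?thesis unfolding ext_deriv_def Let_def W\<omega> .
qed

theorem fat_at_iff:
  assumes can: "canonical_connection K A M m G AG P u\<^sub>H \<omega>"
    and red: "reductive_decomposition K A H \<h> m"
    and nd: "nondegenerate_on \<h> (killing_form br)" and rank: "lie_rank br UNIV = lie_rank br \<h>"
    and v: "linear v" and Xv: "X\<^sub>v \<in> \<h>"
    and dual: "\<And>Y. Y \<in> \<h> \<Longrightarrow> killing_form br X\<^sub>v Y = v (isotropy_algebra_rep K A AH M AG u\<^sub>H Y)"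
  shows "fat_at AG P \<omega> u\<^sub>H v \<longleftrightarrow> nondegenerate_on m (\<lambda>X Y. killing_form br X\<^sub>v (br X Y))"
proof -
  interpret L: lie_algebra br by (rule lie_algebra)
  have form: "smooth_one_form P \<omega>" and invf: "invariant_form K M P \<omega>"
    and fund: "\<And>Z. \<omega> u\<^sub>H (fundamental_vector AG P u\<^sub>H Z) = Z" and \<Lambda>m: "\<And>X. X \<in> m \<Longrightarrow> \<omega> u\<^sub>H (d_orbit X) = 0"
    using can u0 unfolding canonical_connection_def connection_form_def Lambda_map_d_orbit by blast+
  have lin\<omega>: "linear (\<omega> u\<^sub>H)" using form u0 unfolding smooth_one_form_def by blast
  have subm: "subspace m" and hm: "\<h> \<inter> m = {0}" and Adm: "\<And>a. a \<in> H \<Longrightarrow> Ad K A a ` m \<subseteq> m"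
    using red unfolding reductive_decomposition_def by blast+
  have dec: "\<exists>a\<in>\<h>. \<exists>b\<in>m. X = a + b" for X
  proof -
    have "X \<in> {x + y | x y. x \<in> \<h> \<and> y \<in> m}" using red unfolding reductive_decomposition_def by simp
    then show ?thesis by blast
  qed
  have d\<pi>h: "d\<pi> a = 0" if "a \<in> \<h>" for a using that d\<pi>_\<iota> unfolding subgroup_algebra_def by blast
  have orth: "killing_form br u w = 0" if "u \<in> \<h>" "w \<in> m" for u w
  proof (rule L.equal_rank_orthogonal[OF _ subm hm _ nd rank conjugates_open that])
    show "L.subalgebra \<h>" unfolding L.subalgebra_def using subspace_\<h> subalgebra_\<h> by blast
    show "br x y \<in> m" if "x \<in> \<h>" "y \<in> m" for x y by (rule bracket_invariant[OF subm Adm that])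
  qed
  have \<omega>h: "\<omega> u\<^sub>H (d_orbit a) = isotropy_algebra_rep K A AH M AG u\<^sub>H a" if a: "a \<in> \<h>" for a
  proof -
    obtain Y where "a = \<iota> Y" using a unfolding subgroup_algebra_def by blast
    then show ?thesis by (simp add: isotropy_derivative fund isotropy_algebra_rep_\<iota>)
  qed
  have hor: "d_orbit X \<in> horizontal \<omega> u\<^sub>H" if "X \<in> m" for X using \<Lambda>m[OF that] by (simp add: horizontal_def)
  have curv: "v (curvature_form AG P \<omega> u\<^sub>H (d_orbit X) (d_orbit Y)) = - killing_form br X\<^sub>v (br X Y)"
    if XY: "X \<in> m" "Y \<in> m" for X Y
  proof -
    have hp: "horizontal_part AG P \<omega> u\<^sub>H (d_orbit Z) = d_orbit Z" if "Z \<in> m" for Z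
      by (simp add: horizontal_part_def \<Lambda>m[OF that] linear_0[OF Pb.linear_fundamental_vector[OF u0]])
    \<comment> \<open>The \<open>m\<close>-component \<open>b\<close> of the bracket drops out on
      both sides: \<open>\<omega>\<close> vanishes on \<open>d_orbit b\<close>, and \<open>b\<close>
      is orthogonal to \<open>X\<^sub>v\<close>.\<close>
    obtain a b where ab: "a \<in> \<h>" "b \<in> m" "br X Y = a + b" using dec[of "br X Y"] by blast
    have "\<omega> u\<^sub>H (d_orbit (br X Y)) = isotropy_algebra_rep K A AH M AG u\<^sub>H a"
      unfolding ab(3) by (simp add: linear_add[OF linear_d_orbit] linear_add[OF lin\<omega>] \<omega>h ab \<Lambda>m)
    then have "v (\<omega> u\<^sub>H (d_orbit (br X Y))) = killing_form br X\<^sub>v a" using dual[OF ab(1)] by simp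
    also have "\<dots> = killing_form br X\<^sub>v (br X Y)" unfolding ab(3) L.KF_add_right orth[OF Xv ab(2)] by simp
    finally show ?thesis
      unfolding curvature_form_def hp[OF XY(1)] hp[OF XY(2)] ext_deriv_orbit[OF form invf] by (simp add: linear_neg[OF v])
  qed
  have projl: "linear (mderiv P M fst u\<^sub>H)"
    by (rule linear_mderiv[OF Pb.inj smooth_map_smooth_at[OF Pb.manifold Pb.proj_smooth u0]])
  \<comment> \<open>Subtracting \<open>d_orbit b\<close> for some \<open>b\<close> in
    \<open>m\<close> with the same projection leaves a vertical, hence fundamental, vector. Since
    \<open>\<omega>\<close> vanishes on it and recovers its generator, nothing is left.\<close>
  have onto: "\<exists>X\<in>m. \<xi> = d_orbit X" if \<xi>: "\<xi> \<in> horizontal \<omega> u\<^sub>H" for \<xi>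
  proof -
    obtain X where X: "d\<pi> X = mderiv P M fst u\<^sub>H \<xi>" using surjD[OF proj_surj[OF one_closed], of "mderiv P M fst u\<^sub>H \<xi>"] by (elim exE) (rule that, rule sym)
    obtain a b where ab: "a \<in> \<h>" "b \<in> m" "X = a + b" using dec[of X] by blast
    have "d\<pi> b = mderiv P M fst u\<^sub>H \<xi>" using X d\<pi>h[OF ab(1)] by (simp add: ab(3) linear_add[OF linear_d\<pi>])
    then have "mderiv P M fst u\<^sub>H (\<xi> - d_orbit b) = 0" by (simp add: linear_diff[OF projl] proj_d_orbit)
    from Pb.vertical_fundamental[OF u0 this] obtain Z where Z: "\<xi> - d_orbit b = fundamental_vector AG P u\<^sub>H Z" by (elim exE)
    have "Z = \<omega> u\<^sub>H (\<xi> - d_orbit b)" unfolding Z fund ..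
    also have "\<dots> = 0" using \<xi> \<Lambda>m[OF ab(2)] by (simp add: linear_diff[OF lin\<omega>] horizontal_def)
    finally have "\<xi> = d_orbit b" using Z by (simp add: linear_0[OF Pb.linear_fundamental_vector[OF u0]])
    then show ?thesis using ab(2) by blast
  qed
  \<comment> \<open>The kernel of \<open>d\<pi>\<close> is the isotropy algebra, which meets
    \<open>m\<close> only in 0.\<close>
  have inj_m: "X = 0" if "X \<in> m" "d_orbit X = 0" for X
  proof -
    have "d\<pi> X = 0" using proj_d_orbit[of X] that(2) linear_0[OF projl] by simp
    then have "X \<in> \<h> \<inter> m" using ker_d\<pi> that(1) by simp
    then show ?thesis unfolding hm by simp
  qed
  have d0: "d_orbit 0 = 0" by (rule linear_0[OF linear_d_orbit])
  show ?thesis unfolding fat_at_def nondegenerate_on_def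
  proof (intro iffI ballI impI)
    fix X assume f: "\<forall>x\<in>horizontal \<omega> u\<^sub>H. (\<forall>y\<in>horizontal \<omega> u\<^sub>H. v (curvature_form AG P \<omega> u\<^sub>H x y) = 0) \<longrightarrow> x = 0"
      and X: "X \<in> m" "\<forall>Y\<in>m. killing_form br X\<^sub>v (br X Y) = 0"
    have "v (curvature_form AG P \<omega> u\<^sub>H (d_orbit X) y) = 0" if y: "y \<in> horizontal \<omega> u\<^sub>H" for y
    proof -
      obtain Y where "Y \<in> m" "y = d_orbit Y" using onto[OF y] by (elim bexE) (rule that)
      then show ?thesis using curv[OF X(1)] X(2) by simp
    qed
    then have "d_orbit X = 0" using bspec[OF f hor[OF X(1)]] by simp
    then show "X = 0" by (rule inj_m[OF X(1)])
  next
    fix \<xi> assume f: "\<forall>x\<in>m. (\<forall>y\<in>m. killing_form br X\<^sub>v (br x y) = 0) \<longrightarrow> x = 0"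
      and \<xi>: "\<xi> \<in> horizontal \<omega> u\<^sub>H" "\<forall>y\<in>horizontal \<omega> u\<^sub>H. v (curvature_form AG P \<omega> u\<^sub>H \<xi> y) = 0"
    obtain X where X: "X \<in> m" "\<xi> = d_orbit X" using onto[OF \<xi>(1)] by blast
    have "killing_form br X\<^sub>v (br X Y) = 0" if "Y \<in> m" for Y using bspec[OF \<xi>(2) hor[OF that]] curv[OF X(1) that] X(2) by simp
    then have "X = 0" using f X(1) by blast
    then show "\<xi> = 0" using X(2) d0 by simp
  qed
qed

end

theorem theorem9:
  fixes K :: "'k monoid" and AK :: "('k, 'e::euclidean_space) atlas"
    and H :: "'k set" and AH :: "('k, 'd::euclidean_space) atlas"
    and M :: "('k set, real^'n::finite) atlas"
    and m :: "'e set"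
    and G :: "(real^'n^'n) set" and AG :: "(real^'n^'n, 'g::euclidean_space) atlas"
    and P :: "(('k set, 'n) frame, 'q::euclidean_space) atlas"
    and u\<^sub>o :: "real^'n^'n"
    and \<omega> :: "('k set, 'n) frame \<Rightarrow> 'q \<Rightarrow> 'g"
    and v :: "'g \<Rightarrow> real"
    and X\<^sub>v :: 'e
  defines "br \<equiv> lie_bracket K AK"
    and "B \<equiv> killing_form (lie_bracket K AK)"
    and "h \<equiv> subgroup_algebra K AK AH"
    and "lam \<equiv> isotropy_algebra_rep K AK AH M AG (H, u\<^sub>o)"
  assumes "lie_group K AK" and "connected_space (manifold_topology AK)" and "semisimple br"
    and "closed_lie_subgroup K AK H AH"
    and "homogeneous_space K AK H M"
    and "reductive_decomposition K AK H h m"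
    and "G_structure M G AG P" and "invariant_G_structure K M P"
    and "(H, u\<^sub>o) \<in> points P"
    and "inj_on (isotropy_rep K M (H, u\<^sub>o)) H"
    and "nondegenerate_on h B"
    and "lie_rank br UNIV = lie_rank br h"
    and "canonical_connection K AK M m G AG P (H, u\<^sub>o) \<omega>"
    and "linear v"
    and "X\<^sub>v \<in> h" and "\<And>Y. Y \<in> h \<Longrightarrow> B X\<^sub>v Y = v (lam Y)"
  shows "fat_at AG P \<omega> (H, u\<^sub>o) v \<longleftrightarrow> nondegenerate_on m (\<lambda>X Y. B X\<^sub>v (br X Y))"
proof -
  interpret K: lie_grp K AK by (rule lie_grpI) fact
  interpret invariant_structure K AK H AH M G AG P u\<^sub>o
  proof unfold_locales
    show "lie_subgroup GL GL_atlas G AG" using \<open>G_structure M G AG P\<close> unfolding G_structure_def by blast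
  qed fact+
  show ?thesis unfolding B_def br_def
    by (rule fat_at_iff) (use assms in \<open>simp_all add: br_def B_def h_def lam_def\<close>)
qed

end
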